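(* For every sequence $V_n\to\infty$, let $(u_{V_n},h_{V_n})\in\mathcal{A}^\ell_{V_n}$ be a sequence of minimizers of the problems defining $F_\ell(V_n)$. Then there exists a subsequence such that the rescaled profile functions $\tilde h_{V_n}$ converge in $L^1(\mathbb{R})$ to a function $h$ which minimizes $$G(h):=\left(\inf_{u(x,0)=x}\int_{\{h>0\}\times[0,+\infty)}|\nabla u|^2\,dx\,dy\right)+\int_{\mathbb{R}}|h'|+2\mathcal{H}^1(\Gamma_{\mathrm{cuts}})$$ subject to the constraint $\int_{\mathbb{R}}h\,dx=1$. Moreover, $\mathbb{R}^2\setminus\Omega_{\tilde h_{V_n}}$ converges in the Hausdorff topology to $\mathbb{R}^2\setminus\Omega_h$.
   Context: For $h:\mathbb{R}\to[0,\infty)$ lower semicontinuous, let $\Omega_h:=\{(x,y)\in\mathbb{R}^2:0<y<h(x)\}$ and let $\int_{\mathbb{R}}|h'|$ denote the pointwise variation $\sup\{\sum_{i}|h(x_i)-h(x_{i-1})|: x_1<\dots<x_n\}$. For $V>0$, let $\mathcal{A}^\ell_V$ be the set of pairs $(u,h)$ with $h\in BV(\mathbb{R})$ lower semicontinuous, $h\ge0$, $u\in H^1(\Omega_h)$ real-valued, $\int_{\mathbb{R}}h\,dx=V$, and $u(x,0)=x$ for $x\in\operatorname{supp}h$. Set $$F_\ell(V):=\inf\left\{\int_{\Omega_h}|\nabla u|^2\,dx\,dy+\int_{\mathbb{R}}|h'| : (u,h)\in\mathcal{A}^\ell_V\right\};$$ a minimizer is a pair in $\mathcal{A}^\ell_V$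 attaining this infimum. The rescaled profile of $h_V$ is $\tilde h_V(x):=V^{-2/3}h_V(V^{1/3}x)$, so that $\int_{\mathbb{R}}\tilde h_V\,dx=1$. The functional $G$ is considered on lower semicontinuous $h:\mathbb{R}\to[0,\infty)$ of bounded pointwise variation. For such $h$, $h^-(x):=\min\{h(x^+),h(x^-)\}$ with $h(x^\pm):=\lim_{z\to x^\pm}h(z)$, and $\Gamma_{\mathrm{cuts}}:=\{(x,y): h(x)<h^-(x),\ h(x)\le y\le h^-(x)\}$ is the set of vertical cuts; $\mathcal{H}^1$ is the one-dimensional Hausdorff measure. The infimum in $G$ is over real-valued weakly differentiable $u$ on $\{h>0\}\times(0,\infty)$ with trace $u(x,0)=x$. The Hausdorff distance of $A,B\subset\mathbb{R}^2$ is $\inf\{r>0: A\subset N(B,r),\ B\subset N(A,r)\}$ with $N(A,r):=\{p\in\mathbb{R}^2: d(p,A)<r\}$, where $d(p,A)$ is the distance from $p$ to $A$.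
   Formalization: Convergence in L^1 and in the Hausdorff topology is stated for suitable horizontal translates of the rescaled profiles, since translating minimizers gives minimizers, and the claim without translations fails for minimizers that drift to infinity. *)

theory Defs
  imports "HOL-Analysis.Analysis"
begin

section \<open>Weak gradients, Sobolev functions and traces\<close>

text \<open>\<open>\<phi>\<close> is a continuously differentiable function with gradient \<open>d\<phi>\<close> and compact support in \<open>D\<close>.\<close>
definition test_function ::
  "'a::euclidean_space set \<Rightarrow> ('a \<Rightarrow> real) \<Rightarrow> ('a \<Rightarrow> 'a) \<Rightarrow> bool" where
  "test_function D \<phi> d\<phi> \<longleftrightarrow>
     (\<forall>p. (\<phi> has_derivative (\<lambda>v. d\<phi> p \<bullet> v)) (at p)) \<and> continuous_on UNIV d\<phi> \<and>
     compact (closure {p. \<phi> p \<noteq> 0}) \<and> closure {p. \<phi> p \<noteq> 0} \<subseteq> D"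

definition locally_integrable ::
  "'a::euclidean_space set \<Rightarrow> ('a \<Rightarrow> 'b::euclidean_space) \<Rightarrow> bool" where
  "locally_integrable D u \<longleftrightarrow> (\<forall>K. compact K \<and> K \<subseteq> D \<longrightarrow> integrable (lebesgue_on K) u)"

definition has_weak_gradient ::
  "('a::euclidean_space \<Rightarrow> real) \<Rightarrow> ('a \<Rightarrow> 'a) \<Rightarrow> 'a set \<Rightarrow> bool" where
  "has_weak_gradient u g D \<longleftrightarrow>
     locally_integrable D u \<and> locally_integrable D g \<and>
     (\<forall>\<phi> d\<phi>. test_function D \<phi> d\<phi> \<longrightarrow>
        (LINT p|lebesgue_on D. u p *\<^sub>R d\<phi> p) = - (LINT p|lebesgue_on D. \<phi> p *\<^sub>R g p))"

definition weakly_differentiable :: "('a::euclidean_space \<Rightarrow> real) \<Rightarrow> 'a set \<Rightarrow> bool" where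
  "weakly_differentiable u D \<longleftrightarrow> (\<exists>g. has_weak_gradient u g D)"

text \<open>On an open set \<open>D\<close> the weak gradient is unique up to null sets, so that integrals
  over \<open>D\<close> do not depend on the choice made here.\<close>
definition weak_gradient :: "('a::euclidean_space \<Rightarrow> real) \<Rightarrow> 'a set \<Rightarrow> 'a \<Rightarrow> 'a" where
  "weak_gradient u D = (SOME g. has_weak_gradient u g D)"

definition dirichlet_energy :: "('a::euclidean_space \<Rightarrow> real) \<Rightarrow> 'a set \<Rightarrow> ennreal" where
  "dirichlet_energy u D = (\<integral>\<^sup>+ p\<in>D. ennreal ((norm (weak_gradient u D p))\<^sup>2) \<partial>lebesgue)"

definition H1 :: "'a::euclidean_space set \<Rightarrow> ('a \<Rightarrow> real) set" where
  "H1 D = {u. u \<in> borel_measurable (lebesgue_on D) \<and>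
              (\<integral>\<^sup>+ p\<in>D. ennreal ((u p)\<^sup>2) \<partial>lebesgue) < \<infinity> \<and>
              weakly_differentiable u D \<and> dirichlet_energy u D < \<infinity>}"

text \<open>The trace at a boundary point in the sense of approximate limits: the averages of
  \<open>\<bar>u - t\<bar>\<close> over \<open>D \<inter> ball p \<rho>\<close> vanish as \<open>\<rho>\<close> tends to 0.\<close>
definition has_trace_at ::
  "(real \<times> real \<Rightarrow> real) \<Rightarrow> (real \<times> real) set \<Rightarrow> real \<times> real \<Rightarrow> real \<Rightarrow> bool" where
  "has_trace_at u D p t \<longleftrightarrow>
     ((\<lambda>\<rho>. (\<integral>\<^sup>+ q\<in>(D \<inter> ball p \<rho>). ennreal \<bar>u q - t\<bar> \<partial>lebesgue) / ennreal (\<rho>\<^sup>2))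
        \<longlongrightarrow> 0) (at_right 0)"

text \<open>\<open>u(x,0) = x\<close>. A trace on the \<open>x\<close>-axis exists only above the open set \<open>{h > 0}\<close>,
  where \<open>D\<close> is locally a half plane, and it is defined almost everywhere there.\<close>
definition substrate_condition ::
  "(real \<Rightarrow> real) \<Rightarrow> (real \<times> real) set \<Rightarrow> (real \<times> real \<Rightarrow> real) \<Rightarrow> bool" where
  "substrate_condition h D u \<longleftrightarrow> (AE x in lborel. h x > 0 \<longrightarrow> has_trace_at u D (x, 0) x)"

section \<open>Profiles\<close>

definition lsc :: "(real \<Rightarrow> real) \<Rightarrow> bool" where
  "lsc h \<longleftrightarrow> (\<forall>c. open {x. c < h x})"

definition pointwise_variation :: "(real \<Rightarrow> real) \<Rightarrow> ennreal" where
  "pointwise_variation h =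
     (SUP (n, x) \<in> {(n::nat, x::nat \<Rightarrow> real). strict_mono_on {..n} x}.
        \<Sum>i<n. ennreal \<bar>h (x (Suc i)) - h (x i)\<bar>)"

text \<open>\<open>BV(\<real>)\<close>: integrable functions whose distributional derivative is a finite measure.
  Finiteness of the pointwise variation is not part of the definition.\<close>
definition BV :: "(real \<Rightarrow> real) set" where
  "BV = {h. integrable lborel h \<and>
            (SUP (\<phi>, d\<phi>) \<in> {(\<phi>, d\<phi>). test_function UNIV \<phi> d\<phi> \<and> (\<forall>x. \<bar>\<phi> x\<bar> \<le> 1)}.
               ennreal (LINT x|lborel. h x * d\<phi> x)) < \<infinity>}"

definition film_domain :: "(real \<Rightarrow> real) \<Rightarrow> (real \<times> real) set" where
  "film_domain h = {(x, y). 0 < y \<and> y < h x}"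

section \<open>The problem defining \<open>F\<^sub>l\<close>\<close>

definition admissible :: "real \<Rightarrow> ((real \<times> real \<Rightarrow> real) \<times> (real \<Rightarrow> real)) set" where
  "admissible V =
     {(u, h). h \<in> BV \<and> lsc h \<and> (\<forall>x. 0 \<le> h x) \<and> u \<in> H1 (film_domain h) \<and>
              (LINT x|lborel. h x) = V \<and> substrate_condition h (film_domain h) u}"

definition film_energy :: "(real \<times> real \<Rightarrow> real) \<Rightarrow> (real \<Rightarrow> real) \<Rightarrow> ennreal" where
  "film_energy u h = dirichlet_energy u (film_domain h) + pointwise_variation h"

definition F_ell :: "real \<Rightarrow> ennreal" where
  "F_ell V = (INF (u, h) \<in> admissible V. film_energy u h)"

definition film_minimizer ::
  "real \<Rightarrow> (real \<times> real \<Rightarrow> real) \<Rightarrow> (real \<Rightarrow> real) \<Rightarrow> bool" where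
  "film_minimizer V u h \<longleftrightarrow> (u, h) \<in> admissible V \<and> film_energy u h = F_ell V"

definition rescaled_profile :: "real \<Rightarrow> (real \<Rightarrow> real) \<Rightarrow> real \<Rightarrow> real" where
  "rescaled_profile V h x = V powr (-2/3) * h (V powr (1/3) * x)"

text \<open>If \<open>(u, h)\<close> is a minimizer, then so is \<open>((x, y) \<mapsto> u (x - c, y) + c, x \<mapsto> h (x - c))\<close> for
  every \<open>c\<close>. Hence profiles of minimizers can be compact only up to horizontal translation.\<close>
definition translate :: "real \<Rightarrow> (real \<Rightarrow> real) \<Rightarrow> real \<Rightarrow> real" where
  "translate c h x = h (x - c)"

section \<open>The limit functional\<close>

text \<open>The one-dimensional Hausdorff measure, normalized to agree with length.\<close>
definition hausdorff_measure1 :: "'a::metric_space set \<Rightarrow> ennreal" where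
  "hausdorff_measure1 A =
     (SUP \<delta> \<in> {0::real<..}.
        INF E \<in> {E::nat \<Rightarrow> 'a set. A \<subseteq> (\<Union>i. E i) \<and> (\<forall>i. bounded (E i) \<and> diameter (E i) \<le> \<delta>)}.
          \<Sum>i. ennreal (diameter (E i)))"

definition lower_limit :: "(real \<Rightarrow> real) \<Rightarrow> real \<Rightarrow> real" where
  "lower_limit h x = min (Lim (at_right x) h) (Lim (at_left x) h)"

definition cuts :: "(real \<Rightarrow> real) \<Rightarrow> (real \<times> real) set" where
  "cuts h = {(x, y). h x < lower_limit h x \<and> h x \<le> y \<and> y \<le> lower_limit h x}"

definition strip_domain :: "(real \<Rightarrow> real) \<Rightarrow> (real \<times> real) set" where
  "strip_domain h = {x. h x > 0} \<times> {0<..}"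

definition G :: "(real \<Rightarrow> real) \<Rightarrow> ennreal" where
  "G h = (INF u \<in> {u. weakly_differentiable u (strip_domain h) \<and>
                      substrate_condition h (strip_domain h) u}.
            dirichlet_energy u (strip_domain h))
         + pointwise_variation h + 2 * hausdorff_measure1 (cuts h)"

definition G_admissible :: "(real \<Rightarrow> real) set" where
  "G_admissible = {h. lsc h \<and> (\<forall>x. 0 \<le> h x) \<and> pointwise_variation h < \<infinity> \<and>
                      integrable lborel h \<and> (LINT x|lborel. h x) = 1}"

definition G_minimizer :: "(real \<Rightarrow> real) \<Rightarrow> bool" where
  "G_minimizer h \<longleftrightarrow> h \<in> G_admissible \<and> (\<forall>k\<in>G_admissible. G h \<le> G k)"

section \<open>Convergence\<close>

definition L1_convergent_to :: "(nat \<Rightarrow> real \<Rightarrow> real) \<Rightarrow> (real \<Rightarrow> real) \<Rightarrow> bool" where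
  "L1_convergent_to f g \<longleftrightarrow>
     (\<forall>n. integrable lborel (f n)) \<and> integrable lborel g \<and>
     (\<lambda>n. \<integral>\<^sup>+ x. ennreal \<bar>f n x - g x\<bar> \<partial>lborel) \<longlonglongrightarrow> 0"

text \<open>For nonempty \<open>A\<close>; all sets below contain the lower half plane.\<close>
definition nbhd :: "'a::metric_space set \<Rightarrow> real \<Rightarrow> 'a set" where
  "nbhd A r = {p. infdist p A < r}"

definition hausdorff_distance :: "'a::metric_space set \<Rightarrow> 'a set \<Rightarrow> ennreal" where
  "hausdorff_distance A B = Inf {ennreal r |r. 0 < r \<and> A \<subseteq> nbhd B r \<and> B \<subseteq> nbhd A r}"

definition hausdorff_convergent_to :: "(nat \<Rightarrow> 'a::metric_space set) \<Rightarrow> 'a set \<Rightarrow> bool" where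
  "hausdorff_convergent_to A B \<longleftrightarrow> (\<lambda>n. hausdorff_distance (A n) B) \<longlonglongrightarrow> 0"

end

theory Submission
  imports Defs
begin

text \<open>Let \<open>c\<^sub>0 = \<Sum>\<^bsub>k odd\<^esub> 8 / (k \<pi>)\<^sup>3\<close> be the least Dirichlet energy of \<open>u\<close> with \<open>u(x,0) = x\<close> on a
  half-strip of unit width, so that a component of length \<open>l\<close> of \<open>{h > 0}\<close> costs at least \<open>c\<^sub>0 l\<^sup>2\<close>
  in \<open>G\<close>, and \<open>2 sup h\<close> in variation. If the components have lengths \<open>l\<^sub>i\<close> and heights \<open>q\<^sub>i\<close>, then with
  \<open>s\<^sup>2 = \<Sum> l\<^sub>i\<^sup>2\<close> and \<open>Q = \<Sum> q\<^sub>i\<close> the mass constraint gives \<open>1 \<le> s Q\<close>, hence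
  \<open>G h \<ge> c\<^sub>0 s\<^sup>2 + 2 / s\<close>. This is minimal at \<open>s = L\<^sub>0 = c\<^sub>0\<close> to the power \<open>-1/3\<close>, and equality forces a
  single component: up to translation the only minimizer of \<open>G\<close> is the rectangle of width \<open>L\<^sub>0\<close> and
  height \<open>H\<^sub>0 = 1 / L\<^sub>0\<close>, which has no cuts. The argument is stable, so it applies to rescaled film
  profiles at a level \<open>\<epsilon>\<close> with \<open>V\<^bsup>1/3\<^esup> \<epsilon>\<^sup>2\<close> large, once the mass below that level is known to be
  small; the whole sequence converges after translation.

  The elastic lower bound on a rectangle is obtained by duality: \<open>\<integral>\<bar>\<nabla>u\<bar>\<^sup>2 \<ge> 2 \<integral>\<psi>(x,0) dx - \<integral>\<bar>\<nabla>\<psi>\<bar>\<^sup>2\<close> for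
  every stream function \<open>\<psi>\<close> vanishing on the three free sides, applied to a sum of sine modes.\<close>

section \<open>Cutoff functions\<close>

text \<open>The stream functions vanish on three sides of a rectangle, so only the substrate
  contributes. There lies the obstacle: the datum is known merely as an approximate limit at almost
  every point and \<open>u\<close> is only locally integrable in the open domain, yet the weak
  gradient must be tested with functions that do not vanish at y = 0.

  A component above the level \<epsilon> has length at most 1/\<epsilon>, the mass being one. After
  stretching by T = V^(1/3) its rectangle has aspect ratio at least T \<epsilon>^2, and when this is
  large it costs almost as much as a half-strip. Flat rectangles, on the other hand, cost about T
  times their area, so little mass can hide below the level.

  Films and G are served by one asymptotic statement, \<open>near_minimal_profiles\<close>, about
  profiles with an elastic and a variation bound. Applied to a constant sequence with growing T it
  becomes the exact lower bound for G. Hausdorff convergence combines L1 convergence with the upper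
  bound 2 H_0 for the limiting variation, which leaves nothing to spend on a cut.\<close>

lemma has_real_derivative_max_power:
  "((\<lambda>s::real. max 0 s ^ Suc (Suc n)) has_real_derivative real (Suc (Suc n)) * max 0 s ^ Suc n) (at s)"
proof -
  consider "s < 0" | "s > 0" | "s = 0" by linarith
  then show ?thesis
  proof cases
    case 1
    have "((\<lambda>s. 0::real) has_real_derivative 0) (at s)" by simp
    then have "((\<lambda>s::real. max 0 s ^ Suc (Suc n)) has_real_derivative 0) (at s)"
      by (rule has_field_derivative_transform_within_open[of _ _ _ "{..<0}"]) (use 1 in auto)
    with 1 show ?thesis by simp
  next
    case 2
    have "((\<lambda>s. s ^ Suc (Suc n)) has_real_derivative real (Suc (Suc n)) * s ^ Suc n) (at s)"
      using DERIV_pow[of "Suc (Suc n)" s UNIV] by simp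
    then have "((\<lambda>s::real. max 0 s ^ Suc (Suc n)) has_real_derivative real (Suc (Suc n)) * s ^ Suc n) (at s)"
      by (rule has_field_derivative_transform_within_open[of _ _ _ "{0<..}"]) (use 2 in auto)
    with 2 show ?thesis by simp
  next
    case 3
    have "((\<lambda>h::real. max 0 h ^ Suc (Suc n) / h) \<longlongrightarrow> 0) (at 0)"
    proof (rule Lim_null_comparison)
      show "eventually (\<lambda>h::real. norm (max 0 h ^ Suc (Suc n) / h) \<le> \<bar>h\<bar> ^ Suc n) (at 0)"
        by (rule always_eventually) (auto simp: max_def field_simps abs_mult intro!: mult_nonpos_nonneg)
      show "((\<lambda>h::real. \<bar>h\<bar> ^ Suc n) \<longlongrightarrow> 0) (at 0)"
        by (auto intro!: tendsto_eq_intros)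
    qed
    with 3 show ?thesis by (simp add: DERIV_def del: power_Suc)
  qed
qed

text \<open>The step is max(0,s)^3 divided by the positive sum max(0,s)^3 + max(0,1-s)^3. The cube
  is the smallest integer power with a continuous second derivative, which is wanted because
  derivatives of cutoffs must again be test factors.\<close>

lemma smooth_step_exists:
  obtains K K' K'' :: "real \<Rightarrow> real" and C where
    "\<And>s. (K has_real_derivative K' s) (at s)" "\<And>s. (K' has_real_derivative K'' s) (at s)"
    "continuous_on UNIV K''" "\<And>s. s \<le> 0 \<Longrightarrow> K s = 0" "\<And>s. s \<ge> 1 \<Longrightarrow> K s = 1"
    "\<And>s. 0 \<le> K s" "\<And>s. K s \<le> 1" 
    "\<And>s. s < 0 \<or> s > 1 \<Longrightarrow> K' s = 0" "\<And>s. \<bar>K' s\<bar> \<le> C" 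
proof -
  define A where "A \<equiv> \<lambda>s::real. max 0 s ^ 3"
  define A' where "A' \<equiv> \<lambda>s::real. 3 * max 0 s ^ 2"
  define A'' where "A'' \<equiv> \<lambda>s::real. 6 * max 0 s"
  define S where "S \<equiv> \<lambda>s. A s + A (1 - s)"
  define S' where "S' \<equiv> \<lambda>s. A' s - A' (1 - s)"
  define S'' where "S'' \<equiv> \<lambda>s. A'' s + A'' (1 - s)"
  have A: "(A has_real_derivative A' s) (at s)" for s
    using has_real_derivative_max_power[of 1 s] by (simp add: A_def A'_def eval_nat_numeral)
  have A': "(A' has_real_derivative A'' s) (at s)" for s
    using DERIV_cmult[OF has_real_derivative_max_power[of 0 s], of 3]
    by (simp add: A''_def A'_def eval_nat_numeral)
  have S: "(S has_real_derivative S' s) (at s)" for s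
    unfolding S_def S'_def by (auto intro!: derivative_eq_intros DERIV_chain2[OF A] A)
  have S': "(S' has_real_derivative S'' s) (at s)" for s
    unfolding S'_def S''_def by (auto intro!: derivative_eq_intros DERIV_chain2[OF A'] A')
  have Spos: "S s > 0" for s
  proof (cases "s > 0")
    case True then show ?thesis by (auto simp: S_def A_def intro!: add_pos_nonneg)
  next
    case False then show ?thesis by (auto simp: S_def A_def intro!: add_nonneg_pos)
  qed
  define K where "K \<equiv> \<lambda>s. A s / S s"
  define K' where "K' \<equiv> \<lambda>s. (A' s * S s - A s * S' s) / (S s * S s)"
  define K'' where "K'' \<equiv> \<lambda>s. ((A'' s * S s - A s * S'' s) * (S s * S s) - 
    (A' s * S s - A s * S' s) * (2 * S s * S' s)) / ((S s * S s) * (S s * S s))"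
  have K: "(K has_real_derivative K' s) (at s)" for s
    unfolding K_def K'_def using Spos[of s] by (auto intro!: derivative_eq_intros A S)
  have K': "(K' has_real_derivative K'' s) (at s)" for s
    unfolding K'_def K''_def using Spos[of s] 
    by (auto intro!: derivative_eq_intros A S A' S' simp: algebra_simps)
  have cA'': "continuous_on UNIV A''" unfolding A''_def by (intro continuous_intros)
  have cS'': "continuous_on UNIV S''" unfolding S''_def A''_def by (intro continuous_intros)
  have c: "continuous_on UNIV K''"
    unfolding K''_def
    by (intro continuous_intros cA'' cS'' DERIV_continuous_on[OF has_field_derivative_at_within[OF A]]
      DERIV_continuous_on[OF has_field_derivative_at_within[OF A']] DERIV_continuous_on[OF has_field_derivative_at_within[OF S]]
      DERIV_continuous_on[OF has_field_derivative_at_within[OF S']]) (use Spos in \<open>auto simp: less_imp_neq[symmetric]\<close>)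
  have K0: "K s = 0" if "s \<le> 0" for s using that by (simp add: K_def A_def)
  have K1: "K s = 1" if "s \<ge> 1" for s
  proof -
    have "S s = A s" using that by (simp add: S_def A_def)
    then show ?thesis using Spos[of s] by (simp add: K_def)
  qed
  have K'0: "K' s = 0" if "s < 0 \<or> s > 1" for s
  proof -
    have "((\<lambda>s. if s < 0 then 0 else 1::real) has_real_derivative 0) (at s)"
    proof (cases "s < 0")
      case True
      show ?thesis by (rule has_field_derivative_transform_within_open[of "\<lambda>_. 0" _ _ "{..<0}"]) (use True in auto)
    next
      case False
      show ?thesis by (rule has_field_derivative_transform_within_open[of "\<lambda>_. 1" _ _ "{1<..}"]) (use False that in auto)
    qed
    then have "(K has_real_derivative 0) (at s)"
      by (rule has_field_derivative_transform_within_open[of _ _ _ "{..<0} \<union> {1<..}"]) (use that K0 K1 in auto)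
    then show ?thesis using K DERIV_unique by blast
  qed
  have "compact (K' ` {0..1})"
    by (intro compact_continuous_image DERIV_continuous_on[OF has_field_derivative_at_within[OF K']]) auto
  then obtain C where "\<forall>y\<in>K' ` {0..1}. \<bar>y\<bar> \<le> C"
    using compact_imp_bounded bounded_real by metis
  then have C: "\<bar>K' s\<bar> \<le> max C 0" for s
    using K'0[of s] by (cases "s \<in> {0..1}") (auto simp: le_max_iff_disj)
  have K01: "0 \<le> K s" "K s \<le> 1" for s
    using Spos[of s] by (auto simp: K_def divide_le_eq, auto simp: S_def A_def)
  show ?thesis using that[of K K' K'' "max C 0"] K K' c K0 K1 K'0 C K01 by blast
qed

text \<open>One-dimensional test functions. The derivative is an argument, so that a product of two
  bumps is a test function of the plane with an explicit gradient. The interval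
  \<open>{p..q}\<close> may be empty, which makes \<theta> zero; later constructions guard against
  this case.\<close>

definition bump :: "real \<Rightarrow> real \<Rightarrow> (real \<Rightarrow> real) \<Rightarrow> (real \<Rightarrow> real) \<Rightarrow> bool" where
  "bump a b \<theta> \<theta>' \<longleftrightarrow> (\<forall>x. (\<theta> has_real_derivative \<theta>' x) (at x)) \<and> continuous_on UNIV \<theta>' \<and>
     (\<exists>p q. a < p \<and> q < b \<and> (\<forall>x. x \<notin> {p..q} \<longrightarrow> \<theta> x = 0))"

lemma bump_deriv_zero:
  assumes "\<And>x. (\<theta> has_real_derivative \<theta>' x) (at x)" "\<And>x. x \<notin> {p..q::real} \<Longrightarrow> \<theta> x = 0" "x \<notin> {p..q}"
  shows "\<theta>' x = 0"
proof -
  have "((\<lambda>_. 0) has_real_derivative 0) (at x)" by simp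
  then have "(\<theta> has_real_derivative 0) (at x)"
    by (rule has_field_derivative_transform_within_open[of _ _ _ "- {p..q}"]) (use assms in auto)
  then show ?thesis using assms DERIV_unique by blast
qed

lemma bump_deriv: "bump a b \<theta> \<theta>' \<Longrightarrow> (\<theta> has_real_derivative \<theta>' x) (at x)"
  unfolding bump_def by blast

lemma bump_continuous:
  assumes "bump a b \<theta> \<theta>'"
  shows "continuous_on UNIV \<theta>" "continuous_on UNIV \<theta>'"
  using assms by (auto simp: bump_def intro: DERIV_continuous_on has_field_derivative_at_within)

lemma bump_bounds:
  assumes "bump a b \<theta> \<theta>'"
  shows "\<exists>p q M. a < p \<and> q < b \<and> 0 \<le> M \<and> (\<forall>x. x \<notin> {p..q} \<longrightarrow> \<theta> x = 0 \<and> \<theta>' x = 0) \<and>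
     (\<forall>x. \<bar>\<theta> x\<bar> \<le> M \<and> \<bar>\<theta>' x\<bar> \<le> M)"
proof -
  obtain p q where pq: "a < p" "q < b" "\<And>x. x \<notin> {p..q} \<Longrightarrow> \<theta> x = 0"
    and d: "\<And>x. (\<theta> has_real_derivative \<theta>' x) (at x)" and c': "continuous_on UNIV \<theta>'"
    using assms unfolding bump_def by blast
  have c: "continuous_on UNIV \<theta>" using d by (meson DERIV_continuous_on has_field_derivative_at_within)
  have z: "\<And>x. x \<notin> {p..q} \<Longrightarrow> \<theta>' x = 0" using bump_deriv_zero[OF d pq(3)] by blast
  have "compact (\<theta> ` {p..q} \<union> \<theta>' ` {p..q})"
    by (intro compact_Un compact_continuous_image) (auto intro: continuous_on_subset[OF c] continuous_on_subset[OF c'])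
  then obtain C where "\<forall>y\<in>\<theta> ` {p..q} \<union> \<theta>' ` {p..q}. \<bar>y\<bar> \<le> C"
    using compact_imp_bounded bounded_real by metis
  then have "\<bar>\<theta> x\<bar> \<le> max C 0" "\<bar>\<theta>' x\<bar> \<le> max C 0" for x
    using z[of x] pq(3)[of x] by (cases "x \<in> {p..q}"; auto simp: le_max_iff_disj)+
  then show ?thesis using pq z by (intro exI[of _ p] exI[of _ q] exI[of _ "max C 0"]) auto
qed

lemma bumpI:
  assumes "\<And>x. (\<theta> has_real_derivative \<theta>' x) (at x)" "continuous_on UNIV \<theta>'" "a < p" "q < b"
    "\<And>x. x \<notin> {p..q} \<Longrightarrow> \<theta> x = 0"
  shows "bump a b \<theta> \<theta>'"
  using assms unfolding bump_def by blast

text \<open>The point is the last bound: the slope of the cutoffs is at most a constant over the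
  distance to the end points, uniformly in \<open>n\<close>. Against a factor that vanishes linearly
  at the ends this gives domination when the cutoffs are removed.\<close>

lemma cutoff_sequence:
  fixes a b :: real
  assumes "a < b"
  obtains \<eta> \<eta>' \<eta>'' :: "nat \<Rightarrow> real \<Rightarrow> real" and C where
    "\<And>n. bump a b (\<eta> n) (\<eta>' n)" "\<And>n. bump a b (\<eta>' n) (\<eta>'' n)"
    "\<And>n x. 0 \<le> \<eta> n x" "\<And>n x. \<eta> n x \<le> 1"
    "\<And>x. a < x \<Longrightarrow> x < b \<Longrightarrow> eventually (\<lambda>n. \<eta> n x = 1 \<and> \<eta>' n x = 0) sequentially"
    "\<And>n x. a < x \<Longrightarrow> x < b \<Longrightarrow> \<bar>\<eta>' n x\<bar> * min (x - a) (b - x) \<le> C"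
proof -
  obtain K K' K'' :: "real \<Rightarrow> real" and C0 where K:
    "\<And>s. (K has_real_derivative K' s) (at s)" "\<And>s. (K' has_real_derivative K'' s) (at s)"
    "continuous_on UNIV K''" "\<And>s. s \<le> 0 \<Longrightarrow> K s = 0" "\<And>s. s \<ge> 1 \<Longrightarrow> K s = 1"
    "\<And>s. 0 \<le> K s" "\<And>s. K s \<le> 1" 
    "\<And>s. s < 0 \<or> s > 1 \<Longrightarrow> K' s = 0" "\<And>s. \<bar>K' s\<bar> \<le> C0"
    using smooth_step_exists by metis
  \<comment> \<open>The shift by 1 keeps the support at distance at least
    \<open>1 / real (Suc n)\<close> from both ends.\<close>
  define l where "l n x = real (Suc n) * (x - a) - 1" for n x
  define r where "r n x = real (Suc n) * (b - x) - 1" for n x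
  define \<eta> where "\<eta> n x = K (l n x) * K (r n x)" for n x
  define \<eta>' where "\<eta>' n x = real (Suc n) * (K' (l n x) * K (r n x) - K (l n x) * K' (r n x))" for n x
  define \<eta>'' where "\<eta>'' n x = (real (Suc n))\<^sup>2 * (K'' (l n x) * K (r n x) - 2 * K' (l n x) * K' (r n x) + K (l n x) * K'' (r n x))" for n x
  have dl: "(l n has_real_derivative real (Suc n)) (at x)" for n x
    unfolding l_def by (auto intro!: derivative_eq_intros)
  have dr: "(r n has_real_derivative - real (Suc n)) (at x)" for n x
    unfolding r_def by (auto intro!: derivative_eq_intros)
  have d1: "(\<eta> n has_real_derivative \<eta>' n x) (at x)" for n x
    unfolding \<eta>_def \<eta>'_def 
    by (auto intro!: derivative_eq_intros DERIV_chain2[OF K(1) dl] DERIV_chain2[OF K(1) dr] simp: algebra_simps)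
  have d2: "(\<eta>' n has_real_derivative \<eta>'' n x) (at x)" for n x
    unfolding \<eta>'_def \<eta>''_def 
    by (auto intro!: derivative_eq_intros DERIV_chain2[OF K(1) dl] DERIV_chain2[OF K(1) dr] 
       DERIV_chain2[OF K(2) dl] DERIV_chain2[OF K(2) dr] simp: algebra_simps power2_eq_square)
  have cl: "continuous_on UNIV (l n)" and cr: "continuous_on UNIV (r n)" for n
    unfolding l_def r_def by (auto intro!: continuous_intros)
  have cK: "continuous_on UNIV K" "continuous_on UNIV K'"
    using K(1,2) by (meson DERIV_continuous_on has_field_derivative_at_within)+
  have cc: "continuous_on UNIV (\<lambda>x. f (g x))" if "continuous_on UNIV f" "continuous_on UNIV g" for f g :: "real \<Rightarrow> real"
    using continuous_on_compose2[OF that(1) that(2)] by auto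
  have c1: "continuous_on UNIV (\<eta>' n)" for n
    unfolding \<eta>'_def by (intro continuous_intros cc[OF _ cl] cc[OF _ cr] cK)
  have c2: "continuous_on UNIV (\<eta>'' n)" for n
    unfolding \<eta>''_def by (intro continuous_intros cc[OF _ cl] cc[OF _ cr] cK K(3))
  have z: "\<eta> n x = 0" if "x \<notin> {a + 1 / real (Suc n)..b - 1 / real (Suc n)}" for n x
  proof -
    have "l n x \<le> 0 \<or> r n x \<le> 0"
      using that by (auto simp: l_def r_def field_simps not_le)
    then show ?thesis using K(4) by (auto simp: \<eta>_def)
  qed
  have b1: "bump a b (\<eta> n) (\<eta>' n)" for n
    by (rule bumpI[OF d1 c1 _ _ z]) auto
  have b2: "bump a b (\<eta>' n) (\<eta>'' n)" for n
    by (rule bumpI[OF d2 c2 _ _ bump_deriv_zero[OF d1 z]]) auto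
  have ev: "eventually (\<lambda>n. \<eta> n x = 1 \<and> \<eta>' n x = 0) sequentially" if x: "a < x" "x < b" for x
  proof -
    define e where "e = min (x - a) (b - x)"
    have e: "e > 0" using x by (simp add: e_def)
    obtain n0 where n0: "real n0 > 3 / e" using reals_Archimedean2 by blast
    show ?thesis
    proof (rule eventually_sequentiallyI[of n0])
      fix n assume "n0 \<le> n"
      then have "real (Suc n) > 3 / e" using n0 by linarith
      then have *: "real (Suc n) * e > 3" using e by (simp add: field_simps)
      have "real (Suc n) * e \<le> real (Suc n) * (x - a)" "real (Suc n) * e \<le> real (Suc n) * (b - x)"
        by (intro mult_left_mono; simp add: e_def)+
      then have "l n x > 1" "r n x > 1" using * unfolding l_def r_def by linarith+
      then show "\<eta> n x = 1 \<and> \<eta>' n x = 0" using K(5,8) by (simp add: \<eta>_def \<eta>'_def)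
    qed
  qed
  have C0: "C0 \<ge> 0" using K(9)[of 0] by linarith
  have bd: "\<bar>\<eta>' n x\<bar> * min (x - a) (b - x) \<le> 4 * C0" if x: "a < x" "x < b" for n x
  proof -
    \<comment> \<open>Either the slope vanishes, or \<open>l n x\<close> is at most 1 and the scaled
      distance is at most 2; this is where the uniform constant comes from.\<close>
    have 1: "real (Suc n) * (x - a) * \<bar>K' (l n x)\<bar> \<le> 2 * C0"
    proof (cases "l n x > 1")
      case True then show ?thesis using K(8) C0 by simp
    next
      case False
      then have "real (Suc n) * (x - a) \<le> 2" by (simp add: l_def)
      then show ?thesis using K(9)[of "l n x"] x by (intro mult_mono) auto
    qed
    have 2: "real (Suc n) * (b - x) * \<bar>K' (r n x)\<bar> \<le> 2 * C0"
    proof (cases "r n x > 1")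
      case True then show ?thesis using K(8) C0 by simp
    next
      case False
      then have "real (Suc n) * (b - x) \<le> 2" by (simp add: r_def)
      then show ?thesis using K(9)[of "r n x"] x by (intro mult_mono) auto
    qed
    have "\<bar>K' (l n x) * K (r n x) - K (l n x) * K' (r n x)\<bar> \<le> \<bar>K' (l n x)\<bar> + \<bar>K' (r n x)\<bar>"
    proof -
      have "\<bar>K' (l n x) * K (r n x)\<bar> \<le> \<bar>K' (l n x)\<bar>" "\<bar>K (l n x) * K' (r n x)\<bar> \<le> \<bar>K' (r n x)\<bar>"
        using K(6,7) by (auto simp: abs_mult intro: mult_left_le mult_left_le_one_le)
      then show ?thesis by linarith
    qed
    then have "\<bar>\<eta>' n x\<bar> \<le> real (Suc n) * (\<bar>K' (l n x)\<bar> + \<bar>K' (r n x)\<bar>)"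
      by (simp add: \<eta>'_def abs_mult mult_left_mono)
    then have "\<bar>\<eta>' n x\<bar> * min (x - a) (b - x) \<le> real (Suc n) * (\<bar>K' (l n x)\<bar> + \<bar>K' (r n x)\<bar>) * min (x - a) (b - x)"
      using x by (intro mult_right_mono) auto
    also have "\<dots> = real (Suc n) * min (x - a) (b - x) * \<bar>K' (l n x)\<bar> + real (Suc n) * min (x - a) (b - x) * \<bar>K' (r n x)\<bar>"
      by (simp add: algebra_simps)
    also have "\<dots> \<le> real (Suc n) * (x - a) * \<bar>K' (l n x)\<bar> + real (Suc n) * (b - x) * \<bar>K' (r n x)\<bar>"
      by (intro add_mono mult_right_mono mult_left_mono) auto
    finally show ?thesis using 1 2 by linarith
  qed
  have "\<eta> n x \<le> 1" for n x using K(6,7) unfolding \<eta>_def by (intro mult_le_one) auto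
  then show ?thesis using that[of \<eta> \<eta>' \<eta>'' "4 * C0"] b1 b2 ev bd K(6) by (simp add: \<eta>_def)
qed

section \<open>Testing weak gradients with products\<close>

lemma borel_measurable_lebesgueI:
  "f \<in> borel_measurable borel \<Longrightarrow> f \<in> borel_measurable lebesgue"
  by (simp add: measurable_completion)

lemma integrable_scaleR_bounded:
  fixes w :: "'a::euclidean_space \<Rightarrow> real" and d :: "'a \<Rightarrow> 'b::euclidean_space"
  assumes w: "integrable lebesgue w" and d: "continuous_on UNIV d" and N: "\<And>p. norm (d p) \<le> N"
  shows "integrable lebesgue (\<lambda>p. w p *\<^sub>R d p)"
proof (rule Bochner_Integration.integrable_bound)
  show "integrable lebesgue (\<lambda>p. N * w p)" using w by simp
  have "d \<in> borel_measurable lebesgue" using d by (simp add: borel_measurable_continuous_onI borel_measurable_lebesgueI)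
  with w show "(\<lambda>p. w p *\<^sub>R d p) \<in> borel_measurable lebesgue" by simp
  have "norm (w p *\<^sub>R d p) \<le> norm (N * w p)" for p
    using mult_left_mono[OF order_trans[OF N[of p] abs_ge_self], of "\<bar>w p\<bar>"] by (simp add: abs_mult mult.commute)
  then show "AE p in lebesgue. norm (w p *\<^sub>R d p) \<le> norm (N * w p)" by simp
qed

lemma integrable_scaleR_locally_integrable:
  fixes u :: "'a::euclidean_space \<Rightarrow> 'b::euclidean_space"
  assumes "locally_integrable D u" "compact K" "K \<subseteq> D" "f \<in> borel_measurable borel"
    "\<And>p. \<bar>f p\<bar> \<le> M" "\<And>p. p \<notin> K \<Longrightarrow> f p = 0"
  shows "integrable lebesgue (\<lambda>p. f p *\<^sub>R u p)"
proof -
  have K: "K \<in> sets lebesgue" using assms(2) by (simp add: compact_imp_closed lmeasurable_compact fmeasurableD)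
  have "integrable (lebesgue_on K) u" using assms unfolding locally_integrable_def by blast
  then have i: "integrable lebesgue (\<lambda>p. indicator K p *\<^sub>R u p)"
    using K by (subst (asm) integrable_restrict_space) auto
  have fm: "f \<in> borel_measurable lebesgue" using assms(4) by (simp add: borel_measurable_lebesgueI)
  have "integrable lebesgue (\<lambda>p. f p *\<^sub>R (indicator K p *\<^sub>R u p))"
  proof (rule Bochner_Integration.integrable_bound[OF integrable_scaleR_right[OF i, of M]])
    show "(\<lambda>p. f p *\<^sub>R indicator K p *\<^sub>R u p) \<in> borel_measurable lebesgue"
      using fm borel_measurable_integrable[OF i] by (rule borel_measurable_scaleR)
    show "AE x in lebesgue. norm (f x *\<^sub>R indicator K x *\<^sub>R u x) \<le> norm (M *\<^sub>R indicator K x *\<^sub>R u x)"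
    proof (rule AE_I2)
      fix p
      have "\<bar>f p\<bar> * norm (u p) \<le> \<bar>M\<bar> * norm (u p)"
        using assms(5)[of p] by (intro mult_right_mono) auto
      then show "norm (f p *\<^sub>R indicator K p *\<^sub>R u p) \<le> norm (M *\<^sub>R indicator K p *\<^sub>R u p)"
        by (cases "p \<in> K") simp_all
    qed
  qed
  moreover have "(\<lambda>p. f p *\<^sub>R (indicator K p *\<^sub>R u p)) = (\<lambda>p. f p *\<^sub>R u p)"
    using assms(6) by (intro ext, case_tac "p \<in> K") (simp_all)
  ultimately show ?thesis by simp
qed

lemma continuous_on_fst_snd_mult:
  fixes f g :: "real \<Rightarrow> real"
  assumes "continuous_on UNIV f" "continuous_on UNIV g"
  shows "continuous_on UNIV (\<lambda>p. f (fst p) * g (snd p))"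
  by (intro continuous_intros continuous_on_compose2[OF assms(1)] continuous_on_compose2[OF assms(2)]) auto

lemma integrable_mult_bumps:
  fixes u :: "real \<times> real \<Rightarrow> real"
  assumes "locally_integrable D u" "{a<..<b} \<times> {c<..<d} \<subseteq> D"
    "a < p" "q < b" "\<And>x. x \<notin> {p..q} \<Longrightarrow> \<theta> x = 0" "c < p'" "q' < d" "\<And>x. x \<notin> {p'..q'} \<Longrightarrow> \<zeta> x = 0"
    "\<theta> \<in> borel_measurable borel" "\<zeta> \<in> borel_measurable borel" 
    "\<And>x. \<bar>\<theta> x\<bar> \<le> M" "\<And>x. \<bar>\<zeta> x\<bar> \<le> M'"
  shows "integrable lebesgue (\<lambda>p. u p * (\<theta> (fst p) * \<zeta> (snd p)))"
proof -
  have "integrable lebesgue (\<lambda>p. (\<theta> (fst p) * \<zeta> (snd p)) *\<^sub>R u p)"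
  proof (rule integrable_scaleR_locally_integrable[OF assms(1)])
    show "compact ({p..q} \<times> {p'..q'})" by (intro compact_Times) auto
    show "{p..q} \<times> {p'..q'} \<subseteq> D" by (rule order_trans[OF _ assms(2)]) (use assms(3,4,6,7) in auto)
    show "(\<lambda>p. \<theta> (fst p) * \<zeta> (snd p)) \<in> borel_measurable borel"
    proof -
      have "(\<lambda>p. \<theta> (fst p)) \<in> borel_measurable (borel :: (real\<times>real) measure)" "(\<lambda>p. \<zeta> (snd p)) \<in> borel_measurable (borel :: (real\<times>real) measure)"
        using measurable_compose[OF borel_measurable_continuous_onI[OF continuous_on_fst[OF continuous_on_id]] assms(9)]
         measurable_compose[OF borel_measurable_continuous_onI[OF continuous_on_snd[OF continuous_on_id]] assms(10)] by auto
      then show ?thesis by (rule borel_measurable_times)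
    qed
    show "\<bar>\<theta> (fst p) * \<zeta> (snd p)\<bar> \<le> M * M'" for p
      unfolding abs_mult using assms(11)[of 0] by (intro mult_mono assms) auto
    show "\<theta> (fst x) * \<zeta> (snd x) = 0" if "x \<notin> {p..q} \<times> {p'..q'}" for x
      using assms(5)[of "fst x"] assms(8)[of "snd x"] that by (cases x) auto
  qed
  then show ?thesis by (simp add: mult.commute)
qed

lemma test_function_bumps:
  assumes "bump a b \<theta> \<theta>'" "bump c d \<zeta> \<zeta>'" "{a<..<b} \<times> {c<..<d} \<subseteq> D"
  shows "test_function D (\<lambda>p. \<theta> (fst p) * \<zeta> (snd p)) (\<lambda>p. (\<theta>' (fst p) * \<zeta> (snd p), \<theta> (fst p) * \<zeta>' (snd p)))"
proof -
  note t = bump_deriv[OF assms(1)] bump_continuous[OF assms(1)]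
  note z = bump_deriv[OF assms(2)] bump_continuous[OF assms(2)]
  obtain p q where pq: "a < p" "q < b" "\<And>x. x \<notin> {p..q} \<Longrightarrow> \<theta> x = 0"
    using bump_bounds[OF assms(1)] by metis
  obtain p' q' where pq': "c < p'" "q' < d" "\<And>x. x \<notin> {p'..q'} \<Longrightarrow> \<zeta> x = 0"
    using bump_bounds[OF assms(2)] by metis
  let ?\<phi> = "\<lambda>p. \<theta> (fst p) * \<zeta> (snd p)"
  have sub: "closure {p. ?\<phi> p \<noteq> 0} \<subseteq> {p..q} \<times> {p'..q'}"
  proof (rule closure_minimal)
    show "{p. ?\<phi> p \<noteq> 0} \<subseteq> {p..q} \<times> {p'..q'}"
    proof
      fix w assume "w \<in> {p. ?\<phi> p \<noteq> 0}"
      then have "\<theta> (fst w) \<noteq> 0" "\<zeta> (snd w) \<noteq> 0" by auto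
      then have "fst w \<in> {p..q}" "snd w \<in> {p'..q'}" using pq(3) pq'(3) by blast+
      then show "w \<in> {p..q} \<times> {p'..q'}" by (simp add: mem_Times_iff)
    qed
    show "closed ({p..q} \<times> {p'..q'})" by (intro closed_Times) auto
  qed
  have co: "compact (closure {p. ?\<phi> p \<noteq> 0})"
    using compact_Int_closed[of "{p..q} \<times> {p'..q'}" "closure {p. ?\<phi> p \<noteq> 0}"] sub
    by (simp add: compact_Times Int_absorb1)
  have "(?\<phi> has_derivative (\<lambda>v. (\<theta>' (fst p) * \<zeta> (snd p), \<theta> (fst p) * \<zeta>' (snd p)) \<bullet> v)) (at p)" for p
    by (rule has_derivative_eq_rhs[OF has_derivative_mult[OF DERIV_compose_FDERIV[OF t(1) has_derivative_fst[OF has_derivative_ident]]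
        DERIV_compose_FDERIV[OF z(1) has_derivative_snd[OF has_derivative_ident]]]])
      (auto simp: fun_eq_iff inner_prod_def algebra_simps)
  moreover have "continuous_on UNIV (\<lambda>p. (\<theta>' (fst p) * \<zeta> (snd p), \<theta> (fst p) * \<zeta>' (snd p)))"
    by (intro continuous_on_Pair continuous_on_fst_snd_mult t z)
  moreover have "closure {p. ?\<phi> p \<noteq> 0} \<subseteq> D"
    by (rule order_trans[OF sub], rule order_trans[OF _ assms(3)]) (use pq(1,2) pq'(1,2) in auto)
  ultimately show ?thesis using co unfolding test_function_def by blast
qed

lemma integral_lebesgue_on_support:
  fixes f :: "'a::euclidean_space \<Rightarrow> 'b::euclidean_space"
  assumes "open D" "\<And>p. p \<notin> D \<Longrightarrow> f p = 0"
  shows "(LINT p|lebesgue_on D. f p) = (LINT p|lebesgue. f p)"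
proof -
  have "(LINT p|lebesgue_on D. f p) = (LINT p|lebesgue. indicator D p *\<^sub>R f p)"
    using assms(1) by (intro integral_restrict_space) auto
  also have "(\<lambda>p. indicator D p *\<^sub>R f p) = f" using assms(2) by (intro ext, case_tac "p \<in> D") simp_all
  finally show ?thesis .
qed

text \<open>A test function and its gradient vanish off a compact subset of \<open>D\<close>, so the
  integrals over \<open>D\<close> become integrals over the whole space and no restricted measure
  has to be carried further.\<close>

lemma has_weak_gradient_test:
  fixes u :: "'a::euclidean_space \<Rightarrow> real"
  assumes "has_weak_gradient u g D" "open D" "test_function D \<phi> d\<phi>"
  shows "(LINT p|lebesgue. u p *\<^sub>R d\<phi> p) = - (LINT p|lebesgue. \<phi> p *\<^sub>R g p)"
    "integrable lebesgue (\<lambda>p. u p *\<^sub>R d\<phi> p)" "integrable lebesgue (\<lambda>p. \<phi> p *\<^sub>R g p)"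
proof -
  define K where "K = closure {p. \<phi> p \<noteq> 0}"
  have K: "compact K" "K \<subseteq> D" "continuous_on UNIV d\<phi>" and d: "\<And>p. (\<phi> has_derivative (\<lambda>v. d\<phi> p \<bullet> v)) (at p)"
    using assms(3) unfolding test_function_def K_def by auto
  have c\<phi>: "continuous_on UNIV \<phi>"
    using has_derivative_continuous[OF d] by (simp add: continuous_on_eq_continuous_at)
  have z: "\<phi> p = 0" if "p \<notin> K" for p using that closure_subset[of "{p. \<phi> p \<noteq> 0}"] unfolding K_def by blast
  \<comment> \<open>Off the closed support the function is zero on a neighbourhood, so the vector
    representing its derivative is orthogonal to itself.\<close>
  have zd: "d\<phi> p = 0" if "p \<notin> K" for p
  proof -
    have "((\<lambda>_. 0) has_derivative (\<lambda>v. 0)) (at p)" by simp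
    moreover have "open (- K)" using K(1) by (simp add: compact_imp_closed open_Compl)
    ultimately have "(\<phi> has_derivative (\<lambda>v. 0)) (at p)"
      by (rule has_derivative_transform_within_open[of _ _ _ _ "- K"]) (use that z in auto)
    then have "(\<lambda>v. d\<phi> p \<bullet> v) = (\<lambda>v. 0)" by (rule has_derivative_unique[OF d])
    then have "d\<phi> p \<bullet> d\<phi> p = 0" by (rule fun_cong)
    then show ?thesis by simp
  qed
  obtain M where M: "\<And>p. p \<in> K \<Longrightarrow> \<bar>\<phi> p\<bar> \<le> M" 
    using compact_imp_bounded[OF compact_continuous_image[OF continuous_on_subset[OF c\<phi> subset_UNIV] K(1)]] unfolding bounded_real by blast
  then have M': "\<bar>\<phi> p\<bar> \<le> max M 0" for p using z[of p] by (cases "p \<in> K") (auto simp: le_max_iff_disj)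
  show 3: "integrable lebesgue (\<lambda>p. \<phi> p *\<^sub>R g p)"
    using assms(1) K c\<phi> z M' unfolding has_weak_gradient_def
    by (intro integrable_scaleR_locally_integrable[of D g K \<phi> "max M 0"]) (auto intro: borel_measurable_continuous_onI)
  have iK: "integrable lebesgue (\<lambda>p. indicator K p *\<^sub>R u p)"
    using assms(1) K unfolding has_weak_gradient_def 
    by (intro integrable_scaleR_locally_integrable[of D u K "indicator K" 1])
      (auto simp: indicator_def compact_imp_closed intro!: borel_measurable_indicator borel_closed)
  have "bounded (d\<phi> ` K)"
    by (intro compact_imp_bounded compact_continuous_image continuous_on_subset[OF K(3)] K) simp
  then obtain N where "\<forall>y\<in>d\<phi> ` K. norm y \<le> N" by (auto simp: bounded_iff)
  then have N: "\<And>p. p \<in> K \<Longrightarrow> norm (d\<phi> p) \<le> N" by simp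
  have N': "norm (d\<phi> p) \<le> max N 0" for p using N[of p] zd[of p] by (cases "p \<in> K") (auto simp: le_max_iff_disj)
  have "integrable lebesgue (\<lambda>p. (indicator K p *\<^sub>R u p) *\<^sub>R d\<phi> p)"
    using iK K(3) N' by (rule integrable_scaleR_bounded)
  moreover have "(\<lambda>p. (indicator K p *\<^sub>R u p) *\<^sub>R d\<phi> p) = (\<lambda>p. u p *\<^sub>R d\<phi> p)"
    using zd by (intro ext, case_tac "p \<in> K") simp_all
  ultimately show "integrable lebesgue (\<lambda>p. u p *\<^sub>R d\<phi> p)" by simp
  have "(LINT p|lebesgue_on D. u p *\<^sub>R d\<phi> p) = - (LINT p|lebesgue_on D. \<phi> p *\<^sub>R g p)"
    using assms(1,3) unfolding has_weak_gradient_def by blast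
  moreover have "(LINT p|lebesgue_on D. u p *\<^sub>R d\<phi> p) = (LINT p|lebesgue. u p *\<^sub>R d\<phi> p)"
    by (rule integral_lebesgue_on_support[OF assms(2)]) (use zd K(2) in auto)
  moreover have "(LINT p|lebesgue_on D. \<phi> p *\<^sub>R g p) = (LINT p|lebesgue. \<phi> p *\<^sub>R g p)"
    by (rule integral_lebesgue_on_support[OF assms(2)]) (use z K(2) in auto)
  ultimately show "(LINT p|lebesgue. u p *\<^sub>R d\<phi> p) = - (LINT p|lebesgue. \<phi> p *\<^sub>R g p)"
    by (simp only:)
qed

lemma weak_gradient_bumps:
  fixes u :: "real \<times> real \<Rightarrow> real"
  assumes "has_weak_gradient u g D" "open D" "bump a b \<theta> \<theta>'" "bump c d \<zeta> \<zeta>'" "{a<..<b} \<times> {c<..<d} \<subseteq> D"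
  shows "(LINT p|lebesgue. u p * (\<theta>' (fst p) * \<zeta> (snd p))) = - (LINT p|lebesgue. fst (g p) * (\<theta> (fst p) * \<zeta> (snd p)))" (is ?A)
    "(LINT p|lebesgue. u p * (\<theta> (fst p) * \<zeta>' (snd p))) = - (LINT p|lebesgue. snd (g p) * (\<theta> (fst p) * \<zeta> (snd p)))" (is ?B)
proof -
  note w = has_weak_gradient_test[OF assms(1,2) test_function_bumps[OF assms(3-5)]]
  show ?A using arg_cong[OF w(1), of fst]
    unfolding fst_uminus integral_bounded_linear[OF bounded_linear_fst w(2), symmetric] integral_bounded_linear[OF bounded_linear_fst w(3), symmetric]
    by (simp add: mult_ac)
  show ?B using arg_cong[OF w(1), of snd]
    unfolding snd_uminus integral_bounded_linear[OF bounded_linear_snd w(2), symmetric] integral_bounded_linear[OF bounded_linear_snd w(3), symmetric]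
    by (simp add: mult_ac)
qed

lemma borel_measurable_fst_comp:
  fixes f :: "real \<Rightarrow> real"
  assumes "f \<in> borel_measurable borel"
  shows "(\<lambda>z::real \<times> real. f (fst z)) \<in> borel_measurable borel"
  by (rule measurable_compose[OF borel_measurable_continuous_onI[OF continuous_on_fst[OF continuous_on_id]] assms])

lemma borel_measurable_snd_comp:
  fixes f :: "real \<Rightarrow> real"
  assumes "f \<in> borel_measurable borel"
  shows "(\<lambda>z::real \<times> real. f (snd z)) \<in> borel_measurable borel"
  by (rule measurable_compose[OF borel_measurable_continuous_onI[OF continuous_on_snd[OF continuous_on_id]] assms])

text \<open>Local integrability speaks about compact subsets only; an exhaustion of \<open>D\<close>
  by compact sets turns it into measurability on \<open>D\<close>.\<close>

lemma locally_integrable_measurable: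
  fixes u :: "'a::euclidean_space \<Rightarrow> 'b::euclidean_space"
  assumes "locally_integrable D u" "open D"
  shows "(\<lambda>p. indicator D p *\<^sub>R u p) \<in> borel_measurable lebesgue"
proof -
  obtain C where C: "\<And>n. compact (C n)" "\<And>n. C n \<subseteq> D" "\<And>n. C n \<subseteq> interior (C (Suc n))" "\<Union> (range C) = D"
    using open_Union_compact_subsets[OF assms(2)] by metis
  have inc: "C m \<subseteq> C n" if "m \<le> n" for m n
    using C(3) interior_subset by (intro lift_Suc_mono_le[OF _ that]) blast
  show ?thesis
  proof (rule borel_measurable_LIMSEQ_metric)
    fix n
    have "C n \<in> sets borel" using C(1) compact_imp_closed borel_closed by blast
    then show "(\<lambda>p. indicator (C n) p *\<^sub>R u p) \<in> borel_measurable lebesgue"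
      by (intro borel_measurable_integrable integrable_scaleR_locally_integrable[OF assms(1) C(1,2), where M=1] borel_measurable_indicator)
        (simp_all add: indicator_def)
  next
    fix p
    show "(\<lambda>n. indicator (C n) p *\<^sub>R u p) \<longlonglongrightarrow> indicator D p *\<^sub>R u p"
    proof (cases "p \<in> D")
      case True
      then obtain m where "p \<in> C m" using C(4) by blast
      then have "p \<in> C n" if "m \<le> n" for n using inc[OF that] by blast
      then have "eventually (\<lambda>n. indicator (C n) p *\<^sub>R u p = indicator D p *\<^sub>R u p) sequentially"
        using True unfolding eventually_sequentially by (intro exI[of _ m]) simp
      then show ?thesis by (rule tendsto_eventually)
    next
      case False
      then have "p \<notin> C n" for n using C(2) by blast
      with False show ?thesis by simp
    qed
  qed
qed

text \<open>The density is the marginal of a Borel representative of \<open>F\<close>, to which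
  Fubini applies before completion. It reduces a weighted integral over the plane to one function of
  \<open>x\<close>, so that Lebesgue points can be used.\<close>

lemma lebesgue_integral_prod:
  fixes F :: "real \<times> real \<Rightarrow> real"
  assumes "integrable lebesgue F"
  shows "\<exists>t::real \<Rightarrow> real. integrable lborel t \<and>
    (\<forall>\<theta> M. \<theta> \<in> borel_measurable borel \<longrightarrow> (\<forall>x. \<bar>\<theta> x\<bar> \<le> M) \<longrightarrow>
        (LINT z|lebesgue. \<theta> (fst z) * F z) = (LINT x|lborel. \<theta> x * t x))"
proof -
  obtain F' where F': "F' \<in> borel_measurable lborel" "AE z in lborel. F z = F' z"
    using completion_ex_borel_measurable_real[OF borel_measurable_integrable[OF assms]] by blast
  have "integrable lebesgue F'"
    using assms AE_completion[OF F'(2)]  F'(1)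
    by (subst integrable_cong_AE[of _ _ F]) (auto simp: measurable_completion)
  then have iF': "integrable lborel F'" using F'(1) integrable_completion by blast
  then have i2: "integrable (lborel \<Otimes>\<^sub>M lborel) F'" by (simp add: lborel_prod)
  define t where "t x = (LINT y|lborel. F' (x, y))" for x
  show ?thesis
  proof (intro exI[of _ t] conjI allI impI)
    show "integrable lborel t" unfolding t_def by (rule lborel_pair.integrable_fst'[OF i2])
    fix \<theta> :: "real \<Rightarrow> real" and M assume \<theta>: "\<theta> \<in> borel_measurable borel" and \<theta>M: "\<forall>x. \<bar>\<theta> x\<bar> \<le> M"
    note m = borel_measurable_fst_comp[OF \<theta>]
    have iF: "integrable lborel (\<lambda>z. \<theta> (fst z) * F' z)"
    proof (rule Bochner_Integration.integrable_bound[OF integrable_mult_right[OF iF', of M]])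
      show "(\<lambda>z. \<theta> (fst z) * F' z) \<in> borel_measurable lborel" using m F'(1) by simp
      have "norm (\<theta> (fst z) * F' z) \<le> norm (M * F' z)" for z
        using mult_right_mono[OF order_trans[OF \<theta>M[rule_format, of "fst z"] abs_ge_self], of "\<bar>F' z\<bar>"] by (simp add: abs_mult)
      then show "AE z in lborel. norm (\<theta> (fst z) * F' z) \<le> norm (M * F' z)" by simp
    qed
    have "(LINT z|lebesgue. \<theta> (fst z) * F z) = (LINT z|lebesgue. \<theta> (fst z) * F' z)"
    proof (rule integral_cong_AE)
      show "(\<lambda>z. \<theta> (fst z) * F z) \<in> borel_measurable lebesgue"
        using borel_measurable_lebesgueI[OF m] borel_measurable_integrable[OF assms] by simp
      show "(\<lambda>z. \<theta> (fst z) * F' z) \<in> borel_measurable lebesgue"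
        using borel_measurable_lebesgueI[OF m] borel_measurable_integrable[OF \<open>integrable lebesgue F'\<close>] by simp
      show "AE z in lebesgue. \<theta> (fst z) * F z = \<theta> (fst z) * F' z"
        using AE_completion[OF F'(2)] by eventually_elim simp
    qed
    also have "\<dots> = (LINT z|lborel. \<theta> (fst z) * F' z)"
      using borel_measurable_integrable[OF iF] by (intro integral_completion) simp
    also have "\<dots> = (LINT z|(lborel \<Otimes>\<^sub>M lborel). \<theta> (fst z) * F' z)" by (simp add: lborel_prod)
    also have "\<dots> = (LINT x|lborel. (LINT y|lborel. \<theta> x * F' (x, y)))"
      using lborel_pair.integral_fst'[of "\<lambda>z. \<theta> (fst z) * F' z"] iF by (simp add: lborel_prod)
    also have "\<dots> = (LINT x|lborel. \<theta> x * t x)" by (simp add: t_def)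
    finally show "(LINT z|lebesgue. \<theta> (fst z) * F z) = (LINT x|lborel. \<theta> x * t x)" .
  qed
qed

lemma integral_prod_mult:
  fixes f k :: "real \<Rightarrow> real"
  assumes "integrable lborel f" "integrable lborel k"
  shows "integrable lebesgue (\<lambda>z. f (fst z) * k (snd z))"
    "(LINT z|lebesgue. f (fst z) * k (snd z)) = (LINT x|lborel. f x) * (LINT y|lborel. k y)"
proof -
  have m: "(\<lambda>z. f (fst z) * k (snd z)) \<in> borel_measurable borel"
  proof (rule borel_measurable_times)
    have "f \<in> borel_measurable borel" "k \<in> borel_measurable borel"
      using assms[THEN borel_measurable_integrable] by simp_all
    then show "(\<lambda>z. f (fst z)) \<in> borel_measurable (borel :: (real \<times> real) measure)" 
      "(\<lambda>z. k (snd z)) \<in> borel_measurable (borel :: (real \<times> real) measure)"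
      by (auto intro: borel_measurable_fst_comp borel_measurable_snd_comp)
  qed
  have i: "integrable (lborel \<Otimes>\<^sub>M lborel) (\<lambda>z. f (fst z) * k (snd z))"
  proof (rule lborel_pair.Fubini_integrable)
    show "(\<lambda>z. f (fst z) * k (snd z)) \<in> borel_measurable (lborel \<Otimes>\<^sub>M lborel)" using m by (simp add: lborel_prod)
    have "integrable lborel (\<lambda>x. \<bar>f x\<bar> * (LINT y|lborel. \<bar>k y\<bar>))"
      by (intro integrable_mult_left integrable_abs assms)
    then show "integrable lborel (\<lambda>x. LINT y|lborel. norm (f (fst (x, y)) * k (snd (x, y))))"
      by (simp add: abs_mult)
    have "integrable lborel (\<lambda>y. f x * k y)" for x by (intro integrable_mult_right assms)
    then show "AE x in lborel. integrable lborel (\<lambda>y. f (fst (x, y)) * k (snd (x, y)))" by simp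
  qed
  then show "integrable lebesgue (\<lambda>z. f (fst z) * k (snd z))"
    using m by (simp add: lborel_prod integrable_completion)
  have "(LINT z|lebesgue. f (fst z) * k (snd z)) = (LINT z|lborel. f (fst z) * k (snd z))"
    using m by (intro integral_completion) simp
  also have "\<dots> = (LINT x|lborel. f x) * (LINT y|lborel. k y)"
    using lborel_pair.integral_fst'[OF i] by (simp add: lborel_prod)
  finally show "(LINT z|lebesgue. f (fst z) * k (snd z)) = (LINT x|lborel. f x) * (LINT y|lborel. k y)" .
qed

text \<open>Averages to the right of \<open>x\<close> are the form needed: the small squares in
  \<open>slab_average\<close> have (x, 0) as their lower left corner.\<close>

lemma Lebesgue_differentiation_right:
  fixes t :: "real \<Rightarrow> real"
  assumes "integrable lborel t"
  shows "AE x in lborel. \<forall>e>0. \<exists>d>0. \<forall>h. 0 < h \<and> h < d \<longrightarrow> \<bar>(LINT s|lborel. indicator {x<..<x+h} s * t s) / h - t x\<bar> < e"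
proof -
  have s: "set_integrable lborel {a..b} t" for a b
    unfolding set_integrable_def by (rule integrable_mult_indicator[OF _ assms]) simp
  then have "t integrable_on cbox a b" for a b 
    using set_borel_integral_eq_integral(1)[OF s] by simp
  then obtain N where N: "negligible N"
    "\<And>x e. x \<notin> N \<Longrightarrow> 0 < e \<Longrightarrow> \<exists>d>0. \<forall>h. 0 < h \<and> h < d \<longrightarrow>
        norm (integral (cbox x (x + h *\<^sub>R One)) t /\<^sub>R h ^ DIM(real) - t x) < e"
    using integrable_ccontinuous_explicit[of t] by metis
  have eq: "integral (cbox x (x + h *\<^sub>R One)) t = (LINT s|lborel. indicator {x<..<x+h} s * t s)" for x h :: real
  proof -
    have "integral (cbox x (x + h *\<^sub>R One)) t = (LINT s|lborel. indicator {x..x+h} s * t s)"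
      using set_borel_integral_eq_integral(2)[OF s, of x "x + h"] by (simp add: set_lebesgue_integral_def)
    also have "\<dots> = (LINT s|lborel. indicator {x<..<x+h} s * t s)"
    proof (rule integral_cong_AE)
      show "AE s in lborel. indicator {x..x+h} s * t s = indicator {x<..<x+h} s * t s"
        using AE_lborel_singleton[of x] AE_lborel_singleton[of "x + h"]
        by eventually_elim (auto simp: indicator_def)
    qed (use borel_measurable_integrable[OF assms] in auto)
    finally show ?thesis .
  qed
  have "AE x in lborel. x \<notin> N"
  proof -
    have "N \<in> null_sets lebesgue" using N(1) by (simp add: negligible_iff_null_sets)
    then have "AE x in lebesgue. x \<notin> N" by (rule AE_not_in)
    then show ?thesis by (simp add: AE_completion_iff)
  qed
  then show ?thesis
  proof eventually_elim
    case (elim x)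
    show ?case using N(2)[OF elim] unfolding eq by (simp add: divide_inverse mult.commute)
  qed
qed

section \<open>The trace of a weakly differentiable function over the substrate\<close>

text \<open>The vertical factor of a test product that does see the substrate: it equals
  \<open>w0\<close> near y = 0 and vanishes near the top. Its derivative is supported inside the
  open interval, so \<open>u\<close> times \<open>W'\<close> is integrable although \<open>u\<close>
  is not known to be integrable up to the boundary.\<close>

definition profile :: "real \<Rightarrow> real \<Rightarrow> (real \<Rightarrow> real) \<Rightarrow> (real \<Rightarrow> real) \<Rightarrow> bool" where
  "profile \<tau> w0 W W' \<longleftrightarrow> (\<forall>y. (W has_real_derivative W' y) (at y)) \<and> continuous_on UNIV W' \<and>
     (\<exists>s t M. 0 < s \<and> t < \<tau> \<and> (\<forall>y\<le>s. W y = w0) \<and> (\<forall>y\<ge>t. W y = 0) \<and> (\<forall>y. y \<notin> {s..t} \<longrightarrow> W' y = 0) \<and>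
        (\<forall>y. \<bar>W y\<bar> \<le> M \<and> \<bar>W' y\<bar> \<le> M))"

lemma profile_continuous:
  assumes "profile \<tau> w0 W W'"
  shows "continuous_on UNIV W" "continuous_on UNIV W'" "W \<in> borel_measurable borel" "W' \<in> borel_measurable borel"
  using assms by (auto simp: profile_def intro!: borel_measurable_continuous_onI intro: DERIV_continuous_on has_field_derivative_at_within)

lemma profile_diff_bump:
  assumes "profile \<tau> w0 W W'" "profile \<tau> 1 W0 W0'"
  shows "bump 0 \<tau> (\<lambda>y. W y - w0 * W0 y) (\<lambda>y. W' y - w0 * W0' y)"
proof -
  obtain s t where 1: "0 < s" "t < \<tau>" "\<forall>y\<le>s. W y = w0" "\<forall>y\<ge>t. W y = 0"
    using assms(1) unfolding profile_def by metis
  obtain s' t' where 2: "0 < s'" "t' < \<tau>" "\<forall>y\<le>s'. W0 y = 1" "\<forall>y\<ge>t'. W0 y = 0"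
    using assms(2) unfolding profile_def by metis
  show ?thesis
  proof (rule bumpI)
    show "((\<lambda>y. W y - w0 * W0 y) has_real_derivative W' x - w0 * W0' x) (at x)" for x
      using assms unfolding profile_def by (intro DERIV_diff DERIV_cmult) auto
    show "continuous_on UNIV (\<lambda>y. W' y - w0 * W0' y)"
      by (intro continuous_intros profile_continuous[OF assms(1)] profile_continuous[OF assms(2)])
    show "0 < min s s'" "max t t' < \<tau>" using 1 2 by auto
    show "W x - w0 * W0 x = 0" if "x \<notin> {min s s'..max t t'}" for x
    proof (cases "x < min s s'")
      case True then show ?thesis using 1 2 by simp
    next
      case False
      then have "x > max t t'" using that by auto
      then show ?thesis using 1 2 by simp
    qed
  qed
qed

text \<open>Rescalings of one smooth step. As \<open>h\<close> tends to 0, \<open>- w' h\<close> is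
  a bounded kernel of size \<open>C / h\<close> and integral 1 concentrated at heights of order
  \<open>h\<close>, so pairing it with \<open>u\<close> reads off the trace.\<close>

lemma profile_family:
  "\<exists>w w' C. \<forall>h. 0 < h \<longrightarrow> (\<forall>\<tau>\<ge>h. profile \<tau> 1 (w h) (w' h)) \<and> (\<forall>y. \<bar>w h y\<bar> \<le> 1) \<and> (\<forall>y. \<bar>w' h y\<bar> \<le> C / h) \<and>
     (\<forall>y. y \<notin> {h/4..h/2} \<longrightarrow> w' h y = 0) \<and> (\<forall>y\<ge>h/2. w h y = 0) \<and> integrable lborel (w' h) \<and> (LINT y|lborel. w' h y) = (-1::real)"
proof -
  obtain K K' K'' :: "real \<Rightarrow> real" and C where K:
    "\<And>s. (K has_real_derivative K' s) (at s)" "\<And>s. (K' has_real_derivative K'' s) (at s)"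
    "continuous_on UNIV K''" "\<And>s. s \<le> 0 \<Longrightarrow> K s = 0" "\<And>s. s \<ge> 1 \<Longrightarrow> K s = 1"
    "\<And>s. 0 \<le> K s" "\<And>s. K s \<le> 1" 
    "\<And>s. s < 0 \<or> s > 1 \<Longrightarrow> K' s = 0" "\<And>s. \<bar>K' s\<bar> \<le> C"
    using smooth_step_exists by metis
  have cK': "continuous_on UNIV K'"
    using K(2) by (meson DERIV_continuous_on has_field_derivative_at_within)
  define w where "w h y = 1 - K (4 * y / h - 1)" for h y :: real
  define w' where "w' h y = - (4 / h) * K' (4 * y / h - 1)" for h y :: real
  have "(\<forall>\<tau>\<ge>h. profile \<tau> 1 (w h) (w' h)) \<and> (\<forall>y. \<bar>w h y\<bar> \<le> 1) \<and> (\<forall>y. \<bar>w' h y\<bar> \<le> (4 * C) / h) \<and>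
     (\<forall>y. y \<notin> {h/4..h/2} \<longrightarrow> w' h y = 0) \<and> (\<forall>y\<ge>h/2. w h y = 0) \<and> integrable lborel (w' h) \<and> (LINT y|lborel. w' h y) = -1" if h: "0 < h" for h
  proof -
    have d: "(w h has_real_derivative w' h y) (at y)" for y
    proof -
      have "((\<lambda>y. 4 * y / h - 1) has_real_derivative 4 / h) (at y)"
        using h by (auto intro!: derivative_eq_intros)
      from DERIV_diff[OF DERIV_const[of 1] DERIV_chain2[OF K(1) this]] show ?thesis by (simp add: w_def[abs_def] w'_def mult.commute)
    qed
    have c: "continuous_on UNIV (w' h)"
      unfolding w'_def using h by (intro continuous_intros continuous_on_compose2[OF cK']) auto
    have w1: "\<bar>w h y\<bar> \<le> 1" for y using K(6,7)[of "4 * y / h - 1"] by (simp add: w_def)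
    have w2: "\<bar>w' h y\<bar> \<le> 4 * C / h" for y
      using K(9)[of "4 * y / h - 1"] h by (simp add: w'_def abs_mult divide_right_mono)
    have lo: "w h y = 1" if "y \<le> h / 4" for y
      using h that by (simp add: w_def K(4) field_simps)
    have hi: "w h y = 0" if "y \<ge> h / 2" for y
      using h that by (simp add: w_def K(5) field_simps)
    have z: "w' h y = 0" if "y \<notin> {h/4..h/2}" for y
    proof -
      have "4 * y / h - 1 < 0 \<or> 4 * y / h - 1 > 1" using that h by (auto simp: field_simps)
      from K(8)[OF this] show ?thesis by (simp add: w'_def)
    qed
    have "\<forall>\<tau>\<ge>h. profile \<tau> 1 (w h) (w' h)"
      unfolding profile_def
    proof (intro allI impI conjI d c)
      fix \<tau> assume "h \<le> \<tau>"
      then show "\<exists>s t M. 0 < s \<and> t < \<tau> \<and> (\<forall>y\<le>s. w h y = 1) \<and> (\<forall>y\<ge>t. w h y = 0) \<and> (\<forall>y. y \<notin> {s..t} \<longrightarrow> w' h y = 0) \<and>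
        (\<forall>y. \<bar>w h y\<bar> \<le> M \<and> \<bar>w' h y\<bar> \<le> M)"
        using h lo hi z
        by (intro exI[of _ "h/4"] exI[of _ "h/2"] exI[of _ "max 1 (4 * C / h)"] conjI allI impI)
          (auto simp: le_max_iff_disj w1 w2)
    qed
    moreover have "has_bochner_integral lborel (\<lambda>y. w' h y * indicator {h/4..h/2} y) (w h (h/2) - w h (h/4))"
      using h c by (intro has_bochner_integral_FTC_Icc_real d) (auto simp: continuous_on_eq_continuous_at)
    moreover have "(\<lambda>y. w' h y * indicator {h/4..h/2} y) = w' h"
    proof
      fix y show "w' h y * indicator {h/4..h/2} y = w' h y" using z[of y] by (cases "y \<in> {h/4..h/2}") simp_all
    qed
    ultimately have "has_bochner_integral lborel (w' h) (-1)" using lo[of "h/4"] hi[of "h/2"] by simp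
    then have "integrable lborel (w' h)" "(LINT y|lborel. w' h y) = -1"
      by (simp_all add: has_bochner_integral_iff)
    with \<open>\<forall>\<tau>\<ge>h. profile \<tau> 1 (w h) (w' h)\<close> w1 w2 z hi show ?thesis by simp
  qed
  then show ?thesis by blast
qed

text \<open>Square integrability of the gradient on the bounded rectangle makes \<open>g\<close>
  integrable up to all four sides, whereas \<open>u\<close> is only locally integrable in
  \<open>D\<close>; all integrals below keep \<open>u\<close> away from the boundary. Infinite
  energy is treated in \<open>elastic_lower_bound\<close>.\<close>

locale elastic_rectangle =
  fixes u :: "real \<times> real \<Rightarrow> real" and g :: "real \<times> real \<Rightarrow> real \<times> real" and D :: "(real \<times> real) set"
    and a b \<tau> :: real
  assumes grad: "has_weak_gradient u g D" and opn: "open D" and sub: "{a<..<b} \<times> {0<..<\<tau>} \<subseteq> D"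
    and ab: "a < b" and tau: "0 < \<tau>"
    and fin: "(\<integral>\<^sup>+ p\<in>({a<..<b} \<times> {0<..<\<tau>}). ennreal ((norm (g p))\<^sup>2) \<partial>lebesgue) < \<infinity>"
    and trace: "AE x in lborel. a < x \<and> x < b \<longrightarrow> has_trace_at u D (x, 0) x"
begin

definition "Q = {a<..<b} \<times> {0<..<\<tau>}"

lemma open_Q: "open Q" unfolding Q_def by (intro open_Times) auto

lemma Q_sets: "Q \<in> sets lebesgue" using open_Q by simp

lemma gQ_measurable: "(\<lambda>p. indicator Q p *\<^sub>R g p) \<in> borel_measurable lebesgue"
proof -
  have "(\<lambda>p. indicator D p *\<^sub>R g p) \<in> borel_measurable lebesgue"
    using grad opn locally_integrable_measurable unfolding has_weak_gradient_def by blast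
  moreover have "(\<lambda>p. indicator Q p :: real) \<in> borel_measurable lebesgue"
    using Q_sets by (rule borel_measurable_indicator)
  ultimately have "(\<lambda>p. indicator Q p *\<^sub>R (indicator D p *\<^sub>R g p)) \<in> borel_measurable lebesgue" 
    by (rule borel_measurable_scaleR[rotated])
  moreover have "(\<lambda>p. indicator Q p *\<^sub>R (indicator D p *\<^sub>R g p)) = (\<lambda>p. indicator Q p *\<^sub>R g p)"
    using sub unfolding Q_def by (intro ext) (auto simp: indicator_def)
  ultimately show ?thesis by simp
qed

lemma integrable_g2: "integrable lebesgue (\<lambda>p. indicator Q p * (norm (g p))\<^sup>2)"
proof (rule integrableI_nonneg)
  have "(\<lambda>p. (norm (indicator Q p *\<^sub>R g p))\<^sup>2) \<in> borel_measurable lebesgue"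
    using measurable_compose[OF gQ_measurable borel_measurable_norm] by (rule borel_measurable_power)
  moreover have "(\<lambda>p. (norm (indicator Q p *\<^sub>R g p))\<^sup>2) = (\<lambda>p. indicator Q p * (norm (g p))\<^sup>2)"
    by (intro ext) (simp add: indicator_def)
  ultimately show "(\<lambda>p. indicator Q p * (norm (g p))\<^sup>2) \<in> borel_measurable lebesgue" by simp
  show "AE p in lebesgue. 0 \<le> indicator Q p * (norm (g p))\<^sup>2" by simp
  have "(\<integral>\<^sup>+ p. ennreal (indicator Q p * (norm (g p))\<^sup>2) \<partial>lebesgue) = (\<integral>\<^sup>+ p\<in>Q. ennreal ((norm (g p))\<^sup>2) \<partial>lebesgue)"
    by (intro nn_integral_cong) (simp add: indicator_def)
  then show "(\<integral>\<^sup>+ p. ennreal (indicator Q p * (norm (g p))\<^sup>2) \<partial>lebesgue) < \<infinity>" using fin by (simp add: Q_def)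
qed

lemma integrable_indicator_Q: "integrable lebesgue (indicator Q :: _ \<Rightarrow> real)"
proof -
  have "bounded Q" unfolding Q_def by (intro bounded_Times) auto
  then have "emeasure lebesgue Q < \<infinity>"
    using emeasure_bounded_finite[of Q] by (simp add: open_Q borel_open)
  then show ?thesis using Q_sets by (simp add: integrable_indicator_iff)
qed

lemma integrable_gQ: "integrable lebesgue (\<lambda>p. indicator Q p *\<^sub>R g p)"
proof (rule Bochner_Integration.integrable_bound)
  show "integrable lebesgue (\<lambda>p. indicator Q p + indicator Q p * (norm (g p))\<^sup>2)"
    by (intro Bochner_Integration.integrable_add integrable_indicator_Q integrable_g2)
  have "x \<le> 1 + x\<^sup>2" for x :: real
    using zero_le_power2[of "x - 1/2"] by (simp add: power2_eq_square algebra_simps)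
  then show "AE p in lebesgue. norm (indicator Q p *\<^sub>R g p) \<le> norm (indicator Q p + indicator Q p * (norm (g p))\<^sup>2)"
    by (intro AE_I2) (simp add: indicator_def)
qed (rule gQ_measurable)

lemma integrable_g_mult:
  assumes "f \<in> borel_measurable borel" "\<And>p. \<bar>f p\<bar> \<le> M"
  shows "integrable lebesgue (\<lambda>p. indicator Q p * (fst (g p) * f p))"
    "integrable lebesgue (\<lambda>p. indicator Q p * (snd (g p) * f p))"
proof -
  have *: "integrable lebesgue (\<lambda>p. k p * f p)" if k: "integrable lebesgue k" for k :: "real \<times> real \<Rightarrow> real"
  proof (rule Bochner_Integration.integrable_bound)
    show "integrable lebesgue (\<lambda>p. k p * M)" using k by simp
    show "(\<lambda>p. k p * f p) \<in> borel_measurable lebesgue"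
      using borel_measurable_integrable[OF k] borel_measurable_lebesgueI[OF assms(1)] by (rule borel_measurable_times)
    have "norm (k p * f p) \<le> norm (k p * M)" for p
      using mult_left_mono[OF order_trans[OF assms(2)[of p] abs_ge_self], of "\<bar>k p\<bar>"] by (simp add: abs_mult)
    then show "AE p in lebesgue. norm (k p * f p) \<le> norm (k p * M)" by simp
  qed
  show "integrable lebesgue (\<lambda>p. indicator Q p * (fst (g p) * f p))"
    using *[OF integrable_bounded_linear[OF bounded_linear_fst integrable_gQ]] by (simp add: mult.assoc)
  show "integrable lebesgue (\<lambda>p. indicator Q p * (snd (g p) * f p))"
    using *[OF integrable_bounded_linear[OF bounded_linear_snd integrable_gQ]] by (simp add: mult.assoc)
qed

text \<open>For smooth \<open>u\<close> this is the y-derivative of \<open>u\<close> times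
  \<open>W\<close>, so its integral over y is \<open>- w0\<close> times u(x,0). The restriction to
  \<open>{p..q}\<close> keeps it integrable near the lateral sides.\<close>

definition "slab W W' p q z = indicator {p..q} (fst z) * (u z * W' (snd z)) + indicator Q z * (snd (g z) * (indicator {p..q} (fst z) * W (snd z)))"

lemma slab_parts:
  assumes "profile \<tau> w0 W W'" "a < p" "q < b" "\<theta> \<in> borel_measurable borel" "\<And>x. \<bar>\<theta> x\<bar> \<le> M" "\<And>x. x \<notin> {p..q} \<Longrightarrow> \<theta> x = 0"
  shows "integrable lebesgue (\<lambda>z. u z * (\<theta> (fst z) * W' (snd z)))" 
    "integrable lebesgue (\<lambda>z. indicator Q z * (snd (g z) * (\<theta> (fst z) * W (snd z))))"
proof -
  obtain s t N where st: "0 < s" "t < \<tau>" "\<forall>y. y \<notin> {s..t} \<longrightarrow> W' y = 0" "\<forall>y. \<bar>W y\<bar> \<le> N \<and> \<bar>W' y\<bar> \<le> N"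
    using assms(1) unfolding profile_def by metis
  show "integrable lebesgue (\<lambda>z. u z * (\<theta> (fst z) * W' (snd z)))"
    using grad st(3,4)
    by (intro integrable_mult_bumps[OF _ sub assms(2,3,6) st(1,2) _ assms(4) profile_continuous(4)[OF assms(1)] assms(5), where u = u and M' = N])
      (auto simp: has_weak_gradient_def)
  show "integrable lebesgue (\<lambda>z. indicator Q z * (snd (g z) * (\<theta> (fst z) * W (snd z))))"
  proof (rule integrable_g_mult(2))
    show "(\<lambda>z. \<theta> (fst z) * W (snd z)) \<in> borel_measurable borel"
      by (intro borel_measurable_times borel_measurable_fst_comp borel_measurable_snd_comp assms(4) profile_continuous(3)[OF assms(1)])
    show "\<bar>\<theta> (fst z) * W (snd z)\<bar> \<le> M * N" for z
      unfolding abs_mult using assms(5)[of 0] st(4) by (intro mult_mono assms(5)) auto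
  qed
qed

lemma integrable_slab:
  assumes "profile \<tau> w0 W W'" "a < p" "q < b"
  shows "integrable lebesgue (slab W W' p q)"
proof -
  note * = slab_parts[OF assms, of "indicator {p..q}" 1]
  have "integrable lebesgue (\<lambda>z. u z * (indicator {p..q} (fst z) * W' (snd z)) + indicator Q z * (snd (g z) * (indicator {p..q} (fst z) * W (snd z))))"
    by (intro Bochner_Integration.integrable_add *) (auto simp: indicator_def)
  then show ?thesis by (simp add: slab_def[abs_def] mult_ac)
qed

lemma slab_weighted:
  assumes "profile \<tau> w0 W W'" "a < p" "q < b" "\<theta> \<in> borel_measurable borel" "\<And>x. \<bar>\<theta> x\<bar> \<le> M" "\<And>x. x \<notin> {p..q} \<Longrightarrow> \<theta> x = 0"
  shows "(LINT z|lebesgue. \<theta> (fst z) * slab W W' p q z) = 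
    (LINT z|lebesgue. u z * (\<theta> (fst z) * W' (snd z))) + (LINT z|lebesgue. indicator Q z * (snd (g z) * (\<theta> (fst z) * W (snd z))))"
proof -
  have "(\<lambda>z. \<theta> (fst z) * slab W W' p q z) = (\<lambda>z. u z * (\<theta> (fst z) * W' (snd z)) + indicator Q z * (snd (g z) * (\<theta> (fst z) * W (snd z))))"
  proof
    fix z show "\<theta> (fst z) * slab W W' p q z = u z * (\<theta> (fst z) * W' (snd z)) + indicator Q z * (snd (g z) * (\<theta> (fst z) * W (snd z)))"
      using assms(6)[of "fst z"] by (cases "fst z \<in> {p..q}") (simp_all add: slab_def algebra_simps)
  qed
  then show ?thesis using Bochner_Integration.integral_add[OF slab_parts[OF assms]] by simp
qed

text \<open>The difference between \<open>W\<close> and \<open>w0\<close> times \<open>W0\<close> is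
  a bump in the vertical direction. Multiplied by \<theta> it is an admissible test function, and
  the definition of the weak gradient says exactly that it contributes nothing. Hence the slab
  depends on the profile through \<open>w0\<close> alone.\<close>

lemma slab_bump:
  assumes W: "profile \<tau> w0 W W'" and W0: "profile \<tau> 1 W0 W0'" and pq: "a < p" "q < b" 
    and \<theta>: "bump p' q' \<theta> \<theta>'" "p \<le> p'" "q' \<le> q"
  shows "(LINT z|lebesgue. \<theta> (fst z) * slab W W' p q z) = w0 * (LINT z|lebesgue. \<theta> (fst z) * slab W0 W0' p q z)"
proof -
  obtain r s M where rs: "p' < r" "s < q'" "\<forall>x. x \<notin> {r..s} \<longrightarrow> \<theta> x = 0 \<and> \<theta>' x = 0" "\<forall>x. \<bar>\<theta> x\<bar> \<le> M \<and> \<bar>\<theta>' x\<bar> \<le> M"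
    using bump_bounds[OF \<theta>(1)] by metis
  have \<theta>ab: "bump a b \<theta> \<theta>'"
    by (rule bumpI[of _ _ _ r s]) (use bump_deriv[OF \<theta>(1)] bump_continuous[OF \<theta>(1)] rs pq \<theta> in auto)
  have \<theta>m: "\<theta> \<in> borel_measurable borel" using bump_continuous[OF \<theta>(1)] by (simp add: borel_measurable_continuous_onI)
  have \<theta>b: "\<And>x. \<bar>\<theta> x\<bar> \<le> M" using rs by simp
  have \<theta>z: "\<theta> x = 0" if "x \<notin> {p..q}" for x using rs(3) that rs(1,2) \<theta>(2,3) by auto
  let ?\<zeta> = "\<lambda>y. W y - w0 * W0 y" and ?\<zeta>' = "\<lambda>y. W' y - w0 * W0' y"
  have \<zeta>: "bump 0 \<tau> ?\<zeta> ?\<zeta>'" by (rule profile_diff_bump[OF W W0])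
  have z\<zeta>: "\<theta> (fst z) * ?\<zeta> (snd z) = 0" if "z \<notin> Q" for z
  proof -
    obtain c d where "0 < c" "d < \<tau>" "\<forall>y. y \<notin> {c..d} \<longrightarrow> ?\<zeta> y = 0" using bump_bounds[OF \<zeta>] by metis
    then show ?thesis using that \<theta>z[of "fst z"] pq unfolding Q_def mem_Times_iff by (cases "fst z \<in> {p..q}"; cases "snd z \<in> {c..d}") auto
  qed
  note i = slab_parts[OF W pq \<theta>m \<theta>b \<theta>z] and i0 = slab_parts[OF W0 pq \<theta>m \<theta>b \<theta>z]
  have "(LINT z|lebesgue. u z * (\<theta> (fst z) * ?\<zeta>' (snd z))) = 
    (LINT z|lebesgue. u z * (\<theta> (fst z) * W' (snd z))) - w0 * (LINT z|lebesgue. u z * (\<theta> (fst z) * W0' (snd z)))"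
    using i(1) i0(1) by (subst integral_mult_right_zero[symmetric], subst Bochner_Integration.integral_diff[symmetric]) (auto simp: algebra_simps)
  moreover have "(LINT z|lebesgue. snd (g z) * (\<theta> (fst z) * ?\<zeta> (snd z))) =
     (LINT z|lebesgue. indicator Q z * (snd (g z) * (\<theta> (fst z) * W (snd z)))) - w0 * (LINT z|lebesgue. indicator Q z * (snd (g z) * (\<theta> (fst z) * W0 (snd z))))"
  proof -
    have "(\<lambda>z. snd (g z) * (\<theta> (fst z) * ?\<zeta> (snd z))) = (\<lambda>z. indicator Q z * (snd (g z) * (\<theta> (fst z) * W (snd z))) - w0 * (indicator Q z * (snd (g z) * (\<theta> (fst z) * W0 (snd z)))))"
    proof
      fix z show "snd (g z) * (\<theta> (fst z) * ?\<zeta> (snd z)) = indicator Q z * (snd (g z) * (\<theta> (fst z) * W (snd z))) - w0 * (indicator Q z * (snd (g z) * (\<theta> (fst z) * W0 (snd z))))"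
        using z\<zeta>[of z] by (cases "z \<in> Q") (auto simp: algebra_simps)
    qed
    then show ?thesis using i(2) i0(2) by simp
  qed
  ultimately show ?thesis
    using weak_gradient_bumps(2)[OF grad opn \<theta>ab \<zeta> sub] slab_weighted[OF W pq \<theta>m \<theta>b \<theta>z] slab_weighted[OF W0 pq \<theta>m \<theta>b \<theta>z]
    by (simp add: algebra_simps)
qed

text \<open>Lebesgue differentiation needs indicator weights; they are limits of cutoffs between 0
  and 1, dominated by the slab itself.\<close>

lemma slab_indicator:
  assumes W: "profile \<tau> w0 W W'" and W0: "profile \<tau> 1 W0 W0'" and pq: "a < p" "q < b" and xy: "p \<le> x" "x < y" "y \<le> q"
  shows "(LINT z|lebesgue. indicator {x<..<y} (fst z) * slab W W' p q z) = w0 * (LINT z|lebesgue. indicator {x<..<y} (fst z) * slab W0 W0' p q z)"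
proof -
  obtain \<eta> \<eta>' \<eta>'' :: "nat \<Rightarrow> real \<Rightarrow> real" and C where \<eta>:
    "\<And>n. bump x y (\<eta> n) (\<eta>' n)" "\<And>n. bump x y (\<eta>' n) (\<eta>'' n)"
    "\<And>n s. 0 \<le> \<eta> n s" "\<And>n s. \<eta> n s \<le> 1"
    "\<And>s. x < s \<Longrightarrow> s < y \<Longrightarrow> eventually (\<lambda>n. \<eta> n s = 1 \<and> \<eta>' n s = 0) sequentially"
    "\<And>n s. x < s \<Longrightarrow> s < y \<Longrightarrow> \<bar>\<eta>' n s\<bar> * min (s - x) (y - s) \<le> C"
    by (rule cutoff_sequence[OF xy(2)]) (rule that)
  have m: "\<eta> n \<in> borel_measurable borel" for n
    using bump_continuous[OF \<eta>(1)] by (simp add: borel_measurable_continuous_onI)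
  have lim: "(\<lambda>n. \<eta> n s) \<longlonglongrightarrow> indicator {x<..<y} s" for s
  proof (cases "x < s \<and> s < y")
    case True
    then have "eventually (\<lambda>n. \<eta> n s = indicator {x<..<y} s) sequentially"
      using \<eta>(5)[of s] by (auto elim!: eventually_mono)
    then show ?thesis by (rule tendsto_eventually)
  next
    case False
    have "\<eta> n s = 0" for n
    proof -
      obtain r t where "x < r" "t < y" "\<forall>v. v \<notin> {r..t} \<longrightarrow> \<eta> n v = 0" using bump_bounds[OF \<eta>(1)[of n]] by metis
      then show ?thesis using False by auto
    qed
    then show ?thesis using False by simp
  qed
  have L: "(\<lambda>n. LINT z|lebesgue. \<eta> n (fst z) * slab W W' p q z) \<longlonglongrightarrow> (LINT z|lebesgue. indicator {x<..<y} (fst z) * slab W W' p q z)"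
    if W: "profile \<tau> w0 W W'" for W W' w0
  proof (rule integral_dominated_convergence)
    note i = integrable_slab[OF W pq]
    show "integrable lebesgue (\<lambda>z. \<bar>slab W W' p q z\<bar>)" using i by (rule integrable_abs)
    show "(\<lambda>z. indicator {x<..<y} (fst z) * slab W W' p q z) \<in> borel_measurable lebesgue"
      by (intro borel_measurable_times borel_measurable_integrable[OF i] borel_measurable_lebesgueI borel_measurable_fst_comp) simp
    show "(\<lambda>z. \<eta> n (fst z) * slab W W' p q z) \<in> borel_measurable lebesgue" for n
      by (intro borel_measurable_times borel_measurable_integrable[OF i] borel_measurable_lebesgueI borel_measurable_fst_comp m)
    show "AE z in lebesgue. (\<lambda>n. \<eta> n (fst z) * slab W W' p q z) \<longlonglongrightarrow> indicator {x<..<y} (fst z) * slab W W' p q z"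
      by (intro AE_I2 tendsto_mult lim tendsto_const)
    show "AE z in lebesgue. norm (\<eta> n (fst z) * slab W W' p q z) \<le> \<bar>slab W W' p q z\<bar>" for n
      using \<eta>(3,4) by (intro AE_I2) (auto simp: abs_mult intro!: mult_left_le_one_le)
  qed
  have "(\<lambda>n. LINT z|lebesgue. \<eta> n (fst z) * slab W W' p q z) \<longlonglongrightarrow> w0 * (LINT z|lebesgue. indicator {x<..<y} (fst z) * slab W0 W0' p q z)"
    using tendsto_mult_left[OF L[OF W0], of w0] slab_bump[OF W W0 pq \<eta>(1) xy(1,3)] by simp
  then show ?thesis using L[OF W] LIMSEQ_unique by blast
qed

end

context elastic_rectangle begin

lemma trace_average_small:
  assumes "has_trace_at u D (x, 0) x" "0 < e"
  obtains d where "0 < d" "\<And>\<rho>. 0 < \<rho> \<Longrightarrow> \<rho> < d \<Longrightarrow> 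
    (\<integral>\<^sup>+ q. ennreal \<bar>u q - x\<bar> * indicator (D \<inter> ball (x, 0) \<rho>) q \<partial>lebesgue) \<le> ennreal (e * \<rho>\<^sup>2)"
proof -
  have "eventually (\<lambda>\<rho>. (\<integral>\<^sup>+ q. ennreal \<bar>u q - x\<bar> * indicator (D \<inter> ball (x, 0) \<rho>) q \<partial>lebesgue) / ennreal (\<rho>\<^sup>2) < ennreal e) (at_right 0)"
    using assms unfolding has_trace_at_def by (intro order_tendstoD(2)[of _ 0]) auto
  then obtain d where d: "0 < d" "\<And>\<rho>. 0 < \<rho> \<Longrightarrow> \<rho> < d \<Longrightarrow> 
    (\<integral>\<^sup>+ q. ennreal \<bar>u q - x\<bar> * indicator (D \<inter> ball (x, 0) \<rho>) q \<partial>lebesgue) / ennreal (\<rho>\<^sup>2) < ennreal e"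
    unfolding eventually_at_right_field by auto
  show ?thesis
  proof (rule that[OF d(1)])
    fix \<rho> :: real assume \<rho>: "0 < \<rho>" "\<rho> < d"
    show "(\<integral>\<^sup>+ q. ennreal \<bar>u q - x\<bar> * indicator (D \<inter> ball (x, 0) \<rho>) q \<partial>lebesgue) \<le> ennreal (e * \<rho>\<^sup>2)"
      using d(2)[OF \<rho>] \<rho> assms(2) by (subst (asm) divide_less_ennreal) (auto simp: ennreal_mult)
  qed
qed

text \<open>The slab over the square of side \<open>h n\<close> splits into three parts. The
  constant \<open>x\<close> gives \<open>- x\<close> because the kernel has integral -1. The part
  with \<open>u - x\<close> is at most \<open>C / h n\<close> times the integral of |u - x| over a
  ball of radius \<open>2 * h n\<close>, which is o(h) by the trace condition. The gradient part is
  o(h) by Young's inequality, since the energy of a shrinking set vanishes.\<close>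

lemma slab_average:
  assumes x: "a < p" "q < b" "p < x" "x < q" and tr: "has_trace_at u D (x, 0) x"
    and h: "\<And>n. 0 < h n" "\<And>n. x + h n \<le> q" "\<And>n. h n \<le> \<tau>" "h \<longlonglongrightarrow> 0"
    and w: "\<And>h. 0 < h \<Longrightarrow> (\<forall>\<tau>\<ge>h. profile \<tau> 1 (w h) (w' h)) \<and> (\<forall>y. \<bar>w h y\<bar> \<le> 1) \<and> (\<forall>y. \<bar>w' h y\<bar> \<le> C / h) \<and>
     (\<forall>y. y \<notin> {h/4..h/2} \<longrightarrow> w' h y = 0) \<and> (\<forall>y\<ge>h/2. w h y = 0) \<and> integrable lborel (w' h) \<and> (LINT y|lborel. w' h y) = (-1::real)"
  shows "(\<lambda>n. (LINT z|lebesgue. indicator {x<..<x + h n} (fst z) * slab (w (h n)) (w' (h n)) p q z) / h n) \<longlonglongrightarrow> - x"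
proof -
  define I where "I n = {x<..<x + h n}" for n
  define B where "B n z = indicator (I n) (fst z) * ((u z - x) * w' (h n) (snd z))" for n z
  define E where "E n z = indicator Q z * (snd (g z) * (indicator (I n) (fst z) * w (h n) (snd z)))" for n z
  have C: "C \<ge> 0" using w[of 1] by (metis abs_ge_zero div_by_1 order_trans zero_less_one)
  have pr: "profile \<tau> 1 (w (h n)) (w' (h n))" for n using w[OF h(1)[of n]] h(3) by blast
  have Ipq: "s \<in> {p..q}" if "s \<in> I n" for s n using that x h(2)[of n] by (auto simp: I_def)
  have Im: "indicator (I n) \<in> borel_measurable borel" for n :: nat unfolding I_def by simp
  have parts: "integrable lebesgue (\<lambda>z. u z * (indicator (I n) (fst z) * w' (h n) (snd z)))" "integrable lebesgue (E n)" for n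
  proof -
    have 1: "\<And>s. \<bar>indicator (I n) s\<bar> \<le> (1::real)" by (simp add: indicator_def)
    have 2: "\<And>s. s \<notin> {p..q} \<Longrightarrow> indicator (I n) s = (0::real)" using Ipq by (metis indicator_simps(2))
    show "integrable lebesgue (\<lambda>z. u z * (indicator (I n) (fst z) * w' (h n) (snd z)))"
      by (rule slab_parts(1)[OF pr x(1,2) Im 1 2])
    show "integrable lebesgue (E n)"
      unfolding E_def by (rule slab_parts(2)[OF pr x(1,2) Im 1 2])
  qed
  have Iint: "integrable lborel (indicator (I n) :: real \<Rightarrow> real)" "(LINT s|lborel. indicator (I n) s) = h n" for n
    using h(1)[of n] by (simp_all add: I_def)
  have A: "integrable lebesgue (\<lambda>z. indicator (I n) (fst z) * w' (h n) (snd z))" 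
    "(LINT z|lebesgue. indicator (I n) (fst z) * w' (h n) (snd z)) = - h n" for n
    using integral_prod_mult[OF Iint(1)[of n], of "w' (h n)"] w[OF h(1)[of n]] Iint(2)[of n] by auto
  have Bi: "integrable lebesgue (B n)" for n
  proof -
    have "integrable lebesgue (\<lambda>z. u z * (indicator (I n) (fst z) * w' (h n) (snd z)) - x * (indicator (I n) (fst z) * w' (h n) (snd z)))"
      by (intro Bochner_Integration.integrable_diff parts integrable_mult_right A)
    moreover have "(\<lambda>z. u z * (indicator (I n) (fst z) * w' (h n) (snd z)) - x * (indicator (I n) (fst z) * w' (h n) (snd z))) = B n"
      by (intro ext) (simp add: B_def algebra_simps)
    ultimately show ?thesis by simp
  qed
  have eq: "(LINT z|lebesgue. indicator (I n) (fst z) * slab (w (h n)) (w' (h n)) p q z) / h n + x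
     = (LINT z|lebesgue. B n z) / h n + (LINT z|lebesgue. E n z) / h n" for n
  proof -
    have "(\<lambda>z. indicator (I n) (fst z) * slab (w (h n)) (w' (h n)) p q z) = (\<lambda>z. x * (indicator (I n) (fst z) * w' (h n) (snd z)) + B n z + E n z)"
    proof
      fix z show "indicator (I n) (fst z) * slab (w (h n)) (w' (h n)) p q z = x * (indicator (I n) (fst z) * w' (h n) (snd z)) + B n z + E n z"
        using Ipq[of "fst z" n] by (cases "fst z \<in> I n") (simp_all add: B_def E_def slab_def algebra_simps)
    qed
    then have "(LINT z|lebesgue. indicator (I n) (fst z) * slab (w (h n)) (w' (h n)) p q z) = x * (- h n) + (LINT z|lebesgue. B n z) + (LINT z|lebesgue. E n z)"
      using A[of n] Bi[of n] parts(2)[of n] by simp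
    then show ?thesis using h(1)[of n] by (simp add: field_simps)
  qed
  have "(\<lambda>n. (LINT z|lebesgue. B n z) / h n) \<longlonglongrightarrow> 0"
  proof (rule LIMSEQ_I)
    fix r :: real assume r: "0 < r"
    \<comment> \<open>Chosen so that \<open>4 * C * e < r\<close>. The 4 is the square of the 2 in
      the radius \<open>2 * h n\<close>, a ball about (x, 0) that contains the part of the square
      where the kernel lives.\<close>
    define e where "e = r / (8 * (C + 1))"
    have e: "0 < e" using r C by (simp add: e_def)
    obtain d where d: "0 < d" "\<And>\<rho>. 0 < \<rho> \<Longrightarrow> \<rho> < d \<Longrightarrow> 
      (\<integral>\<^sup>+ q. ennreal \<bar>u q - x\<bar> * indicator (D \<inter> ball (x, 0) \<rho>) q \<partial>lebesgue) \<le> ennreal (e * \<rho>\<^sup>2)"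
      by (rule trace_average_small[OF tr e]) (rule that)
    obtain N where N: "\<And>n. n \<ge> N \<Longrightarrow> h n < d / 2" using order_tendstoD(2)[OF h(4), of "d/2"] d(1)
      by (auto simp: eventually_sequentially)
    have "norm ((LINT z|lebesgue. B n z) / h n) < r" if n: "n \<ge> N" for n
    proof -
      let ?R = "D \<inter> ball (x, 0) (2 * h n)"
      have mu: "(\<lambda>q. ennreal \<bar>u q - x\<bar> * indicator ?R q) \<in> borel_measurable lebesgue"
      proof -
        have "(\<lambda>q. indicator D q *\<^sub>R u q) \<in> borel_measurable lebesgue"
          using grad opn locally_integrable_measurable unfolding has_weak_gradient_def by blast
        then have "(\<lambda>q. ennreal \<bar>indicator D q *\<^sub>R u q - x\<bar>) \<in> borel_measurable lebesgue" by simp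
        moreover have "?R \<in> sets lebesgue" using opn by (simp add: borel_open open_Int)
        ultimately have "(\<lambda>q. ennreal \<bar>indicator D q *\<^sub>R u q - x\<bar> * indicator ?R q) \<in> borel_measurable lebesgue"
          by (intro borel_measurable_times_ennreal borel_measurable_indicator)
        moreover have "(\<lambda>q. ennreal \<bar>indicator D q *\<^sub>R u q - x\<bar> * indicator ?R q) = (\<lambda>q. ennreal \<bar>u q - x\<bar> * indicator ?R q)"
          by (intro ext) (simp add: indicator_def)
        ultimately show ?thesis by simp
      qed
      have bd: "ennreal \<bar>B n z\<bar> \<le> ennreal (C / h n) * (ennreal \<bar>u z - x\<bar> * indicator ?R z)" for z
      proof (cases "fst z \<in> I n \<and> snd z \<in> {h n/4..h n/2}")
        case True
        have "z \<in> Q" using True x h(1,2,3)[of n] by (auto simp: Q_def mem_Times_iff I_def)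
        moreover have "z \<in> ball (x, 0) (2 * h n)"
        proof -
          have "dist (x, 0) z \<le> \<bar>x - fst z\<bar> + \<bar>snd z\<bar>"
            using sqrt_sum_squares_le_sum_abs[of "x - fst z" "snd z"] by (simp add: dist_prod_def dist_real_def)
          also have "\<dots> < 2 * h n" using True h(1)[of n] by (auto simp: I_def)
          finally show ?thesis by simp
        qed
        ultimately have "z \<in> ?R" using sub by (auto simp: Q_def)
        moreover have "\<bar>B n z\<bar> \<le> C / h n * \<bar>u z - x\<bar>"
        proof -
          have "\<bar>w' (h n) (snd z)\<bar> \<le> C / h n" using w[OF h(1)[of n]] by blast
          from mult_right_mono[OF this, of "\<bar>u z - x\<bar>"] show ?thesis
            using True by (simp add: B_def abs_mult mult.commute)
        qed
        ultimately show ?thesis using C h(1)[of n] by (simp add: ennreal_mult[symmetric] ennreal_leI)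
      next
        case False
        have z0: "snd z \<notin> {h n/4..h n/2} \<Longrightarrow> w' (h n) (snd z) = 0" using w[OF h(1)[of n]] by blast
        have "B n z = 0" using False z0 by (cases "fst z \<in> I n") (auto simp: B_def)
        then show ?thesis by simp
      qed
      have "ennreal \<bar>LINT z|lebesgue. B n z\<bar> \<le> ennreal (LINT z|lebesgue. \<bar>B n z\<bar>)"
        by (intro ennreal_leI integral_abs_bound)
      also have "\<dots> = (\<integral>\<^sup>+ z. ennreal \<bar>B n z\<bar> \<partial>lebesgue)"
        by (intro nn_integral_eq_integral[symmetric] integrable_abs Bi) simp
      also have "\<dots> \<le> (\<integral>\<^sup>+ z. ennreal (C / h n) * (ennreal \<bar>u z - x\<bar> * indicator ?R z) \<partial>lebesgue)"
        by (intro nn_integral_mono bd)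
      also have "\<dots> = ennreal (C / h n) * (\<integral>\<^sup>+ z. ennreal \<bar>u z - x\<bar> * indicator ?R z \<partial>lebesgue)"
        by (intro nn_integral_cmult mu)
      also have "\<dots> \<le> ennreal (C / h n) * ennreal (e * (2 * h n)\<^sup>2)"
        using d(2)[of "2 * h n"] h(1)[of n] N[OF n] by (intro mult_left_mono) auto
      also have "\<dots> = ennreal (C / h n * (e * (2 * h n)\<^sup>2))"
        using C h(1)[of n] e by (intro ennreal_mult[symmetric]) auto
      finally have "\<bar>LINT z|lebesgue. B n z\<bar> \<le> C / h n * (e * (2 * h n)\<^sup>2)"
        using C h(1)[of n] e by (subst (asm) ennreal_le_iff) auto
      then have "\<bar>LINT z|lebesgue. B n z\<bar> \<le> 4 * C * e * h n"
        using h(1)[of n] by (simp add: power2_eq_square field_simps)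
      then have "\<bar>LINT z|lebesgue. B n z\<bar> / h n \<le> 4 * C * e" using h(1)[of n] by (simp add: field_simps)
      also have "\<dots> < r" using r C by (simp add: e_def field_simps) (auto intro: add_pos_nonneg)
      finally show ?thesis using h(1)[of n] by simp
    qed
    then show "\<exists>N. \<forall>n\<ge>N. norm ((LINT z|lebesgue. B n z) / h n - 0) < r" by auto
  qed
  moreover have "(\<lambda>n. (LINT z|lebesgue. E n z) / h n) \<longlonglongrightarrow> 0"
  proof (rule LIMSEQ_I)
    fix r :: real assume r: "0 < r"
    define R where "R n z = indicator (I n \<times> {0<..<h n}) z * (indicator Q z * (norm (g z))\<^sup>2)" for n z
    have Rm: "R n \<in> borel_measurable lebesgue" for n
    proof -
      have "I n \<times> {0<..<h n} \<in> sets borel" unfolding I_def by (intro borel_open open_Times) auto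
      then show ?thesis unfolding R_def using integrable_g2
        by (intro borel_measurable_times borel_measurable_indicator borel_measurable_integrable) auto
    qed
    have Rb: "norm (R n z) \<le> indicator Q z * (norm (g z))\<^sup>2" for n z by (simp add: R_def indicator_def)
    have Ri: "integrable lebesgue (R n)" for n
      by (rule Bochner_Integration.integrable_bound[OF integrable_g2 Rm]) (use Rb in \<open>auto simp: abs_mult\<close>)
    \<comment> \<open>Only the energy in the layer of height \<open>h n\<close> matters, and this
      layer shrinks to the empty set.\<close>
    have "(\<lambda>n. LINT z|lebesgue. R n z) \<longlonglongrightarrow> (LINT z|(lebesgue :: (real \<times> real) measure). 0)"
    proof (rule integral_dominated_convergence[OF _ Rm integrable_g2])
      show "AE z in lebesgue. (\<lambda>n. R n z) \<longlonglongrightarrow> 0"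
      proof (rule AE_I2)
        fix z :: "real \<times> real"
        show "(\<lambda>n. R n z) \<longlonglongrightarrow> 0"
        proof (cases "snd z > 0")
          case True
          then have "eventually (\<lambda>n. h n < snd z) sequentially" using order_tendstoD(2)[OF h(4)] by blast
          then have "eventually (\<lambda>n. R n z = 0) sequentially"
            by eventually_elim (auto simp: R_def mem_Times_iff)
          then show ?thesis by (rule tendsto_eventually)
        next
          case False then have "R n z = 0" for n by (auto simp: R_def mem_Times_iff indicator_def)
          then show ?thesis by simp
        qed
      qed
    qed (use Rb in auto)
    then have "eventually (\<lambda>n. (LINT z|lebesgue. R n z) < r\<^sup>2) sequentially"
      using r by (intro order_tendstoD(2)) auto
    then obtain N where N: "\<And>n. n \<ge> N \<Longrightarrow> (LINT z|lebesgue. R n z) < r\<^sup>2" by (auto simp: eventually_sequentially)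
    have "norm ((LINT z|lebesgue. E n z) / h n) < r" if n: "n \<ge> N" for n
    proof -
      let ?J = "\<lambda>z. indicator (I n) (fst z) * indicator {0<..<h n} (snd z) :: real"
      have Jint: "integrable lebesgue ?J" "(LINT z|lebesgue. ?J z) = h n * h n"
        using integral_prod_mult[OF Iint(1)[of n], of "indicator {0<..<h n}"] Iint(2)[of n] h(1)[of n] by auto
      \<comment> \<open>The Young weight \<open>r / h n\<close> balances the area
        \<open>h n * h n\<close> of the square: after division by \<open>h n\<close> both terms are
        bounded by multiples of \<open>r\<close>.\<close>
      have bd: "\<bar>E n z\<bar> \<le> r / (2 * h n) * ?J z + h n / (2 * r) * R n z" for z
      proof (cases "fst z \<in> I n \<and> snd z \<in> {0<..<h n}")
        case True
        have zQ: "z \<in> Q" using True x h(1,2,3)[of n] by (auto simp: Q_def mem_Times_iff I_def)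
        have "\<bar>E n z\<bar> \<le> \<bar>snd (g z)\<bar>"
          using True w[OF h(1)[of n]] zQ by (auto simp: E_def abs_mult intro: mult_left_le)
        also have "\<dots> \<le> norm (g z)" using norm_snd_le[of "snd (g z)" "fst (g z)"] by simp
        also have "\<dots> \<le> r / (2 * h n) + h n / (2 * r) * (norm (g z))\<^sup>2"
        proof -
          have "0 \<le> (r - h n * norm (g z))\<^sup>2" by simp
          then show ?thesis using r h(1)[of n] by (simp add: field_simps power2_eq_square)
        qed
        finally show ?thesis using True zQ by (simp add: R_def mem_Times_iff)
      next
        case False
        have "indicator (I n) (fst z) * w (h n) (snd z) = 0 \<or> z \<notin> Q"
        proof (cases "fst z \<in> I n")
          case True
          then have "snd z \<le> 0 \<or> snd z \<ge> h n / 2" using False h(1)[of n] by auto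
          then show ?thesis using w[OF h(1)[of n]] by (auto simp: Q_def mem_Times_iff)
        qed simp
        then have "E n z = 0" by (auto simp: E_def)
        then show ?thesis using r h(1)[of n] by (simp add: R_def)
      qed
      have "\<bar>LINT z|lebesgue. E n z\<bar> \<le> (LINT z|lebesgue. \<bar>E n z\<bar>)" by (rule integral_abs_bound)
      also have "\<dots> \<le> (LINT z|lebesgue. r / (2 * h n) * ?J z + h n / (2 * r) * R n z)"
        by (intro integral_mono Bochner_Integration.integrable_add integrable_mult_right integrable_abs Jint Ri parts bd)
      also have "\<dots> = r / (2 * h n) * (h n * h n) + h n / (2 * r) * (LINT z|lebesgue. R n z)"
        using Jint Ri[of n] by simp
      finally have "\<bar>LINT z|lebesgue. E n z\<bar> / h n \<le> r / 2 + (LINT z|lebesgue. R n z) / (2 * r)"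
        using h(1)[of n] r by (simp add: field_simps)
      also have "\<dots> < r / 2 + r\<^sup>2 / (2 * r)" using N[OF n] r by (intro add_strict_left_mono divide_strict_right_mono) auto
      also have "\<dots> = r" using r by (simp add: power2_eq_square)
      finally show ?thesis using h(1)[of n] by simp
    qed
    then show "\<exists>N. \<forall>n\<ge>N. norm ((LINT z|lebesgue. E n z) / h n - 0) < r" by auto
  qed
  ultimately have "(\<lambda>n. (LINT z|lebesgue. B n z) / h n + (LINT z|lebesgue. E n z) / h n) \<longlonglongrightarrow> 0 + 0"
    by (rule tendsto_add)
  then have "(\<lambda>n. ((LINT z|lebesgue. indicator (I n) (fst z) * slab (w (h n)) (w' (h n)) p q z) / h n + x) - x) \<longlonglongrightarrow> 0 - x"
    unfolding eq[symmetric] by (intro tendsto_diff tendsto_const) simp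
  then show ?thesis by (simp add: I_def)
qed

text \<open>Green's formula up to the substrate with the datum inserted. The marginal
  \<open>t\<close> of one fixed slab is identified with \<open>- x\<close> at almost every point,
  and every other profile has \<open>w0\<close> times this marginal.\<close>

lemma slab_trace:
  assumes W: "profile \<tau> w0 W W'" and \<theta>: "bump a b \<theta> \<theta>'"
  shows "(LINT z|lebesgue. u z * (\<theta> (fst z) * W' (snd z))) + (LINT z|lebesgue. indicator Q z * (snd (g z) * (\<theta> (fst z) * W (snd z))))
    = - w0 * (LINT x|lborel. \<theta> x * x)"
proof -
  obtain r s M where rs: "a < r" "s < b" "\<forall>x. x \<notin> {r..s} \<longrightarrow> \<theta> x = 0 \<and> \<theta>' x = 0" "\<forall>x. \<bar>\<theta> x\<bar> \<le> M \<and> \<bar>\<theta>' x\<bar> \<le> M"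
    using bump_bounds[OF \<theta>] by metis
  \<comment> \<open>The first entries separate \<open>p\<close> and \<open>q\<close> from the
    support of \<theta>; the second ones, at one third and two thirds of the interval, ensure
    \<open>p < q\<close> even when that support is empty.\<close>
  define p where "p = min ((a + r) / 2) ((2 * a + b) / 3)"
  define q where "q = max ((s + b) / 2) ((a + 2 * b) / 3)"
  have pq: "a < p" "q < b" "p < q" "p < r" "s < q" using ab rs(1,2) by (auto simp: p_def q_def min_def max_def)
  have \<theta>pq: "bump p q \<theta> \<theta>'"
    by (rule bumpI[of _ _ _ r s]) (use bump_deriv[OF \<theta>] bump_continuous[OF \<theta>] rs pq in auto)
  have \<theta>m: "\<theta> \<in> borel_measurable borel" using bump_continuous[OF \<theta>] by (simp add: borel_measurable_continuous_onI)
  have \<theta>b: "\<And>x. \<bar>\<theta> x\<bar> \<le> M" using rs by simp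
  have \<theta>z: "\<theta> x = 0" if "x \<notin> {p..q}" for x using rs(3) that pq by auto
  obtain w w' C where w: "\<And>h. 0 < h \<Longrightarrow> (\<forall>\<tau>\<ge>h. profile \<tau> 1 (w h) (w' h)) \<and> (\<forall>y. \<bar>w h y\<bar> \<le> 1) \<and> (\<forall>y. \<bar>w' h y\<bar> \<le> C / h) \<and>
     (\<forall>y. y \<notin> {h/4..h/2} \<longrightarrow> w' h y = 0) \<and> (\<forall>y\<ge>h/2. w h y = 0) \<and> integrable lborel (w' h) \<and> (LINT y|lborel. w' h y) = (-1::real)"
    using profile_family by blast
  define W0 where "W0 = w \<tau>"
  define W0' where "W0' = w' \<tau>"
  have W0: "profile \<tau> 1 W0 W0'" using w[OF tau] by (simp add: W0_def W0'_def)
  obtain t where t: "integrable lborel t" "\<forall>\<theta> M. \<theta> \<in> borel_measurable borel \<longrightarrow> (\<forall>x. \<bar>\<theta> x\<bar> \<le> M) \<longrightarrow>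
        (LINT z|lebesgue. \<theta> (fst z) * slab W0 W0' p q z) = (LINT x|lborel. \<theta> x * t x)"
    using lebesgue_integral_prod[OF integrable_slab[OF W0 pq(1,2)]] by metis
  \<comment> \<open>At a Lebesgue point the averages of \<open>t\<close> tend to \<open>t x\<close>.
    By \<open>slab_indicator\<close> the same averages may be computed with the shrinking profile of
    height \<open>h n\<close> in place of the fixed one, and then they tend to
    \<open>- x\<close>.\<close>
  have "AE x in lborel. p < x \<and> x < q \<longrightarrow> t x = - x"
    using trace Lebesgue_differentiation_right[OF t(1)]
  proof eventually_elim
    case (elim x)
    show ?case
    proof
      assume x: "p < x \<and> x < q"
      then have tr: "has_trace_at u D (x, 0) x" using elim(1) pq by auto
      define c where "c = min \<tau> (q - x)"
      have c: "0 < c" "c \<le> \<tau>" "x + c \<le> q" using x tau by (auto simp: c_def)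
      define h where "h n = c / real (Suc n)" for n
      have hc: "h n \<le> c" for n using c by (simp add: h_def field_simps)
      have h: "0 < h n" "x + h n \<le> q" "h n \<le> \<tau>" for n using c hc[of n] by (auto simp: h_def)
      have h0: "h \<longlonglongrightarrow> 0" unfolding h_def[abs_def] by (rule LIMSEQ_Suc[OF lim_const_over_n])
      have 1: "(\<lambda>n. (LINT s|lborel. indicator {x<..<x + h n} s * t s) / h n) \<longlonglongrightarrow> - x"
      proof -
        have "(LINT z|lebesgue. indicator {x<..<x + h n} (fst z) * slab (w (h n)) (w' (h n)) p q z) = (LINT s|lborel. indicator {x<..<x + h n} s * t s)" for n
        proof -
          have pr: "profile \<tau> 1 (w (h n)) (w' (h n))" using w[OF h(1)[of n]] h(3)[of n] by blast
          have "(LINT z|lebesgue. indicator {x<..<x + h n} (fst z) * slab (w (h n)) (w' (h n)) p q z) = 1 * (LINT z|lebesgue. indicator {x<..<x + h n} (fst z) * slab W0 W0' p q z)"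
            using x h(1,2)[of n] by (intro slab_indicator[OF pr W0 pq(1,2)]) auto
          also have "\<dots> = (LINT s|lborel. indicator {x<..<x + h n} s * t s)"
            using t(2)[rule_format, of "indicator {x<..<x + h n}" 1] by (simp add: indicator_def)
          finally show ?thesis .
        qed
        then show ?thesis using slab_average[OF pq(1,2) _ _ tr h h0 w] x by simp
      qed
      have 2: "(\<lambda>n. (LINT s|lborel. indicator {x<..<x + h n} s * t s) / h n) \<longlonglongrightarrow> t x"
      proof (rule LIMSEQ_I)
        fix e :: real assume "0 < e"
        then obtain d where d: "d > 0" "\<And>h. 0 < h \<Longrightarrow> h < d \<Longrightarrow> \<bar>(LINT s|lborel. indicator {x<..<x+h} s * t s) / h - t x\<bar> < e"
          using elim(2) by blast
        obtain N where "\<forall>n\<ge>N. h n < d" using order_tendstoD(2)[OF h0 d(1)] by (auto simp: eventually_sequentially)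
        then show "\<exists>N. \<forall>n\<ge>N. norm ((LINT s|lborel. indicator {x<..<x + h n} s * t s) / h n - t x) < e"
          using d(2) h(1) by (intro exI[of _ N]) auto
      qed
      show "t x = - x" by (rule LIMSEQ_unique[OF 2 1])
    qed
  qed
  then have "(LINT x|lborel. \<theta> x * t x) = (LINT x|lborel. - (\<theta> x * x))"
  proof (intro integral_cong_AE)
    assume "AE x in lborel. p < x \<and> x < q \<longrightarrow> t x = - x"
    then show "AE x in lborel. \<theta> x * t x = - (\<theta> x * x)"
    proof eventually_elim
      case (elim x) show ?case
        using elim rs(3) pq by (cases "x \<in> {r..s}") auto
    qed
  qed (use \<theta>m borel_measurable_integrable[OF t(1)] in auto)
  moreover have "(LINT z|lebesgue. \<theta> (fst z) * slab W W' p q z) = w0 * (LINT x|lborel. \<theta> x * t x)"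
    using slab_bump[OF W W0 pq(1,2) \<theta>pq] t(2)[rule_format, OF \<theta>m \<theta>b] by simp
  ultimately show ?thesis
    using slab_weighted[OF W pq(1,2) \<theta>m \<theta>b \<theta>z] by simp
qed

text \<open>The integral of u X' Y' is evaluated twice: by the weak x-derivative tested with X Y',
  and by \<open>slab_trace\<close> with weight X'. Eliminating it removes \<open>u\<close> and
  leaves the gradient paired with (- X Y', X' Y), the rotated gradient of the stream function X Y.
  On the right the datum x is integrated by parts against X'.\<close>

lemma product_identity_compact:
  assumes X: "bump a b X X'" "bump a b X' X''" and Y: "profile \<tau> w0 Y Y'" "bump 0 \<tau> Y' Y''"
  shows "(LINT z|lebesgue. indicator Q z * (snd (g z) * (X' (fst z) * Y (snd z)))) - (LINT z|lebesgue. indicator Q z * (fst (g z) * (X (fst z) * Y' (snd z))))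
     = w0 * (LINT x|lborel. X x)"
proof -
  obtain r s where rs: "a < r" "s < b" "\<forall>x. x \<notin> {r..s} \<longrightarrow> X x = 0 \<and> X' x = 0"
    using bump_bounds[OF X(1)] by metis
  \<comment> \<open>Keeps the interval from \<open>r' - 1\<close> to \<open>s + 1\<close>
    nondegenerate when the support interval of \<open>X\<close> is empty.\<close>
  define r' where "r' = min r s"
  have rs': "r' \<le> r" "r' \<le> s" by (auto simp: r'_def)
  obtain r2 s2 where rs2: "0 < r2" "s2 < \<tau>" "\<forall>x. x \<notin> {r2..s2} \<longrightarrow> Y' x = 0"
    using bump_bounds[OF Y(2)] by metis
  have dX: "((\<lambda>x. x * X x) has_real_derivative X x + X' x * x) (at x)" for x
    using DERIV_mult[OF DERIV_ident bump_deriv[OF X(1)]] by simp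
  have cX: "continuous_on UNIV X" "continuous_on UNIV X'" using bump_continuous[OF X(1)] by auto
  have "has_bochner_integral lborel (\<lambda>x. (X x + X' x * x) * indicator {r'-1..s+1} x) ((s + 1) * X (s + 1) - (r'-1) * X (r'-1))"
    using rs'(2) cX by (intro has_bochner_integral_FTC_Icc_real dX) (auto simp: continuous_on_eq_continuous_at intro!: continuous_intros)
  moreover have "X (s + 1) = 0" "X (r' - 1) = 0" using rs' rs(3) by auto
  moreover have "(\<lambda>x. (X x + X' x * x) * indicator {r'-1..s+1} x) = (\<lambda>x. X x + X' x * x)"
  proof
    fix x show "(X x + X' x * x) * indicator {r'-1..s+1} x = X x + X' x * x"
      using rs(3)[rule_format, of x] rs'(1) by (cases "x \<in> {r'-1..s+1}") auto
  qed
  ultimately have "(LINT x|lborel. X x + X' x * x) = 0" by (simp add: has_bochner_integral_iff)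
  moreover have "integrable lborel X" "integrable lborel (\<lambda>x. X' x * x)"
  proof -
    have *: "integrable lborel f" if f: "continuous_on UNIV f" "\<And>x. x \<notin> {r..s} \<Longrightarrow> f x = 0" for f :: "real \<Rightarrow> real"
    proof -
      have "integrable lborel (\<lambda>x. indicator {r..s} x *\<^sub>R f x)"
        using borel_integrable_compact[of "{r..s}" f] continuous_on_subset[OF f(1)] by auto
      moreover have "(\<lambda>x. indicator {r..s} x *\<^sub>R f x) = f"
      proof
        fix x show "indicator {r..s} x *\<^sub>R f x = f x" using f(2)[of x] by (cases "x \<in> {r..s}") auto
      qed
      ultimately show ?thesis by simp
    qed
    show "integrable lborel X" by (rule *) (use cX rs(3) in auto)
    show "integrable lborel (\<lambda>x. X' x * x)" by (rule *) (use cX rs(3) in \<open>auto intro!: continuous_intros\<close>)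
  qed
  ultimately have parts: "(LINT x|lborel. X' x * x) = - (LINT x|lborel. X x)" by simp
  have "(\<lambda>z. indicator Q z * (fst (g z) * (X (fst z) * Y' (snd z)))) = (\<lambda>z. fst (g z) * (X (fst z) * Y' (snd z)))"
  proof
    fix z
    have "X (fst z) * Y' (snd z) = 0" if "z \<notin> Q"
    proof -
      have "fst z \<notin> {r..s} \<or> snd z \<notin> {r2..s2}" using that rs rs2 by (auto simp: Q_def mem_Times_iff)
      then show ?thesis using rs(3) rs2(3) by auto
    qed
    then show "indicator Q z * (fst (g z) * (X (fst z) * Y' (snd z))) = fst (g z) * (X (fst z) * Y' (snd z))"
      by (cases "z \<in> Q") auto
  qed
  then show ?thesis
    using weak_gradient_bumps(1)[OF grad opn X(1) Y(2) sub] slab_trace[OF Y(1) X(2)] parts by simp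
qed

end

section \<open>Integration by parts up to the boundary of a rectangle\<close>

lemma integral_FTC_open:
  fixes F f :: "real \<Rightarrow> real"
  assumes "a \<le> b" "\<And>x. (F has_real_derivative f x) (at x)" "continuous_on UNIV f"
  shows "integrable lborel (\<lambda>x. indicator {a<..<b} x * f x)" "(LINT x|lborel. indicator {a<..<b} x * f x) = F b - F a"
proof -
  have "has_bochner_integral lborel (\<lambda>x. f x * indicator {a..b} x) (F b - F a)"
    using assms by (intro has_bochner_integral_FTC_Icc_real) (auto simp: continuous_on_eq_continuous_at)
  moreover have "has_bochner_integral lborel (\<lambda>x. f x * indicator {a..b} x) c = has_bochner_integral lborel (\<lambda>x. indicator {a<..<b} x * f x) c" for c
  proof (rule has_bochner_integral_cong_AE)
    have "f \<in> borel_measurable borel" using assms(3) by (rule borel_measurable_continuous_onI)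
    then show "(\<lambda>x. f x * indicator {a..b} x) \<in> borel_measurable lborel" "(\<lambda>x. indicator {a<..<b} x * f x) \<in> borel_measurable lborel" by auto
    show "AE x in lborel. f x * indicator {a..b} x = indicator {a<..<b} x * f x"
      using AE_lborel_singleton[of a] AE_lborel_singleton[of b] by eventually_elim (auto simp: indicator_def)
  qed
  ultimately have "has_bochner_integral lborel (\<lambda>x. indicator {a<..<b} x * f x) (F b - F a)" by simp
  then show "integrable lborel (\<lambda>x. indicator {a<..<b} x * f x)" "(LINT x|lborel. indicator {a<..<b} x * f x) = F b - F a"
    by (simp_all add: has_bochner_integral_iff)
qed

lemma continuous_has_antiderivative:
  fixes f :: "real \<Rightarrow> real"
  assumes "continuous_on UNIV f"
  shows "\<exists>F. \<forall>x. (F has_real_derivative f x) (at x)"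
proof -
  have "\<exists>F. \<forall>x::real. - \<infinity> < ereal x \<longrightarrow> ereal x < \<infinity> \<longrightarrow> (F has_vector_derivative f x) (at x)"
    using assms by (intro einterval_antiderivative) (auto simp: continuous_on_eq_continuous_at)
  then show ?thesis by (simp add: has_real_derivative_iff_has_vector_derivative)
qed

text \<open>Cutting off a vertical factor near y = 0 would destroy its trace. Instead its derivative
  is cut off and integrated back from the top, which leaves the factor constant near the
  substrate.\<close>

lemma profile_antiderivative:
  assumes f: "bump 0 \<tau> f f'" and tau: "0 < \<tau>"
  shows "\<exists>W. profile \<tau> (W 0) W f \<and> (\<forall>y. 0 \<le> y \<and> y \<le> \<tau> \<longrightarrow> W y = - (LINT s|lborel. indicator {y<..<\<tau>} s * f s))"
proof -
  note c = bump_continuous[OF f]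
  obtain F where F: "\<forall>x. (F has_real_derivative f x) (at x)" using continuous_has_antiderivative[OF c(1)] by blast
  define W where "W y = F y - F \<tau>" for y
  have dW: "(W has_real_derivative f y) (at y)" for y
    unfolding W_def[abs_def] using DERIV_diff[OF F[rule_format] DERIV_const] by simp
  obtain p q M where pq: "0 < p" "q < \<tau>" "\<forall>x. x \<notin> {p..q} \<longrightarrow> f x = 0" "\<forall>x. \<bar>f x\<bar> \<le> M"
    using bump_bounds[OF f] by metis
  have lo: "W y = W 0" if "y < p" for y
  proof -
    have "\<exists>c. \<forall>x\<in>{..<p}. W x = c"
    proof (rule has_field_derivative_zero_constant)
      fix x assume "x \<in> {..<p}"
      then have "f x = 0" using pq(3) by auto
      then show "(W has_real_derivative 0) (at x within {..<p})"
        using has_field_derivative_at_within[OF dW[of x]] by simp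
    qed simp
    then show ?thesis using that pq(1) by auto
  qed
  have hi: "W y = 0" if "y > q" for y
  proof -
    have "\<exists>c. \<forall>x\<in>{q<..}. W x = c"
    proof (rule has_field_derivative_zero_constant)
      fix x assume "x \<in> {q<..}"
      then have "f x = 0" using pq(3) by auto
      then show "(W has_real_derivative 0) (at x within {q<..})"
        using has_field_derivative_at_within[OF dW[of x]] by simp
    qed simp
    then have "W y = W \<tau>" using that pq(2) by auto
    then show ?thesis by (simp add: W_def)
  qed
  have cW: "continuous_on UNIV W" using dW by (meson DERIV_continuous_on has_field_derivative_at_within)
  have "bounded (W ` {p..q})"
    by (intro compact_imp_bounded compact_continuous_image continuous_on_subset[OF cW]) auto
  then obtain B where B: "\<forall>y\<in>W ` {p..q}. \<bar>y\<bar> \<le> B" unfolding bounded_real by blast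
  define N where "N = max (max B \<bar>W 0\<bar>) (max M 0)"
  have N: "\<bar>W y\<bar> \<le> N" for y
  proof (cases "y \<in> {p..q}")
    case True then show ?thesis using B by (auto simp: N_def le_max_iff_disj)
  next
    case False then show ?thesis using lo[of y] hi[of y] by (auto simp: N_def le_max_iff_disj not_le)
  qed
  have pr: "profile \<tau> (W 0) W f"
    unfolding profile_def
  proof (intro conjI allI dW c)
    have "0 < p / 2 \<and> (q + \<tau>) / 2 < \<tau> \<and> (\<forall>y\<le>p/2. W y = W 0) \<and> (\<forall>y\<ge>(q + \<tau>)/2. W y = 0) \<and>
        (\<forall>y. y \<notin> {p/2..(q + \<tau>)/2} \<longrightarrow> f y = 0) \<and> (\<forall>y. \<bar>W y\<bar> \<le> N \<and> \<bar>f y\<bar> \<le> N)"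
    proof (intro conjI allI impI)
      show "0 < p / 2" "(q + \<tau>) / 2 < \<tau>" using pq(1,2) by auto
      fix y
      show "W y = W 0" if "y \<le> p / 2" using lo[of y] pq(1) that by auto
      show "W y = 0" if "(q + \<tau>) / 2 \<le> y" using hi[of y] pq(2) that by auto
      show "f y = 0" if "y \<notin> {p/2..(q + \<tau>)/2}" using pq that by auto
      show "\<bar>W y\<bar> \<le> N" by (rule N)
      show "\<bar>f y\<bar> \<le> N" using pq(4)[rule_format, of y] by (auto simp: N_def)
    qed
    then show "\<exists>s t M. 0 < s \<and> t < \<tau> \<and> (\<forall>y\<le>s. W y = W 0) \<and> (\<forall>y\<ge>t. W y = 0) \<and> (\<forall>y. y \<notin> {s..t} \<longrightarrow> f y = 0) \<and>
        (\<forall>y. \<bar>W y\<bar> \<le> M \<and> \<bar>f y\<bar> \<le> M)" by blast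
  qed
  have "W y = - (LINT s|lborel. indicator {y<..<\<tau>} s * f s)" if "0 \<le> y \<and> y \<le> \<tau>" for y
    using integral_FTC_open(2)[of y \<tau> F f] F c(1) that by (simp add: W_def)
  with pr show ?thesis by blast
qed

context elastic_rectangle begin

text \<open>Removes the compact supports: \<open>X\<close> is multiplied by lateral cutoffs, while
  for \<open>Y\<close> the cutoff is put on \<open>Y'\<close>. Both limits follow by dominated
  convergence because \<open>g\<close> is integrable on the whole rectangle. The linear vanishing of
  \<open>X\<close> at the sides is what controls the derivative of the lateral cutoff.\<close>

lemma product_identity:
  assumes X: "\<And>x. (X has_real_derivative X' x) (at x)" "\<And>x. (X' has_real_derivative X'' x) (at x)" "continuous_on UNIV X''"
    "\<And>x. a < x \<Longrightarrow> x < b \<Longrightarrow> \<bar>X x\<bar> \<le> L * min (x - a) (b - x)"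
   and Y: "\<And>y. (Y has_real_derivative Y' y) (at y)" "\<And>y. (Y' has_real_derivative Y'' y) (at y)" "continuous_on UNIV Y''" "Y \<tau> = 0"
  shows "(LINT z|lebesgue. indicator Q z * (snd (g z) * (X' (fst z) * Y (snd z)))) - (LINT z|lebesgue. indicator Q z * (fst (g z) * (X (fst z) * Y' (snd z))))
     = Y 0 * (LINT x|lborel. indicator {a<..<b} x * X x)"
proof -
  obtain \<eta> \<eta>' \<eta>'' :: "nat \<Rightarrow> real \<Rightarrow> real" and C where \<eta>:
    "\<And>n. bump a b (\<eta> n) (\<eta>' n)" "\<And>n. bump a b (\<eta>' n) (\<eta>'' n)"
    "\<And>n s. 0 \<le> \<eta> n s" "\<And>n s. \<eta> n s \<le> 1"
    "\<And>s. a < s \<Longrightarrow> s < b \<Longrightarrow> eventually (\<lambda>n. \<eta> n s = 1 \<and> \<eta>' n s = 0) sequentially"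
    "\<And>n s. a < s \<Longrightarrow> s < b \<Longrightarrow> \<bar>\<eta>' n s\<bar> * min (s - a) (b - s) \<le> C"
    by (rule cutoff_sequence[OF ab]) (rule that)
  obtain \<kappa> \<kappa>' \<kappa>'' :: "nat \<Rightarrow> real \<Rightarrow> real" and C' where \<kappa>:
    "\<And>n. bump 0 \<tau> (\<kappa> n) (\<kappa>' n)" "\<And>n. bump 0 \<tau> (\<kappa>' n) (\<kappa>'' n)"
    "\<And>n s. 0 \<le> \<kappa> n s" "\<And>n s. \<kappa> n s \<le> 1"
    "\<And>s. 0 < s \<Longrightarrow> s < \<tau> \<Longrightarrow> eventually (\<lambda>n. \<kappa> n s = 1 \<and> \<kappa>' n s = 0) sequentially"
    "\<And>n s. 0 < s \<Longrightarrow> s < \<tau> \<Longrightarrow> \<bar>\<kappa>' n s\<bar> * min (s - 0) (\<tau> - s) \<le> C'"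
    by (rule cutoff_sequence[OF tau]) (rule that)
  have cX: "continuous_on UNIV X" "continuous_on UNIV X'" and cY: "continuous_on UNIV Y" "continuous_on UNIV Y'"
    using X(1,2) Y(1,2) by (meson DERIV_continuous_on has_field_derivative_at_within)+
  note c\<eta> = bump_continuous[OF \<eta>(1)] bump_continuous[OF \<eta>(2)]
  note c\<kappa> = bump_continuous[OF \<kappa>(1)] bump_continuous[OF \<kappa>(2)]
  define Xn where "Xn n x = X x * \<eta> n x" for n x
  define Xn' where "Xn' n x = X' x * \<eta> n x + X x * \<eta>' n x" for n x
  define Xn'' where "Xn'' n x = X'' x * \<eta> n x + 2 * (X' x * \<eta>' n x) + X x * \<eta>'' n x" for n x
  have d1: "(Xn n has_real_derivative Xn' n x) (at x)" for n x
    unfolding Xn_def[abs_def] Xn'_def using DERIV_mult[OF X(1) bump_deriv[OF \<eta>(1)]] by (simp add: add.commute mult.commute)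
  have d2: "(Xn' n has_real_derivative Xn'' n x) (at x)" for n x
    unfolding Xn'_def[abs_def] Xn''_def
    using DERIV_add[OF DERIV_mult[OF X(2) bump_deriv[OF \<eta>(1)[of n]]] DERIV_mult[OF X(1) bump_deriv[OF \<eta>(2)[of n]]]]
    by (simp add: algebra_simps)
  have bX: "bump a b (Xn n) (Xn' n)" "bump a b (Xn' n) (Xn'' n)" for n
  proof -
    obtain p q where pq: "a < p" "q < b" "\<forall>x. x \<notin> {p..q} \<longrightarrow> \<eta> n x = 0 \<and> \<eta>' n x = 0"
      using bump_bounds[OF \<eta>(1)[of n]] by metis
    show "bump a b (Xn n) (Xn' n)"
      by (rule bumpI[OF d1 _ pq(1,2)])
        (use pq(3) in \<open>auto simp: Xn_def Xn'_def[abs_def] intro!: continuous_intros cX c\<eta>\<close>)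
    show "bump a b (Xn' n) (Xn'' n)"
      by (rule bumpI[OF d2 _ pq(1,2)])
        (use pq(3) in \<open>auto simp: Xn'_def Xn''_def[abs_def] intro!: continuous_intros cX c\<eta> X(3)\<close>)
  qed
  have bY: "bump 0 \<tau> (\<lambda>y. Y' y * \<kappa> n y) (\<lambda>y. Y'' y * \<kappa> n y + Y' y * \<kappa>' n y)" for n
  proof -
    obtain p q where pq: "0 < p" "q < \<tau>" "\<forall>x. x \<notin> {p..q} \<longrightarrow> \<kappa> n x = 0 \<and> \<kappa>' n x = 0"
      using bump_bounds[OF \<kappa>(1)[of n]] by metis
    show ?thesis
      by (rule bumpI[OF _ _ pq(1,2)]) (use pq(3) DERIV_mult[OF Y(2) bump_deriv[OF \<kappa>(1)[of n]]] in 
        \<open>auto simp: algebra_simps intro!: continuous_intros cY c\<kappa> Y(3)\<close>)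
  qed
  obtain Yn where Yn: "\<And>n. profile \<tau> (Yn n 0) (Yn n) (\<lambda>y. Y' y * \<kappa> n y)"
    "\<And>n y. 0 \<le> y \<Longrightarrow> y \<le> \<tau> \<Longrightarrow> Yn n y = - (LINT s|lborel. indicator {y<..<\<tau>} s * (Y' s * \<kappa> n s))"
    using profile_antiderivative[OF bY tau] by metis
  have mi: "(\<lambda>s. indicator {c<..<d} s * f s) \<in> borel_measurable lborel" if "continuous_on UNIV f" for f :: "real \<Rightarrow> real" and c d
    using borel_measurable_continuous_onI[OF that] by simp
  have bdd: "\<exists>B. \<forall>x\<in>{c..d}. \<bar>f x\<bar> \<le> B" if "continuous_on UNIV f" for f :: "real \<Rightarrow> real" and c d
  proof -
    have "bounded (f ` {c..d})"
      by (intro compact_imp_bounded compact_continuous_image continuous_on_subset[OF that]) auto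
    then show ?thesis unfolding bounded_real by blast
  qed
  obtain MX where MX: "\<forall>x\<in>{a..b}. \<bar>X x\<bar> \<le> MX" using bdd[OF cX(1)] by blast
  obtain MX' where MX': "\<forall>x\<in>{a..b}. \<bar>X' x\<bar> \<le> MX'" using bdd[OF cX(2)] by blast
  obtain MY' where MY': "\<forall>x\<in>{0..\<tau>}. \<bar>Y' x\<bar> \<le> MY'" using bdd[OF cY(2)] by blast
  have nn: "0 \<le> MX" "0 \<le> MX'" "0 \<le> MY'" using MX MX' MY' ab tau by (force intro: order_trans[OF abs_ge_zero])+
  have L0: "0 \<le> L"
    using order_trans[OF abs_ge_zero X(4)[of "(a+b)/2"]] ab by (simp add: zero_le_mult_iff min_def split: if_splits)
  have iM: "integrable lborel (\<lambda>s. indicator {0<..<\<tau>} s * MY')" using tau by (intro integrable_mult_left) simp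
  have dom: "\<bar>indicator {y<..<\<tau>} s * (Y' s * \<kappa> n s)\<bar> \<le> indicator {0<..<\<tau>} s * MY'" if "0 \<le> y" for y s n
  proof (cases "s \<in> {y<..<\<tau>}")
    case True
    then have "\<bar>Y' s\<bar> * \<kappa> n s \<le> MY' * 1" using MY' \<kappa>(3,4) that nn by (intro mult_mono) auto
    then show ?thesis using True that \<kappa>(3) by (simp add: abs_mult)
  qed (use nn in simp)
  have Ymeas: "(\<lambda>s. indicator {y<..<\<tau>} s * (Y' s * \<kappa> n s)) \<in> borel_measurable lborel" "(\<lambda>s. indicator {y<..<\<tau>} s * Y' s) \<in> borel_measurable lborel" for y n
    by (intro mi continuous_intros cY c\<kappa>)+
  have Ybd: "\<bar>Yn n y\<bar> \<le> \<tau> * MY'" if y: "0 \<le> y" "y \<le> \<tau>" for n y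
  proof -
    have "\<bar>Yn n y\<bar> \<le> (LINT s|lborel. \<bar>indicator {y<..<\<tau>} s * (Y' s * \<kappa> n s)\<bar>)"
      using integral_abs_bound unfolding Yn(2)[OF y] by simp
    also have "\<dots> \<le> (LINT s|lborel. indicator {0<..<\<tau>} s * MY')"
      using dom[OF y(1)]
      by (intro integral_mono integrable_abs iM Bochner_Integration.integrable_bound[OF iM Ymeas(1)]) (auto intro: AE_I2 order_trans[OF _ abs_ge_self])
    also have "\<dots> = \<tau> * MY'" using tau by simp
    finally show ?thesis .
  qed
  have Ylim: "(\<lambda>n. Yn n y) \<longlonglongrightarrow> Y y" if y: "0 \<le> y" "y \<le> \<tau>" for y
  proof -
    have "(\<lambda>n. LINT s|lborel. indicator {y<..<\<tau>} s * (Y' s * \<kappa> n s)) \<longlonglongrightarrow> (LINT s|lborel. indicator {y<..<\<tau>} s * Y' s)"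
    proof (rule integral_dominated_convergence[OF Ymeas(2) Ymeas(1) iM])
      show "AE s in lborel. norm (indicator {y<..<\<tau>} s * (Y' s * \<kappa> n s)) \<le> indicator {0<..<\<tau>} s * MY'" for n
        using dom[OF y(1)] by simp
      show "AE s in lborel. (\<lambda>n. indicator {y<..<\<tau>} s * (Y' s * \<kappa> n s)) \<longlonglongrightarrow> indicator {y<..<\<tau>} s * Y' s"
      proof (rule AE_I2)
        fix s
        show "(\<lambda>n. indicator {y<..<\<tau>} s * (Y' s * \<kappa> n s)) \<longlonglongrightarrow> indicator {y<..<\<tau>} s * Y' s"
        proof (cases "s \<in> {y<..<\<tau>}")
          case True
          then have "eventually (\<lambda>n. indicator {y<..<\<tau>} s * (Y' s * \<kappa> n s) = indicator {y<..<\<tau>} s * Y' s) sequentially"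
            using y by (intro eventually_mono[OF \<kappa>(5)[of s]]) auto
          then show ?thesis by (rule tendsto_eventually)
        qed simp
      qed
    qed
    then have "(\<lambda>n. Yn n y) \<longlonglongrightarrow> - (LINT s|lborel. indicator {y<..<\<tau>} s * Y' s)"
      unfolding Yn(2)[OF y] by (rule tendsto_minus)
    also have "(LINT s|lborel. indicator {y<..<\<tau>} s * Y' s) = - Y y"
      using integral_FTC_open(2)[OF y(2) Y(1) cY(2)] Y(4) by simp
    finally show ?thesis by simp
  qed
  have Xbd: "\<bar>Xn n x\<bar> \<le> MX" "\<bar>Xn' n x\<bar> \<le> MX' + L * C" if x: "a < x" "x < b" for n x
  proof -
    have "\<bar>X x\<bar> * \<bar>\<eta> n x\<bar> \<le> MX * 1" using MX x \<eta>(3,4) nn by (intro mult_mono) auto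
    then show "\<bar>Xn n x\<bar> \<le> MX" by (simp add: Xn_def abs_mult)
    have "\<bar>X' x\<bar> * \<bar>\<eta> n x\<bar> \<le> MX' * 1" using MX' x \<eta>(3,4) nn by (intro mult_mono) auto
    \<comment> \<open>The slope of the cutoff blows up like one over the distance to the sides, and
      \<open>X\<close> is bounded by \<open>L\<close> times this distance.\<close>
    moreover have "\<bar>X x\<bar> * \<bar>\<eta>' n x\<bar> \<le> L * C"
    proof -
      have "\<bar>X x\<bar> * \<bar>\<eta>' n x\<bar> \<le> L * min (x - a) (b - x) * \<bar>\<eta>' n x\<bar>" by (intro mult_right_mono X(4) x) simp
      also have "\<dots> \<le> L * C" using mult_left_mono[OF \<eta>(6)[OF x, of n] L0] by (simp add: mult_ac)
      finally show ?thesis .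
    qed
    ultimately show "\<bar>Xn' n x\<bar> \<le> MX' + L * C"
      unfolding Xn'_def using abs_triangle_ineq[of "X' x * \<eta> n x" "X x * \<eta>' n x"] by (simp add: abs_mult)
  qed
  have Xlim: "(\<lambda>n. Xn n x) \<longlonglongrightarrow> X x" "(\<lambda>n. Xn' n x) \<longlonglongrightarrow> X' x" if x: "a < x" "x < b" for x
  proof -
    have "eventually (\<lambda>n. Xn n x = X x) sequentially" "eventually (\<lambda>n. Xn' n x = X' x) sequentially"
      by (rule eventually_mono[OF \<eta>(5)[OF x]], simp add: Xn_def Xn'_def)+
    then show "(\<lambda>n. Xn n x) \<longlonglongrightarrow> X x" "(\<lambda>n. Xn' n x) \<longlonglongrightarrow> X' x" by (auto intro: tendsto_eventually)
  qed
  have m2: "(\<lambda>z. f (fst z) * k (snd z)) \<in> borel_measurable borel" if "continuous_on UNIV f" "continuous_on UNIV k" for f k :: "real \<Rightarrow> real"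
    by (intro borel_measurable_continuous_onI continuous_on_fst_snd_mult that)
  have lim2: "(\<lambda>n. LINT z|lebesgue. indicator Q z * (G z * (fn n (fst z) * kn n (snd z)))) \<longlonglongrightarrow> (LINT z|lebesgue. indicator Q z * (G z * (f (fst z) * k (snd z))))"
    if G: "integrable lebesgue (\<lambda>z. indicator Q z * G z)" 
      and cn: "\<And>n. continuous_on UNIV (fn n)" "\<And>n. continuous_on UNIV (kn n)" "continuous_on UNIV f" "continuous_on UNIV k"
      and bn: "\<And>n x. a < x \<Longrightarrow> x < b \<Longrightarrow> \<bar>fn n x\<bar> \<le> M1" "\<And>n y. 0 < y \<Longrightarrow> y < \<tau> \<Longrightarrow> \<bar>kn n y\<bar> \<le> M2"
      and ln: "\<And>x. a < x \<Longrightarrow> x < b \<Longrightarrow> (\<lambda>n. fn n x) \<longlonglongrightarrow> f x" "\<And>y. 0 < y \<Longrightarrow> y < \<tau> \<Longrightarrow> (\<lambda>n. kn n y) \<longlonglongrightarrow> k y"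
    for G :: "real \<times> real \<Rightarrow> real" and fn kn :: "nat \<Rightarrow> real \<Rightarrow> real" and f k M1 M2
  proof (rule integral_dominated_convergence)
    note mG = borel_measurable_integrable[OF G]
    have M1: "0 \<le> M1" using order_trans[OF abs_ge_zero bn(1)[of "(a+b)/2"]] ab by simp
    show "integrable lebesgue (\<lambda>z. M1 * M2 * \<bar>indicator Q z * G z\<bar>)" by (intro integrable_mult_right integrable_abs G)
    show "(\<lambda>z. indicator Q z * (G z * (f (fst z) * k (snd z)))) \<in> borel_measurable lebesgue"
      using borel_measurable_times[OF mG borel_measurable_lebesgueI[OF m2[OF cn(3,4)]]] by (simp add: mult.assoc)
    show "(\<lambda>z. indicator Q z * (G z * (fn n (fst z) * kn n (snd z)))) \<in> borel_measurable lebesgue" for n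
      using borel_measurable_times[OF mG borel_measurable_lebesgueI[OF m2[OF cn(1,2)]]] by (simp add: mult.assoc)
    show "AE z in lebesgue. (\<lambda>n. indicator Q z * (G z * (fn n (fst z) * kn n (snd z)))) \<longlonglongrightarrow> indicator Q z * (G z * (f (fst z) * k (snd z)))"
    proof (rule AE_I2)
      fix z :: "real \<times> real"
      show "(\<lambda>n. indicator Q z * (G z * (fn n (fst z) * kn n (snd z)))) \<longlonglongrightarrow> indicator Q z * (G z * (f (fst z) * k (snd z)))"
      proof (cases "z \<in> Q")
        case True
        then have "a < fst z" "fst z < b" "0 < snd z" "snd z < \<tau>" by (auto simp: Q_def)
        then show ?thesis by (intro tendsto_intros ln)
      qed simp
    qed
    show "AE z in lebesgue. norm (indicator Q z * (G z * (fn n (fst z) * kn n (snd z)))) \<le> M1 * M2 * \<bar>indicator Q z * G z\<bar>" for n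
    proof (rule AE_I2)
      fix z :: "real \<times> real"
      show "norm (indicator Q z * (G z * (fn n (fst z) * kn n (snd z)))) \<le> M1 * M2 * \<bar>indicator Q z * G z\<bar>"
      proof (cases "z \<in> Q")
        case True
        then have "a < fst z" "fst z < b" "0 < snd z" "snd z < \<tau>" by (auto simp: Q_def)
        then have "\<bar>fn n (fst z)\<bar> * \<bar>kn n (snd z)\<bar> \<le> M1 * M2" using M1 by (intro mult_mono bn) auto
        then have "\<bar>G z\<bar> * (\<bar>fn n (fst z)\<bar> * \<bar>kn n (snd z)\<bar>) \<le> \<bar>G z\<bar> * (M1 * M2)" by (intro mult_left_mono) auto
        then show ?thesis using True by (simp add: abs_mult mult_ac)
      qed simp
    qed
  qed
  have G: "integrable lebesgue (\<lambda>z. indicator Q z * snd (g z))" "integrable lebesgue (\<lambda>z. indicator Q z * fst (g z))"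
    using integrable_g_mult[of "\<lambda>_. 1" 1] by auto
  have 1: "(\<lambda>n. LINT z|lebesgue. indicator Q z * (snd (g z) * (Xn' n (fst z) * Yn n (snd z)))) \<longlonglongrightarrow> (LINT z|lebesgue. indicator Q z * (snd (g z) * (X' (fst z) * Y (snd z))))"
    by (rule lim2[OF G(1) bump_continuous(1)[OF bX(2)] profile_continuous(1)[OF Yn(1)] cX(2) cY(1) Xbd(2) Ybd Xlim(2) Ylim]) auto
  have kb: "\<bar>Y' y * \<kappa> n y\<bar> \<le> MY'" if "0 < y" "y < \<tau>" for n y
  proof -
    have "\<bar>Y' y\<bar> * \<bar>\<kappa> n y\<bar> \<le> MY' * 1" using MY' that \<kappa>(3,4) nn by (intro mult_mono) auto
    then show ?thesis by (simp add: abs_mult)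
  qed
  have kl: "(\<lambda>n. Y' y * \<kappa> n y) \<longlonglongrightarrow> Y' y" if "0 < y" "y < \<tau>" for y
    by (intro tendsto_eventually eventually_mono[OF \<kappa>(5)[OF that]]) simp
  have 2: "(\<lambda>n. LINT z|lebesgue. indicator Q z * (fst (g z) * (Xn n (fst z) * (Y' (snd z) * \<kappa> n (snd z))))) \<longlonglongrightarrow> (LINT z|lebesgue. indicator Q z * (fst (g z) * (X (fst z) * Y' (snd z))))"
    by (rule lim2[OF G(2) bump_continuous(1)[OF bX(1)] bump_continuous(1)[OF bY] cX(1) cY(2) Xbd(1) kb Xlim(1) kl]) auto
  have 3: "(\<lambda>n. LINT x|lborel. Xn n x) \<longlonglongrightarrow> (LINT x|lborel. indicator {a<..<b} x * X x)"
  proof (rule integral_dominated_convergence)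
    show "integrable lborel (\<lambda>x. indicator {a<..<b} x * MX)" using ab by (intro integrable_mult_left) simp
    show "(\<lambda>x. indicator {a<..<b} x * X x) \<in> borel_measurable lborel" "Xn n \<in> borel_measurable lborel" for n
      using mi[OF cX(1)] borel_measurable_continuous_onI[OF bump_continuous(1)[OF bX(1)]] by simp_all
    have z: "Xn n x = 0" if "x \<notin> {a<..<b}" for n x
    proof -
      obtain p q where "a < p" "q < b" "\<forall>x. x \<notin> {p..q} \<longrightarrow> Xn n x = 0" using bump_bounds[OF bX(1)] by metis
      then show ?thesis using that by auto
    qed
    have "norm (Xn n x) \<le> indicator {a<..<b} x * MX" for n x
      using Xbd(1)[of x n] z[of x n] by (cases "x \<in> {a<..<b}") auto
    then show "AE x in lborel. norm (Xn n x) \<le> indicator {a<..<b} x * MX" for n by simp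
    have "(\<lambda>n. Xn n x) \<longlonglongrightarrow> indicator {a<..<b} x * X x" for x
      using Xlim(1)[of x] z[of x] by (cases "x \<in> {a<..<b}") auto
    then show "AE x in lborel. (\<lambda>n. Xn n x) \<longlonglongrightarrow> indicator {a<..<b} x * X x" by simp
  qed
  have "(\<lambda>n. Yn n 0 * (LINT x|lborel. Xn n x)) \<longlonglongrightarrow> Y 0 * (LINT x|lborel. indicator {a<..<b} x * X x)"
    using tau by (intro tendsto_mult Ylim 3) auto
  moreover have "(\<lambda>n. Yn n 0 * (LINT x|lborel. Xn n x)) \<longlonglongrightarrow> (LINT z|lebesgue. indicator Q z * (snd (g z) * (X' (fst z) * Y (snd z)))) - (LINT z|lebesgue. indicator Q z * (fst (g z) * (X (fst z) * Y' (snd z))))"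
    using tendsto_diff[OF 1 2] product_identity_compact[OF bX Yn(1) bY] by simp
  ultimately show ?thesis using LIMSEQ_unique by blast
qed

end

section \<open>Lower bound for the elastic energy of a rectangle\<close>

text \<open>Only odd multiples of pi occur: a sine mode of even index has mean zero over the base
  and so gains nothing in the dual functional.\<close>

definition kap :: "nat \<Rightarrow> real" where "kap j = real (2 * j + 1) * pi"

lemma kap_pos: "0 < kap j" by (simp add: kap_def)

lemma sin_kap: "sin (kap j) = 0" unfolding kap_def by (rule sin_npi)

lemma cos_kap: "cos (kap j) = -1" unfolding kap_def by (simp only: cos_npi) simp

lemma sin_kap_diff: "sin (kap i - kap j) = 0" "sin (kap i + kap j) = 0"
  by (simp_all add: sin_diff sin_add sin_kap)

lemma kap_eq_iff: "kap i = kap j \<longleftrightarrow> i = j" by (simp add: kap_def)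

text \<open>The contribution of the first \<open>N\<close> odd modes to the elastic energy of a
  rectangle of unit width and height \<open>t\<close>; \<open>tanh\<close> records the free top at
  finite height.\<close>

definition gam :: "nat \<Rightarrow> real \<Rightarrow> real" where
  "gam N t = (\<Sum>j<N. 8 / kap j ^ 3 * tanh (kap j * t))"

lemma mode_orthogonal:
  fixes a b :: real
  assumes "a < b"
  defines "l \<equiv> b - a"
  shows "integrable lborel (\<lambda>x. indicator {a<..<b} x * (sin (kap i * (x - a) / l) * sin (kap j * (x - a) / l)))" (is ?A)
    "(LINT x|lborel. indicator {a<..<b} x * (sin (kap i * (x - a) / l) * sin (kap j * (x - a) / l))) = (if i = j then l / 2 else 0)" (is ?B)
    "integrable lborel (\<lambda>x. indicator {a<..<b} x * (cos (kap i * (x - a) / l) * cos (kap j * (x - a) / l)))" (is ?C)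
    "(LINT x|lborel. indicator {a<..<b} x * (cos (kap i * (x - a) / l) * cos (kap j * (x - a) / l))) = (if i = j then l / 2 else 0)" (is ?D)
proof -
  have l: "l > 0" using assms by simp
  have cs: "continuous_on UNIV (\<lambda>x. sin (kap i * (x - a) / l) * sin (kap j * (x - a) / l))" 
    "continuous_on UNIV (\<lambda>x. cos (kap i * (x - a) / l) * cos (kap j * (x - a) / l))" using l by (auto intro!: continuous_intros)
  define p where "p = kap i + kap j"
  define m where "m = kap i - kap j"
  have p: "p > 0" "sin p = 0" "sin m = 0" using kap_pos[of i] kap_pos[of j] by (auto simp: p_def m_def sin_kap_diff)
  define Fp where "Fp x = l / p * sin (p * (x - a) / l)" for x
  define Fm where "Fm x = (if i = j then x else l / m * sin (m * (x - a) / l))" for x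
  have dp: "(Fp has_real_derivative cos (p * (x - a) / l)) (at x)" for x
    unfolding Fp_def[abs_def] using l p by (auto intro!: derivative_eq_intros simp: field_simps)
  have dm: "(Fm has_real_derivative cos (m * (x - a) / l)) (at x)" for x
  proof (cases "i = j")
    case True
    then show ?thesis unfolding Fm_def[abs_def] m_def by (auto intro!: derivative_eq_intros)
  next
    case False
    then have "m \<noteq> 0" by (simp add: m_def kap_eq_iff)
    then show ?thesis unfolding Fm_def[abs_def] using l False by (auto intro!: derivative_eq_intros simp: field_simps)
  qed
  have ss: "sin (kap i * (x - a) / l) * sin (kap j * (x - a) / l) = (cos (m * (x - a) / l) - cos (p * (x - a) / l)) / 2"
    "cos (kap i * (x - a) / l) * cos (kap j * (x - a) / l) = (cos (m * (x - a) / l) + cos (p * (x - a) / l)) / 2" for x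
    unfolding m_def p_def by (simp_all add: sin_times_sin cos_times_cos algebra_simps diff_divide_distrib add_divide_distrib)
  have d1: "((\<lambda>x. (Fm x - Fp x) / 2) has_real_derivative sin (kap i * (x - a) / l) * sin (kap j * (x - a) / l)) (at x)" for x
    unfolding ss by (intro DERIV_cdivide DERIV_diff dm dp)
  have d2: "((\<lambda>x. (Fm x + Fp x) / 2) has_real_derivative cos (kap i * (x - a) / l) * cos (kap j * (x - a) / l)) (at x)" for x
    unfolding ss by (intro DERIV_cdivide DERIV_add dm dp)
  have v: "Fp b - Fp a = 0" "Fm b - Fm a = (if i = j then l else 0)"
    using l p by (auto simp: Fp_def Fm_def) (auto simp: l_def)
  note i1 = integral_FTC_open[OF less_imp_le[OF assms(1)] d1 cs(1)] and i2 = integral_FTC_open[OF less_imp_le[OF assms(1)] d2 cs(2)]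
  show ?A ?C by (rule i1(1), rule i2(1))
  show ?B ?D using i1(2) i2(2) v by (auto simp: field_simps)
qed

lemma mode_integral:
  fixes a b :: real
  assumes "a < b"
  shows "integrable lborel (\<lambda>x. indicator {a<..<b} x * sin (kap j * (x - a) / (b - a)))"
    "(LINT x|lborel. indicator {a<..<b} x * sin (kap j * (x - a) / (b - a))) = 2 * (b - a) / kap j"
proof -
  define l where "l = b - a"
  have l: "l > 0" using assms by (simp add: l_def)
  have d: "((\<lambda>x. - l / kap j * cos (kap j * (x - a) / l)) has_real_derivative sin (kap j * (x - a) / l)) (at x)" for x
    using l kap_pos[of j] by (auto intro!: derivative_eq_intros simp: field_simps)
  have c: "continuous_on UNIV (\<lambda>x. sin (kap j * (x - a) / l))" using l by (auto intro!: continuous_intros)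
  note i = integral_FTC_open[OF less_imp_le[OF assms] d c]
  have "kap j * (b - a) / l = kap j" using l by (simp add: l_def)
  then show "integrable lborel (\<lambda>x. indicator {a<..<b} x * sin (kap j * (x - a) / (b - a)))"
    "(LINT x|lborel. indicator {a<..<b} x * sin (kap j * (x - a) / (b - a))) = 2 * (b - a) / kap j"
    using i by (simp_all add: l_def[symmetric] cos_kap field_simps)
qed

lemma gam_nonneg: "0 \<le> t \<Longrightarrow> 0 \<le> gam N t"
  unfolding gam_def using kap_pos by (intro sum_nonneg mult_nonneg_nonneg) (auto simp: less_imp_le)

context elastic_rectangle begin

text \<open>The dual field (\<open>s1\<close>, \<open>s2\<close>) is the rotated gradient of a
  combination of modes X Y. \<open>product_identity\<close> evaluates its pairing with
  \<open>g\<close> mode by mode, and orthogonality of the sines and cosines makes its square norm a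
  sum over single modes. What remains is the pointwise inequality 2 g.s - |s|^2 <= |g|^2.\<close>

lemma energy_lower_bound:
  "(b - a)\<^sup>2 * gam N (\<tau> / (b - a)) \<le> (LINT z|lebesgue. indicator Q z * (norm (g z))\<^sup>2)"
proof -
  define l where "l = b - a"
  have l: "l > 0" using ab by (simp add: l_def)
  define k where "k j = kap j / l" for j
  have k: "k j > 0" for j using kap_pos l by (simp add: k_def)
  define T where "T j = tanh (kap j * (\<tau> / l))" for j
  have kT: "kap j * (\<tau> / l) = k j * \<tau>" for j by (simp add: k_def)
  have T: "T j > 0" for j using k[of j] tau unfolding T_def kT by simp
  define X where "X j x = sin (kap j * (x - a) / l)" for j x
  define C where "C j x = cos (kap j * (x - a) / l)" for j x
  \<comment> \<open>Among factors with value 1 at y = 0 and 0 at the top, this one minimizes the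
    integral of Y'^2 + k^2 Y^2; the mode X Y is then harmonic.\<close>
  define Y where "Y j y = sinh (k j * (\<tau> - y)) / sinh (k j * \<tau>)" for j y
  define Z where "Z j y = - k j * cosh (k j * (\<tau> - y)) / sinh (k j * \<tau>)" for j y
  have sp: "sinh (k j * \<tau>) > 0" for j using k[of j] tau by simp
  have dX: "(X j has_real_derivative k j * C j x) (at x)" for j x
    unfolding X_def[abs_def] C_def k_def using l by (auto intro!: derivative_eq_intros simp: field_simps)
  have dC: "(C j has_real_derivative - k j * X j x) (at x)" for j x
    unfolding C_def[abs_def] X_def k_def using l by (auto intro!: derivative_eq_intros simp: field_simps)
  have dX': "((\<lambda>x. k j * C j x) has_real_derivative k j * (- k j * X j x)) (at x)" for j x
    by (intro DERIV_cmult dC)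
  have dY: "(Y j has_real_derivative Z j y) (at y)" for j y
    unfolding Y_def[abs_def] Z_def using sp[of j] by (auto intro!: derivative_eq_intros simp: field_simps)
  have dZ: "(Z j has_real_derivative (k j)\<^sup>2 * Y j y) (at y)" for j y
    unfolding Z_def[abs_def] Y_def using sp[of j] by (auto intro!: derivative_eq_intros simp: field_simps power2_eq_square)
  have cX: "continuous_on UNIV (X j)" and cC: "continuous_on UNIV (C j)" and cY: "continuous_on UNIV (Y j)" and cZ: "continuous_on UNIV (Z j)" for j
    using dX dC dY dZ by (meson DERIV_continuous_on has_field_derivative_at_within)+
  have Xb: "\<bar>X j x\<bar> \<le> k j * min (x - a) (b - x)" if x: "a < x" "x < b" for j x
  proof -
    have 1: "\<bar>X j x\<bar> \<le> k j * (x - a)" using abs_sin_x_le_abs_x[of "kap j * (x - a) / l"] x kap_pos[of j] l by (simp add: X_def k_def abs_mult)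
    have "kap j * (x - a) / l = kap j - kap j * (b - x) / l" using l by (simp add: l_def field_simps)
    then have "X j x = sin (kap j * (b - x) / l)" unfolding X_def by (simp add: sin_diff sin_kap cos_kap)
    then have 2: "\<bar>X j x\<bar> \<le> k j * (b - x)" using abs_sin_x_le_abs_x[of "kap j * (b - x) / l"] x kap_pos[of j] l by (simp add: k_def abs_mult)
    show ?thesis using 1 2 by (simp add: min_def)
  qed
  have id: "(LINT z|lebesgue. indicator Q z * (snd (g z) * (k j * C j (fst z) * Y j (snd z)))) - (LINT z|lebesgue. indicator Q z * (fst (g z) * (X j (fst z) * Z j (snd z))))
     = 2 * l / kap j" for j
  proof -
    have "sinh (k j * \<tau>) \<noteq> 0" using sp[of j] by linarith
    then have "Y j 0 = 1" unfolding Y_def diff_zero by (rule divide_self)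
    then show ?thesis
      using product_identity[OF dX dX' _ Xb dY dZ] mode_integral(2)[OF ab, of j] cX cY
      by (simp add: Y_def[of j \<tau>] l_def[symmetric] X_def[of j, symmetric] continuous_intros)
  qed
  \<comment> \<open>The maximizer of the quadratic \<open>2 * \<beta> * (2 * l / kap j) - \<beta>^2
    * (l / 2) * (k j / T j)\<close> that each mode contributes at the end.\<close>
  define \<beta> where "\<beta> j = 4 * l / (kap j)\<^sup>2 * T j" for j
  define s1 where "s1 z = - (\<Sum>j<N. \<beta> j * (X j (fst z) * Z j (snd z)))" for z :: "real \<times> real"
  define s2 where "s2 z = (\<Sum>j<N. \<beta> j * (k j * C j (fst z) * Y j (snd z)))" for z :: "real \<times> real"
  define G1 where "G1 j z = indicator Q z * (fst (g z) * (X j (fst z) * Z j (snd z)))" for j z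
  define G2 where "G2 j z = indicator Q z * (snd (g z) * (k j * C j (fst z) * Y j (snd z)))" for j z
  have Gi: "integrable lebesgue (G1 j)" "integrable lebesgue (G2 j)" for j
  proof -
    have *: "integrable lebesgue (\<lambda>z. indicator Q z * (fst (g z) * (f (fst z) * h (snd z))))" 
      "integrable lebesgue (\<lambda>z. indicator Q z * (snd (g z) * (f (fst z) * h (snd z))))" 
      if c: "continuous_on UNIV f" "continuous_on UNIV h" for f h :: "real \<Rightarrow> real"
    proof -
      let ?F = "\<lambda>z::real\<times>real. indicator Q z * (f (fst z) * h (snd z))"
      have cF: "continuous_on UNIV (\<lambda>z::real\<times>real. f (fst z) * h (snd z))" by (rule continuous_on_fst_snd_mult[OF c])
      have "compact ({a..b} \<times> {0..\<tau>})" by (intro compact_Times) auto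
      then have "bounded ((\<lambda>z. f (fst z) * h (snd z)) ` ({a..b} \<times> {0..\<tau>}))"
        by (intro compact_imp_bounded compact_continuous_image continuous_on_subset[OF cF]) auto
      then obtain B where B: "\<forall>y\<in>(\<lambda>z. f (fst z) * h (snd z)) ` ({a..b} \<times> {0..\<tau>}). \<bar>y\<bar> \<le> B" unfolding bounded_real by blast
      have FB: "\<bar>?F z\<bar> \<le> max B 0" for z
        using B by (cases "z \<in> Q") (auto simp: Q_def le_max_iff_disj)
      have Fm: "?F \<in> borel_measurable borel" using open_Q borel_measurable_continuous_onI[OF cF] by (simp add: borel_open)
      show "integrable lebesgue (\<lambda>z. indicator Q z * (fst (g z) * (f (fst z) * h (snd z))))"
        using integrable_g_mult(1)[OF Fm FB] by (rule back_subst[of "integrable lebesgue"]) (auto simp: indicator_def fun_eq_iff)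
      show "integrable lebesgue (\<lambda>z. indicator Q z * (snd (g z) * (f (fst z) * h (snd z))))"
        using integrable_g_mult(2)[OF Fm FB] by (rule back_subst[of "integrable lebesgue"]) (auto simp: indicator_def fun_eq_iff)
    qed
    show "integrable lebesgue (G1 j)" unfolding G1_def[abs_def] by (rule *(1)[OF cX cZ])
    show "integrable lebesgue (G2 j)" unfolding G2_def[abs_def] by (rule *(2)[OF _ cY]) (intro continuous_intros cC)
  qed
  define P where "P z = indicator Q z * (fst (g z) * s1 z + snd (g z) * s2 z)" for z
  have Peq: "P = (\<lambda>z. \<Sum>j<N. \<beta> j * (G2 j z - G1 j z))"
    by (intro ext) (simp add: P_def s1_def s2_def G1_def G2_def sum_distrib_left sum_subtractf[symmetric] sum.distrib[symmetric] sum_negf[symmetric] algebra_simps)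
  have Pint: "integrable lebesgue P" "(LINT z|lebesgue. P z) = (\<Sum>j<N. \<beta> j * (2 * l / kap j))"
  proof -
    show "integrable lebesgue P" unfolding Peq
      by (intro Bochner_Integration.integrable_sum integrable_mult_right Bochner_Integration.integrable_diff Gi)
    show "(LINT z|lebesgue. P z) = (\<Sum>j<N. \<beta> j * (2 * l / kap j))"
      unfolding Peq using Gi id by (simp add: Bochner_Integration.integral_sum G1_def[symmetric] G2_def[symmetric])
  qed
  define S where "S z = indicator Q z * ((s1 z)\<^sup>2 + (s2 z)\<^sup>2)" for z
  define IX where "IX i j x = indicator {a<..<b} x * (X i x * X j x)" for i j x
  define IC where "IC i j x = indicator {a<..<b} x * (C i x * C j x)" for i j x
  define IZ where "IZ i j y = indicator {0<..<\<tau>} y * (Z i y * Z j y)" for i j y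
  define IY where "IY i j y = indicator {0<..<\<tau>} y * (Y i y * Y j y)" for i j y
  have IX: "integrable lborel (IX i j)" "(LINT x|lborel. IX i j x) = (if i = j then l / 2 else 0)"
   and IC: "integrable lborel (IC i j)" "(LINT x|lborel. IC i j x) = (if i = j then l / 2 else 0)" for i j
    unfolding IX_def[abs_def] IC_def[abs_def] X_def C_def using mode_orthogonal[OF ab, of i j] unfolding l_def by simp_all
  have IZ: "integrable lborel (IZ i j)" and IY: "integrable lborel (IY i j)" for i j
  proof -
    have *: "integrable lborel (\<lambda>y. indicator {0<..<\<tau>} y * f y)" if "continuous_on UNIV f" for f :: "real \<Rightarrow> real"
      using continuous_has_antiderivative[OF that] integral_FTC_open(1)[OF less_imp_le[OF tau] _ that] by blast
    show "integrable lborel (IZ i j)" "integrable lborel (IY i j)"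
      unfolding IZ_def[abs_def] IY_def[abs_def] by (intro * continuous_intros cZ cY)+
  qed
  \<comment> \<open>The integrand is the derivative of \<open>Y j\<close> times \<open>Z j\<close>,
    which vanishes at the top; the value at y = 0 is k coth(k \<tau>).\<close>
  have IYZ: "(LINT y|lborel. IZ j j y) + (k j)\<^sup>2 * (LINT y|lborel. IY j j y) = k j / T j" for j
  proof -
    have d: "((\<lambda>y. Y j y * Z j y) has_real_derivative Z j y * Z j y + (k j)\<^sup>2 * (Y j y * Y j y)) (at y)" for y
      using DERIV_mult[OF dY[of j y] dZ[of j y]] by (simp add: algebra_simps)
    have "(LINT y|lborel. indicator {0<..<\<tau>} y * (Z j y * Z j y + (k j)\<^sup>2 * (Y j y * Y j y))) = Y j \<tau> * Z j \<tau> - Y j 0 * Z j 0"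
      by (rule integral_FTC_open(2)[OF less_imp_le[OF tau] d]) (intro continuous_intros cZ cY)
    also have "\<dots> = k j / T j" using sp[of j] unfolding T_def kT by (simp add: Y_def Z_def tanh_def)
    also have "(\<lambda>y. indicator {0<..<\<tau>} y * (Z j y * Z j y + (k j)\<^sup>2 * (Y j y * Y j y))) = (\<lambda>y. IZ j j y + (k j)\<^sup>2 * IY j j y)"
      by (intro ext) (simp add: IZ_def IY_def algebra_simps)
    finally show ?thesis using IZ IY by simp
  qed
  have Seq: "S = (\<lambda>z. \<Sum>i<N. \<Sum>j<N. \<beta> i * \<beta> j * (IX i j (fst z) * IZ i j (snd z) + k i * k j * (IC i j (fst z) * IY i j (snd z))))"
  proof
    fix z :: "real \<times> real"
    show "S z = (\<Sum>i<N. \<Sum>j<N. \<beta> i * \<beta> j * (IX i j (fst z) * IZ i j (snd z) + k i * k j * (IC i j (fst z) * IY i j (snd z))))"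
    proof (cases "z \<in> Q")
      case True
      then have "fst z \<in> {a<..<b}" "snd z \<in> {0<..<\<tau>}" by (auto simp: Q_def)
      then show ?thesis using True
        by (simp add: S_def s1_def s2_def IX_def IZ_def IC_def IY_def power2_eq_square sum_product sum.distrib[symmetric] algebra_simps)
    next
      case False
      then have "fst z \<notin> {a<..<b} \<or> snd z \<notin> {0<..<\<tau>}" by (auto simp: Q_def mem_Times_iff)
      then have 0: "IX i j (fst z) * IZ i j (snd z) = 0" "IC i j (fst z) * IY i j (snd z) = 0" for i j
        by (auto simp: IX_def IZ_def IC_def IY_def)
      have "S z = 0" using False by (simp add: S_def)
      then show ?thesis by (simp only: 0 mult_zero_right add_0_left sum.neutral_const)
    qed
  qed
  have Sint: "integrable lebesgue S" "(LINT z|lebesgue. S z) = (\<Sum>j<N. (\<beta> j)\<^sup>2 * (l / 2) * (k j / T j))"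
  proof -
    note i1 = integral_prod_mult[OF IX(1) IZ] and i2 = integral_prod_mult[OF IC(1) IY]
    show "integrable lebesgue S" unfolding Seq
      by (intro Bochner_Integration.integrable_sum integrable_mult_right Bochner_Integration.integrable_add i1(1) i2(1))
    have "(LINT z|lebesgue. S z) = (\<Sum>i<N. \<Sum>j<N. \<beta> i * \<beta> j * ((if i = j then l / 2 else 0) * (LINT y|lborel. IZ i j y) + k i * k j * ((if i = j then l / 2 else 0) * (LINT y|lborel. IY i j y))))"
      unfolding Seq using i1 i2 IX(2) IC(2) by (simp add: Bochner_Integration.integral_sum)
    also have "\<dots> = (\<Sum>i<N. \<Sum>j<N. if i = j then \<beta> i * \<beta> i * (l / 2) * ((LINT y|lborel. IZ i i y) + (k i)\<^sup>2 * (LINT y|lborel. IY i i y)) else 0)"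
      by (intro sum.cong refl) (auto simp: algebra_simps power2_eq_square)
    also have "\<dots> = (\<Sum>i<N. \<beta> i * \<beta> i * (l / 2) * (k i / T i))"
      unfolding IYZ by (simp add: sum.delta)
    finally show "(LINT z|lebesgue. S z) = (\<Sum>j<N. (\<beta> j)\<^sup>2 * (l / 2) * (k j / T j))" by (simp add: power2_eq_square)
  qed
  have "2 * (LINT z|lebesgue. P z) - (LINT z|lebesgue. S z) = (LINT z|lebesgue. 2 * P z - S z)"
    using Pint(1) Sint(1) by simp
  also have "\<dots> \<le> (LINT z|lebesgue. indicator Q z * (norm (g z))\<^sup>2)"
  proof (intro integral_mono integrable_g2 Bochner_Integration.integrable_diff integrable_mult_right Pint Sint)
    fix z
    have "(norm (g z))\<^sup>2 = (fst (g z))\<^sup>2 + (snd (g z))\<^sup>2" by (simp add: norm_prod_def)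
    moreover have "0 \<le> (fst (g z) - s1 z)\<^sup>2 + (snd (g z) - s2 z)\<^sup>2" by simp
    ultimately have "2 * (fst (g z) * s1 z + snd (g z) * s2 z) - ((s1 z)\<^sup>2 + (s2 z)\<^sup>2) \<le> (norm (g z))\<^sup>2"
      by (simp add: power2_diff algebra_simps)
    then show "2 * P z - S z \<le> indicator Q z * (norm (g z))\<^sup>2" by (simp add: P_def S_def indicator_def)
  qed
  also have "2 * (LINT z|lebesgue. P z) - (LINT z|lebesgue. S z) = (\<Sum>j<N. 2 * (\<beta> j * (2 * l / kap j)) - (\<beta> j)\<^sup>2 * (l / 2) * (k j / T j))"
    unfolding Pint(2) Sint(2) by (simp add: sum_subtractf sum_distrib_left)
  also have "\<dots> = (\<Sum>j<N. l\<^sup>2 * (8 / kap j ^ 3 * T j))"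
  proof (intro sum.cong refl)
    fix j
    show "2 * (\<beta> j * (2 * l / kap j)) - (\<beta> j)\<^sup>2 * (l / 2) * (k j / T j) = l\<^sup>2 * (8 / kap j ^ 3 * T j)"
      using kap_pos[of j] T[of j] l by (simp add: \<beta>_def k_def field_simps power2_eq_square power3_eq_cube)
  qed
  also have "\<dots> = (b - a)\<^sup>2 * gam N (\<tau> / (b - a))"
    by (simp add: gam_def sum_distrib_left T_def l_def)
  finally show ?thesis .
qed

end

theorem elastic_lower_bound:
  assumes "has_weak_gradient u g D" "open D" "{a<..<b} \<times> {0<..<\<tau>} \<subseteq> D" "a < b" "0 < \<tau>"
    "AE x in lborel. a < x \<and> x < b \<longrightarrow> has_trace_at u D (x, 0) x"
  shows "ennreal ((b - a)\<^sup>2 * gam N (\<tau> / (b - a))) \<le> (\<integral>\<^sup>+ p\<in>({a<..<b} \<times> {0<..<\<tau>}). ennreal ((norm (g p))\<^sup>2) \<partial>lebesgue)"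
proof (cases "(\<integral>\<^sup>+ p\<in>({a<..<b} \<times> {0<..<\<tau>}). ennreal ((norm (g p))\<^sup>2) \<partial>lebesgue) < \<infinity>")
  case True
  then interpret elastic_rectangle u g D a b \<tau> using assms by unfold_locales auto
  have "ennreal (LINT z|lebesgue. indicator Q z * (norm (g z))\<^sup>2) = (\<integral>\<^sup>+ z. ennreal (indicator Q z * (norm (g z))\<^sup>2) \<partial>lebesgue)"
    by (intro nn_integral_eq_integral[symmetric] integrable_g2) simp
  also have "\<dots> = (\<integral>\<^sup>+ p\<in>({a<..<b} \<times> {0<..<\<tau>}). ennreal ((norm (g p))\<^sup>2) \<partial>lebesgue)"
    unfolding Q_def by (intro nn_integral_cong) (simp add: indicator_def)
  finally show ?thesis using ennreal_leI[OF energy_lower_bound[of N]] by simp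
next
  case False
  then show ?thesis by (simp add: less_top[symmetric])
qed

section \<open>Uniqueness of weak gradients\<close>

lemma integrable_lebesgue_compact:
  fixes f :: "'a::euclidean_space \<Rightarrow> 'b::euclidean_space"
  assumes "continuous_on UNIV f" "compact K"
  shows "integrable lebesgue (\<lambda>x. indicator K x *\<^sub>R f x)" "integrable lborel (\<lambda>x. indicator K x *\<^sub>R f x)"
proof -
  show i: "integrable lborel (\<lambda>x. indicator K x *\<^sub>R f x)"
    by (rule borel_integrable_compact) (use assms continuous_on_subset in auto)
  then show "integrable lebesgue (\<lambda>x. indicator K x *\<^sub>R f x)"
    using borel_measurable_integrable[OF i] by (simp add: integrable_completion)
qed

lemma locally_integrable_continuous:
  fixes f :: "'a::euclidean_space \<Rightarrow> 'b::euclidean_space"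
  assumes "continuous_on UNIV f"
  shows "locally_integrable D f"
  unfolding locally_integrable_def
proof (intro allI impI)
  fix K assume K: "compact K \<and> K \<subseteq> D"
  then have "K \<in> sets lebesgue" by (simp add: lmeasurable_compact fmeasurableD)
  with integrable_lebesgue_compact(1)[OF assms] K show "integrable (lebesgue_on K) f"
    by (subst integrable_restrict_space) auto
qed

lemma integral_line_derivative_zero:
  fixes f F :: "real \<Rightarrow> real"
  assumes "\<And>x. (F has_real_derivative f x) (at x)" "continuous_on UNIV f" "0 < M" "\<And>x. \<bar>x\<bar> \<ge> M \<Longrightarrow> F x = 0 \<and> f x = 0"
  shows "(LINT x|lborel. f x) = 0"
proof -
  have "(LINT x|lborel. indicator {-M<..<M} x * f x) = F M - F (-M)"
    by (rule integral_FTC_open(2)) (use assms in auto)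
  moreover have "(\<lambda>x. indicator {-M<..<M} x * f x) = f"
  proof
    fix x show "indicator {-M<..<M} x * f x = f x" using assms(4)[of x] by (cases "x \<in> {-M<..<M}") auto
  qed
  ultimately show ?thesis using assms(3) assms(4)[of M] assms(4)[of "-M"] by simp
qed

text \<open>Each component is integrated first along its own direction, where the fundamental
  theorem gives zero; Fubini is used in both orders.\<close>

lemma integral_gradient_zero:
  fixes F :: "real \<times> real \<Rightarrow> real" and dF :: "real \<times> real \<Rightarrow> real \<times> real"
  assumes d: "\<And>p. (F has_derivative (\<lambda>v. dF p \<bullet> v)) (at p)" and c: "continuous_on UNIV dF"
    and K: "compact K" and z: "\<forall>p. p \<notin> K \<longrightarrow> F p = 0 \<and> dF p = 0"
  shows "integrable lebesgue dF" "(LINT p|lebesgue. dF p) = 0"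
proof -
  have eq: "(\<lambda>p. indicator K p *\<^sub>R dF p) = dF"
  proof
    fix p show "indicator K p *\<^sub>R dF p = dF p" using z[rule_format, of p] by (cases "p \<in> K") auto
  qed
  show il: "integrable lebesgue dF" using integrable_lebesgue_compact(1)[OF c K] unfolding eq .
  have ib: "integrable lborel dF" using integrable_lebesgue_compact(2)[OF c K] unfolding eq .
  obtain M where M: "0 < M" "\<forall>p\<in>K. norm p < M"
    using compact_imp_bounded[OF K] bounded_pos_less by metis
  have zM: "F p = 0 \<and> dF p = 0" if "\<bar>fst p\<bar> \<ge> M \<or> \<bar>snd p\<bar> \<ge> M" for p
  proof -
    have "norm p \<ge> M" using that norm_fst_le[of "fst p" "snd p"] norm_snd_le[of "snd p" "fst p"] by auto
    then have "p \<notin> K" using M(2) by force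
    then show ?thesis using z by blast
  qed
  have cf: "continuous_on UNIV (\<lambda>x. f (dF (x, y)))" "continuous_on UNIV (\<lambda>x. f (dF (y, x)))" if "continuous_on UNIV f" for f :: "real \<times> real \<Rightarrow> real" and y
    by (rule continuous_on_compose2[OF that continuous_on_compose2[OF c]]; auto intro!: continuous_intros)+
  have dx: "((\<lambda>x. F (x, y)) has_real_derivative fst (dF (x, y))) (at x)" for x y
  proof -
    have "((\<lambda>x. F (x, y)) has_derivative (\<lambda>h. dF (x, y) \<bullet> (h, 0))) (at x)"
      by (rule has_derivative_compose[OF _ d, where f="\<lambda>x. (x, y)", simplified]) (auto intro!: derivative_eq_intros)
    then show ?thesis unfolding has_field_derivative_def
      by (rule back_subst[where P="\<lambda>f. ((\<lambda>x. F (x, y)) has_derivative f) (at x)"]) (auto simp: inner_prod_def)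
  qed
  have dy: "((\<lambda>y. F (x, y)) has_real_derivative snd (dF (x, y))) (at y)" for x y
  proof -
    have "((\<lambda>y. F (x, y)) has_derivative (\<lambda>h. dF (x, y) \<bullet> (0, h))) (at y)"
      by (rule has_derivative_compose[OF _ d, where f="\<lambda>y. (x, y)", simplified]) (auto intro!: derivative_eq_intros)
    then show ?thesis unfolding has_field_derivative_def
      by (rule back_subst[where P="\<lambda>f. ((\<lambda>y. F (x, y)) has_derivative f) (at y)"]) (auto simp: inner_prod_def)
  qed
  have ip: "integrable (lborel \<Otimes>\<^sub>M lborel) (\<lambda>p. fst (dF p))" "integrable (lborel \<Otimes>\<^sub>M lborel) (\<lambda>p. snd (dF p))"
    using integrable_bounded_linear[OF bounded_linear_fst ib] integrable_bounded_linear[OF bounded_linear_snd ib] by (simp_all add: lborel_prod)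
  have "(LINT p|lborel. fst (dF p)) = (LINT y|lborel. (LINT x|lborel. fst (dF (x, y))))"
    using lborel_pair.integral_snd[of "\<lambda>x y. fst (dF (x, y))"] ip(1) by (simp add: lborel_prod case_prod_unfold)
  also have "\<dots> = 0"
  proof -
    have "(LINT x|lborel. fst (dF (x, y))) = 0" for y
      by (rule integral_line_derivative_zero[OF dx cf(1)[OF continuous_on_fst[OF continuous_on_id]] M(1)]) (use zM in auto)
    then show ?thesis by simp
  qed
  finally have 1: "(LINT p|lborel. fst (dF p)) = 0" .
  have "(LINT p|lborel. snd (dF p)) = (LINT x|lborel. (LINT y|lborel. snd (dF (x, y))))"
    using lborel_pair.integral_fst'[OF ip(2)] by (simp add: lborel_prod)
  also have "\<dots> = 0"
  proof -
    have "(LINT y|lborel. snd (dF (x, y))) = 0" for x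
      by (rule integral_line_derivative_zero[OF dy cf(2)[OF continuous_on_snd[OF continuous_on_id]] M(1)]) (use zM in auto)
    then show ?thesis by simp
  qed
  finally have 2: "(LINT p|lborel. snd (dF p)) = 0" .
  have "(LINT p|lborel. dF p) = 0"
    using 1 2 integral_bounded_linear[OF bounded_linear_fst ib] integral_bounded_linear[OF bounded_linear_snd ib]
    by (simp add: prod_eq_iff)
  moreover have "(LINT p|lebesgue. dF p) = (LINT p|lborel. dF p)"
    using borel_measurable_integrable[OF ib] by (intro integral_completion) simp
  ultimately show "(LINT p|lebesgue. dF p) = 0" by simp
qed

text \<open>The gradient of the product with a test function integrates to zero. This makes the
  explicit C^1 displacements used as competitors weakly differentiable.\<close>

lemma classical_gradient_is_weak:
  fixes u :: "real \<times> real \<Rightarrow> real"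
  assumes d: "\<And>p. (u has_derivative (\<lambda>v. du p \<bullet> v)) (at p)" and c: "continuous_on UNIV du" and D: "open D"
  shows "has_weak_gradient u du D"
  unfolding has_weak_gradient_def
proof (intro conjI allI impI)
  have cu: "continuous_on UNIV u" using has_derivative_continuous[OF d] by (simp add: continuous_on_eq_continuous_at)
  show "locally_integrable D u" "locally_integrable D du" by (intro locally_integrable_continuous cu c)+
  fix \<phi> d\<phi> assume t: "test_function D \<phi> d\<phi>"
  define K where "K = closure {p. \<phi> p \<noteq> 0}"
  have K: "compact K" "K \<subseteq> D" "continuous_on UNIV d\<phi>" and d\<phi>: "\<And>p. (\<phi> has_derivative (\<lambda>v. d\<phi> p \<bullet> v)) (at p)"
    using t unfolding test_function_def K_def by auto
  have c\<phi>: "continuous_on UNIV \<phi>" using has_derivative_continuous[OF d\<phi>] by (simp add: continuous_on_eq_continuous_at)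
  have z: "\<phi> p = 0" if "p \<notin> K" for p using that closure_subset[of "{p. \<phi> p \<noteq> 0}"] unfolding K_def by blast
  have oK: "open (- K)" using K(1) by (simp add: compact_imp_closed open_Compl)
  have zd: "d\<phi> p = 0" if "p \<notin> K" for p
  proof -
    have "((\<lambda>_. 0) has_derivative (\<lambda>v. 0)) (at p)" by simp
    then have "(\<phi> has_derivative (\<lambda>v. 0)) (at p)"
      by (rule has_derivative_transform_within_open[OF _ oK]) (use that z in auto)
    then have "(\<lambda>v. d\<phi> p \<bullet> v) = (\<lambda>v. 0)" by (rule has_derivative_unique[OF d\<phi>])
    then have "d\<phi> p \<bullet> d\<phi> p = 0" by (rule fun_cong)
    then show ?thesis by simp
  qed
  have "((\<lambda>p. u p * \<phi> p) has_derivative (\<lambda>v. (u p *\<^sub>R d\<phi> p + \<phi> p *\<^sub>R du p) \<bullet> v)) (at p)" for p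
    by (rule has_derivative_eq_rhs[OF has_derivative_mult[OF d d\<phi>]]) (auto simp: inner_add_left)
  moreover have "continuous_on UNIV (\<lambda>p. u p *\<^sub>R d\<phi> p + \<phi> p *\<^sub>R du p)" by (intro continuous_intros cu c c\<phi> K(3))
  ultimately have 0: "(LINT p|lebesgue. u p *\<^sub>R d\<phi> p + \<phi> p *\<^sub>R du p) = 0"
    by (rule integral_gradient_zero(2)[OF _ _ K(1)]) (use z zd in auto)
  have eq: "(\<lambda>p. u p *\<^sub>R d\<phi> p) = (\<lambda>p. indicator K p *\<^sub>R (u p *\<^sub>R d\<phi> p))" "(\<lambda>p. \<phi> p *\<^sub>R du p) = (\<lambda>p. indicator K p *\<^sub>R (\<phi> p *\<^sub>R du p))"
    using z zd by (auto simp: fun_eq_iff indicator_def)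
  have i: "integrable lebesgue (\<lambda>p. u p *\<^sub>R d\<phi> p)" "integrable lebesgue (\<lambda>p. \<phi> p *\<^sub>R du p)"
    by (subst eq, rule integrable_lebesgue_compact(1)[OF _ K(1)], intro continuous_intros cu c c\<phi> K(3))+
  have "(LINT p|lebesgue_on D. u p *\<^sub>R d\<phi> p) = (LINT p|lebesgue. u p *\<^sub>R d\<phi> p)"
    by (rule integral_lebesgue_on_support[OF D]) (use zd K(2) in auto)
  moreover have "(LINT p|lebesgue_on D. \<phi> p *\<^sub>R du p) = (LINT p|lebesgue. \<phi> p *\<^sub>R du p)"
    by (rule integral_lebesgue_on_support[OF D]) (use z K(2) in auto)
  moreover have "(LINT p|lebesgue. u p *\<^sub>R d\<phi> p) = - (LINT p|lebesgue. \<phi> p *\<^sub>R du p)"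
    using 0 unfolding Bochner_Integration.integral_add[OF i] by (simp add: eq_neg_iff_add_eq_0)
  ultimately show "(LINT p|lebesgue_on D. u p *\<^sub>R d\<phi> p) = - (LINT p|lebesgue_on D. \<phi> p *\<^sub>R du p)"
    by (simp only:)
qed

text \<open>Products of cutoffs in the two variables increase to the indicator of the open box in
  the limit, and testing is available for exactly these products.\<close>

lemma integral_box_zero:
  fixes d :: "real \<times> real \<Rightarrow> real \<times> real"
  assumes d: "integrable lebesgue (\<lambda>p. indicator ({a..b} \<times> {c..e}) p *\<^sub>R d p)" and lt: "a < b" "c < e"
    and z: "\<And>\<theta> \<theta>' \<zeta> \<zeta>'. bump a b \<theta> \<theta>' \<Longrightarrow> bump c e \<zeta> \<zeta>' \<Longrightarrow> (LINT p|lebesgue. (\<theta> (fst p) * \<zeta> (snd p)) *\<^sub>R d p) = 0"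
  shows "(LINT p|lebesgue. indicator ({a<..<b} \<times> {c<..<e}) p *\<^sub>R d p) = 0"
proof -
  obtain \<eta> \<eta>' \<eta>'' :: "nat \<Rightarrow> real \<Rightarrow> real" and C where \<eta>:
    "\<And>n. bump a b (\<eta> n) (\<eta>' n)" "\<And>n. bump a b (\<eta>' n) (\<eta>'' n)"
    "\<And>n s. 0 \<le> \<eta> n s" "\<And>n s. \<eta> n s \<le> 1"
    "\<And>s. a < s \<Longrightarrow> s < b \<Longrightarrow> eventually (\<lambda>n. \<eta> n s = 1 \<and> \<eta>' n s = 0) sequentially"
    "\<And>n s. a < s \<Longrightarrow> s < b \<Longrightarrow> \<bar>\<eta>' n s\<bar> * min (s - a) (b - s) \<le> C"
    by (rule cutoff_sequence[OF lt(1)]) (rule that)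
  obtain \<kappa> \<kappa>' \<kappa>'' :: "nat \<Rightarrow> real \<Rightarrow> real" and C' where \<kappa>:
    "\<And>n. bump c e (\<kappa> n) (\<kappa>' n)" "\<And>n. bump c e (\<kappa>' n) (\<kappa>'' n)"
    "\<And>n s. 0 \<le> \<kappa> n s" "\<And>n s. \<kappa> n s \<le> 1"
    "\<And>s. c < s \<Longrightarrow> s < e \<Longrightarrow> eventually (\<lambda>n. \<kappa> n s = 1 \<and> \<kappa>' n s = 0) sequentially"
    "\<And>n s. c < s \<Longrightarrow> s < e \<Longrightarrow> \<bar>\<kappa>' n s\<bar> * min (s - c) (e - s) \<le> C'"
    by (rule cutoff_sequence[OF lt(2)]) (rule that)
  let ?B = "{a<..<b} \<times> {c<..<e}" and ?K = "{a..b} \<times> {c..e}"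
  define w where "w n p = \<eta> n (fst p) * \<kappa> n (snd p)" for n and p :: "real \<times> real"
  have wz: "w n p = 0" if "p \<notin> ?B" for n p
  proof -
    obtain p1 q1 where 1: "a < p1" "q1 < b" "\<forall>x. x \<notin> {p1..q1} \<longrightarrow> \<eta> n x = 0" using bump_bounds[OF \<eta>(1)[of n]] by metis
    obtain p2 q2 where 2: "c < p2" "q2 < e" "\<forall>x. x \<notin> {p2..q2} \<longrightarrow> \<kappa> n x = 0" using bump_bounds[OF \<kappa>(1)[of n]] by metis
    have "fst p \<notin> {p1..q1} \<or> snd p \<notin> {p2..q2}" using that 1(1,2) 2(1,2) by (auto simp: mem_Times_iff)
    then show ?thesis using 1(3) 2(3) by (auto simp: w_def)
  qed
  have w01: "0 \<le> w n p" "w n p \<le> 1" for n p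
    using \<eta>(3,4) \<kappa>(3,4) by (auto simp: w_def intro!: mult_le_one)
  have wlim: "(\<lambda>n. w n p) \<longlonglongrightarrow> indicator ?B p" for p
  proof (cases "p \<in> ?B")
    case True
    then have "a < fst p" "fst p < b" "c < snd p" "snd p < e" by auto
    then have "eventually (\<lambda>n. w n p = indicator ?B p) sequentially"
      using eventually_conj[OF \<eta>(5)[of "fst p"] \<kappa>(5)[of "snd p"]] True by (auto simp: w_def elim!: eventually_mono)
    then show ?thesis by (rule tendsto_eventually)
  next
    case False then show ?thesis using wz by simp
  qed
  have cw: "continuous_on UNIV (w n)" for n
    unfolding w_def[abs_def] by (intro continuous_on_fst_snd_mult bump_continuous(1)[OF \<eta>(1)] bump_continuous(1)[OF \<kappa>(1)])
  have eqw: "w n p *\<^sub>R d p = w n p *\<^sub>R (indicator ?K p *\<^sub>R d p)" for n p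
    using wz[of p n] by (cases "p \<in> ?K") (auto simp: mem_Times_iff)
  have eqB: "indicator ?B p *\<^sub>R d p = indicator ?B p *\<^sub>R (indicator ?K p *\<^sub>R d p)" for p
    by (cases "p \<in> ?B") auto
  note md = borel_measurable_integrable[OF d]
  have "(\<lambda>n. LINT p|lebesgue. w n p *\<^sub>R d p) \<longlonglongrightarrow> (LINT p|lebesgue. indicator ?B p *\<^sub>R d p)"
  proof (rule integral_dominated_convergence)
    show "integrable lebesgue (\<lambda>p. norm (indicator ?K p *\<^sub>R d p))" by (rule integrable_norm[OF d])
    have "w n \<in> borel_measurable lebesgue" for n by (intro borel_measurable_lebesgueI borel_measurable_continuous_onI cw)
    then show "(\<lambda>p. w n p *\<^sub>R d p) \<in> borel_measurable lebesgue" for n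
      unfolding eqw by (rule borel_measurable_scaleR[OF _ md])
    have "open ?B" by (intro open_Times) auto
    then have "(indicator ?B :: _ \<Rightarrow> real) \<in> borel_measurable lebesgue" by (intro borel_measurable_indicator) simp
    then show "(\<lambda>p. indicator ?B p *\<^sub>R d p) \<in> borel_measurable lebesgue"
      unfolding eqB by (rule borel_measurable_scaleR[OF _ md])
    show "AE p in lebesgue. (\<lambda>n. w n p *\<^sub>R d p) \<longlonglongrightarrow> indicator ?B p *\<^sub>R d p"
      by (intro AE_I2 tendsto_scaleR wlim tendsto_const)
    have "norm (w n p *\<^sub>R d p) \<le> norm (indicator ?K p *\<^sub>R d p)" for n p
      unfolding eqw using w01[of n p] mult_left_le_one_le[OF norm_ge_zero, of "w n p" "indicator ?K p *\<^sub>R d p"] by simp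
    then show "AE p in lebesgue. norm (w n p *\<^sub>R d p) \<le> norm (indicator ?K p *\<^sub>R d p)" for n by simp
  qed
  moreover have "(LINT p|lebesgue. w n p *\<^sub>R d p) = 0" for n
    unfolding w_def by (rule z[OF \<eta>(1) \<kappa>(1)])
  ultimately show ?thesis by (simp add: LIMSEQ_const_iff)
qed

text \<open>Needed because \<open>weak_gradient\<close> is an arbitrary choice, whereas the energy
  of a competitor has to be computed from its classical gradient. The difference \<open>d\<close>
  has integral zero over every small square in \<open>D\<close>, hence vanishes at each of its
  Lebesgue points; countably many closed boxes cover \<open>D\<close>.\<close>

lemma weak_gradient_unique:
  fixes u :: "real \<times> real \<Rightarrow> real"
  assumes g: "has_weak_gradient u g D" and g': "has_weak_gradient u g' D" and D: "open D"
  shows "AE p in lebesgue. p \<in> D \<longrightarrow> g p = g' p"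
proof -
  define d where "d p = g p - g' p" for p
  have lg: "locally_integrable D g" "locally_integrable D g'" using g g' unfolding has_weak_gradient_def by blast+
  have box_eq: "box (x1, y1) (x2, y2) = {x1<..<x2} \<times> {y1<..<y2}" for x1 x2 y1 y2 :: real
    by (auto simp: box_def Basis_prod_def)
  have box: "AE p in lebesgue. p \<in> cbox k l \<longrightarrow> d p = 0" if kl: "cbox k l \<subseteq> D" for k l
  proof -
    let ?K = "cbox k l"
    have i: "integrable lebesgue (\<lambda>p. indicator K p *\<^sub>R d p)" if "compact K" "K \<subseteq> D" for K
    proof -
      have m: "(indicator K :: _ \<Rightarrow> real) \<in> borel_measurable borel" using that(1) by (intro borel_measurable_indicator borel_closed compact_imp_closed)
      have "integrable lebesgue (\<lambda>p. indicator K p *\<^sub>R g p)" "integrable lebesgue (\<lambda>p. indicator K p *\<^sub>R g' p)"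
        using lg by (intro integrable_scaleR_locally_integrable[OF _ that m, where M=1]; simp add: indicator_def)+
      then show ?thesis unfolding d_def scaleR_diff_right by (rule Bochner_Integration.integrable_diff)
    qed
    define f where "f p = indicator ?K p *\<^sub>R d p" for p
    have fi: "integrable lebesgue f" unfolding f_def[abs_def] by (rule i[OF compact_cbox kl])
    have fs: "set_integrable lebesgue (cbox x y) f" for x y
      unfolding set_integrable_def by (rule integrable_mult_indicator[OF _ fi]) simp
    have "f integrable_on cbox x y" for x y
      using set_lebesgue_integral_eq_integral(1)[OF fs] by simp
    then obtain N where N: "negligible N" "\<And>x e. x \<notin> N \<Longrightarrow> 0 < e \<Longrightarrow> \<exists>r>0. \<forall>h. 0 < h \<and> h < r \<longrightarrow>
        norm (integral (cbox x (x + h *\<^sub>R One)) f /\<^sub>R h ^ DIM(real \<times> real) - f x) < e"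
      using integrable_ccontinuous_explicit[of f] by metis
    have zero: "d p = 0" if p: "p \<in> box k l" "p \<notin> N" for p
    proof (rule ccontr)
      assume nz: "d p \<noteq> 0"
      have fp: "f p = d p" using p box_subset_cbox[of k l] by (auto simp: f_def)
      obtain r where r: "r > 0" "\<And>h. 0 < h \<Longrightarrow> h < r \<Longrightarrow> norm (integral (cbox p (p + h *\<^sub>R One)) f /\<^sub>R h ^ DIM(real \<times> real) - f p) < norm (d p)"
        using N(2)[OF p(2), of "norm (d p)"] nz by auto
      obtain x y where xy: "p = (x, y)" by (cases p)
      have One: "(One :: real \<times> real) = (1, 1)" by (simp add: Basis_prod_def sum.union_disjoint) 
      have in_box: "fst k < x" "x < fst l" "snd k < y" "y < snd l"
        using p(1) box_eq[of "fst k" "snd k" "fst l" "snd l"] xy by auto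
      define h where "h = min (r / 2) (min ((fst l - x) / 2) ((snd l - y) / 2))"
      have h0: "h \<le> r / 2" "h \<le> (fst l - x) / 2" "h \<le> (snd l - y) / 2" unfolding h_def
        by (rule min.cobounded1, rule min.coboundedI2[OF min.cobounded1], rule min.coboundedI2[OF min.cobounded2])
      have "0 < h" using r(1) in_box by (simp add: h_def)
      then have h: "0 < h" "h < r" "x + h < fst l" "y + h < snd l" using h0 r(1) in_box by (simp_all add: field_simps)
      have sub: "{x..x+h} \<times> {y..y+h} \<subseteq> ?K" using h in_box by (cases k, cases l) (auto simp: cbox_Pair_eq)
      have cb: "cbox p (p + h *\<^sub>R One) = {x..x+h} \<times> {y..y+h}" by (simp add: xy One cbox_Pair_eq)
      have bx: "box p (p + h *\<^sub>R One) = {x<..<x+h} \<times> {y<..<y+h}" by (simp add: xy One box_eq)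
      have "integral (cbox p (p + h *\<^sub>R One)) f = (LINT q|lebesgue. indicator ({x..x+h} \<times> {y..y+h}) q *\<^sub>R f q)"
        using set_lebesgue_integral_eq_integral(2)[OF fs[of p "p + h *\<^sub>R One"]] unfolding set_lebesgue_integral_def cb by simp
      also have "\<dots> = (LINT q|lebesgue. indicator ({x<..<x+h} \<times> {y<..<y+h}) q *\<^sub>R d q)"
      proof (rule integral_cong_AE)
        have c1: "compact ({x..x+h} \<times> {y..y+h})" by (intro compact_Times) auto
        have e1: "(\<lambda>q. indicator ({x..x+h} \<times> {y..y+h}) q *\<^sub>R f q) = (\<lambda>q. indicator ({x..x+h} \<times> {y..y+h}) q *\<^sub>R d q)"
          using sub by (intro ext) (auto simp: f_def indicator_def)
        have "integrable lebesgue (\<lambda>q. indicator ({x..x+h} \<times> {y..y+h}) q *\<^sub>R d q)"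
          using i[OF c1] sub kl by blast
        then show m1: "(\<lambda>q. indicator ({x..x+h} \<times> {y..y+h}) q *\<^sub>R f q) \<in> borel_measurable lebesgue"
          unfolding e1 by (rule borel_measurable_integrable)
        have "open ({x<..<x+h} \<times> {y<..<y+h})" by (intro open_Times) auto
        then have "(indicator ({x<..<x+h} \<times> {y<..<y+h}) :: _ \<Rightarrow> real) \<in> borel_measurable lebesgue" by (intro borel_measurable_indicator) simp
        then have "(\<lambda>q. indicator ({x<..<x+h} \<times> {y<..<y+h}) q *\<^sub>R (indicator ({x..x+h} \<times> {y..y+h}) q *\<^sub>R f q)) \<in> borel_measurable lebesgue"
          by (rule borel_measurable_scaleR[OF _ m1])
        moreover have "(\<lambda>q. indicator ({x<..<x+h} \<times> {y<..<y+h}) q *\<^sub>R (indicator ({x..x+h} \<times> {y..y+h}) q *\<^sub>R f q)) = (\<lambda>q. indicator ({x<..<x+h} \<times> {y<..<y+h}) q *\<^sub>R d q)"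
        proof
          fix q show "indicator ({x<..<x+h} \<times> {y<..<y+h}) q *\<^sub>R (indicator ({x..x+h} \<times> {y..y+h}) q *\<^sub>R f q) = indicator ({x<..<x+h} \<times> {y<..<y+h}) q *\<^sub>R d q"
          proof (cases "q \<in> {x<..<x+h} \<times> {y<..<y+h}")
            case True
            then have "q \<in> {x..x+h} \<times> {y..y+h}" by auto
            then show ?thesis using sub by (auto simp: f_def)
          qed simp
        qed
        ultimately show "(\<lambda>q. indicator ({x<..<x+h} \<times> {y<..<y+h}) q *\<^sub>R d q) \<in> borel_measurable lebesgue" by simp
        have "negligible (cbox p (p + h *\<^sub>R One) - box p (p + h *\<^sub>R One))" by (rule negligible_frontier_interval)
        then have "AE q in lebesgue. q \<notin> cbox p (p + h *\<^sub>R One) - box p (p + h *\<^sub>R One)"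
          by (intro AE_not_in) (simp add: negligible_iff_null_sets)
        then show "AE q in lebesgue. indicator ({x..x+h} \<times> {y..y+h}) q *\<^sub>R f q = indicator ({x<..<x+h} \<times> {y<..<y+h}) q *\<^sub>R d q"
          unfolding cb bx
        proof eventually_elim
          case (elim q)
          show ?case
          proof (cases "q \<in> {x..x+h} \<times> {y..y+h}")
            case True
            then have "q \<in> {x<..<x+h} \<times> {y<..<y+h}" using elim by blast
            then show ?thesis using True sub by (auto simp: f_def indicator_def)
          next
            case False
            then have "q \<notin> {x<..<x+h} \<times> {y<..<y+h}" by auto
            then show ?thesis using False by simp
          qed
        qed
      qed
      also have "\<dots> = 0"
      proof (rule integral_box_zero)
        show "x < x + h" "y < y + h" using h by auto
        show "integrable lebesgue (\<lambda>p. indicator ({x..x+h} \<times> {y..y+h}) p *\<^sub>R d p)"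
          using sub kl by (intro i compact_Times) auto
        fix \<theta> \<theta>' \<zeta> \<zeta>' assume b: "bump x (x + h) \<theta> \<theta>'" "bump y (y + h) \<zeta> \<zeta>'"
        have s: "{x<..<x+h} \<times> {y<..<y+h} \<subseteq> D" using sub kl by fastforce
        note t = test_function_bumps[OF b s]
        show "(LINT p|lebesgue. (\<theta> (fst p) * \<zeta> (snd p)) *\<^sub>R d p) = 0"
          using has_weak_gradient_test(1)[OF g D t] has_weak_gradient_test(1)[OF g' D t]
          unfolding d_def scaleR_diff_right Bochner_Integration.integral_diff[OF has_weak_gradient_test(3)[OF g D t] has_weak_gradient_test(3)[OF g' D t]]
          by simp
      qed
      finally have "norm (f p) < norm (d p)" using r(2)[OF h(1,2)] by simp
      then show False using fp by simp
    qed
    have "AE p in lebesgue. p \<notin> N" using N(1) by (intro AE_not_in) (simp add: negligible_iff_null_sets)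
    moreover have "AE p in lebesgue. p \<notin> cbox k l - box k l"
      using negligible_frontier_interval[of k l] by (intro AE_not_in) (simp add: negligible_iff_null_sets)
    ultimately show ?thesis
    proof eventually_elim
      case (elim p) then show ?case using zero[of p] by blast
    qed
  qed
  obtain \<D> where \<D>: "countable \<D>" "\<D> \<subseteq> Pow D" "\<And>X. X \<in> \<D> \<Longrightarrow> \<exists>a b. X = cbox a b" "\<Union>\<D> = D"
    using open_countable_Union_open_cbox[OF D] by metis
  have "AE p in lebesgue. \<forall>X\<in>\<D>. p \<in> X \<longrightarrow> d p = 0"
  proof (rule AE_ball_countable'[OF _ \<D>(1)])
    fix X assume X: "X \<in> \<D>"
    then obtain k l where "X = cbox k l" using \<D>(3) by blast
    then show "AE p in lebesgue. p \<in> X \<longrightarrow> d p = 0" using box[of k l] X \<D>(2) by auto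
  qed
  then show ?thesis
  proof eventually_elim
    case (elim p) then show ?case using \<D>(4) by (auto simp: d_def)
  qed
qed

lemma dirichlet_energy_eq:
  fixes u :: "real \<times> real \<Rightarrow> real"
  assumes "has_weak_gradient u g D" "open D"
  shows "dirichlet_energy u D = (\<integral>\<^sup>+ p\<in>D. ennreal ((norm (g p))\<^sup>2) \<partial>lebesgue)"
proof -
  have "has_weak_gradient u (weak_gradient u D) D" unfolding weak_gradient_def using someI[of "\<lambda>g. has_weak_gradient u g D", OF assms(1)] .
  from weak_gradient_unique[OF this assms] show ?thesis
    unfolding dirichlet_energy_def
    by (intro nn_integral_cong_AE) (auto elim!: eventually_mono simp: indicator_def)
qed

section \<open>Nearly optimal displacements of a half-strip\<close>

text \<open>The quotient is at most pi times the oscillation \<open>w\<close> of \<open>u\<close> on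
  the ball, the area of the ball being pi \<rho>^2.\<close>

lemma continuous_has_trace:
  assumes "isCont u p" "u p = t"
  shows "has_trace_at u D p t"
  unfolding has_trace_at_def
proof (rule tendsto_sandwich[OF _ _ tendsto_const])
  show "eventually (\<lambda>\<rho>. 0 \<le> (\<integral>\<^sup>+ q\<in>(D \<inter> ball p \<rho>). ennreal \<bar>u q - t\<bar> \<partial>lebesgue) / ennreal (\<rho>\<^sup>2)) (at_right 0)" by simp
  define w where "w \<rho> = (SUP q\<in>ball p \<rho>. ennreal \<bar>u q - t\<bar>)" for \<rho>
  have "(\<integral>\<^sup>+ q\<in>(D \<inter> ball p \<rho>). ennreal \<bar>u q - t\<bar> \<partial>lebesgue) / ennreal (\<rho>\<^sup>2) \<le> w \<rho> * ennreal pi" if \<rho>: "\<rho> > 0" for \<rho>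
  proof -
    have "(\<integral>\<^sup>+ q\<in>(D \<inter> ball p \<rho>). ennreal \<bar>u q - t\<bar> \<partial>lebesgue) \<le> (\<integral>\<^sup>+ q. w \<rho> * indicator (ball p \<rho>) q \<partial>lebesgue)"
      by (intro nn_integral_mono) (auto simp: w_def indicator_def intro: SUP_upper)
    also have "\<dots> = w \<rho> * emeasure lborel (ball p \<rho>)"
      by (subst nn_integral_cmult_indicator) auto
    also have "\<dots> = w \<rho> * ennreal (pi * \<rho>\<^sup>2)"
      using \<rho> by (simp add: emeasure_ball unit_ball_vol_2 power2_eq_square)
    finally have "(\<integral>\<^sup>+ q\<in>(D \<inter> ball p \<rho>). ennreal \<bar>u q - t\<bar> \<partial>lebesgue) \<le> (w \<rho> * ennreal pi) * ennreal (\<rho>\<^sup>2)"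
      by (simp add: ennreal_mult mult.assoc)
    then have "(\<integral>\<^sup>+ q\<in>(D \<inter> ball p \<rho>). ennreal \<bar>u q - t\<bar> \<partial>lebesgue) / ennreal (\<rho>\<^sup>2) \<le> (w \<rho> * ennreal pi) * ennreal (\<rho>\<^sup>2) / ennreal (\<rho>\<^sup>2)"
      by (rule divide_right_mono_ennreal)
    also have "\<dots> = w \<rho> * ennreal pi" using \<rho> by (intro ennreal_mult_divide_eq) auto
    finally show ?thesis .
  qed
  then show "eventually (\<lambda>\<rho>. (\<integral>\<^sup>+ q\<in>(D \<inter> ball p \<rho>). ennreal \<bar>u q - t\<bar> \<partial>lebesgue) / ennreal (\<rho>\<^sup>2) \<le> w \<rho> * ennreal pi) (at_right 0)"
    by (auto simp: eventually_at_right_field intro: exI[of _ 1])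
  have "(w \<longlongrightarrow> 0) (at_right 0)"
  proof (rule order_tendstoI)
    fix y :: ennreal assume "0 < y"
    obtain e :: real where e: "0 < e" "ennreal e < y"
    proof -
      obtain z where z: "0 < z" "z < y" using dense[OF \<open>0 < y\<close>] by blast
      then have "z < \<infinity>" by (metis infinity_ennreal_def order_less_le_trans top_greatest)
      then show ?thesis using z that[of "enn2real z"] by (simp add: enn2real_positive_iff)
    qed
    have "\<exists>d>0. \<forall>q. dist q p < d \<longrightarrow> \<bar>u q - t\<bar> < e"
      using assms e(1) unfolding continuous_at_eps_delta dist_real_def by metis
    then obtain d where d: "d > 0" "\<forall>q. dist q p < d \<longrightarrow> \<bar>u q - t\<bar> < e" by blast
    have "w \<rho> < y" if "0 < \<rho>" "\<rho> < d" for \<rho>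
    proof -
      have "\<bar>u q - t\<bar> \<le> e" if "q \<in> ball p \<rho>" for q
        using d(2) that \<open>\<rho> < d\<close> by (metis dist_commute dual_order.strict_trans less_imp_le mem_ball)
      then have "w \<rho> \<le> ennreal e" unfolding w_def by (intro SUP_least ennreal_leI)
      then show ?thesis using e(2) by (rule order_le_less_trans)
    qed
    then show "eventually (\<lambda>\<rho>. w \<rho> < y) (at_right 0)" using d(1) by (auto simp: eventually_at_right_field)
  qed simp
  then show "((\<lambda>\<rho>. w \<rho> * ennreal pi) \<longlongrightarrow> 0) (at_right 0)"
    using tendsto_mult_ennreal[of w 0 "at_right 0" "\<lambda>_. ennreal pi" "ennreal pi"] by (simp add: tendsto_const)
qed

section \<open>Constants of the Fourier expansion of the datum over an interval\<close>

definition cN :: "nat \<Rightarrow> real" where "cN N = (\<Sum>j<N. 8 / kap j ^ 3)"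

text \<open>The mean square of the remainder when the constant 1 is expanded in the first
  \<open>N\<close> odd sines; it measures how well the datum is resolved by \<open>N\<close>
  modes.\<close>

definition dN :: "nat \<Rightarrow> real" where "dN N = 1 - (\<Sum>j<N. 8 / (kap j)\<^sup>2)"

text \<open>Parseval for the constant 1. The odd part of the sum of inverse squares is the full sum
  minus its even part, which is a quarter of it: pi^2/6 - pi^2/24 = pi^2/8.\<close>

lemma odd_inverse_squares_sums: "(\<lambda>j. 8 / (kap j)\<^sup>2) sums 1"
proof -
  have "(\<lambda>n. (\<Sum>i\<in>{n * 2..<n * 2 + 2}. 1 / (real i + 1)\<^sup>2)) sums (pi\<^sup>2 / 6)"
    using sums_group[OF inverse_squares_sums, of 2] by (simp add: add.commute)
  moreover have "(\<Sum>i\<in>{n * 2..<n * 2 + 2}. 1 / (real i + 1)\<^sup>2) = 1 / (2 * real n + 1)\<^sup>2 + 1 / 4 * (1 / (real n + 1)\<^sup>2)" for n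
  proof -
    have "{n * 2..<n * 2 + 2} = {n * 2, n * 2 + 1}" by auto
    moreover have "(real (n * 2 + 1) + 1)\<^sup>2 = 4 * (real n + 1)\<^sup>2" by (simp add: power2_eq_square algebra_simps)
    ultimately show ?thesis by (simp add: mult.commute)
  qed
  ultimately have "(\<lambda>n. 1 / (2 * real n + 1)\<^sup>2 + 1 / 4 * (1 / (real n + 1)\<^sup>2)) sums (pi\<^sup>2 / 6)" by (simp only:)
  from sums_diff[OF this sums_mult[OF inverse_squares_sums, of "1/4"]]
  have "(\<lambda>n. 1 / (2 * real n + 1)\<^sup>2) sums (pi\<^sup>2 / 8)" by (simp add: field_simps)
  from sums_mult[OF this, of "8 / pi\<^sup>2"] have "(\<lambda>n. 8 / pi\<^sup>2 * (1 / (2 * real n + 1)\<^sup>2)) sums 1" by simp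
  moreover have "8 / (kap n)\<^sup>2 = 8 / pi\<^sup>2 * (1 / (2 * real n + 1)\<^sup>2)" for n
  proof -
    have "kap n = pi * (2 * real n + 1)" by (simp add: kap_def)
    then show ?thesis by (simp only: power_mult_distrib) simp
  qed
  ultimately show ?thesis by (simp only:)
qed

lemma dN_tendsto: "dN \<longlonglongrightarrow> 0"
  using tendsto_diff[OF tendsto_const[of 1] odd_inverse_squares_sums[unfolded sums_def]] by (simp add: dN_def[abs_def])

lemma summable_inverse_kap_cube: "summable (\<lambda>j. 8 / kap j ^ 3)"
proof (rule summable_comparison_test'[OF sums_summable[OF odd_inverse_squares_sums]])
  fix j
  have "1 \<le> kap j"
  proof -
    have "1 * 1 \<le> real (2 * j + 1) * pi" using pi_gt3 by (intro mult_mono) auto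
    then show ?thesis by (simp add: kap_def)
  qed
  then show "norm (8 / kap j ^ 3) \<le> 8 / (kap j)\<^sup>2"
    by (simp add: frac_le power_increasing)
qed

text \<open>The Dirichlet energy of the optimal displacement on a half-strip of unit width.\<close>

definition c0 :: real where "c0 = (\<Sum>j. 8 / kap j ^ 3)"

lemma cN_tendsto: "cN \<longlonglongrightarrow> c0"
  unfolding cN_def[abs_def] c0_def by (rule summable_LIMSEQ[OF summable_inverse_kap_cube])

lemma cN_le: "cN N \<le> c0"
  unfolding cN_def c0_def using kap_pos by (intro sum_le_suminf summable_inverse_kap_cube) (auto simp: less_imp_le)

lemma c0_pos: "0 < c0"
  using cN_le[of 1] kap_pos[of 0] by (simp add: cN_def) (meson divide_pos_pos order_less_le_trans zero_less_numeral zero_less_power)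

lemma integral_exp_half_line:
  fixes c :: real
  assumes "c > 0"
  shows "integrable lborel (\<lambda>y. indicator {0<..} y * exp (- c * y))" "(LINT y|lborel. indicator {0<..} y * exp (- c * y)) = 1 / c"
proof -
  have d: "((\<lambda>y. - exp (- c * y) / c) has_real_derivative exp (- c * y)) (at y)" for y
    using assms by (auto intro!: derivative_eq_intros)
  have lim: "((\<lambda>y. - exp (- c * y) / c) \<longlongrightarrow> 0) at_top"
  proof -
    have "filterlim (\<lambda>y. - c * y) at_bot at_top"
      using assms by (intro filterlim_tendsto_neg_mult_at_bot[OF tendsto_const]) (auto simp: filterlim_ident)
    from tendsto_minus[OF tendsto_divide[OF filterlim_compose[OF exp_at_bot this] tendsto_const, of c]]
    show ?thesis using assms by simp
  qed
  have "(\<integral>\<^sup>+ y. ennreal (exp (- c * y)) * indicator {0..} y \<partial>lborel) = ennreal (0 - (- exp (- c * 0) / c))"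
    by (rule nn_integral_FTC_atLeast[OF _ d _ lim]) (auto intro!: borel_measurable_continuous_onI continuous_intros)
  also have "(\<integral>\<^sup>+ y. ennreal (exp (- c * y)) * indicator {0..} y \<partial>lborel) = (\<integral>\<^sup>+ y. ennreal (indicator {0<..} y * exp (- c * y)) \<partial>lborel)"
  proof (rule nn_integral_cong_AE)
    show "AE y in lborel. ennreal (exp (- c * y)) * indicator {0..} y = ennreal (indicator {0<..} y * exp (- c * y))"
      using AE_lborel_singleton[of 0] by eventually_elim (auto simp: indicator_def)
  qed
  finally have "(\<integral>\<^sup>+ y. ennreal (indicator {0<..} y * exp (- c * y)) \<partial>lborel) = ennreal (1 / c)" by simp
  moreover have "(\<lambda>y. indicator {0<..} y * exp (- c * y)) \<in> borel_measurable lborel"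
    using borel_measurable_continuous_onI[of "\<lambda>y. exp (- c * y)"] by (auto intro!: borel_measurable_times continuous_intros)
  ultimately have "has_bochner_integral lborel (\<lambda>y. indicator {0<..} y * exp (- c * y)) (1 / c)"
    using assms by (intro has_bochner_integral_nn_integral) auto
  then show "integrable lborel (\<lambda>y. indicator {0<..} y * exp (- c * y))" "(LINT y|lborel. indicator {0<..} y * exp (- c * y)) = 1 / c"
    by (simp_all add: has_bochner_integral_iff)
qed

lemma has_derivative_fst_snd_mult:
  fixes f k :: "real \<Rightarrow> real"
  assumes "\<And>x. (f has_real_derivative f' x) (at x)" "\<And>y. (k has_real_derivative k' y) (at y)"
  shows "((\<lambda>p. f (fst p) * k (snd p)) has_derivative (\<lambda>v. (f' (fst p) * k (snd p), f (fst p) * k' (snd p)) \<bullet> v)) (at p)"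
  by (rule has_derivative_eq_rhs[OF has_derivative_mult[OF DERIV_compose_FDERIV[OF assms(1) has_derivative_fst[OF has_derivative_ident]]
        DERIV_compose_FDERIV[OF assms(2) has_derivative_snd[OF has_derivative_ident]]]])
      (auto simp: fun_eq_iff inner_prod_def algebra_simps)

lemma cos_kap_half: "cos (kap j / 2) = 0"
proof -
  have "kap j / 2 = real j * pi + pi / 2" by (simp add: kap_def field_simps)
  then show ?thesis by (simp only: cos_add) simp
qed

text \<open>Competitors are C^1 on the whole plane with the exact datum on the entire axis, so that
  one displacement can be restricted to any open film or strip domain.\<close>

definition displacement :: "(real \<times> real \<Rightarrow> real) \<Rightarrow> (real \<times> real \<Rightarrow> real \<times> real) \<Rightarrow> bool" where
  "displacement U dU \<longleftrightarrow> (\<forall>p. (U has_derivative (\<lambda>v. dU p \<bullet> v)) (at p)) \<and> continuous_on UNIV dU \<and> (\<forall>x. U (x, 0) = x)"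

text \<open>The first \<open>N\<close> modes of x - l/2 are extended upwards harmonically by
  decaying exponentials and cost l^2 \<open>cN N\<close>. The remainder \<open>r\<close> of the
  expansion is kept, so the datum is met exactly, and is extended with the decay length l; its cost
  is at most l^2 \<open>dN N\<close>. The cross term is absorbed by Young's inequality with
  parameter \<open>s\<close>.\<close>

theorem near_optimal_displacement:
  fixes l s :: real
  assumes l: "0 < l" and s: "0 < s"
  shows "\<exists>U dU. displacement U dU \<and>
    (\<integral>\<^sup>+ p\<in>({0<..<l} \<times> {0<..}). ennreal ((norm (dU p))\<^sup>2) \<partial>lebesgue) \<le> ennreal (l\<^sup>2 * ((1 + s) * cN N + (1 + 1 / s) * dN N))"
proof -
  define k where "k j = kap j / l" for j
  have k: "k j > 0" for j using kap_pos l by (simp add: k_def)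
  \<comment> \<open>\<open>- A j\<close> are the Fourier coefficients of x - l/2 in the cosines, and
    \<open>q j\<close> those of its derivative 1 in the sines; hence \<open>r\<close> and
    \<open>r'\<close> below are matching remainders.\<close>
  define A where "A j = 4 * l / (kap j)\<^sup>2" for j
  define q where "q j = 4 / kap j" for j
  have Ak: "A j * k j = q j" for j using kap_pos[of j] l by (simp add: A_def k_def q_def power2_eq_square field_simps)
  define X where "X j x = sin (kap j * (x - 0) / (l - 0))" for j x
  define C where "C j x = cos (kap j * (x - 0) / (l - 0))" for j x
  define E where "E c y = exp (- c * y)" for c y :: real
  define r where "r x = x - l / 2 + (\<Sum>j<N. A j * C j x)" for x
  define r' where "r' x = 1 - (\<Sum>j<N. q j * X j x)" for x
  have dC: "(C j has_real_derivative - (k j * X j x)) (at x)" for j x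
    unfolding C_def[abs_def] X_def k_def using l by (auto intro!: derivative_eq_intros simp: field_simps)
  have dX: "(X j has_real_derivative k j * C j x) (at x)" for j x
    unfolding X_def[abs_def] C_def k_def using l by (auto intro!: derivative_eq_intros simp: field_simps)
  have dE: "(E c has_real_derivative - c * E c y) (at y)" for c y
    unfolding E_def[abs_def] by (auto intro!: derivative_eq_intros)
  have cX: "continuous_on UNIV (X j)" and cC: "continuous_on UNIV (C j)" and cE: "continuous_on UNIV (E c)" for j c
    using dX dC dE by (meson DERIV_continuous_on has_field_derivative_at_within)+
  have dr: "(r has_real_derivative r' x) (at x)" for x
  proof -
    have "((\<lambda>x. x - l / 2 + (\<Sum>j<N. A j * C j x)) has_real_derivative 1 - 0 + (\<Sum>j<N. A j * - (k j * X j x))) (at x)"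
      by (intro DERIV_add DERIV_diff DERIV_ident DERIV_const DERIV_sum DERIV_cmult dC)
    moreover have "1 - 0 + (\<Sum>j<N. A j * - (k j * X j x)) = r' x"
      by (simp add: r'_def sum_negf Ak[symmetric] mult.assoc)
    ultimately show ?thesis unfolding r_def[abs_def] by simp
  qed
  have cr: "continuous_on UNIV r" "continuous_on UNIV r'"
    using dr by (meson DERIV_continuous_on has_field_derivative_at_within) (unfold r'_def[abs_def], intro continuous_intros cX)
  define U where "U p = l / 2 + (- (\<Sum>j<N. A j * (C j (fst p) * E (k j) (snd p))) + r (fst p) * E (1 / l) (snd p))" for p
  define a1 where "a1 p = (\<Sum>j<N. q j * (X j (fst p) * E (k j) (snd p)))" for p :: "real \<times> real"
  define a2 where "a2 p = (\<Sum>j<N. q j * (C j (fst p) * E (k j) (snd p)))" for p :: "real \<times> real"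
  define b1 where "b1 p = r' (fst p) * E (1 / l) (snd p)" for p :: "real \<times> real"
  define b2 where "b2 p = - (r (fst p) / l * E (1 / l) (snd p))" for p :: "real \<times> real"
  define dU where "dU p = (a1 p + b1 p, a2 p + b2 p)" for p
  have dUd: "(U has_derivative (\<lambda>v. dU p \<bullet> v)) (at p)" for p
  proof -
    have 1: "((\<lambda>p. A j * (C j (fst p) * E (k j) (snd p))) has_derivative (\<lambda>v. A j * ((- (k j * X j (fst p)) * E (k j) (snd p), C j (fst p) * (- k j * E (k j) (snd p))) \<bullet> v))) (at p)" for j
      by (intro has_derivative_mult_right has_derivative_fst_snd_mult dC dE)
    have 2: "((\<lambda>p. r (fst p) * E (1 / l) (snd p)) has_derivative (\<lambda>v. (r' (fst p) * E (1 / l) (snd p), r (fst p) * (- (1 / l) * E (1 / l) (snd p))) \<bullet> v)) (at p)"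
      by (intro has_derivative_fst_snd_mult dr dE)
    have "(U has_derivative (\<lambda>v. 0 + (- (\<Sum>j<N. A j * ((- (k j * X j (fst p)) * E (k j) (snd p), C j (fst p) * (- k j * E (k j) (snd p))) \<bullet> v))
        + (r' (fst p) * E (1 / l) (snd p), r (fst p) * (- (1 / l) * E (1 / l) (snd p))) \<bullet> v))) (at p)"
      unfolding U_def[abs_def] by (intro has_derivative_add has_derivative_const has_derivative_minus has_derivative_sum 1 2)
    moreover have "0 + (- (\<Sum>j<N. A j * ((- (k j * X j (fst p)) * E (k j) (snd p), C j (fst p) * (- k j * E (k j) (snd p))) \<bullet> v))
        + (r' (fst p) * E (1 / l) (snd p), r (fst p) * (- (1 / l) * E (1 / l) (snd p))) \<bullet> v) = dU p \<bullet> v" for v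
    proof -
      have "A j * ((- (k j * X j (fst p)) * E (k j) (snd p), C j (fst p) * (- k j * E (k j) (snd p))) \<bullet> v)
         = - (q j * (X j (fst p) * E (k j) (snd p)) * fst v) - q j * (C j (fst p) * E (k j) (snd p)) * snd v" for j
        unfolding Ak[symmetric] by (simp add: inner_prod_def algebra_simps)
      then have "(\<Sum>j<N. A j * ((- (k j * X j (fst p)) * E (k j) (snd p), C j (fst p) * (- k j * E (k j) (snd p))) \<bullet> v))
         = - (a1 p * fst v) - a2 p * snd v"
        by (simp only: a1_def a2_def sum_subtractf sum_negf sum_distrib_right)
      then show ?thesis
        by (simp only:) (simp add: dU_def b1_def b2_def inner_prod_def algebra_simps)
    qed
    ultimately show ?thesis by simp
  qed
  have cdU: "continuous_on UNIV dU"
    unfolding dU_def[abs_def] a1_def a2_def b1_def b2_def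
    by (intro continuous_intros continuous_on_compose2[OF cr(1)] continuous_on_compose2[OF cr(2)] continuous_on_compose2[OF cX]
       continuous_on_compose2[OF cC] continuous_on_compose2[OF cE]) (use l in auto)
  have U0: "U (x, 0) = x" for x by (simp add: U_def E_def r_def)
  define IX where "IX i j x = indicator {0<..<l} x * (X i x * X j x)" for i j x
  define IC where "IC i j x = indicator {0<..<l} x * (C i x * C j x)" for i j x
  define IE where "IE i j y = indicator {0<..} y * E (k i + k j) y" for i j y
  have IX: "integrable lborel (IX i j)" "(LINT x|lborel. IX i j x) = (if i = j then l / 2 else 0)"
   and IC: "integrable lborel (IC i j)" "(LINT x|lborel. IC i j x) = (if i = j then l / 2 else 0)" for i j
    unfolding IX_def[abs_def] IC_def[abs_def] X_def C_def using mode_orthogonal[OF l, of i j] by simp_all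
  have IE: "integrable lborel (IE i j)" "(LINT y|lborel. IE i j y) = 1 / (k i + k j)" for i j
    unfolding IE_def[abs_def] E_def using integral_exp_half_line[of "k i + k j"] k[of i] k[of j] by simp_all
  have IX1: "integrable lborel (\<lambda>x. indicator {0<..<l} x * X j x)" "(LINT x|lborel. indicator {0<..<l} x * X j x) = 2 * l / kap j" for j
    unfolding X_def using mode_integral[OF l, of j] by simp_all
  define S where "S z = (\<Sum>i<N. \<Sum>j<N. q i * q j * (IX i j (fst z) * IE i j (snd z) + IC i j (fst z) * IE i j (snd z)))" for z
  have EE: "E (k i) y * E (k j) y = E (k i + k j) y" for i j y by (simp add: E_def exp_add[symmetric] algebra_simps)
  have Seq: "(a1 z)\<^sup>2 + (a2 z)\<^sup>2 = S z" if "z \<in> {0<..<l} \<times> {0<..}" for z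
  proof -
    have "fst z \<in> {0<..<l}" "snd z \<in> {0<..}" using that by auto
    then show ?thesis
      by (simp add: S_def a1_def a2_def IX_def IC_def IE_def EE[symmetric] power2_eq_square sum_product sum.distrib[symmetric] algebra_simps)
  qed
  have Sint: "integrable lebesgue S" "(LINT z|lebesgue. S z) = l\<^sup>2 * cN N"
  proof -
    note i1 = integral_prod_mult[OF IX(1) IE(1)] and i2 = integral_prod_mult[OF IC(1) IE(1)]
    show "integrable lebesgue S" unfolding S_def[abs_def]
      by (intro Bochner_Integration.integrable_sum integrable_mult_right Bochner_Integration.integrable_add i1(1) i2(1))
    have "(LINT z|lebesgue. S z) = (\<Sum>i<N. \<Sum>j<N. q i * q j * ((if i = j then l / 2 else 0) * (1 / (k i + k j)) + (if i = j then l / 2 else 0) * (1 / (k i + k j))))"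
      unfolding S_def[abs_def] using i1 i2 IX(2) IC(2) IE(2) by (simp add: Bochner_Integration.integral_sum)
    also have "\<dots> = (\<Sum>i<N. \<Sum>j<N. if i = j then q i * q i * l / (2 * k i) else 0)"
      by (intro sum.cong refl) auto
    also have "\<dots> = (\<Sum>i<N. l\<^sup>2 * (8 / kap i ^ 3))"
    proof -
      have "q i * q i * l / (2 * k i) = l\<^sup>2 * (8 / kap i ^ 3)" for i
        using kap_pos[of i] l by (simp add: q_def k_def field_simps power2_eq_square power3_eq_cube)
      then show ?thesis by (simp add: sum.delta)
    qed
    finally show "(LINT z|lebesgue. S z) = l\<^sup>2 * cN N" by (simp add: cN_def sum_distrib_left)
  qed
  define R where "R x = indicator {0<..<l} x * (r' x)\<^sup>2" for x
  have Rint: "integrable lborel R" "(LINT x|lborel. R x) = l * dN N"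
  proof -
    have ione: "integrable lborel (indicator {0<..<l} :: real \<Rightarrow> real)" "(LINT x|lborel. indicator {0<..<l} x) = l" using l by simp_all
    have eq: "R = (\<lambda>x. indicator {0<..<l} x - 2 * (\<Sum>j<N. q j * (indicator {0<..<l} x * X j x)) + (\<Sum>i<N. \<Sum>j<N. q i * q j * IX i j x))"
    proof
      fix x show "R x = indicator {0<..<l} x - 2 * (\<Sum>j<N. q j * (indicator {0<..<l} x * X j x)) + (\<Sum>i<N. \<Sum>j<N. q i * q j * IX i j x)"
        by (cases "x \<in> {0<..<l}") (simp_all add: R_def r'_def IX_def power2_eq_square sum_product algebra_simps)
    qed
    show "integrable lborel R" unfolding eq
      by (intro Bochner_Integration.integrable_add Bochner_Integration.integrable_diff Bochner_Integration.integrable_sum integrable_mult_right ione IX1 IX)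
    have "(LINT x|lborel. R x) = l - 2 * (\<Sum>j<N. q j * (2 * l / kap j)) + (\<Sum>i<N. \<Sum>j<N. q i * q j * (if i = j then l / 2 else 0))"
      unfolding eq using ione IX1 IX by (simp add: Bochner_Integration.integral_sum)
    also have "(\<Sum>i<N. \<Sum>j<N. q i * q j * (if i = j then l / 2 else 0)) = (\<Sum>i<N. \<Sum>j<N. if i = j then q i * q i * (l / 2) else 0)"
      by (intro sum.cong refl) auto
    also have "\<dots> = (\<Sum>i<N. l * (8 / (kap i)\<^sup>2))"
      by (simp add: q_def power2_eq_square mult.commute)
    also have "(\<Sum>j<N. q j * (2 * l / kap j)) = (\<Sum>i<N. l * (8 / (kap i)\<^sup>2))"
      by (simp add: q_def power2_eq_square mult.commute)
    finally show "(LINT x|lborel. R x) = l * dN N" unfolding sum_distrib_left[symmetric] dN_def by (simp add: algebra_simps)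
  qed
  have dN0: "0 \<le> dN N"
  proof -
    have "0 \<le> (LINT x|lborel. R x)" by (intro Bochner_Integration.integral_nonneg) (simp add: R_def)
    then show ?thesis using Rint(2) l by (simp add: zero_le_mult_iff)
  qed
  have rb: "(r x)\<^sup>2 \<le> l\<^sup>2 * dN N" if x: "0 \<le> x" "x \<le> l" for x
  proof (cases "r x = 0")
    case True then show ?thesis using dN0 l by simp
  next
    case False
    \<comment> \<open>The pointwise bound combines \<open>r (l / 2) = 0\<close>, which holds as
      every cosine mode vanishes at the midpoint, with Cauchy-Schwarz for \<open>r'\<close>. The
      latter is run through Young's inequality; this weight is the one for which the result closes
      up.\<close>
    define m where "m = \<bar>r x\<bar> / l"
    have m: "m > 0" using False l by (simp add: m_def)
    let ?f = "\<lambda>x. (m + (r' x)\<^sup>2 / m) / 2"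
    have cf: "continuous_on UNIV ?f" using m by (intro continuous_intros cr) auto
    obtain P where P: "\<forall>x. (P has_real_derivative ?f x) (at x)" using continuous_has_antiderivative[OF cf] by blast
    have fr: "\<bar>r' x\<bar> \<le> ?f x" for x
    proof -
      have "0 \<le> (m - \<bar>r' x\<bar>)\<^sup>2" by simp
      then show ?thesis using m by (simp add: power2_diff field_simps) (simp add: power2_eq_square)
    qed
    have mono: "P u \<le> P v \<and> \<bar>r v - r u\<bar> \<le> P v - P u" if "u \<le> v" for u v
    proof -
      have "P u - r u \<le> P v - r v"
      proof (intro DERIV_nonneg_imp_nondecreasing[of u v "\<lambda>x. P x - r x"] that exI conjI)
        fix x show "((\<lambda>x. P x - r x) has_real_derivative ?f x - r' x) (at x)" by (intro DERIV_diff P[rule_format] dr)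
        show "0 \<le> ?f x - r' x" using fr[of x] by linarith
      qed
      moreover have "P u + r u \<le> P v + r v"
      proof (intro DERIV_nonneg_imp_nondecreasing[of u v "\<lambda>x. P x + r x"] that exI conjI)
        fix x show "((\<lambda>x. P x + r x) has_real_derivative ?f x + r' x) (at x)" by (intro DERIV_add P[rule_format] dr)
        show "0 \<le> ?f x + r' x" using fr[of x] by linarith
      qed
      ultimately show ?thesis by linarith
    qed
    have "r (l / 2) = 0" using l by (simp add: r_def C_def cos_kap_half)
    then have "\<bar>r x\<bar> \<le> P l - P 0"
      using mono[of 0 "l/2"] mono[of "l/2" l] mono[of "l/2" x] mono[of x "l/2"] mono[of 0 x] mono[of x l] x l by linarith
    also have "P l - P 0 = (LINT x|lborel. indicator {0<..<l} x * ?f x)"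
      using integral_FTC_open(2)[OF less_imp_le[OF l] P[rule_format] cf] by simp
    also have "\<dots> = (LINT x|lborel. m / 2 * indicator {0<..<l} x + 1 / (2 * m) * R x)"
      using m by (intro Bochner_Integration.integral_cong refl) (simp add: R_def field_simps)
    also have "\<dots> = m / 2 * l + 1 / (2 * m) * (l * dN N)" using Rint l by simp
    finally have "2 * \<bar>r x\<bar> \<le> m * l + l * dN N / m" using m by (simp add: field_simps)
    also have "m * l = \<bar>r x\<bar>" using l by (simp add: m_def)
    finally have "\<bar>r x\<bar> \<le> l * dN N / m" by simp
    then have "\<bar>r x\<bar> * m \<le> l * dN N" using m by (simp add: field_simps)
    then show ?thesis using l by (simp add: m_def field_simps power2_eq_square)
  qed
  \<comment> \<open>A majorant for the energy density of the remainder: the square of the vertical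
    derivative \<open>r / l\<close> is replaced by its bound \<open>dN N\<close>.\<close>
  define H where "H z = (R (fst z) + dN N * indicator {0<..<l} (fst z)) * (indicator {0<..} (snd z) * exp (- (2 / l) * snd z))" for z
  have Hint: "integrable lebesgue H" "(LINT z|lebesgue. H z) = l\<^sup>2 * dN N"
  proof -
    have i: "integrable lborel (\<lambda>x. R x + dN N * indicator {0<..<l} x)" "(LINT x|lborel. R x + dN N * indicator {0<..<l} x) = l * dN N + dN N * l"
      using Rint l by simp_all
    note e = integral_exp_half_line[of "2 / l"]
    show "integrable lebesgue H" "(LINT z|lebesgue. H z) = l\<^sup>2 * dN N"
      unfolding H_def[abs_def] using integral_prod_mult[OF i(1) e(1)] i(2) e(2) l by (simp_all add: power2_eq_square algebra_simps)
  qed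
  have pw: "(norm (dU z))\<^sup>2 \<le> (1 + s) * S z + (1 + 1 / s) * H z" if z: "z \<in> {0<..<l} \<times> {0<..}" for z
  proof -
    have young: "(a + b)\<^sup>2 \<le> (1 + s) * a\<^sup>2 + (1 + 1 / s) * b\<^sup>2" for a b :: real
    proof -
      have "0 \<le> (s * a - b)\<^sup>2 / s" using s by simp
      also have "(s * a - b)\<^sup>2 / s = s * a\<^sup>2 - 2 * a * b + b\<^sup>2 / s" using s by (simp add: power2_eq_square field_simps)
      finally show ?thesis by (simp add: power2_eq_square algebra_simps)
    qed
    have zz: "0 < fst z" "fst z < l" "0 < snd z" using z by auto
    have E2: "(E (1 / l) (snd z))\<^sup>2 = exp (- (2 / l) * snd z)" by (simp add: E_def power2_eq_square exp_add[symmetric])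
    have "(b1 z)\<^sup>2 + (b2 z)\<^sup>2 = ((r' (fst z))\<^sup>2 + (r (fst z))\<^sup>2 / l\<^sup>2) * exp (- (2 / l) * snd z)"
      unfolding b1_def b2_def E2[symmetric] by (simp add: power_mult_distrib power_divide algebra_simps)
    also have "\<dots> \<le> ((r' (fst z))\<^sup>2 + dN N) * exp (- (2 / l) * snd z)"
      using rb[of "fst z"] zz l by (intro mult_right_mono add_left_mono) (auto simp: divide_le_eq mult.commute)
    also have "\<dots> = H z" using zz by (simp add: H_def R_def)
    finally have bH: "(b1 z)\<^sup>2 + (b2 z)\<^sup>2 \<le> H z" .
    have "(norm (dU z))\<^sup>2 = (a1 z + b1 z)\<^sup>2 + (a2 z + b2 z)\<^sup>2" by (simp add: dU_def norm_prod_def)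
    also have "\<dots> \<le> ((1 + s) * (a1 z)\<^sup>2 + (1 + 1 / s) * (b1 z)\<^sup>2) + ((1 + s) * (a2 z)\<^sup>2 + (1 + 1 / s) * (b2 z)\<^sup>2)"
      by (intro add_mono young)
    also have "\<dots> = (1 + s) * S z + (1 + 1 / s) * ((b1 z)\<^sup>2 + (b2 z)\<^sup>2)" unfolding Seq[OF z, symmetric] by (simp add: algebra_simps)
    also have "\<dots> \<le> (1 + s) * S z + (1 + 1 / s) * H z" using bH s by (intro add_left_mono mult_left_mono) auto
    finally show ?thesis .
  qed
  have S0: "0 \<le> S z" "0 \<le> H z" for z
  proof -
    show "0 \<le> H z" using dN0 by (simp add: H_def R_def)
    show "0 \<le> S z"
    proof (cases "z \<in> {0<..<l} \<times> {0<..}")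
      case True then show ?thesis using Seq[OF True] by (metis add_nonneg_nonneg zero_le_power2)
    next
      case False
      then have "IX i j (fst z) * IE i j (snd z) + IC i j (fst z) * IE i j (snd z) = 0" for i j
        by (cases z) (auto simp: IX_def IC_def IE_def)
      then show ?thesis unfolding S_def by (simp only: mult_zero_right sum.neutral_const)
    qed
  qed
  have "(\<integral>\<^sup>+ p\<in>({0<..<l} \<times> {0<..}). ennreal ((norm (dU p))\<^sup>2) \<partial>lebesgue) \<le> (\<integral>\<^sup>+ z. ennreal ((1 + s) * S z + (1 + 1 / s) * H z) \<partial>lebesgue)"
    using pw by (intro nn_integral_mono) (auto simp: indicator_def intro!: ennreal_leI)
  also have "\<dots> = ennreal (LINT z|lebesgue. (1 + s) * S z + (1 + 1 / s) * H z)"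
    using S0 s by (intro nn_integral_eq_integral Bochner_Integration.integrable_add integrable_mult_right Sint Hint) auto
  also have "(LINT z|lebesgue. (1 + s) * S z + (1 + 1 / s) * H z) = l\<^sup>2 * ((1 + s) * cN N + (1 + 1 / s) * dN N)"
    using Sint Hint by (simp add: algebra_simps)
  finally have "(\<integral>\<^sup>+ p\<in>({0<..<l} \<times> {0<..}). ennreal ((norm (dU p))\<^sup>2) \<partial>lebesgue) \<le> ennreal (l\<^sup>2 * ((1 + s) * cN N + (1 + 1 / s) * dN N))" .
  moreover have "displacement U dU" unfolding displacement_def using dUd cdU U0 by simp
  ultimately show ?thesis by blast
qed

section \<open>Mass at low height\<close>

definition Gam :: "real \<Rightarrow> real" where "Gam t = (\<Sum>j. 8 / kap j ^ 3 * tanh (kap j * t))"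

lemma tanh_bounds:
  fixes x :: real
  assumes "0 \<le> x"
  shows "0 \<le> tanh x" "tanh x \<le> 1"
  using assms tanh_real_lt_1[of x] by (auto simp: less_imp_le)

lemma summable_Gam:
  assumes "0 \<le> t"
  shows "summable (\<lambda>j. 8 / kap j ^ 3 * tanh (kap j * t))"
proof (rule summable_comparison_test'[OF summable_inverse_kap_cube])
  fix j
  have "0 \<le> tanh (kap j * t)" "tanh (kap j * t) \<le> 1" using kap_pos[of j] assms by (auto intro!: tanh_bounds)
  then show "norm (8 / kap j ^ 3 * tanh (kap j * t)) \<le> 8 / kap j ^ 3"
    using kap_pos[of j] by (simp add: abs_mult divide_right_mono)
qed

lemma Gam_term_nonneg: "0 \<le> t \<Longrightarrow> 0 \<le> 8 / kap j ^ 3 * tanh (kap j * t)"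
  using kap_pos[of j] by (auto intro!: mult_nonneg_nonneg tanh_bounds)

lemma gam_le_Gam: "0 \<le> t \<Longrightarrow> gam N t \<le> Gam t"
  unfolding gam_def Gam_def by (intro sum_le_suminf summable_Gam Gam_term_nonneg) auto

lemma gam_tendsto_Gam: "0 \<le> t \<Longrightarrow> (\<lambda>N. gam N t) \<longlonglongrightarrow> Gam t"
  unfolding gam_def Gam_def by (intro summable_LIMSEQ summable_Gam)

lemma Gam_le_c0: "0 \<le> t \<Longrightarrow> Gam t \<le> c0"
  unfolding Gam_def c0_def
proof (intro suminf_le summable_Gam summable_inverse_kap_cube)
  fix j assume "0 \<le> t"
  then show "8 / kap j ^ 3 * tanh (kap j * t) \<le> 8 / kap j ^ 3"
    using kap_pos[of j] tanh_bounds(2)[of "kap j * t"] by (intro mult_left_le) auto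
qed

lemma Gam_mono: "0 \<le> s \<Longrightarrow> s \<le> t \<Longrightarrow> Gam s \<le> Gam t"
  unfolding Gam_def using kap_pos by (intro suminf_le summable_Gam mult_left_mono) (auto simp: less_imp_le)

text \<open>Only the first mode is kept, where \<open>kap 0\<close> is pi, and exp(2 pi t) >= 1 + 2
  t is used. The bound is linear for small \<open>t\<close>: a flat rectangle pays in proportion to
  its area, which is what \<open>small_mass\<close> lives on.\<close>

lemma Gam_ge:
  assumes "0 \<le> t"
  shows "8 / pi ^ 3 * (t / (1 + t)) \<le> Gam t"
proof -
  have "t / (1 + t) \<le> tanh (pi * t)"
  proof -
    have e: "1 + 2 * (pi * t) \<le> exp (2 * (pi * t))" by (rule exp_ge_add_one_self)
    have "t \<le> pi * t" using assms pi_gt3 by (simp add: mult_le_cancel_right1)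
    then have "1 + 2 * t \<le> exp (2 * (pi * t))" using e by linarith
    then have "2 / (exp (2 * (pi * t)) + 1) \<le> 2 / (2 + 2 * t)" using assms by (intro divide_left_mono mult_pos_pos) auto
    moreover have "tanh (pi * t) = 1 - 2 / (exp (2 * (pi * t)) + 1)"
    proof -
      have *: "(1 - inverse z) / (1 + inverse z) = 1 - 2 / (z + 1)" if "z > 0" for z :: real
      proof -
        have "1 - inverse z = (z - 1) / z" "1 + inverse z = (z + 1) / z" "1 - 2 / (z + 1) = (z - 1) / (z + 1)"
          using that by (simp_all add: field_simps)
        then show ?thesis using that by simp
      qed
      have "tanh (pi * t) = (1 - inverse (exp (2 * (pi * t)))) / (1 + inverse (exp (2 * (pi * t))))"
        unfolding exp_minus[symmetric] using tanh_real_altdef[of "pi * t"] by simp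
      then show ?thesis using *[of "exp (2 * (pi * t))"] by simp
    qed
    moreover have "2 / (2 + 2 * t) = 1 / (1 + t)" using assms by (simp add: field_simps)
    moreover have "t / (1 + t) = 1 - 1 / (1 + t)" using assms by (simp add: field_simps)
    ultimately show ?thesis by linarith
  qed
  then have "8 / pi ^ 3 * (t / (1 + t)) \<le> 8 / pi ^ 3 * tanh (pi * t)" by (intro mult_left_mono) auto
  also have "\<dots> = gam 1 t" by (simp add: gam_def kap_def)
  also have "\<dots> \<le> Gam t" by (rule gam_le_Gam[OF assms])
  finally show ?thesis .
qed

text \<open>From below it suffices to fix a truncation \<open>N\<close> with \<open>cN N\<close>
  close to \<open>c0\<close> and to let finitely many \<open>tanh\<close> terms tend to 1; from
  above \<open>c0\<close> is a bound anyway.\<close>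

lemma Gam_tendsto:
  assumes "filterlim t at_top sequentially"
  shows "(\<lambda>n. Gam (t n)) \<longlonglongrightarrow> c0"
proof (rule order_tendstoI)
  fix y assume "y < c0"
  then have "eventually (\<lambda>N. y < cN N) sequentially" using order_tendstoD(1)[OF cN_tendsto] by blast
  then obtain N where N: "y < cN N" by (auto simp: eventually_sequentially)
  have "(\<lambda>n. gam N (t n)) \<longlonglongrightarrow> (\<Sum>j<N. 8 / kap j ^ 3 * 1)"
    unfolding gam_def
  proof (intro tendsto_sum tendsto_mult tendsto_const)
    fix j
    have "filterlim (\<lambda>n. kap j * t n) at_top sequentially"
      using kap_pos[of j] assms by (intro filterlim_tendsto_pos_mult_at_top[OF tendsto_const])
    then show "(\<lambda>n. tanh (kap j * t n)) \<longlonglongrightarrow> 1"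
      by (rule filterlim_compose[OF tanh_real_at_top])
  qed
  then have "eventually (\<lambda>n. y < gam N (t n)) sequentially" by (rule order_tendstoD(1)) (use N in \<open>simp add: cN_def\<close>)
  moreover have "eventually (\<lambda>n. 0 \<le> t n) sequentially" using assms by (simp add: filterlim_at_top)
  ultimately show "eventually (\<lambda>n. y < Gam (t n)) sequentially"
    by eventually_elim (use gam_le_Gam in \<open>force intro: order_less_le_trans\<close>)
next
  fix y assume "c0 < y"
  have "eventually (\<lambda>n. 0 \<le> t n) sequentially" using assms by (simp add: filterlim_at_top)
  then show "eventually (\<lambda>n. Gam (t n) < y) sequentially"
    by eventually_elim (use Gam_le_c0 \<open>c0 < y\<close> in \<open>force intro: order_le_less_trans\<close>)
qed

text \<open>\<open>E\<close> dominates the elastic energy of every family of disjoint rectangles below the graph of \<open>h\<close>,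
  the vertical direction being stretched by the factor \<open>T\<close>.\<close>

definition elastic_bound :: "real \<Rightarrow> (real \<Rightarrow> real) \<Rightarrow> real \<Rightarrow> bool" where
  "elastic_bound T h E \<longleftrightarrow> (\<forall>S b y. finite S \<longrightarrow> (\<forall>a\<in>S. a < b a \<and> 0 < y a \<and> (\<forall>x\<in>{a<..<b a}. y a \<le> h x)) \<longrightarrow>
     disjoint_family_on (\<lambda>a. {a<..<b a}) S \<longrightarrow> (\<Sum>a\<in>S. (b a - a)\<^sup>2 * Gam (T * y a / (b a - a))) \<le> E)"

lemma elastic_boundD:
  assumes "elastic_bound T h E" "finite S" "\<forall>a\<in>S. a < b a \<and> 0 < y a \<and> (\<forall>x\<in>{a<..<b a}. y a \<le> h x)"
    "disjoint_family_on (\<lambda>a. {a<..<b a}) S"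
  shows "(\<Sum>a\<in>S. (b a - a)\<^sup>2 * Gam (T * y a / (b a - a))) \<le> E"
  using assms(1)[unfolded elastic_bound_def, THEN spec[of _ S], THEN spec[of _ b], THEN spec[of _ y]] assms(2-4) by simp

text \<open>\<open>v\<close> stands for the variation of \<open>h\<close> up to the point
  \<open>x\<close>. In this form the variation over disjoint intervals adds up by telescoping, and
  translation or rescaling of \<open>h\<close> acts on \<open>v\<close> directly.\<close>

definition variation_bound :: "(real \<Rightarrow> real) \<Rightarrow> (real \<Rightarrow> real) \<Rightarrow> real \<Rightarrow> bool" where
  "variation_bound h v B \<longleftrightarrow> (\<forall>x. 0 \<le> v x \<and> v x \<le> B) \<and> (\<forall>x y. x \<le> y \<longrightarrow> \<bar>h y - h x\<bar> \<le> v y - v x)"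

text \<open>\<open>v' t\<close> is the supremum over partitions whose last point is
  \<open>t\<close>. Appending a later point \<open>r\<close> to such a partition gives the increment
  inequality; the one-point partition makes the family nonempty.\<close>

lemma variation_bound_exists:
  assumes "pointwise_variation h < \<infinity>"
  shows "\<exists>v. variation_bound h v (enn2real (pointwise_variation h))"
proof -
  define s where "s n x = (\<Sum>i<n. ennreal \<bar>h (x (Suc i)) - h (x i)\<bar>)" for n and x :: "nat \<Rightarrow> real"
  define v' where "v' t = (SUP (n, x) \<in> {(n, x). strict_mono_on {..n} x \<and> x n = t}. s n x)" for t
  have le: "v' t \<le> pointwise_variation h" for t
    unfolding v'_def pointwise_variation_def s_def by (intro SUP_subset_mono) auto
  have step: "v' t + ennreal \<bar>h r - h t\<bar> \<le> v' r" if "t < r" for t r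
  proof -
    have "s n x + ennreal \<bar>h r - h t\<bar> \<le> v' r" if x: "strict_mono_on {..n} x" "x n = t" for n x
    proof -
      define x' where "x' i = (if i \<le> n then x i else r)" for i
      have "strict_mono_on {..Suc n} x'"
      proof (rule strict_mono_onI)
        fix i j assume ij: "i \<in> {..Suc n}" "j \<in> {..Suc n}" "i < j"
        show "x' i < x' j"
        proof (cases "j \<le> n")
          case True then show ?thesis using ij x(1) by (simp add: x'_def strict_mono_onD)
        next
          case False
          then have "x i \<le> x n" using ij strict_mono_onD[OF x(1), of i n] by (cases "i = n") (auto simp: less_imp_le)
          then show ?thesis using False ij x(2) \<open>t < r\<close> by (simp add: x'_def)
        qed
      qed
      then have "s (Suc n) x' \<le> v' r"
        unfolding v'_def by (intro SUP_upper2[of "(Suc n, x')"]) (auto simp: x'_def)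
      moreover have "s (Suc n) x' = s n x + ennreal \<bar>h r - h t\<bar>"
        using x(2) by (simp add: s_def x'_def)
      ultimately show ?thesis by simp
    qed
    note sx = this
    define P where "P = {(n, x :: nat \<Rightarrow> real). strict_mono_on {..n} x \<and> x n = t}"
    have "(0, \<lambda>_. t) \<in> P" by (auto simp: P_def intro!: strict_mono_onI)
    then have P: "P \<noteq> {}" by (metis empty_iff)
    have "v' t + ennreal \<bar>h r - h t\<bar> = (SUP z\<in>P. (case z of (n, x) \<Rightarrow> s n x) + ennreal \<bar>h r - h t\<bar>)"
      unfolding v'_def[of t] P_def[symmetric] by (rule ennreal_SUP_add_left[OF P, symmetric])
    also have "\<dots> \<le> v' r"
    proof (rule SUP_least)
      fix z assume "z \<in> P"
      then show "(case z of (n, x) \<Rightarrow> s n x) + ennreal \<bar>h r - h t\<bar> \<le> v' r"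
        using sx[of "fst z" "snd z"] by (simp add: P_def case_prod_beta)
    qed
    finally show ?thesis .
  qed
  define v where "v t = enn2real (v' t)" for t
  have fin: "v' t < top" for t using order_le_less_trans[OF le assms] by simp
  have ev: "ennreal (v t) = v' t" for t unfolding v_def using fin by simp
  have "\<bar>h y - h x\<bar> \<le> v y - v x" if "x \<le> y" for x y
  proof (cases "x = y")
    case False
    then have "ennreal (v x) + ennreal \<bar>h y - h x\<bar> \<le> ennreal (v y)" using step[of x y] that by (simp add: ev)
    then have "ennreal (v x + \<bar>h y - h x\<bar>) \<le> ennreal (v y)" by (simp add: v_def)
    then show ?thesis by (subst (asm) ennreal_le_iff) (auto simp: v_def)
  qed simp
  moreover have "0 \<le> v x" "v x \<le> enn2real (pointwise_variation h)" for x
    unfolding v_def using le[of x] assms by (auto intro: enn2real_mono)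
  ultimately show ?thesis unfolding variation_bound_def by blast
qed

text \<open>The line is cut into cells of width \<open>\<mu>\<close>. Below its infimum on a cell, \<open>h\<close> is paid for by the
  elastic energy of a rectangle; the remainder is at most \<open>\<mu>\<close> times the variation.\<close>

lemma small_mass:
  assumes h: "\<And>x. 0 \<le> h x" "integrable lborel h" and v: "variation_bound h v B" and EB: "elastic_bound T h E"
    and pos: "0 < T" "0 < \<mu>" "0 < \<epsilon>"
  shows "(LINT x|lborel. min (h x) \<epsilon>) \<le> (1 / T + \<epsilon> / \<mu>) * E * (pi ^ 3 / 8) + \<mu> * B"
proof -
  have v0: "0 \<le> v x" "v x \<le> B" and vh: "x \<le> y \<Longrightarrow> \<bar>h y - h x\<bar> \<le> v y - v x" for x y
    using v unfolding variation_bound_def by auto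
  have hm: "h \<in> borel_measurable borel" using borel_measurable_integrable[OF h(2)] by simp
  have im: "integrable lborel (\<lambda>x. min (h x) \<epsilon>)"
    by (rule Bochner_Integration.integrable_bound[OF h(2)]) (use hm h(1) pos in auto)
  define m where "m a = Inf (h ` {a<..<a + \<mu>})" for a
  have bb: "bdd_below (h ` {a<..<a + \<mu>})" for a using h(1) by (intro bdd_belowI[of _ 0]) auto
  have ne: "h ` {a<..<a + \<mu>} \<noteq> {}" for a using pos by auto
  have m0: "0 \<le> m a" for a unfolding m_def using h(1) by (intro cInf_greatest ne) auto
  have ml: "m a \<le> h x" if "x \<in> {a<..<a + \<mu>}" for a x unfolding m_def using that by (intro cInf_lower bb) auto
  have mu: "h x \<le> m a + (v (a + \<mu>) - v a)" if x: "x \<in> {a<..<a + \<mu>}" for a x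
  proof -
    have "h x - (v (a + \<mu>) - v a) \<le> m a"
      unfolding m_def
    proof (intro cInf_greatest ne)
      fix z assume "z \<in> h ` {a<..<a + \<mu>}"
      then obtain t where t: "t \<in> {a<..<a + \<mu>}" "z = h t" by blast
      have "v a \<le> v x" "v x \<le> v (a + \<mu>)" "v a \<le> v t" "v t \<le> v (a + \<mu>)" 
        using vh[of a x] vh[of x "a + \<mu>"] vh[of a t] vh[of t "a + \<mu>"] x t by auto
      then show "h x - (v (a + \<mu>) - v a) \<le> z"
        using vh[of x t] vh[of t x] t by (cases "x \<le> t") auto
    qed
    then show ?thesis by linarith
  qed
  \<comment> \<open>With aspect ratio \<open>t\<close>, the inequality min(m,\<epsilon>) (1 + t) <=
    m + \<epsilon> t matches the factor t/(1+t) of \<open>Gam_ge\<close>. Its two terms become the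
    two summands \<open>1 / T\<close> and \<open>\<epsilon> / \<mu>\<close>.\<close>
  have cell: "\<mu> * min (m a) \<epsilon> \<le> (1 / T + \<epsilon> / \<mu>) * (pi ^ 3 / 8) * (\<mu>\<^sup>2 * Gam (T * m a / \<mu>))" for a
  proof -
    define t where "t = T * m a / \<mu>"
    have t: "0 \<le> t" "m a = \<mu> * t / T" using m0[of a] pos by (auto simp: t_def)
    have "\<mu> * min (m a) \<epsilon> * (1 + t) \<le> (1 / T + \<epsilon> / \<mu>) * \<mu>\<^sup>2 * t"
    proof -
      have "min (m a) \<epsilon> * (1 + t) \<le> m a + \<epsilon> * t" 
      proof -
        have "min (m a) \<epsilon> * 1 \<le> m a" "min (m a) \<epsilon> * t \<le> \<epsilon> * t" using t by (auto intro: mult_right_mono)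
        then show ?thesis by (simp add: distrib_left)
      qed
      then have "\<mu> * (min (m a) \<epsilon> * (1 + t)) \<le> \<mu> * (m a + \<epsilon> * t)" using pos by (intro mult_left_mono) auto
      also have "\<dots> = (1 / T + \<epsilon> / \<mu>) * \<mu>\<^sup>2 * t" using pos by (simp add: t(2) power2_eq_square field_simps)
      finally show ?thesis by (simp add: mult.assoc)
    qed
    then have "\<mu> * min (m a) \<epsilon> \<le> (1 / T + \<epsilon> / \<mu>) * \<mu>\<^sup>2 * t / (1 + t)" using t by (simp add: le_divide_eq)
    also have "\<dots> = (1 / T + \<epsilon> / \<mu>) * (pi ^ 3 / 8) * (\<mu>\<^sup>2 * (8 / pi ^ 3 * (t / (1 + t))))" by simp
    also have "\<dots> \<le> (1 / T + \<epsilon> / \<mu>) * (pi ^ 3 / 8) * (\<mu>\<^sup>2 * Gam t)"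
      using pos Gam_ge[OF t(1)] by (intro mult_left_mono) auto
    finally show ?thesis by (simp add: t_def)
  qed
  have fin: "(LINT x|lborel. indicator {- (real K * \<mu>)<..<real K * \<mu>} x * min (h x) \<epsilon>) \<le> (1 / T + \<epsilon> / \<mu>) * E * (pi ^ 3 / 8) + \<mu> * B" for K :: nat
  proof -
    \<comment> \<open>The \<open>2 * K\<close> cells tile the interval from
      \<open>- K * \<mu>\<close> to \<open>K * \<mu>\<close> up to their end points, which form a
      finite set.\<close>
    define a where "a k = (real k - real K) * \<mu>" for k :: nat
    have aS: "a (Suc k) = a k + \<mu>" for k by (simp add: a_def algebra_simps)
    have amono: "a k \<le> a j \<longleftrightarrow> k \<le> j" "a k < a j \<longleftrightarrow> k < j" for k j using pos by (auto simp: a_def)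
    define w where "w k = min (m (a k)) \<epsilon> + (v (a k + \<mu>) - v (a k))" for k
    have w0: "0 \<le> w k" for k using m0[of "a k"] pos vh[of "a k" "a k + \<mu>"] by (simp add: w_def)
    have "(LINT x|lborel. indicator {- (real K * \<mu>)<..<real K * \<mu>} x * min (h x) \<epsilon>) \<le> (LINT x|lborel. (\<Sum>k<2*K. w k * indicator {a k<..<a k + \<mu>} x))"
    proof (rule integral_mono_AE)
      show "integrable lborel (\<lambda>x. indicator {- (real K * \<mu>)<..<real K * \<mu>} x * min (h x) \<epsilon>)"
        using integrable_mult_indicator[OF _ im, of "{- (real K * \<mu>)<..<real K * \<mu>}"] by simp
      show "integrable lborel (\<lambda>x. \<Sum>k<2*K. w k * indicator {a k<..<a k + \<mu>} x)"
        using pos by (intro Bochner_Integration.integrable_sum integrable_mult_right) simp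
      have "AE x in lborel. \<forall>k\<in>{..<2*K}. x \<noteq> a k"
        by (intro AE_finite_allI) (auto intro: AE_lborel_singleton)
      then show "AE x in lborel. indicator {- (real K * \<mu>)<..<real K * \<mu>} x * min (h x) \<epsilon> \<le> (\<Sum>k<2*K. w k * indicator {a k<..<a k + \<mu>} x)"
      proof eventually_elim
        case (elim x)
        show ?case
        proof (cases "x \<in> {- (real K * \<mu>)<..<real K * \<mu>}")
          case False then show ?thesis using w0 by (simp add: sum_nonneg)
        next
          case True
          define k where "k = nat \<lfloor>x / \<mu> + real K\<rfloor>"
          have xp: "0 < x / \<mu> + real K" "x / \<mu> + real K < 2 * real K" using True pos by (auto simp: field_simps)
          have k: "real k \<le> x / \<mu> + real K" "x / \<mu> + real K < real k + 1" using xp unfolding k_def by linarith+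
          then have kK: "k < 2 * K" using xp by linarith
          have "a k \<le> x" "x < a k + \<mu>" using k pos by (auto simp: a_def field_simps)
          then have xin: "x \<in> {a k<..<a k + \<mu>}" using elim kK by force
          have "0 \<le> v (a k + \<mu>) - v (a k)" using vh[of "a k" "a k + \<mu>"] pos by simp
          then have "min (h x) \<epsilon> \<le> w k" using mu[OF xin] unfolding w_def min_def by simp
          also have "\<dots> = w k * indicator {a k<..<a k + \<mu>} x" using xin by simp
          also have "\<dots> \<le> (\<Sum>k<2*K. w k * indicator {a k<..<a k + \<mu>} x)"
            using kK w0 by (intro member_le_sum) auto
          finally show ?thesis using True by simp
        qed
      qed
    qed
    also have "\<dots> = (\<Sum>k<2*K. w k * \<mu>)"
      using pos by (subst Bochner_Integration.integral_sum) auto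
    also have "\<dots> = (\<Sum>k<2*K. \<mu> * min (m (a k)) \<epsilon>) + \<mu> * (\<Sum>k<2*K. v (a (Suc k)) - v (a k))"
      unfolding sum_distrib_left sum.distrib[symmetric] by (simp add: w_def aS algebra_simps)
    also have "(\<Sum>k<2*K. v (a (Suc k)) - v (a k)) = v (a (2*K)) - v (a 0)" by (rule sum_lessThan_telescope)
    also have "(\<Sum>k<2*K. \<mu> * min (m (a k)) \<epsilon>) \<le> (1 / T + \<epsilon> / \<mu>) * E * (pi ^ 3 / 8)"
    proof -
      define S where "S = a ` {k\<in>{..<2*K}. 0 < m (a k)}"
      have inj: "inj_on a {k\<in>{..<2*K}. 0 < m (a k)}" using pos by (auto simp: inj_on_def a_def)
      have "(\<Sum>k<2*K. \<mu> * min (m (a k)) \<epsilon>) = (\<Sum>k\<in>{k\<in>{..<2*K}. 0 < m (a k)}. \<mu> * min (m (a k)) \<epsilon>)"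
        using m0 pos by (intro sum.mono_neutral_right) (auto simp: not_less min_def intro: antisym)
      also have "\<dots> \<le> (\<Sum>k\<in>{k\<in>{..<2*K}. 0 < m (a k)}. (1 / T + \<epsilon> / \<mu>) * (pi ^ 3 / 8) * (\<mu>\<^sup>2 * Gam (T * m (a k) / \<mu>)))"
        by (intro sum_mono cell)
      also have "\<dots> = (1 / T + \<epsilon> / \<mu>) * (pi ^ 3 / 8) * (\<Sum>s\<in>S. (s + \<mu> - s)\<^sup>2 * Gam (T * m s / (s + \<mu> - s)))"
        unfolding S_def sum.reindex[OF inj] sum_distrib_left by simp
      also have "\<dots> \<le> (1 / T + \<epsilon> / \<mu>) * (pi ^ 3 / 8) * E"
      proof (rule mult_left_mono)
        have d: "disjoint_family_on (\<lambda>s. {s<..<s + \<mu>}) S"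
          unfolding disjoint_family_on_def
        proof (intro ballI impI)
          fix s t assume "s \<in> S" "t \<in> S" "s \<noteq> t"
          then obtain k j where kj: "s = a k" "t = a j" "k \<noteq> j" by (auto simp: S_def)
          then have "Suc k \<le> j \<or> Suc j \<le> k" by linarith
          then have "a k + \<mu> \<le> a j \<or> a j + \<mu> \<le> a k" using amono(1) aS by metis
          then show "{s<..<s + \<mu>} \<inter> {t<..<t + \<mu>} = {}" using kj by auto
        qed
        show "(\<Sum>s\<in>S. (s + \<mu> - s)\<^sup>2 * Gam (T * m s / (s + \<mu> - s))) \<le> E"
        proof (rule elastic_boundD[OF EB _ _ d])
          show "finite S" by (simp add: S_def)
          show "\<forall>s\<in>S. s < s + \<mu> \<and> 0 < m s \<and> (\<forall>x\<in>{s<..<s + \<mu>}. m s \<le> h x)"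
          proof (intro ballI conjI)
            fix s assume "s \<in> S"
            then show "0 < m s" by (auto simp: S_def)
            show "s < s + \<mu>" using pos by simp
            fix x assume "x \<in> {s<..<s + \<mu>}" then show "m s \<le> h x" by (rule ml)
          qed
        qed
      qed (use pos in auto)
      finally show ?thesis by (simp add: mult_ac)
    qed
    also have "v (a (2*K)) - v (a 0) \<le> B" using v0(1)[of "a 0"] v0(2)[of "a (2*K)"] by linarith
    finally show ?thesis using pos by (simp add: mult_left_mono)
  qed
  have "(\<lambda>K. LINT x|lborel. indicator {- (real K * \<mu>)<..<real K * \<mu>} x * min (h x) \<epsilon>) \<longlonglongrightarrow> (LINT x|lborel. min (h x) \<epsilon>)"
  proof (rule integral_dominated_convergence[OF _ _ im])
    show "(\<lambda>x. min (h x) \<epsilon>) \<in> borel_measurable lborel" "(\<lambda>x. indicator {- (real K * \<mu>)<..<real K * \<mu>} x * min (h x) \<epsilon>) \<in> borel_measurable lborel" for K using hm by auto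
    show "AE x in lborel. norm (indicator {- (real K * \<mu>)<..<real K * \<mu>} x * min (h x) \<epsilon>) \<le> min (h x) \<epsilon>" for K
      using h(1) pos by (intro AE_I2) (auto simp: indicator_def)
    show "AE x in lborel. (\<lambda>K. indicator {- (real K * \<mu>)<..<real K * \<mu>} x * min (h x) \<epsilon>) \<longlonglongrightarrow> min (h x) \<epsilon>"
    proof (rule AE_I2)
      fix x
      obtain K0 where K0: "\<bar>x\<bar> / \<mu> < real K0" using reals_Archimedean2 by blast
      have "x \<in> {- (real K * \<mu>)<..<real K * \<mu>}" if "K \<ge> K0" for K
      proof -
        have "\<bar>x\<bar> / \<mu> < real K" using K0 that by linarith
        then show ?thesis using pos by (auto simp: field_simps abs_less_iff)
      qed
      then show "(\<lambda>K. indicator {- (real K * \<mu>)<..<real K * \<mu>} x * min (h x) \<epsilon>) \<longlonglongrightarrow> min (h x) \<epsilon>"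
        by (intro tendsto_eventually eventually_sequentiallyI[of K0]) simp
    qed
  qed
  then show ?thesis by (rule LIMSEQ_le_const2) (use fin in auto)
qed

section \<open>Profiles of nearly minimal energy\<close>

text \<open>Induction on the interval furthest to the right: the increments over the others are
  already bounded by \<open>v\<close> at its left end.\<close>

lemma sum_increments_le:
  fixes v :: "real \<Rightarrow> real"
  assumes "finite S" "\<And>x. 0 \<le> v x" "\<And>x y. x \<le> y \<Longrightarrow> v x \<le> v y"
    "\<forall>a\<in>S. \<forall>a'\<in>S. a < a' \<longrightarrow> b a \<le> a'" "\<forall>a\<in>S. a < b a \<and> b a \<le> M"
  shows "(\<Sum>a\<in>S. v (b a) - v a) \<le> v M"
  using assms(1,4,5)
proof (induction S arbitrary: M rule: finite_linorder_max_induct)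
  case empty
  then show ?case using assms(2) by simp
next
  case (insert a0 S)
  have "(\<Sum>a\<in>S. v (b a) - v a) \<le> v a0" using insert by (intro insert.IH) auto
  moreover have "v (b a0) \<le> v M" using insert.prems by (intro assms(3)) auto
  moreover have "a0 \<notin> S" using insert.hyps by auto
  ultimately show ?case using insert.hyps by simp
qed

text \<open>An interval on which \<open>h\<close> exceeds \<epsilon> has length at most the mass
  divided by \<epsilon>. This makes the components of the superlevel set bounded on both
  sides.\<close>

lemma superlevel_escape:
  fixes h :: "real \<Rightarrow> real"
  assumes h: "\<And>x. 0 \<le> h x" "integrable lborel h" and e: "0 < \<epsilon>"
  shows "\<exists>z<x. h z \<le> \<epsilon>" "\<exists>z>x. h z \<le> \<epsilon>"
proof -
  have len: "\<epsilon> * l \<le> (LINT x|lborel. h x)" if "0 < l" "\<forall>z\<in>{a<..<a + l}. \<epsilon> < h z" for a l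
  proof -
    have "\<epsilon> * l = (LINT x|lborel. \<epsilon> * indicator {a<..<a + l} x)" using that by simp
    also have "\<dots> \<le> (LINT x|lborel. h x)"
    proof (rule integral_mono[OF _ h(2)])
      show "integrable lborel (\<lambda>x. \<epsilon> * indicator {a<..<a + l} x)" using that by (intro integrable_mult_right) simp
      show "\<epsilon> * indicator {a<..<a + l} x \<le> h x" for x
        using that(2) h(1) by (cases "x \<in> {a<..<a + l}") (auto simp: less_imp_le)
    qed
    finally show ?thesis .
  qed
  define l where "l = (LINT x|lborel. h x) / \<epsilon> + 1"
  have l: "0 < l" "\<epsilon> * l > (LINT x|lborel. h x)"
  proof -
    have "0 \<le> (LINT x|lborel. h x)" using h(1) by (intro Bochner_Integration.integral_nonneg)
    then show "0 < l" unfolding l_def using e by (intro add_nonneg_pos divide_nonneg_pos) auto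
    show "\<epsilon> * l > (LINT x|lborel. h x)" using e by (simp add: l_def distrib_left)
  qed
  show "\<exists>z<x. h z \<le> \<epsilon>"
  proof (rule ccontr)
    assume "\<not> (\<exists>z<x. h z \<le> \<epsilon>)"
    then have "\<forall>z\<in>{x - l<..<x - l + l}. \<epsilon> < h z" by auto
    from len[OF l(1) this] l(2) show False by simp
  qed
  show "\<exists>z>x. h z \<le> \<epsilon>"
  proof (rule ccontr)
    assume "\<not> (\<exists>z>x. h z \<le> \<epsilon>)"
    then have "\<forall>z\<in>{x<..<x + l}. \<epsilon> < h z" by auto
    from len[OF l(1) this] l(2) show False by simp
  qed
qed

text \<open>Of the components of the set where \<open>h\<close> exceeds \<epsilon>, only those that
  reach above \<open>2 * \<epsilon>\<close> are kept, recorded by their left ends. The gap between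
  the two levels gives each of them a fixed minimal variation and thereby makes them finite in
  number. End points are outside the open superlevel set, hence \<open>h\<close> is at most
  \<epsilon> there.\<close>

lemma superlevel_components:
  assumes h: "lsc h" "\<And>x. 0 \<le> h x" "integrable lborel h" and v: "variation_bound h v B" and e: "0 < \<epsilon>"
  obtains S :: "real set" and b :: "real \<Rightarrow> real" where
    "finite S" "\<forall>a\<in>S. a < b a \<and> h a \<le> \<epsilon> \<and> h (b a) \<le> \<epsilon> \<and> (\<forall>x\<in>{a<..<b a}. \<epsilon> < h x)"
    "\<forall>a\<in>S. \<forall>a'\<in>S. a < a' \<longrightarrow> b a \<le> a'" "\<forall>x. 2 * \<epsilon> < h x \<longrightarrow> (\<exists>a\<in>S. x \<in> {a<..<b a})"
    "\<forall>a\<in>S. \<exists>x\<in>{a<..<b a}. 2 * \<epsilon> < h x"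
proof -
  define A where "A = {x. \<epsilon> < h x}"
  have v0: "0 \<le> v x" "v x \<le> B" and vh: "x \<le> y \<Longrightarrow> \<bar>h y - h x\<bar> \<le> v y - v x" for x y
    using v unfolding variation_bound_def by auto
  have vm: "v x \<le> v y" if "x \<le> y" for x y using vh[OF that] by linarith
  have "open A" using h(1) by (simp add: A_def lsc_def)
  then have cl: "closed (- A)" by (simp add: closed_Compl)
  define b where "b a = Inf ({a..} \<inter> {x. a < x \<and> x \<notin> A})" for a
  define S where "S = {a. a \<notin> A \<and> (\<exists>x>a. {a<..x} \<subseteq> A \<and> 2 * \<epsilon> < h x)}"
  have bp: "x < b a \<and> b a \<notin> A \<and> {a<..<b a} \<subseteq> A" if ax: "a < x" "{a<..x} \<subseteq> A" for a x
  proof -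
    let ?Z = "{x..} \<inter> - A"
    have ne: "?Z \<noteq> {}"
    proof -
      obtain z where "z > x" "h z \<le> \<epsilon>" using superlevel_escape(2)[OF h(2,3) e] by blast
      then have "z \<in> ?Z" by (auto simp: A_def)
      then show ?thesis by (metis empty_iff)
    qed
    have eq: "{a..} \<inter> {x. a < x \<and> x \<notin> A} = ?Z"
    proof
      show "{a..} \<inter> {x. a < x \<and> x \<notin> A} \<subseteq> ?Z"
      proof
        fix z assume z: "z \<in> {a..} \<inter> {x. a < x \<and> x \<notin> A}"
        then have "z \<notin> {a<..x}" using ax by blast
        then show "z \<in> ?Z" using z by auto
      qed
    qed (use ax in auto)
    have bdd: "bdd_below ?Z" by (rule bdd_belowI[of _ x]) auto
    have "Inf ?Z \<in> ?Z" using cl by (intro closed_contains_Inf ne bdd closed_Int) auto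
    then have bZ: "b a \<in> ?Z" by (simp add: b_def eq)
    have "x \<noteq> b a" using bZ ax by auto
    then have 1: "x < b a" using bZ by auto
    have "{a<..<b a} \<subseteq> A"
    proof
      fix z assume z: "z \<in> {a<..<b a}"
      show "z \<in> A"
      proof (rule ccontr)
        assume "z \<notin> A"
        then have "z \<in> {a..} \<inter> {x. a < x \<and> x \<notin> A}" using z by auto
        then have "b a \<le> z" unfolding b_def by (intro cInf_lower) (auto simp: eq bdd)
        then show False using z by auto
      qed
    qed
    with 1 bZ show ?thesis by auto
  qed
  have Sp: "a < b a \<and> h a \<le> \<epsilon> \<and> h (b a) \<le> \<epsilon> \<and> (\<forall>x\<in>{a<..<b a}. \<epsilon> < h x) \<and> (\<exists>x\<in>{a<..<b a}. 2 * \<epsilon> < h x)" if "a \<in> S" for a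
  proof -
    obtain x where x: "a \<notin> A" "a < x" "{a<..x} \<subseteq> A" "2 * \<epsilon> < h x" using \<open>a \<in> S\<close> unfolding S_def by blast
    have "x < b a" "b a \<notin> A" "{a<..<b a} \<subseteq> A" using bp[OF x(2,3)] by auto
    moreover have "x \<in> {a<..<b a}" using x(2) \<open>x < b a\<close> by simp
    ultimately show ?thesis using x by (auto simp: A_def not_less)
  qed
  have ord: "b a \<le> a'" if "a \<in> S" "a' \<in> S" "a < a'" for a a'
  proof (rule ccontr)
    assume "\<not> b a \<le> a'"
    then have "a' \<in> {a<..<b a}" using that by auto
    then have "\<epsilon> < h a'" using Sp[OF that(1)] by blast
    moreover have "h a' \<le> \<epsilon>" using Sp[OF that(2)] by blast
    ultimately show False by linarith
  qed
  have cover: "\<exists>a\<in>S. x \<in> {a<..<b a}" if x: "2 * \<epsilon> < h x" for x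
  proof -
    have xA: "x \<in> A" using x e by (simp add: A_def)
    let ?Z = "{..x} \<inter> - A"
    obtain z where "z < x" "h z \<le> \<epsilon>" using superlevel_escape(1)[OF h(2,3) e] by blast
    then have "z \<in> ?Z" by (auto simp: A_def)
    then have ne: "?Z \<noteq> {}" by (metis empty_iff)
    define a where "a = Sup ?Z"
    have bdd: "bdd_above ?Z" by (rule bdd_aboveI[of _ x]) auto
    have "Sup ?Z \<in> ?Z" using cl by (intro closed_contains_Sup ne bdd closed_Int) auto
    then have aZ: "a \<in> ?Z" by (simp add: a_def)
    then have ax: "a < x" using xA by (cases "a = x") auto
    have sub: "{a<..x} \<subseteq> A"
    proof
      fix t assume t: "t \<in> {a<..x}"
      show "t \<in> A"
      proof (rule ccontr)
        assume "t \<notin> A"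
        then have "t \<in> ?Z" using t by auto
        then have "t \<le> a" unfolding a_def by (intro cSup_upper bdd)
        then show False using t by auto
      qed
    qed
    then have "a \<in> S" using aZ ax x by (auto simp: S_def)
    then show ?thesis using bp[OF ax sub] ax by (intro bexI[of _ a]) auto
  qed
  \<comment> \<open>On each component the profile climbs from at most \<epsilon> to above
    \<open>2 * \<epsilon>\<close> and comes back, which uses up variation
    \<open>2 * \<epsilon>\<close>.\<close>
  have "finite S \<and> card S \<le> nat \<lfloor>B / (2 * \<epsilon>)\<rfloor>"
  proof (rule finite_if_finite_subsets_card_bdd)
    fix F assume F: "F \<subseteq> S" "finite F"
    define M where "M = Max (insert 0 (b ` F))"
    have "(\<Sum>a\<in>F. v (b a) - v a) \<le> v M"
    proof (intro sum_increments_le v0 vm)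
      show "finite F" by (rule F(2))
      show "\<forall>a\<in>F. \<forall>a'\<in>F. a < a' \<longrightarrow> b a \<le> a'" using F(1) ord by blast
      have "b a \<le> M" if "a \<in> F" for a unfolding M_def using F(2) that by (intro Max_ge) auto
      then show "\<forall>a\<in>F. a < b a \<and> b a \<le> M" using F(1) Sp by blast
    qed
    moreover have "2 * \<epsilon> \<le> v (b a) - v a" if "a \<in> F" for a
    proof -
      have "a \<in> S" using that F by auto
      then obtain x where x: "x \<in> {a<..<b a}" "2 * \<epsilon> < h x" "h a \<le> \<epsilon>" "h (b a) \<le> \<epsilon>" using Sp by blast
      then show ?thesis using vh[of a x] vh[of x "b a"] by auto
    qed
    then have "(\<Sum>a\<in>F. 2 * \<epsilon>) \<le> (\<Sum>a\<in>F. v (b a) - v a)" by (intro sum_mono)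
    ultimately have "real (card F) * (2 * \<epsilon>) \<le> B" using v0(2)[of M] by simp
    then have "real (card F) \<le> B / (2 * \<epsilon>)" using e by (simp add: field_simps)
    then show "card F \<le> nat \<lfloor>B / (2 * \<epsilon>)\<rfloor>" by (simp add: le_nat_floor)
  qed
  then show ?thesis using that[of S b] Sp ord cover by blast
qed

text \<open>Here \<open>p\<close> is the length of the longest component, \<open>s\<close> the
  l2-norm of all lengths, \<open>Q\<close> the total height above \<epsilon>, and \<mu> the mass
  that survives truncation at \<open>2 * \<epsilon>\<close>. The last estimate measures how far the
  profile is from a single component: each of the others is no longer than sqrt(s^2 - p^2).\<close>

lemma structure_of_profile:
  assumes h: "lsc h" "\<And>x. 0 \<le> h x" "integrable lborel h" "(LINT x|lborel. h x) = 1" and v: "variation_bound h v B"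
    and EB: "elastic_bound T h E" and e: "0 < \<epsilon>" and T: "0 < T"
    and \<mu>: "\<mu> = 1 - (LINT x|lborel. min (h x) (2 * \<epsilon>))" "0 < \<mu>"
  shows "\<exists>a p s Q. 0 < p \<and> p \<le> s \<and> Gam (T * \<epsilon>\<^sup>2) * s\<^sup>2 \<le> E \<and> 2 * Q \<le> B \<and> 0 < Q \<and> \<mu> \<le> p * Q \<and>
    (\<forall>x\<in>{a<..<a+p}. h x \<le> Q + \<epsilon>) \<and> \<mu> - sqrt (s\<^sup>2 - p\<^sup>2) * Q \<le> (LINT x|lborel. indicator {a<..<a+p} x * h x)"
proof -
  obtain S b where S: "finite S" "\<forall>a\<in>S. a < b a \<and> h a \<le> \<epsilon> \<and> h (b a) \<le> \<epsilon> \<and> (\<forall>x\<in>{a<..<b a}. \<epsilon> < h x)"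
    "\<forall>a\<in>S. \<forall>a'\<in>S. a < a' \<longrightarrow> b a \<le> a'" "\<forall>x. 2 * \<epsilon> < h x \<longrightarrow> (\<exists>a\<in>S. x \<in> {a<..<b a})"
    "\<forall>a\<in>S. \<exists>x\<in>{a<..<b a}. 2 * \<epsilon> < h x"
    by (rule superlevel_components[OF h(1-3) v e]) (rule that)
  have v0: "0 \<le> v x" "v x \<le> B" and vh: "x \<le> y \<Longrightarrow> \<bar>h y - h x\<bar> \<le> v y - v x" for x y
    using v unfolding variation_bound_def by auto
  have vm: "v x \<le> v y" if "x \<le> y" for x y using vh[OF that] by linarith
  have hm: "h \<in> borel_measurable borel" using borel_measurable_integrable[OF h(3)] by simp
  define len where "len a = b a - a" for a
  define M where "M a = Sup (h ` {a<..<b a})" for a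
  define q where "q a = M a - \<epsilon>" for a
  have lp: "0 < len a" if "a \<in> S" for a using S(2) that by (simp add: len_def)
  have bdd: "bdd_above (h ` {a<..<b a})" for a
  proof (rule bdd_aboveI2)
    fix x assume "x \<in> {a<..<b a}"
    then show "h x \<le> h a + B" using vh[of a x] v0(1)[of a] v0(2)[of x] by auto
  qed
  have hM: "h x \<le> M a" if "x \<in> {a<..<b a}" for a x unfolding M_def using that by (intro cSup_upper bdd) auto
  have q0: "0 < q a" if "a \<in> S" for a
  proof -
    obtain x where "x \<in> {a<..<b a}" "2 * \<epsilon> < h x" using S(5) \<open>a \<in> S\<close> by blast
    then show ?thesis using hM[of x a] e by (simp add: q_def)
  qed
  \<comment> \<open>The profile rises from at most \<epsilon> at one end to its supremum and
    descends again, so the height above \<epsilon> is paid twice.\<close>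
  have qv: "2 * q a \<le> v (b a) - v a" if a: "a \<in> S" for a
  proof -
    have "M a \<le> \<epsilon> + (v (b a) - v a) / 2"
      unfolding M_def
    proof (rule cSup_least)
      show "h ` {a<..<b a} \<noteq> {}" using S(2) a by auto
      fix y assume "y \<in> h ` {a<..<b a}"
      then obtain x where x: "x \<in> {a<..<b a}" "y = h x" by blast
      have "h a \<le> \<epsilon>" "h (b a) \<le> \<epsilon>" using S(2) a by auto
      then show "y \<le> \<epsilon> + (v (b a) - v a) / 2" using vh[of a x] vh[of x "b a"] x by (auto simp: field_simps)
    qed
    then show ?thesis by (simp add: q_def field_simps)
  qed
  define Q where "Q = (\<Sum>a\<in>S. q a)"
  define s where "s = sqrt (\<Sum>a\<in>S. (len a)\<^sup>2)"
  have s2: "s\<^sup>2 = (\<Sum>a\<in>S. (len a)\<^sup>2)" unfolding s_def by (intro real_sqrt_pow2 sum_nonneg) simp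
  have QB: "2 * Q \<le> B"
  proof -
    have "2 * Q \<le> (\<Sum>a\<in>S. v (b a) - v a)" unfolding Q_def sum_distrib_left by (intro sum_mono qv)
    also have "\<dots> \<le> v (Max (insert 0 (b ` S)))"
      using S(1-3) by (intro sum_increments_le v0 vm) auto
    finally show ?thesis using v0(2) order_trans by blast
  qed
  have ii: "integrable lborel (indicator {a<..<b a} :: real \<Rightarrow> real)" if "a \<in> S" for a
    using lp[OF that] by (simp add: len_def)
  have len_le: "len a \<le> 1 / \<epsilon>" if a: "a \<in> S" for a
  proof -
    have "\<epsilon> * len a = (LINT x|lborel. \<epsilon> * indicator {a<..<b a} x)" using lp[OF a] by (simp add: len_def)
    also have "\<dots> \<le> (LINT x|lborel. h x)"
      using lp[OF a] S(2) a h(2) by (intro integral_mono integrable_mult_right ii[OF a] h(3)) (auto simp: indicator_def less_imp_le len_def)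
    finally show ?thesis using h(4) e by (simp add: field_simps)
  qed
  have disj: "disjoint_family_on (\<lambda>a. {a<..<b a}) S"
    unfolding disjoint_family_on_def
  proof (intro ballI impI)
    fix a a' assume aa: "a \<in> S" "a' \<in> S" "a \<noteq> a'"
    then have "b a \<le> a' \<or> b a' \<le> a" using S(3) by (meson linorder_neqE_linordered_idom)
    then show "{a<..<b a} \<inter> {a'<..<b a'} = {}" by auto
  qed
  have GE: "Gam (T * \<epsilon>\<^sup>2) * s\<^sup>2 \<le> E"
  proof -
    have "Gam (T * \<epsilon>\<^sup>2) * s\<^sup>2 \<le> (\<Sum>a\<in>S. (b a - a)\<^sup>2 * Gam (T * \<epsilon> / (b a - a)))"
      unfolding s2 sum_distrib_left
    proof (rule sum_mono)
      fix a assume a: "a \<in> S"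
      have "\<epsilon> * len a \<le> 1" using len_le[OF a] e by (simp add: field_simps)
      then have "T * \<epsilon> * (\<epsilon> * len a) \<le> T * \<epsilon> * 1" using T e by (intro mult_left_mono) auto
      then have "T * \<epsilon>\<^sup>2 \<le> T * \<epsilon> / len a" using lp[OF a] by (simp add: le_divide_eq power2_eq_square mult_ac)
      then have "Gam (T * \<epsilon>\<^sup>2) \<le> Gam (T * \<epsilon> / len a)" using T e by (intro Gam_mono) auto
      then have "Gam (T * \<epsilon>\<^sup>2) * (len a)\<^sup>2 \<le> Gam (T * \<epsilon> / len a) * (len a)\<^sup>2" by (intro mult_right_mono) auto
      then show "Gam (T * \<epsilon>\<^sup>2) * (len a)\<^sup>2 \<le> (b a - a)\<^sup>2 * Gam (T * \<epsilon> / (b a - a))"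
        by (simp only: len_def mult.commute)
    qed
    also have "\<dots> \<le> E"
    proof (rule elastic_boundD[OF EB S(1) _ disj])
      show "\<forall>a\<in>S. a < b a \<and> 0 < \<epsilon> \<and> (\<forall>x\<in>{a<..<b a}. \<epsilon> \<le> h x)" using S(2) e by (auto simp: less_imp_le)
    qed
    finally show ?thesis .
  qed
  define f where "f a x = indicator {a<..<b a} x * (h x - \<epsilon>)" for a x
  have ind_h: "integrable lborel (\<lambda>x. indicator {c<..<d} x * h x)" for c d :: real
    using integrable_mult_indicator[OF _ h(3), of "{c<..<d}"] by simp
  have fi: "integrable lborel (f a)" if "a \<in> S" for a
  proof -
    have "integrable lborel (\<lambda>x. indicator {a<..<b a} x * h x - \<epsilon> * indicator {a<..<b a} x)"
      using lp[OF that] by (intro Bochner_Integration.integrable_diff ind_h integrable_mult_right) (simp add: len_def)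
    then show ?thesis unfolding f_def[abs_def] by (simp add: algebra_simps)
  qed
  have f0: "0 \<le> f a x" if "a \<in> S" for a x using S(2) that by (auto simp: f_def indicator_def less_imp_le)
  define m where "m a = (LINT x|lborel. f a x)" for a
  have mq: "m a \<le> len a * q a" if a: "a \<in> S" for a
  proof -
    have "m a \<le> (LINT x|lborel. q a * indicator {a<..<b a} x)"
      unfolding m_def using lp[OF a] hM by (intro integral_mono fi a integrable_mult_right ii) (auto simp: f_def q_def indicator_def len_def)
    also have "\<dots> = len a * q a" using lp[OF a] by (simp add: len_def)
    finally show ?thesis .
  qed
  have \<mu>m: "\<mu> \<le> (\<Sum>a\<in>S. m a)"
  proof -
    have im: "integrable lborel (\<lambda>x. min (h x) (2 * \<epsilon>))"
      by (rule Bochner_Integration.integrable_bound[OF h(3)]) (use hm h(2) e in auto)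
    have "\<mu> = (LINT x|lborel. h x - min (h x) (2 * \<epsilon>))" using h(3,4) im \<mu>(1) by simp
    also have "\<dots> \<le> (LINT x|lborel. (\<Sum>a\<in>S. f a x))"
    proof (intro integral_mono Bochner_Integration.integrable_diff h(3) im Bochner_Integration.integrable_sum fi)
      fix x
      show "h x - min (h x) (2 * \<epsilon>) \<le> (\<Sum>a\<in>S. f a x)"
      proof (cases "2 * \<epsilon> < h x")
        case True
        then obtain a where a: "a \<in> S" "x \<in> {a<..<b a}" using S(4) by blast
        have "h x - min (h x) (2 * \<epsilon>) \<le> f a x" using True a e by (simp add: f_def)
        also have "\<dots> \<le> (\<Sum>a\<in>S. f a x)" using a S(1) f0 by (intro member_le_sum) auto
        finally show ?thesis .
      next
        case False
        then show ?thesis using f0 by (simp add: sum_nonneg)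
      qed
    qed
    also have "\<dots> = (\<Sum>a\<in>S. m a)" unfolding m_def by (intro Bochner_Integration.integral_sum fi)
    finally show ?thesis .
  qed
  have Sne: "S \<noteq> {}" using \<mu>m \<mu>(2) by auto
  define p where "p = Max (len ` S)"
  have "p \<in> len ` S" unfolding p_def using S(1) Sne by (intro Max_in) auto
  then obtain a0 where a0: "a0 \<in> S" "p = len a0" by blast
  have pmax: "len a \<le> p" if "a \<in> S" for a unfolding p_def using S(1) that by (intro Max_ge) auto
  have p0: "0 < p" using a0 lp by simp
  have split: "(\<Sum>a\<in>S. (len a)\<^sup>2) = p\<^sup>2 + (\<Sum>a\<in>S - {a0}. (len a)\<^sup>2)"
    using S(1) a0 by (simp add: sum.remove[of S a0])
  have ps: "p \<le> s"
  proof (rule power2_le_imp_le)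
    show "p\<^sup>2 \<le> s\<^sup>2" unfolding s2 split by (simp add: sum_nonneg)
    show "0 \<le> s" unfolding s_def by (intro real_sqrt_ge_zero sum_nonneg) simp
  qed
  have Q0: "0 < Q" unfolding Q_def using S(1) Sne q0 by (intro sum_pos) auto
  have pQ: "\<mu> \<le> p * Q"
  proof -
    have "\<mu> \<le> (\<Sum>a\<in>S. len a * q a)" by (rule order_trans[OF \<mu>m]) (intro sum_mono mq)
    also have "\<dots> \<le> (\<Sum>a\<in>S. p * q a)" using pmax q0 by (intro sum_mono mult_right_mono) (auto simp: less_imp_le)
    finally show ?thesis by (simp add: Q_def sum_distrib_left)
  qed
  have I: "\<mu> - sqrt (s\<^sup>2 - p\<^sup>2) * Q \<le> (LINT x|lborel. indicator {a0<..<b a0} x * h x)"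
  proof -
    \<comment> \<open>The square of one remaining length is at most the sum of the squares of all
      remaining lengths, which is s^2 - p^2.\<close>
    have "(\<Sum>a\<in>S - {a0}. m a) \<le> (\<Sum>a\<in>S - {a0}. sqrt (s\<^sup>2 - p\<^sup>2) * q a)"
    proof (rule sum_mono)
      fix a assume a: "a \<in> S - {a0}"
      have "(len a)\<^sup>2 \<le> (\<Sum>a\<in>S - {a0}. (len a)\<^sup>2)" using S(1) a by (intro member_le_sum) auto
      then have "(len a)\<^sup>2 \<le> s\<^sup>2 - p\<^sup>2" unfolding s2 split by simp
      then have "len a \<le> sqrt (s\<^sup>2 - p\<^sup>2)" by (rule real_le_rsqrt)
      then have "len a * q a \<le> sqrt (s\<^sup>2 - p\<^sup>2) * q a" using q0 a by (intro mult_right_mono) (auto simp: less_imp_le)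
      then show "m a \<le> sqrt (s\<^sup>2 - p\<^sup>2) * q a" using mq[of a] a by simp
    qed
    also have "\<dots> = sqrt (s\<^sup>2 - p\<^sup>2) * (\<Sum>a\<in>S - {a0}. q a)" by (simp add: sum_distrib_left)
    also have "\<dots> \<le> sqrt (s\<^sup>2 - p\<^sup>2) * Q"
    proof (rule mult_left_mono)
      show "(\<Sum>a\<in>S - {a0}. q a) \<le> Q" unfolding Q_def using S(1) q0 by (intro sum_mono2) (auto simp: less_imp_le)
      show "0 \<le> sqrt (s\<^sup>2 - p\<^sup>2)" using ps p0 by (simp add: power_mono)
    qed
    finally have "\<mu> - sqrt (s\<^sup>2 - p\<^sup>2) * Q \<le> m a0"
      using \<mu>m S(1) a0(1) by (simp add: sum.remove[of S a0])
    also have "m a0 \<le> (LINT x|lborel. indicator {a0<..<b a0} x * h x)"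
      unfolding m_def using e by (intro integral_mono fi a0 ind_h) (auto simp: f_def indicator_def)
    finally show ?thesis .
  qed
  have "q a0 \<le> Q" unfolding Q_def using S(1) a0 q0 by (intro member_le_sum) (auto simp: less_imp_le)
  then have hQ: "\<forall>x\<in>{a0<..<b a0}. h x \<le> Q + \<epsilon>" using hM[of _ a0] by (force simp: q_def)
  have "b a0 = a0 + p" using a0 by (simp add: len_def)
  then show ?thesis using p0 ps GE QB Q0 pQ hQ I by (intro exI[of _ a0] exI[of _ p] exI[of _ s] exI[of _ Q]) simp
qed

section \<open>The optimal rectangle and its stability\<close>

definition L0 :: real where "L0 = (1 / c0) powr (1 / 3)"
definition H0 :: real where "H0 = 1 / L0"

lemma L0_pos: "0 < L0" "0 < H0" using c0_pos by (auto simp: L0_def H0_def)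

text \<open>The minimal value 3 \<open>H0\<close> splits into the elastic share c0 L0^2 =
  \<open>H0\<close> and the variation 2 \<open>H0\<close> of the two vertical sides.\<close>

lemma c0_L0: "c0 = 1 / L0 ^ 3" "c0 * L0\<^sup>2 = H0" "L0 * H0 = 1"
proof -
  have "L0 ^ 3 = 1 / c0"
    using c0_pos by (simp add: L0_def powr_realpow[symmetric] powr_powr)
  then have "c0 * L0 ^ 3 = 1" using c0_pos by simp
  then show 1: "c0 = 1 / L0 ^ 3" using L0_pos(1) by (simp add: eq_divide_eq)
  show "c0 * L0\<^sup>2 = H0" "L0 * H0 = 1" using L0_pos(1) by (simp_all add: 1 H0_def field_simps power2_eq_square power3_eq_cube)
qed

text \<open>After multiplication by L0^3 the excess energy is the cubic s^3 - 3 L0^2 s + 2 L0^3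
  divided by s, which factors as (s - L0)^2 (s + 2 L0) / s.\<close>

lemma rectangle_energy_stable:
  assumes "0 < s"
  shows "(s - L0)\<^sup>2 \<le> L0 ^ 3 * (c0 * s\<^sup>2 + 2 / s - 3 * H0)"
proof -
  have L: "0 < L0" by (rule L0_pos)
  have "L0 ^ 3 * (c0 * s\<^sup>2 + 2 / s - 3 * H0) = (s - L0)\<^sup>2 * (s + 2 * L0) / s"
    unfolding c0_L0(1) H0_def using L assms by (simp add: field_simps power2_eq_square power3_eq_cube)
  also have "\<dots> = (s - L0)\<^sup>2 + (s - L0)\<^sup>2 * (2 * L0) / s" using assms by (simp add: field_simps)
  finally show ?thesis using L assms by simp
qed

text \<open>Four errors are added: the mass outside the chosen interval, the area between profile
  and ceiling \<open>M\<close> inside it, the error in height, and the error in width.\<close>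

lemma translated_distance_le:
  fixes h :: "real \<Rightarrow> real"
  assumes h: "\<And>x. 0 \<le> h x" "integrable lborel h" "(LINT x|lborel. h x) = 1" and p: "0 < p" and L: "0 < L" and H: "0 \<le> H"
    and M: "\<forall>x\<in>{a<..<a+p}. h x \<le> M"
  defines "J \<equiv> LINT x|lborel. indicator {a<..<a+p} x * h x"
  shows "(LINT x|lborel. \<bar>h (x + a) - H * indicator {0<..<L} x\<bar>) \<le> (1 - J) + (M * p - J) + \<bar>M - H\<bar> * p + H * \<bar>p - L\<bar>"
proof -
  have i1: "integrable lborel (indicator {a<..<a+p} :: real \<Rightarrow> real)" "(LINT x|lborel. indicator {a<..<a+p} x) = p" using p by simp_all
  have i2: "integrable lborel (indicator {a<..<a+L} :: real \<Rightarrow> real)" using L by simp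
  have ih: "integrable lborel (\<lambda>x. indicator {a<..<a+p} x * h x)"
    using integrable_mult_indicator[OF _ h(2), of "{a<..<a+p}"] by simp
  define D where "D = {a + min p L..a + max p L}"
  have i3: "integrable lborel (indicator D :: real \<Rightarrow> real)" "(LINT x|lborel. indicator D x) = \<bar>p - L\<bar>"
    unfolding D_def using p L by (auto simp: min_def max_def)
  let ?I = "indicator {a<..<a+p} :: real \<Rightarrow> real"
  have "(LINT x|lborel. \<bar>h (x + a) - H * indicator {0<..<L} x\<bar>) = (LINT x|lborel. \<bar>h x - H * indicator {a<..<a+L} x\<bar>)"
    using lborel_integral_real_affine[of 1 "\<lambda>x. \<bar>h x - H * indicator {a<..<a+L} x\<bar>" a] by (simp add: indicator_def add.commute)
  also have "\<dots> \<le> (LINT x|lborel. (h x - ?I x * h x) + (M * ?I x - ?I x * h x) + \<bar>M - H\<bar> * ?I x + H * indicator D x)"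
  proof (intro integral_mono Bochner_Integration.integrable_add Bochner_Integration.integrable_diff integrable_mult_right integrable_abs h(2) i1 i2 i3 ih)
    fix x
    have "\<bar>?I x - indicator {a<..<a+L} x\<bar> \<le> indicator D x"
      by (auto simp: D_def indicator_def min_def max_def)
    then have 1: "H * \<bar>?I x - indicator {a<..<a+L} x\<bar> \<le> H * indicator D x" using H by (intro mult_left_mono)
    have "h x - H * indicator {a<..<a+L} x = (h x - ?I x * h x) - (M * ?I x - ?I x * h x) + (M - H) * ?I x + H * (?I x - indicator {a<..<a+L} x)"
      by (simp add: algebra_simps)
    then have "\<bar>h x - H * indicator {a<..<a+L} x\<bar> \<le> \<bar>h x - ?I x * h x\<bar> + \<bar>M * ?I x - ?I x * h x\<bar> + \<bar>(M - H) * ?I x\<bar> + \<bar>H * (?I x - indicator {a<..<a+L} x)\<bar>"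
      by linarith
    also have "\<bar>h x - ?I x * h x\<bar> = h x - ?I x * h x" using h(1)[of x] by (simp add: indicator_def)
    also have "\<bar>M * ?I x - ?I x * h x\<bar> = M * ?I x - ?I x * h x" using M by (simp add: indicator_def)
    also have "\<bar>(M - H) * ?I x\<bar> = \<bar>M - H\<bar> * ?I x" by (simp add: abs_mult)
    also have "\<bar>H * (?I x - indicator {a<..<a+L} x)\<bar> = H * \<bar>?I x - indicator {a<..<a+L} x\<bar>" using H by (simp add: abs_mult)
    finally show "\<bar>h x - H * indicator {a<..<a+L} x\<bar> \<le> (h x - ?I x * h x) + (M * ?I x - ?I x * h x) + \<bar>M - H\<bar> * ?I x + H * indicator D x"
      using 1 by linarith
  qed
  also have "\<dots> = (1 - J) + (M * p - J) + \<bar>M - H\<bar> * p + H * \<bar>p - L\<bar>"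
  proof -
    have b: "has_bochner_integral lborel h 1" "has_bochner_integral lborel ?I p" "has_bochner_integral lborel (\<lambda>x. ?I x * h x) J"
      "has_bochner_integral lborel (indicator D :: real \<Rightarrow> real) \<bar>p - L\<bar>"
      using h(2,3) i1 i3 ih by (simp_all add: has_bochner_integral_iff J_def)
    show ?thesis
      by (intro has_bochner_integral_integral_eq has_bochner_integral_add has_bochner_integral_diff has_bochner_integral_mult_right b)
  qed
  finally show ?thesis .
qed

text \<open>The quantitative form of the minimization, stated without reference to displacements.
  For films it gives convergence and the bound on the variation; the third claim yields the lower
  bound for the limit functional.\<close>

theorem near_minimal_profiles:
  fixes h :: "nat \<Rightarrow> real \<Rightarrow> real" and v :: "nat \<Rightarrow> real \<Rightarrow> real" and T B E :: "nat \<Rightarrow> real"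
  assumes h: "\<And>n. lsc (h n)" "\<And>n x. 0 \<le> h n x" "\<And>n. integrable lborel (h n)" "\<And>n. (LINT x|lborel. h n x) = 1"
    and v: "\<And>n. variation_bound (h n) (v n) (B n)" and EB: "\<And>n. elastic_bound (T n) (h n) (E n)"
    and T: "\<And>n. 0 < T n" "filterlim T at_top sequentially"
    and en: "\<And>\<delta>. 0 < \<delta> \<Longrightarrow> eventually (\<lambda>n. E n + B n \<le> 3 * H0 + \<delta>) sequentially"
  shows "\<exists>a. (\<lambda>n. LINT x|lborel. \<bar>h n (x + a n) - H0 * indicator {0<..<L0} x\<bar>) \<longlonglongrightarrow> 0"
    "\<And>\<delta>. 0 < \<delta> \<Longrightarrow> eventually (\<lambda>n. B n \<le> 2 * H0 + \<delta>) sequentially"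
    "\<And>\<delta>. 0 < \<delta> \<Longrightarrow> eventually (\<lambda>n. 3 * H0 - \<delta> \<le> E n + B n) sequentially"
proof -
  define e where "e n = max (E n + B n) (3 * H0)" for n
  have e_lim: "e \<longlonglongrightarrow> 3 * H0"
  proof (rule order_tendstoI)
    fix y assume "y < 3 * H0" then show "eventually (\<lambda>n. y < e n) sequentially" by (auto simp: e_def less_max_iff_disj)
  next
    fix y assume y: "3 * H0 < y"
    then have "eventually (\<lambda>n. E n + B n \<le> 3 * H0 + (y - 3 * H0) / 2) sequentially" by (intro en) simp
    then show "eventually (\<lambda>n. e n < y) sequentially" by eventually_elim (use y in \<open>auto simp: e_def field_simps\<close>)
  qed
  have E0: "0 \<le> E n" for n using elastic_boundD[OF EB, of "{}"] by (simp add: disjoint_family_on_def)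
  have B0: "0 \<le> B n" for n using v[of n] unfolding variation_bound_def by (meson order_trans)
  have le: "E n + B n \<le> e n" "E n \<le> e n" "B n \<le> e n" for n using E0[of n] B0[of n] by (auto simp: e_def)
  have e0: "0 < e n" for n using L0_pos by (simp add: e_def less_max_iff_disj)
  \<comment> \<open>The level \<epsilon> = 1/\<tau> tends to 0 while T \<epsilon>^2 = \<tau>
    diverges, as the aspect ratios demand.\<close>
  define \<tau> where "\<tau> n = T n powr (1 / 3)" for n
  have \<tau>0: "0 < \<tau> n" for n using T(1)[of n] by (simp add: \<tau>_def)
  have T\<tau>: "T n = \<tau> n ^ 3" for n using T(1)[of n] by (simp add: \<tau>_def powr_realpow[symmetric] powr_powr)
  have \<tau>_lim: "filterlim \<tau> at_top sequentially"
    unfolding filterlim_at_top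
  proof
    fix Z
    have "eventually (\<lambda>n. (max Z 1) ^ 3 \<le> T n) sequentially" using T(2) by (simp add: filterlim_at_top)
    then show "eventually (\<lambda>n. Z \<le> \<tau> n) sequentially"
    proof eventually_elim
      case (elim n)
      have "max Z 1 \<le> \<tau> n"
        by (rule power_le_imp_le_base[of _ 2]) (use elim \<tau>0[of n] in \<open>auto simp: T\<tau> eval_nat_numeral\<close>)
      then show ?case by simp
    qed
  qed
  define \<epsilon> where "\<epsilon> n = 1 / \<tau> n" for n
  have \<epsilon>0: "0 < \<epsilon> n" for n using \<tau>0 by (simp add: \<epsilon>_def)
  have T\<epsilon>: "T n * (\<epsilon> n)\<^sup>2 = \<tau> n" for n using \<tau>0[of n] by (simp add: T\<tau> \<epsilon>_def power2_eq_square power3_eq_cube)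
  have \<epsilon>_lim: "\<epsilon> \<longlonglongrightarrow> 0" unfolding \<epsilon>_def[abs_def] using tendsto_divide_0[OF tendsto_const filterlim_at_top_imp_at_infinity[OF \<tau>_lim]] .
  have sq_lim: "(\<lambda>n. sqrt (\<epsilon> n)) \<longlonglongrightarrow> 0" using tendsto_real_sqrt[OF \<epsilon>_lim] by simp
  have T_lim: "(\<lambda>n. 1 / T n) \<longlonglongrightarrow> 0" using tendsto_divide_0[OF tendsto_const filterlim_at_top_imp_at_infinity[OF T(2)]] .
  define \<mu> where "\<mu> n = 1 - (LINT x|lborel. min (h n x) (2 * \<epsilon> n))" for n
  have \<mu>1: "\<mu> n \<le> 1" for n
    unfolding \<mu>_def using h(2) \<epsilon>0[of n] by (simp add: Bochner_Integration.integral_nonneg less_imp_le)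
  \<comment> \<open>This is the bound of \<open>small_mass\<close> at height
    \<open>2 * \<epsilon> n\<close> with cells of width sqrt \<epsilon>: the width tends to zero,
    and so does the ratio of height to width.\<close>
  define r where "r n = (1 / T n + 2 * sqrt (\<epsilon> n)) * e n * (pi ^ 3 / 8) + sqrt (\<epsilon> n) * e n" for n
  have r_lim: "(\<lambda>n. 1 - r n) \<longlonglongrightarrow> 1 - ((0 + 2 * 0) * (3 * H0) * (pi ^ 3 / 8) + 0 * (3 * H0))"
    unfolding r_def by (intro tendsto_intros T_lim sq_lim e_lim)
  have \<mu>r: "1 - r n \<le> \<mu> n" for n
  proof -
    have "2 * \<epsilon> n / sqrt (\<epsilon> n) = 2 * sqrt (\<epsilon> n)"
      using real_div_sqrt[of "\<epsilon> n"] \<epsilon>0[of n] unfolding times_divide_eq_right[symmetric] by simp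
    then have "(LINT x|lborel. min (h n x) (2 * \<epsilon> n)) \<le> (1 / T n + 2 * sqrt (\<epsilon> n)) * E n * (pi ^ 3 / 8) + sqrt (\<epsilon> n) * B n"
      using small_mass[OF h(2,3) v EB T(1)[of n], of "sqrt (\<epsilon> n)" "2 * \<epsilon> n"] \<epsilon>0[of n] by simp
    also have "\<dots> \<le> r n"
      unfolding r_def using le[of n] \<epsilon>0[of n] T(1)[of n] by (intro add_mono mult_right_mono mult_left_mono) auto
    finally show ?thesis by (simp add: \<mu>_def)
  qed
  have \<mu>_lim: "\<mu> \<longlonglongrightarrow> 1"
    by (rule tendsto_sandwich[OF _ _ _ tendsto_const[of 1]]) (use \<mu>r \<mu>1 r_lim in auto)
  define c where "c n = Gam (\<tau> n)" for n
  have c_lim: "c \<longlonglongrightarrow> c0" unfolding c_def[abs_def] by (rule Gam_tendsto[OF \<tau>_lim])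
  have cc: "c n \<le> c0" for n using \<tau>0[of n] by (simp add: c_def Gam_le_c0)
  define good where "good n \<longleftrightarrow> 1/2 < \<mu> n \<and> c0 / 2 < c n" for n
  have good: "eventually good sequentially"
    unfolding good_def using c0_pos
    by (intro eventually_conj order_tendstoD(1)[OF \<mu>_lim] order_tendstoD(1)[OF c_lim]) auto
  have "\<forall>n. \<exists>w. good n \<longrightarrow> (case w of (a, p, s, Q) \<Rightarrow> 0 < p \<and> p \<le> s \<and> c n * s\<^sup>2 \<le> E n \<and> 2 * Q \<le> B n \<and> 0 < Q \<and> \<mu> n \<le> p * Q \<and>
    (\<forall>x\<in>{a<..<a+p}. h n x \<le> Q + \<epsilon> n) \<and> \<mu> n - sqrt (s\<^sup>2 - p\<^sup>2) * Q \<le> (LINT x|lborel. indicator {a<..<a+p} x * h n x))"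
  proof
    fix n
    show "\<exists>w. good n \<longrightarrow> (case w of (a, p, s, Q) \<Rightarrow> 0 < p \<and> p \<le> s \<and> c n * s\<^sup>2 \<le> E n \<and> 2 * Q \<le> B n \<and> 0 < Q \<and> \<mu> n \<le> p * Q \<and>
    (\<forall>x\<in>{a<..<a+p}. h n x \<le> Q + \<epsilon> n) \<and> \<mu> n - sqrt (s\<^sup>2 - p\<^sup>2) * Q \<le> (LINT x|lborel. indicator {a<..<a+p} x * h n x))"
    proof (cases "good n")
      case True
      then have "0 < \<mu> n" by (simp add: good_def)
      from structure_of_profile[OF h(1-4) v EB \<epsilon>0 T(1) \<mu>_def this] show ?thesis
        unfolding T\<epsilon> c_def[symmetric] by auto
    qed simp
  qed
  from choice[OF this] obtain w where w: "\<forall>n. good n \<longrightarrow> (case w n of (a, p, s, Q) \<Rightarrow> 0 < p \<and> p \<le> s \<and> c n * s\<^sup>2 \<le> E n \<and> 2 * Q \<le> B n \<and> 0 < Q \<and> \<mu> n \<le> p * Q \<and>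
    (\<forall>x\<in>{a<..<a+p}. h n x \<le> Q + \<epsilon> n) \<and> \<mu> n - sqrt (s\<^sup>2 - p\<^sup>2) * Q \<le> (LINT x|lborel. indicator {a<..<a+p} x * h n x))" ..
  define a where "a n = fst (w n)" for n
  define p where "p n = fst (snd (w n))" for n
  define s where "s n = fst (snd (snd (w n)))" for n
  define Q where "Q n = snd (snd (snd (w n)))" for n
  have W: "0 < p n" "p n \<le> s n" "c n * (s n)\<^sup>2 \<le> E n" "2 * Q n \<le> B n" "0 < Q n" "\<mu> n \<le> p n * Q n"
    "\<forall>x\<in>{a n<..<a n+p n}. h n x \<le> Q n + \<epsilon> n" "\<mu> n - sqrt ((s n)\<^sup>2 - (p n)\<^sup>2) * Q n \<le> (LINT x|lborel. indicator {a n<..<a n+p n} x * h n x)"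
    if "good n" for n
    using w that by (auto simp: a_def p_def s_def Q_def case_prod_beta)
  have s0: "0 < s n" if "good n" for n using W(1,2)[OF that] by linarith
  have \<mu>s: "\<mu> n / s n \<le> Q n" if "good n" for n
  proof -
    have "\<mu> n \<le> s n * Q n" using W(6)[OF that] mult_right_mono[OF W(2)[OF that], of "Q n"] W(5)[OF that] by linarith
    then show ?thesis using s0[OF that] by (simp add: divide_le_eq mult.commute)
  qed
  \<comment> \<open>\<open>rectangle_energy_stable\<close> wants the constants \<open>c0\<close> and
    1 in place of \<open>c n\<close> and \<open>\<mu> n\<close>. The last two terms pay for the
    exchange, by means of the crude bounds s^2 <= 2 e / c0 and 1 / s <= e.\<close>
  define R where "R n = L0 ^ 3 * ((e n - 3 * H0) + (c0 - c n) * (2 * e n / c0) + 2 * (1 - \<mu> n) * e n)" for n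
  have R_lim: "R \<longlonglongrightarrow> L0 ^ 3 * ((3 * H0 - 3 * H0) + (c0 - c0) * (2 * (3 * H0) / c0) + 2 * (1 - 1) * (3 * H0))"
    unfolding R_def[abs_def] using c0_pos by (intro tendsto_intros e_lim c_lim \<mu>_lim) auto
  have sR: "(s n - L0)\<^sup>2 \<le> R n" if g: "good n" for n
  proof -
    have g': "1/2 < \<mu> n" "c0 / 2 < c n" using g by (auto simp: good_def)
    have q: "0 < s n" by (rule s0[OF g])
    have en': "c n * (s n)\<^sup>2 + 2 * (\<mu> n / s n) \<le> e n" using W(3,4)[OF g] \<mu>s[OF g] le(1)[of n] by linarith
    have "c0 / 2 * (s n)\<^sup>2 \<le> c n * (s n)\<^sup>2" using g' by (intro mult_right_mono) auto
    also have "\<dots> \<le> e n" using W(3)[OF g] le(2)[of n] by linarith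
    finally have s2: "(s n)\<^sup>2 \<le> 2 * e n / c0" using c0_pos by (simp add: field_simps)
    have "1/2 / s n \<le> \<mu> n / s n" using g' q by (intro divide_right_mono) auto
    also have "\<dots> \<le> e n / 2" using \<mu>s[OF g] W(4)[OF g] le(3)[of n] by linarith
    finally have s1: "1 / s n \<le> e n" by simp
    have "c0 * (s n)\<^sup>2 + 2 / s n = (c n * (s n)\<^sup>2 + 2 * (\<mu> n / s n)) + (c0 - c n) * (s n)\<^sup>2 + 2 * (1 - \<mu> n) * (1 / s n)"
      by (simp add: algebra_simps diff_divide_distrib)
    also have "\<dots> \<le> e n + (c0 - c n) * (2 * e n / c0) + 2 * (1 - \<mu> n) * e n"
      using en' cc[of n] \<mu>1[of n] s1 s2 by (intro add_mono mult_left_mono) auto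
    finally have "L0 ^ 3 * (c0 * (s n)\<^sup>2 + 2 / s n - 3 * H0) \<le> R n"
      unfolding R_def using L0_pos by (intro mult_left_mono) auto
    then show ?thesis using rectangle_energy_stable[OF q] by linarith
  qed
  have s_lim: "s \<longlonglongrightarrow> L0"
  proof -
    have "(\<lambda>n. (s n - L0)\<^sup>2) \<longlonglongrightarrow> 0"
      by (rule tendsto_sandwich[OF _ _ tendsto_const]) (use R_lim good sR in \<open>auto elim!: eventually_mono\<close>)
    then have "(\<lambda>n. sqrt ((s n - L0)\<^sup>2)) \<longlonglongrightarrow> sqrt 0" by (rule tendsto_real_sqrt)
    then have "(\<lambda>n. s n - L0) \<longlonglongrightarrow> 0" by (simp add: tendsto_rabs_zero_iff)
    then show ?thesis by (simp add: LIM_zero_iff)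
  qed
  \<comment> \<open>The elastic part takes at least its limiting share \<open>H0\<close>, so at most
    2 \<open>H0\<close> is left for the variation. This is the second claim and also bounds
    \<open>Q\<close> from above.\<close>
  have B_lim: "(\<lambda>n. e n - c n * (s n)\<^sup>2) \<longlonglongrightarrow> 2 * H0"
  proof -
    have "(\<lambda>n. e n - c n * (s n)\<^sup>2) \<longlonglongrightarrow> 3 * H0 - c0 * L0\<^sup>2" by (intro tendsto_intros e_lim c_lim s_lim)
    then show ?thesis by (simp add: c0_L0(2))
  qed
  have BB: "B n \<le> e n - c n * (s n)\<^sup>2" if "good n" for n using W(3)[OF that] le(1)[of n] by linarith
  show "eventually (\<lambda>n. B n \<le> 2 * H0 + \<delta>) sequentially" if "0 < \<delta>" for \<delta>
  proof -
    have "eventually (\<lambda>n. e n - c n * (s n)\<^sup>2 < 2 * H0 + \<delta>) sequentially"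
      by (rule order_tendstoD(2)[OF B_lim]) (use that in simp)
    with good show ?thesis by eventually_elim (use BB in force)
  qed
  have Qlo: "(\<lambda>n. \<mu> n / s n) \<longlonglongrightarrow> H0"
    unfolding H0_def using L0_pos by (intro tendsto_intros \<mu>_lim s_lim) auto
  have Q_lim: "Q \<longlonglongrightarrow> H0"
  proof (rule tendsto_sandwich[OF _ _ Qlo])
    show "eventually (\<lambda>n. \<mu> n / s n \<le> Q n) sequentially" using good by eventually_elim (rule \<mu>s)
    show "eventually (\<lambda>n. Q n \<le> (e n - c n * (s n)\<^sup>2) / 2) sequentially"
      using good by eventually_elim (use BB W(4) in force)
    show "(\<lambda>n. (e n - c n * (s n)\<^sup>2) / 2) \<longlonglongrightarrow> H0" using tendsto_divide[OF B_lim tendsto_const[of 2]] by simp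
  qed
  \<comment> \<open>The longest component is squeezed between \<open>\<mu> n / Q n\<close> and the
    l2-norm \<open>s n\<close>, both tending to \<open>L0\<close>; the other components become
    negligible.\<close>
  have p_lim: "p \<longlonglongrightarrow> L0"
  proof (rule tendsto_sandwich[OF _ _ _ s_lim])
    show "eventually (\<lambda>n. \<mu> n / Q n \<le> p n) sequentially"
      using good by eventually_elim (use W(5,6) in \<open>auto simp: divide_le_eq\<close>)
    show "eventually (\<lambda>n. p n \<le> s n) sequentially" using good by eventually_elim (rule W(2))
    have "(\<lambda>n. \<mu> n / Q n) \<longlonglongrightarrow> 1 / H0" using L0_pos by (intro tendsto_intros \<mu>_lim Q_lim) auto
    then show "(\<lambda>n. \<mu> n / Q n) \<longlonglongrightarrow> L0" by (simp add: H0_def)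
  qed
  define J where "J n = (LINT x|lborel. indicator {a n<..<a n+p n} x * h n x)" for n
  have J_lim: "J \<longlonglongrightarrow> 1"
  proof (rule tendsto_sandwich)
    show "eventually (\<lambda>n. \<mu> n - sqrt ((s n)\<^sup>2 - (p n)\<^sup>2) * Q n \<le> J n) sequentially"
      unfolding J_def using good by eventually_elim (rule W(8))
    have "J n \<le> 1" for n
    proof -
      have "J n \<le> (LINT x|lborel. h n x)" unfolding J_def
        using integrable_mult_indicator[OF _ h(3)[of n], of "{a n<..<a n+p n}"] h(2)
        by (intro integral_mono h(3)) (auto simp: indicator_def)
      then show ?thesis by (simp add: h(4))
    qed
    then show "eventually (\<lambda>n. J n \<le> 1) sequentially" by simp
    have "(\<lambda>n. \<mu> n - sqrt ((s n)\<^sup>2 - (p n)\<^sup>2) * Q n) \<longlonglongrightarrow> 1 - sqrt (L0\<^sup>2 - L0\<^sup>2) * H0"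
      by (intro tendsto_intros \<mu>_lim s_lim p_lim Q_lim)
    then show "(\<lambda>n. \<mu> n - sqrt ((s n)\<^sup>2 - (p n)\<^sup>2) * Q n) \<longlonglongrightarrow> 1" by simp
  qed simp
  have "(\<lambda>n. LINT x|lborel. \<bar>h n (x + a n) - H0 * indicator {0<..<L0} x\<bar>) \<longlonglongrightarrow> 0"
  proof (rule tendsto_sandwich[OF _ _ tendsto_const])
    show "eventually (\<lambda>n. 0 \<le> (LINT x|lborel. \<bar>h n (x + a n) - H0 * indicator {0<..<L0} x\<bar>)) sequentially"
      by (intro always_eventually allI Bochner_Integration.integral_nonneg) simp
    show "eventually (\<lambda>n. (LINT x|lborel. \<bar>h n (x + a n) - H0 * indicator {0<..<L0} x\<bar>) \<le>
       (1 - J n) + ((Q n + \<epsilon> n) * p n - J n) + \<bar>Q n + \<epsilon> n - H0\<bar> * p n + H0 * \<bar>p n - L0\<bar>) sequentially"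
      using good
    proof eventually_elim
      case (elim n)
      show ?case unfolding J_def
        by (rule translated_distance_le[OF h(2-4) W(1)[OF elim] L0_pos(1) less_imp_le[OF L0_pos(2)] W(7)[OF elim]])
    qed
    have "(\<lambda>n. (1 - J n) + ((Q n + \<epsilon> n) * p n - J n) + \<bar>Q n + \<epsilon> n - H0\<bar> * p n + H0 * \<bar>p n - L0\<bar>) \<longlonglongrightarrow>
       (1 - 1) + ((H0 + 0) * L0 - 1) + \<bar>H0 + 0 - H0\<bar> * L0 + H0 * \<bar>L0 - L0\<bar>"
      by (intro tendsto_intros J_lim Q_lim \<epsilon>_lim p_lim)
    then show "(\<lambda>n. (1 - J n) + ((Q n + \<epsilon> n) * p n - J n) + \<bar>Q n + \<epsilon> n - H0\<bar> * p n + H0 * \<bar>p n - L0\<bar>) \<longlonglongrightarrow> 0"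
      using c0_L0(3) by (simp add: mult.commute)
  qed
  then show "\<exists>a. (\<lambda>n. LINT x|lborel. \<bar>h n (x + a n) - H0 * indicator {0<..<L0} x\<bar>) \<longlonglongrightarrow> 0" by blast
  have lo: "(\<lambda>n. c n * (s n)\<^sup>2 + 2 * Q n) \<longlonglongrightarrow> c0 * L0\<^sup>2 + 2 * H0" by (intro tendsto_intros c_lim s_lim Q_lim)
  show "eventually (\<lambda>n. 3 * H0 - \<delta> \<le> E n + B n) sequentially" if "0 < \<delta>" for \<delta>
  proof -
    have "eventually (\<lambda>n. 3 * H0 - \<delta> < c n * (s n)\<^sup>2 + 2 * Q n) sequentially"
      by (rule order_tendstoD(1)[OF lo]) (use that c0_L0(2) in simp)
    with good show ?thesis by eventually_elim (use W(3,4) in force)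
  qed
qed

section \<open>Hausdorff convergence\<close>

definition rect_profile :: "real \<Rightarrow> real \<Rightarrow> real \<Rightarrow> real" where
  "rect_profile l H x = H * indicator {0<..<l} x"

lemma L1_lower_bound:
  fixes d :: "real \<Rightarrow> real"
  assumes "integrable lborel d" "0 < l" "0 \<le> t" "\<forall>x\<in>{c<..<c+l}. t \<le> \<bar>d x\<bar>"
  shows "t * l \<le> (LINT x|lborel. \<bar>d x\<bar>)"
proof -
  have "t * l = (LINT x|lborel. t * indicator {c<..<c+l} x)" using assms(2) by simp
  also have "\<dots> \<le> (LINT x|lborel. \<bar>d x\<bar>)"
  proof (intro integral_mono integrable_abs assms(1) integrable_mult_right)
    show "integrable lborel (indicator {c<..<c+l} :: real \<Rightarrow> real)" using assms(2) by simp
    show "t * indicator {c<..<c+l} x \<le> \<bar>d x\<bar>" for x using assms(4) by (cases "x \<in> {c<..<c+l}") auto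
  qed
  finally show ?thesis .
qed

lemma dist_pair_less:
  fixes x y :: real
  assumes "\<bar>x' - x\<bar> < r / 2" "\<bar>y' - y\<bar> \<le> r / 2" "0 < r"
  shows "dist (x, y) (x', y') < r"
proof -
  have "dist (x, y) (x', y') \<le> \<bar>x - x'\<bar> + \<bar>y - y'\<bar>"
    using sqrt_sum_squares_le_sum_abs[of "x - x'" "y - y'"] by (simp add: dist_prod_def dist_real_def)
  also have "\<dots> < r" using assms by linarith
  finally show ?thesis .
qed

lemma infdist_compl_film_domain:
  assumes "r \<le> infdist (x, y) (- film_domain f)" "dist (x, y) (x', y') < r"
  shows "0 < y' \<and> y' < f x'"
proof (rule ccontr)
  assume "\<not> (0 < y' \<and> y' < f x')"
  then have "(x', y') \<in> - film_domain f" by (auto simp: film_domain_def)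
  from infdist_le[OF this, of "(x, y)"] assms show False by simp
qed

text \<open>The two inclusions have different reasons. A film boundary point deep inside the
  rectangle would cost extra variation, which the bound on \<open>B\<close> forbids. Conversely a
  film that covers a whole ball around a point outside the rectangle exceeds the rectangle on a set
  of area at least r^2/4, which L1 closeness forbids.\<close>

lemma film_complements_close:
  assumes f: "\<And>x. 0 \<le> f x" "integrable lborel f" "variation_bound f v B" "B < 2 * H + r / 2"
    and L1: "(LINT x|lborel. \<bar>f x - rect_profile l H x\<bar>) < r\<^sup>2 / 4"
    and pos: "0 < l" "0 < H" "0 < r"
  shows "- film_domain f \<subseteq> nbhd (- film_domain (rect_profile l H)) r"
    "- film_domain (rect_profile l H) \<subseteq> nbhd (- film_domain f) r"
proof -
  let ?k = "rect_profile l H"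
  have ik: "integrable lborel (\<lambda>x. f x - ?k x)"
    unfolding rect_profile_def using pos by (intro Bochner_Integration.integrable_diff f(2) integrable_mult_right) simp
  have v0: "0 \<le> v x" "v x \<le> B" and vh: "x \<le> y \<Longrightarrow> \<bar>f y - f x\<bar> \<le> v y - v x" for x y
    using f(3) unfolding variation_bound_def by auto
  have ex: "\<exists>x\<in>{c<..<c+r}. \<bar>f x - ?k x\<bar> < r / 4" for c
  proof (rule ccontr)
    assume "\<not> (\<exists>x\<in>{c<..<c+r}. \<bar>f x - ?k x\<bar> < r / 4)"
    then have "r / 4 * r \<le> (LINT x|lborel. \<bar>f x - ?k x\<bar>)"
      using pos by (intro L1_lower_bound[OF ik, of r "r/4" c]) (auto simp: not_less)
    then show False using L1 by (simp add: power2_eq_square)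
  qed
  have noex: "\<not> (\<forall>x\<in>{c<..<c+r/2}. r / 2 \<le> \<bar>f x - ?k x\<bar>)" for c
  proof
    assume "\<forall>x\<in>{c<..<c+r/2}. r / 2 \<le> \<bar>f x - ?k x\<bar>"
    then have "r / 2 * (r / 2) \<le> (LINT x|lborel. \<bar>f x - ?k x\<bar>)"
      using pos by (intro L1_lower_bound[OF ik, of "r/2" "r/2" c]) auto
    then show False using L1 by (simp add: power2_eq_square)
  qed
  show "- film_domain f \<subseteq> nbhd (- film_domain ?k) r"
  proof
    fix z assume z: "z \<in> - film_domain f"
    obtain x y where xy: "z = (x, y)" by (cases z)
    show "z \<in> nbhd (- film_domain ?k) r"
    proof (rule ccontr)
      assume "z \<notin> nbhd (- film_domain ?k) r"
      then have far: "r \<le> infdist (x, y) (- film_domain ?k)" by (simp add: nbhd_def xy)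
      have "0 < y \<and> y < ?k x" using infdist_compl_film_domain[OF far, of x y] pos by simp
      then have in_k: "0 < y" "y < H" "0 < x" "x < l" by (cases "0 < x \<and> x < l"; auto simp: rect_profile_def)+
      have fy: "f x \<le> y" using z in_k by (auto simp: xy film_domain_def)
      have 1: "r \<le> x"
      proof (rule ccontr)
        assume "\<not> r \<le> x"
        then have "dist (x, y) (0, y) < r" using in_k by (simp add: dist_prod_def dist_real_def)
        from infdist_compl_film_domain[OF far this] in_k show False by (simp add: rect_profile_def)
      qed
      have 2: "r \<le> l - x"
      proof (rule ccontr)
        assume "\<not> r \<le> l - x"
        then have "dist (x, y) (l, y) < r" using in_k by (simp add: dist_prod_def dist_real_def)
        from infdist_compl_film_domain[OF far this] in_k show False by (simp add: rect_profile_def)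
      qed
      have 3: "r \<le> H - y"
      proof (rule ccontr)
        assume "\<not> r \<le> H - y"
        then have "dist (x, y) (x, H) < r" using in_k by (simp add: dist_prod_def dist_real_def)
        from infdist_compl_film_domain[OF far this] in_k show False by (simp add: rect_profile_def)
      qed
      \<comment> \<open>Good points just outside and just inside each lateral side. Going through
        them and \<open>x\<close>, the profile climbs by at least H - r/2, drops by at least 3r/4
        because \<open>f x\<close> is at most H - r, and does the mirror image on the right: in
        total at least 2H + r/2, the threshold in the hypothesis on \<open>B\<close>.\<close>
      obtain x0 where x0: "x0 \<in> {-r<..<-r+r}" "\<bar>f x0 - ?k x0\<bar> < r / 4" using ex[of "-r"] by blast
      obtain x1 where x1: "x1 \<in> {0<..<0+r}" "\<bar>f x1 - ?k x1\<bar> < r / 4" using ex[of 0] by blast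
      obtain x2 where x2: "x2 \<in> {l-r<..<l-r+r}" "\<bar>f x2 - ?k x2\<bar> < r / 4" using ex[of "l-r"] by blast
      obtain x3 where x3: "x3 \<in> {l<..<l+r}" "\<bar>f x3 - ?k x3\<bar> < r / 4" using ex[of l] by blast
      have k: "?k x0 = 0" "?k x1 = H" "?k x2 = H" "?k x3 = 0"
        using x0 x1 x2 x3 1 2 in_k pos by (auto simp: rect_profile_def)
      have "x0 \<le> x1" "x1 \<le> x" "x \<le> x2" "x2 \<le> x3" using x0 x1 x2 x3 1 2 by auto
      then have "f x1 - f x0 \<le> v x1 - v x0" "f x1 - f x \<le> v x - v x1" "f x2 - f x \<le> v x2 - v x" "f x2 - f x3 \<le> v x3 - v x2"
        using vh[of x0 x1] vh[of x1 x] vh[of x x2] vh[of x2 x3] by linarith+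
      moreover have "f x0 < r / 4" "H - r / 4 < f x1" "H - r / 4 < f x2" "f x3 < r / 4"
        using x0(2) x1(2) x2(2) x3(2) unfolding k abs_less_iff by linarith+
      ultimately have "2 * H + r / 2 \<le> B" using v0(1)[of x0] v0(2)[of x3] fy 3 by linarith
      then show False using f(4) by simp
    qed
  qed
  show "- film_domain ?k \<subseteq> nbhd (- film_domain f) r"
  proof
    fix z assume z: "z \<in> - film_domain ?k"
    obtain x y where xy: "z = (x, y)" by (cases z)
    show "z \<in> nbhd (- film_domain f) r"
    proof (rule ccontr)
      assume "z \<notin> nbhd (- film_domain f) r"
      then have far: "r \<le> infdist (x, y) (- film_domain f)" by (simp add: nbhd_def xy)
      have y: "0 < y" using infdist_compl_film_domain[OF far, of x y] pos by simp
      \<comment> \<open>The film rises more than r/2 above \<open>y\<close> over an interval of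
        length r around \<open>x\<close>. In each case below the rectangle profile stays at or below
        \<open>y\<close> on one half of this interval, which contradicts
        \<open>noex\<close>.\<close>
      have hi: "y + r / 2 < f x'" if "\<bar>x' - x\<bar> < r / 2" for x'
        using infdist_compl_film_domain[OF far dist_pair_less[OF that]] pos by simp
      have "y \<ge> ?k x" using z y by (auto simp: xy film_domain_def not_less)
      then consider "x \<le> 0" | "l \<le> x" | "H \<le> y" using y by (cases "0 < x \<and> x < l") (auto simp: rect_profile_def not_less)
      then show False
      proof cases
        case 1
        have "\<forall>x'\<in>{x - r/2<..<x - r/2 + r/2}. r / 2 \<le> \<bar>f x' - ?k x'\<bar>"
        proof
          fix x' assume "x' \<in> {x - r/2<..<x - r/2 + r/2}"
          then show "r / 2 \<le> \<bar>f x' - ?k x'\<bar>" using hi[of x'] y 1 by (auto simp: rect_profile_def)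
        qed
        then show False using noex by blast
      next
        case 2
        have "\<forall>x'\<in>{x<..<x + r/2}. r / 2 \<le> \<bar>f x' - ?k x'\<bar>"
        proof
          fix x' assume "x' \<in> {x<..<x + r/2}"
          then show "r / 2 \<le> \<bar>f x' - ?k x'\<bar>" using hi[of x'] y 2 by (auto simp: rect_profile_def)
        qed
        then show False using noex by blast
      next
        case 3
        have "\<forall>x'\<in>{x<..<x + r/2}. r / 2 \<le> \<bar>f x' - ?k x'\<bar>"
        proof
          fix x' assume x': "x' \<in> {x<..<x + r/2}"
          have "?k x' \<le> H" using pos by (simp add: rect_profile_def indicator_def)
          then show "r / 2 \<le> \<bar>f x' - ?k x'\<bar>" using hi[of x'] x' 3 by auto
        qed
        then show False using noex by blast
      qed
    qed
  qed
qed

text \<open>L1 convergence alone would allow thin deep gaps in the film, which move the complement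
  by a fixed distance; the asymptotic bound 2H on the variation rules them out.\<close>

lemma film_complements_converge:
  assumes f: "\<And>n x. 0 \<le> f n x" "\<And>n. integrable lborel (f n)" "\<And>n. variation_bound (f n) (v n) (B n)"
    and B: "\<And>\<delta>. 0 < \<delta> \<Longrightarrow> eventually (\<lambda>n. B n \<le> 2 * H + \<delta>) sequentially"
    and L1: "(\<lambda>n. LINT x|lborel. \<bar>f n x - rect_profile l H x\<bar>) \<longlonglongrightarrow> 0" and pos: "0 < l" "0 < H"
  shows "hausdorff_convergent_to (\<lambda>n. - film_domain (f n)) (- film_domain (rect_profile l H))"
  unfolding hausdorff_convergent_to_def
proof (rule order_tendstoI)
  fix y :: ennreal assume "0 < y"
  obtain r :: real where r: "0 < r" "ennreal r < y"
  proof -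
    obtain z where z: "0 < z" "z < y" using dense[OF \<open>0 < y\<close>] by blast
    then have "z < \<infinity>" by (metis infinity_ennreal_def order_less_le_trans top_greatest)
    then show ?thesis using z that[of "enn2real z"] by (simp add: enn2real_positive_iff)
  qed
  have "eventually (\<lambda>n. B n \<le> 2 * H + r / 4) sequentially" by (rule B) (use r in simp)
  moreover have "eventually (\<lambda>n. (LINT x|lborel. \<bar>f n x - rect_profile l H x\<bar>) < r\<^sup>2 / 4) sequentially"
    by (rule order_tendstoD(2)[OF L1]) (use r in simp)
  ultimately show "eventually (\<lambda>n. hausdorff_distance (- film_domain (f n)) (- film_domain (rect_profile l H)) < y) sequentially"
  proof eventually_elim
    case (elim n)
    have "hausdorff_distance (- film_domain (f n)) (- film_domain (rect_profile l H)) \<le> ennreal r"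
      unfolding hausdorff_distance_def
    proof (rule Inf_lower)
      have "B n < 2 * H + r / 2" using elim(1) r by linarith
      from film_complements_close[OF f(1-3) this elim(2) pos r(1)]
      show "ennreal r \<in> {ennreal r' |r'. 0 < r' \<and> - film_domain (f n) \<subseteq> nbhd (- film_domain (rect_profile l H)) r' \<and>
          - film_domain (rect_profile l H) \<subseteq> nbhd (- film_domain (f n)) r'}"
        using r(1) by blast
    qed
    then show ?case using r(2) by (rule order_le_less_trans)
  qed
qed simp

section \<open>Elastic energy of films and of strips\<close>

lemma open_film_domain:
  assumes "lsc h"
  shows "open (film_domain h)"
proof -
  have "film_domain h = (\<Union>c. {x. c < h x} \<times> {0<..<c})"
  proof (intro set_eqI iffI)
    fix p assume "p \<in> film_domain h"
    then obtain x y where p: "p = (x, y)" "0 < y" "y < h x" by (auto simp: film_domain_def)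
    obtain c where "y < c" "c < h x" using dense[OF p(3)] by blast
    then show "p \<in> (\<Union>c. {x. c < h x} \<times> {0<..<c})" using p by auto
  qed (auto simp: film_domain_def)
  then show ?thesis using assms by (auto simp: lsc_def intro!: open_UN open_Times)
qed

lemma open_strip_domain:
  assumes "lsc h"
  shows "open (strip_domain h)"
  unfolding strip_domain_def using assms by (auto simp: lsc_def intro!: open_Times)

text \<open>The rectangles stand on disjoint intervals of the substrate, so they are disjoint and
  their separate lower bounds add up.\<close>

lemma energy_of_rectangles:
  fixes \<alpha> \<beta> y :: "'i \<Rightarrow> real"
  assumes u: "weakly_differentiable u D" and D: "open D" and I: "finite I"
    and r: "\<forall>i\<in>I. \<alpha> i < \<beta> i \<and> 0 < y i \<and> {\<alpha> i<..<\<beta> i} \<times> {0<..<y i} \<subseteq> D"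
    and disj: "disjoint_family_on (\<lambda>i. {\<alpha> i<..<\<beta> i}) I"
    and tr: "AE x in lborel. (\<exists>i\<in>I. x \<in> {\<alpha> i<..<\<beta> i}) \<longrightarrow> has_trace_at u D (x, 0) x"
  shows "ennreal (\<Sum>i\<in>I. (\<beta> i - \<alpha> i)\<^sup>2 * gam N (y i / (\<beta> i - \<alpha> i))) \<le> dirichlet_energy u D"
proof -
  define g where "g = weak_gradient u D"
  have g: "has_weak_gradient u g D"
    using u unfolding weakly_differentiable_def g_def weak_gradient_def by (rule someI_ex)
  define R where "R i = {\<alpha> i<..<\<beta> i} \<times> {0<..<y i}" for i
  have gm: "(\<lambda>p. indicator D p *\<^sub>R g p) \<in> borel_measurable lebesgue"
    using g D locally_integrable_measurable unfolding has_weak_gradient_def by blast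
  have "ennreal (\<Sum>i\<in>I. (\<beta> i - \<alpha> i)\<^sup>2 * gam N (y i / (\<beta> i - \<alpha> i))) = (\<Sum>i\<in>I. ennreal ((\<beta> i - \<alpha> i)\<^sup>2 * gam N (y i / (\<beta> i - \<alpha> i))))"
    using r by (intro sum_ennreal[symmetric] mult_nonneg_nonneg gam_nonneg) (auto simp: less_imp_le)
  also have "\<dots> \<le> (\<Sum>i\<in>I. \<integral>\<^sup>+ p. ennreal ((norm (g p))\<^sup>2) * indicator (R i) p \<partial>lebesgue)"
  proof (rule sum_mono)
    fix i assume i: "i \<in> I"
    have "AE x in lborel. \<alpha> i < x \<and> x < \<beta> i \<longrightarrow> has_trace_at u D (x, 0) x"
      using tr by eventually_elim (use i in auto)
    then show "ennreal ((\<beta> i - \<alpha> i)\<^sup>2 * gam N (y i / (\<beta> i - \<alpha> i))) \<le> (\<integral>\<^sup>+ p. ennreal ((norm (g p))\<^sup>2) * indicator (R i) p \<partial>lebesgue)"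
      unfolding R_def using r i by (intro elastic_lower_bound[OF g D]) auto
  qed
  also have "\<dots> = (\<integral>\<^sup>+ p. (\<Sum>i\<in>I. ennreal ((norm (g p))\<^sup>2) * indicator (R i) p) \<partial>lebesgue)"
  proof (rule nn_integral_sum[symmetric])
    fix i assume i: "i \<in> I"
    have "open (R i)" unfolding R_def by (intro open_Times) auto
    then have "R i \<in> sets lebesgue" by simp
    moreover have "(\<lambda>p. ennreal ((norm (indicator D p *\<^sub>R g p))\<^sup>2)) \<in> borel_measurable lebesgue"
      using measurable_compose[OF gm borel_measurable_norm] by (intro measurable_compose[OF _ measurable_ennreal] borel_measurable_power)
    ultimately have "(\<lambda>p. ennreal ((norm (indicator D p *\<^sub>R g p))\<^sup>2) * indicator (R i) p) \<in> borel_measurable lebesgue"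
      by (intro borel_measurable_times_ennreal borel_measurable_indicator)
    moreover have "(\<lambda>p. ennreal ((norm (indicator D p *\<^sub>R g p))\<^sup>2) * indicator (R i) p) = (\<lambda>p. ennreal ((norm (g p))\<^sup>2) * indicator (R i) p)"
      using r i unfolding R_def by (intro ext) (auto simp: indicator_def)
    ultimately show "(\<lambda>p. ennreal ((norm (g p))\<^sup>2) * indicator (R i) p) \<in> borel_measurable lebesgue" by simp
  qed
  also have "\<dots> \<le> (\<integral>\<^sup>+ p\<in>D. ennreal ((norm (g p))\<^sup>2) \<partial>lebesgue)"
  proof (rule nn_integral_mono)
    fix p
    show "(\<Sum>i\<in>I. ennreal ((norm (g p))\<^sup>2) * indicator (R i) p) \<le> ennreal ((norm (g p))\<^sup>2) * indicator D p"
    proof (cases "\<exists>i\<in>I. p \<in> R i")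
      case True
      then obtain i where i: "i \<in> I" "p \<in> R i" by blast
      have "p \<notin> R j" if "j \<in> I" "j \<noteq> i" for j
        using disjoint_family_onD[OF disj that(1) i(1) that(2)] i(2) by (auto simp: R_def)
      then have "(\<Sum>j\<in>I. ennreal ((norm (g p))\<^sup>2) * indicator (R j) p) = (\<Sum>j\<in>I. if j = i then ennreal ((norm (g p))\<^sup>2) else 0)"
        using i by (intro sum.cong) auto
      also have "\<dots> = ennreal ((norm (g p))\<^sup>2)" using I i by simp
      finally have sum: "(\<Sum>j\<in>I. ennreal ((norm (g p))\<^sup>2) * indicator (R j) p) = ennreal ((norm (g p))\<^sup>2)" .
      have "p \<in> D" using i r unfolding R_def by blast
      then show ?thesis unfolding sum by simp
    next
      case False
      then have "(\<Sum>j\<in>I. ennreal ((norm (g p))\<^sup>2) * indicator (R j) p) = 0" by (intro sum.neutral) auto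
      then show ?thesis by simp
    qed
  qed
  finally show ?thesis unfolding dirichlet_energy_def g_def .
qed

lemma sum_gam_le_imp_Gam:
  assumes "\<And>N. (\<Sum>i\<in>I. c i * gam N (t i)) \<le> e" "\<forall>i\<in>I. 0 \<le> t i"
  shows "(\<Sum>i\<in>I. c i * Gam (t i)) \<le> e"
proof (rule LIMSEQ_le_const2)
  show "(\<lambda>N. \<Sum>i\<in>I. c i * gam N (t i)) \<longlonglongrightarrow> (\<Sum>i\<in>I. c i * Gam (t i))"
    using assms(2) by (intro tendsto_sum tendsto_mult tendsto_const gam_tendsto_Gam) auto
qed (use assms(1) in auto)

text \<open>Half-strips contain rectangles of every height, so the bound holds with any stretching
  factor \<open>T\<close>; \<open>G_lower_bound\<close> uses this freedom to send \<open>T\<close>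
  to infinity for one fixed profile.\<close>

lemma strip_elastic_bound:
  assumes "lsc k" "weakly_differentiable u (strip_domain k)" "substrate_condition k (strip_domain k) u"
    "dirichlet_energy u (strip_domain k) \<le> ennreal e" "0 \<le> e" "0 < T"
  shows "elastic_bound T k e"
  unfolding elastic_bound_def
proof (intro allI impI)
  fix S :: "real set" and b y :: "real \<Rightarrow> real"
  assume S: "finite S" "\<forall>a\<in>S. a < b a \<and> 0 < y a \<and> (\<forall>x\<in>{a<..<b a}. y a \<le> k x)" "disjoint_family_on (\<lambda>a. {a<..<b a}) S"
  show "(\<Sum>a\<in>S. (b a - a)\<^sup>2 * Gam (T * y a / (b a - a))) \<le> e"
  proof (rule sum_gam_le_imp_Gam)
    fix N
    have pos: "0 < k x" if "a \<in> S" "x \<in> {a<..<b a}" for a x using S(2) that by force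
    have "ennreal (\<Sum>a\<in>S. (b a - a)\<^sup>2 * gam N (T * y a / (b a - a))) \<le> dirichlet_energy u (strip_domain k)"
    proof (rule energy_of_rectangles[OF assms(2) open_strip_domain[OF assms(1)] S(1) _ S(3)])
      show "\<forall>a\<in>S. a < b a \<and> 0 < T * y a \<and> {a<..<b a} \<times> {0<..<T * y a} \<subseteq> strip_domain k"
        using S(2) pos assms(6) by (auto simp: strip_domain_def)
      show "AE x in lborel. (\<exists>a\<in>S. x \<in> {a<..<b a}) \<longrightarrow> has_trace_at u (strip_domain k) (x, 0) x"
        using assms(3) unfolding substrate_condition_def by eventually_elim (use pos in blast)
    qed
    also note assms(4)
    finally show "(\<Sum>a\<in>S. (b a - a)\<^sup>2 * gam N (T * y a / (b a - a))) \<le> e" using assms(5) by simp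
  qed (use S(2) assms(6) in \<open>auto simp: less_imp_le\<close>)
qed

lemma rescaled_profile_eq:
  assumes "0 < V"
  shows "rescaled_profile V h x = h (V powr (1/3) * x) / (V powr (1/3))\<^sup>2"
proof -
  have "V powr (-2/3) = 1 / (V powr (1/3))\<^sup>2"
    using assms by (simp add: powr_realpow[symmetric] powr_powr powr_minus_divide[of V "2/3", symmetric])
  then show ?thesis by (simp add: rescaled_profile_def)
qed

text \<open>Undoing the rescaling turns width l and height y into T l and T^2 y. The aspect ratio
  thus gains the factor T, and the energy, quadratic in the width, the factor T^2.\<close>

lemma film_elastic_bound:
  assumes adm: "(u, h) \<in> admissible V" and V: "0 < V" and e: "dirichlet_energy u (film_domain h) \<le> ennreal e" "0 \<le> e"
  defines "T \<equiv> V powr (1/3)"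
  shows "elastic_bound T (rescaled_profile V h) (e / T\<^sup>2)"
  unfolding elastic_bound_def
proof (intro allI impI)
  have T: "0 < T" using V by (simp add: T_def)
  have h: "lsc h" "weakly_differentiable u (film_domain h)" "substrate_condition h (film_domain h) u"
    using adm unfolding admissible_def H1_def by auto
  fix S :: "real set" and b y :: "real \<Rightarrow> real"
  assume S: "finite S" "\<forall>a\<in>S. a < b a \<and> 0 < y a \<and> (\<forall>x\<in>{a<..<b a}. y a \<le> rescaled_profile V h x)" "disjoint_family_on (\<lambda>a. {a<..<b a}) S"
  have hy: "T\<^sup>2 * y a \<le> h x" if "a \<in> S" "x \<in> {T * a<..<T * b a}" for a x
  proof -
    have "x / T \<in> {a<..<b a}" using that(2) T by (auto simp: field_simps)
    then have "y a \<le> rescaled_profile V h (x / T)" using S(2) that(1) by blast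
    then show ?thesis using T unfolding rescaled_profile_eq[OF V] T_def[symmetric] by (simp add: field_simps)
  qed
  show "(\<Sum>a\<in>S. (b a - a)\<^sup>2 * Gam (T * y a / (b a - a))) \<le> e / T\<^sup>2"
  proof (rule sum_gam_le_imp_Gam)
    fix N
    have ypos: "0 < T\<^sup>2 * y a" if "a \<in> S" for a using S(2) that T by simp
    have pos: "0 < h x" if "a \<in> S" "x \<in> {T * a<..<T * b a}" for a x using hy[OF that] ypos[OF that(1)] by linarith
    have "ennreal (\<Sum>a\<in>S. (T * b a - T * a)\<^sup>2 * gam N (T\<^sup>2 * y a / (T * b a - T * a))) \<le> dirichlet_energy u (film_domain h)"
    proof (rule energy_of_rectangles[OF h(2) open_film_domain[OF h(1)] S(1)])
      have "{T * a<..<T * b a} \<times> {0<..<T\<^sup>2 * y a} \<subseteq> film_domain h" if "a \<in> S" for a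
        using hy[OF that] by (force simp: film_domain_def)
      then show "\<forall>a\<in>S. T * a < T * b a \<and> 0 < T\<^sup>2 * y a \<and> {T * a<..<T * b a} \<times> {0<..<T\<^sup>2 * y a} \<subseteq> film_domain h"
        using S(2) T ypos by auto
      show "disjoint_family_on (\<lambda>a. {T * a<..<T * b a}) S"
        unfolding disjoint_family_on_def
      proof (intro ballI impI)
        fix a a' assume a: "a \<in> S" "a' \<in> S" "a \<noteq> a'"
        show "{T * a<..<T * b a} \<inter> {T * a'<..<T * b a'} = {}"
        proof (rule ccontr)
          assume "{T * a<..<T * b a} \<inter> {T * a'<..<T * b a'} \<noteq> {}"
          then obtain x where "x \<in> {T * a<..<T * b a}" "x \<in> {T * a'<..<T * b a'}" by blast
          then have x: "T * a < x" "x < T * b a" "T * a' < x" "x < T * b a'" by simp_all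
          then have "x / T \<in> {a<..<b a} \<inter> {a'<..<b a'}" using T by (auto simp: field_simps)
          then show False using disjoint_family_onD[OF S(3) a] by blast
        qed
      qed
      show "AE x in lborel. (\<exists>a\<in>S. x \<in> {T * a<..<T * b a}) \<longrightarrow> has_trace_at u (film_domain h) (x, 0) x"
        using h(3) unfolding substrate_condition_def by eventually_elim (use pos in blast)
    qed
    also note e(1)
    finally have "(\<Sum>a\<in>S. (T * b a - T * a)\<^sup>2 * gam N (T\<^sup>2 * y a / (T * b a - T * a))) \<le> e" using e(2) by simp
    also have "(\<Sum>a\<in>S. (T * b a - T * a)\<^sup>2 * gam N (T\<^sup>2 * y a / (T * b a - T * a))) = T\<^sup>2 * (\<Sum>a\<in>S. (b a - a)\<^sup>2 * gam N (T * y a / (b a - a)))"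
    proof -
      have "T\<^sup>2 * y a / (T * b a - T * a) = T * y a / (b a - a)" for a
        using T by (simp add: right_diff_distrib[symmetric] power2_eq_square)
      then show ?thesis
        by (simp add: sum_distrib_left right_diff_distrib[symmetric] power_mult_distrib mult.assoc)
    qed
    finally show "(\<Sum>a\<in>S. (b a - a)\<^sup>2 * gam N (T * y a / (b a - a))) \<le> e / T\<^sup>2" using T by (simp add: field_simps)
  qed (use S(2) T in \<open>auto simp: less_imp_le\<close>)
qed

section \<open>Rectangular competitors and the limit problem\<close>

lemma rect_profile_alt: "rect_profile l H x = (if 0 < x \<and> x < l then H else 0)"
  by (simp add: rect_profile_def)

lemma rect_profile_props:
  assumes "0 < l" "0 < H"
  shows "lsc (rect_profile l H)" "0 \<le> rect_profile l H x" "integrable lborel (rect_profile l H)"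
    "(LINT x|lborel. rect_profile l H x) = H * l"
    "film_domain (rect_profile l H) = {0<..<l} \<times> {0<..<H}" "strip_domain (rect_profile l H) = {0<..<l} \<times> {0<..}"
proof -
  have "{x. c < rect_profile l H x} = (if c < 0 then UNIV else if c < H then {0<..<l} else {})" for c
    using assms by (auto simp: rect_profile_alt)
  then show "lsc (rect_profile l H)" by (simp add: lsc_def)
  show "0 \<le> rect_profile l H x" using assms by (simp add: rect_profile_def)
  show "integrable lborel (rect_profile l H)" "(LINT x|lborel. rect_profile l H x) = H * l"
    unfolding rect_profile_def[abs_def] using assms by simp_all
  show "film_domain (rect_profile l H) = {0<..<l} \<times> {0<..<H}" "strip_domain (rect_profile l H) = {0<..<l} \<times> {0<..}"
    using assms by (auto simp: film_domain_def strip_domain_def rect_profile_alt split: if_splits)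
qed

lemma rect_profile_variation:
  assumes "0 < l" "0 < H"
  shows "pointwise_variation (rect_profile l H) \<le> ennreal (2 * H)"
  unfolding pointwise_variation_def
proof (rule SUP_least, clarify)
  fix n and x :: "nat \<Rightarrow> real" assume x: "strict_mono_on {..n} x"
  \<comment> \<open>The jumps up at 0 and down at \<open>l\<close> are majorized by the increments
    of two monotone step functions, whose sums telescope. The strict and weak inequalities reflect
    that the profile is zero at both end points.\<close>
  define f where "f t = H * of_bool (0 < t)" for t :: real
  define g where "g t = H * of_bool (l \<le> t)" for t :: real
  have inc: "x i < x (Suc i)" if "i < n" for i using strict_mono_onD[OF x, of i "Suc i"] that by simp
  have "(\<Sum>i<n. ennreal \<bar>rect_profile l H (x (Suc i)) - rect_profile l H (x i)\<bar>) = ennreal (\<Sum>i<n. \<bar>rect_profile l H (x (Suc i)) - rect_profile l H (x i)\<bar>)"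
    by (rule sum_ennreal) simp
  also have "(\<Sum>i<n. \<bar>rect_profile l H (x (Suc i)) - rect_profile l H (x i)\<bar>) \<le> (\<Sum>i<n. (f (x (Suc i)) - f (x i)) + (g (x (Suc i)) - g (x i)))"
  proof (rule sum_mono)
    fix i assume "i \<in> {..<n}"
    then have "x i < x (Suc i)" using inc by simp
    then show "\<bar>rect_profile l H (x (Suc i)) - rect_profile l H (x i)\<bar> \<le> (f (x (Suc i)) - f (x i)) + (g (x (Suc i)) - g (x i))"
      using assms by (auto simp: rect_profile_def f_def g_def indicator_def)
  qed
  also have "\<dots> = (f (x n) - f (x 0)) + (g (x n) - g (x 0))"
    unfolding sum.distrib by (simp only: sum_lessThan_telescope[of "\<lambda>i. f (x i)"] sum_lessThan_telescope[of "\<lambda>i. g (x i)"])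
  also have "\<dots> \<le> 2 * H" using assms by (auto simp: f_def g_def)
  finally show "(\<Sum>i<n. ennreal \<bar>rect_profile l H (x (Suc i)) - rect_profile l H (x i)\<bar>) \<le> ennreal (2 * H)"
    by (simp add: ennreal_leI)
qed

lemma rect_profile_BV:
  assumes "0 < l" "0 < H"
  shows "rect_profile l H \<in> BV"
proof -
  have "(SUP (\<phi>, d\<phi>) \<in> {(\<phi>, d\<phi>). test_function UNIV \<phi> d\<phi> \<and> (\<forall>x. \<bar>\<phi> x\<bar> \<le> 1)}.
       ennreal (LINT x|lborel. rect_profile l H x * d\<phi> x)) \<le> ennreal (2 * H)"
  proof (rule SUP_least, clarify)
    fix \<phi> d\<phi> :: "real \<Rightarrow> real" assume t: "test_function UNIV \<phi> d\<phi>" and b: "\<forall>x. \<bar>\<phi> x\<bar> \<le> 1"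
    have d: "(\<phi> has_real_derivative d\<phi> x) (at x)" for x
    proof -
      have "(\<phi> has_derivative (\<lambda>v. d\<phi> x \<bullet> v)) (at x)" using t unfolding test_function_def by blast
      then show ?thesis by (simp add: has_field_derivative_def inner_real_def)
    qed
    have c: "continuous_on UNIV d\<phi>" using t unfolding test_function_def by blast
    have "(LINT x|lborel. rect_profile l H x * d\<phi> x) = (LINT x|lborel. H * (indicator {0<..<l} x * d\<phi> x))"
      by (simp add: rect_profile_def mult.assoc)
    also have "\<dots> = H * (\<phi> l - \<phi> 0)"
      using integral_FTC_open[OF less_imp_le[OF assms(1)] d c] by simp
    also have "\<dots> \<le> H * 2"
      using assms b[rule_format, of l] b[rule_format, of 0] by (intro mult_left_mono) auto
    finally show "ennreal (LINT x|lborel. rect_profile l H x * d\<phi> x) \<le> ennreal (2 * H)" by (simp add: ennreal_leI mult.commute)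
  qed
  then have "(SUP (\<phi>, d\<phi>) \<in> {(\<phi>, d\<phi>). test_function UNIV \<phi> d\<phi> \<and> (\<forall>x. \<bar>\<phi> x\<bar> \<le> 1)}.
       ennreal (LINT x|lborel. rect_profile l H x * d\<phi> x)) < \<infinity>"
    using order_le_less_trans[OF _ ennreal_less_top] by auto
  then show ?thesis unfolding BV_def using rect_profile_props(3)[OF assms] by simp
qed

lemma near_optimal_constants:
  assumes "0 < \<delta>"
  obtains s N where "0 < s" "L0\<^sup>2 * ((1 + s) * cN N + (1 + 1 / s) * dN N) \<le> H0 + \<delta>"
proof -
  \<comment> \<open>Makes the factor \<open>1 + s\<close> cost exactly \<delta>/2 in the limit of
    large \<open>N\<close>; the other half of \<delta> pays for a finite \<open>N\<close>.\<close>
  define s where "s = \<delta> / (2 * H0)"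
  have s: "0 < s" using assms L0_pos by (simp add: s_def)
  have "(\<lambda>N. L0\<^sup>2 * ((1 + s) * cN N + (1 + 1 / s) * dN N)) \<longlonglongrightarrow> L0\<^sup>2 * ((1 + s) * c0 + (1 + 1 / s) * 0)"
    by (intro tendsto_intros cN_tendsto dN_tendsto)
  moreover have "L0\<^sup>2 * ((1 + s) * c0 + (1 + 1 / s) * 0) = H0 + \<delta> / 2"
  proof -
    have "L0\<^sup>2 * ((1 + s) * c0 + (1 + 1 / s) * 0) = (1 + s) * (c0 * L0\<^sup>2)" by simp
    also have "\<dots> = H0 + \<delta> / 2" unfolding c0_L0(2) using L0_pos by (simp add: s_def field_simps)
    finally show ?thesis .
  qed
  ultimately have "(\<lambda>N. L0\<^sup>2 * ((1 + s) * cN N + (1 + 1 / s) * dN N)) \<longlonglongrightarrow> H0 + \<delta> / 2" by simp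
  then have "eventually (\<lambda>N. L0\<^sup>2 * ((1 + s) * cN N + (1 + 1 / s) * dN N) < H0 + \<delta>) sequentially"
    by (rule order_tendstoD(2)) (use assms in simp)
  then obtain N where "L0\<^sup>2 * ((1 + s) * cN N + (1 + 1 / s) * dN N) < H0 + \<delta>" by (auto simp: eventually_sequentially)
  then show ?thesis using that[OF s, of N] by simp
qed

lemma strip_displacement:
  assumes "0 < l" "0 < \<delta>"
  shows "\<exists>U dU. displacement U dU \<and>
    (\<integral>\<^sup>+ p\<in>({0<..<l} \<times> {0<..}). ennreal ((norm (dU p))\<^sup>2) \<partial>lebesgue) \<le> ennreal ((l / L0)\<^sup>2 * (H0 + \<delta>))"
proof -
  obtain s N where s: "0 < s" "L0\<^sup>2 * ((1 + s) * cN N + (1 + 1 / s) * dN N) \<le> H0 + \<delta>"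
    by (rule near_optimal_constants[OF assms(2)]) (rule that)
  have "l\<^sup>2 * ((1 + s) * cN N + (1 + 1 / s) * dN N) = (l / L0)\<^sup>2 * (L0\<^sup>2 * ((1 + s) * cN N + (1 + 1 / s) * dN N))"
    using L0_pos(1) by (simp add: power_divide)
  also have "\<dots> \<le> (l / L0)\<^sup>2 * (H0 + \<delta>)" by (intro mult_left_mono s) simp
  finally have "ennreal (l\<^sup>2 * ((1 + s) * cN N + (1 + 1 / s) * dN N)) \<le> ennreal ((l / L0)\<^sup>2 * (H0 + \<delta>))" by (rule ennreal_leI)
  then show ?thesis using near_optimal_displacement[OF assms(1) s(1), of N] order_trans by blast
qed

lemma classical_displacement:
  assumes U: "displacement U dU" and D: "open D" "D \<subseteq> A"
  shows "weakly_differentiable U D" "dirichlet_energy U D \<le> (\<integral>\<^sup>+ p\<in>A. ennreal ((norm (dU p))\<^sup>2) \<partial>lebesgue)"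
    "substrate_condition h D U" "continuous_on UNIV U"
proof -
  have d: "\<And>p. (U has_derivative (\<lambda>v. dU p \<bullet> v)) (at p)" and c: "continuous_on UNIV dU" and U0: "\<And>x. U (x, 0) = x"
    using U unfolding displacement_def by auto
  have w: "has_weak_gradient U dU D" by (rule classical_gradient_is_weak[OF d c D(1)])
  then show "weakly_differentiable U D" unfolding weakly_differentiable_def by blast
  show "dirichlet_energy U D \<le> (\<integral>\<^sup>+ p\<in>A. ennreal ((norm (dU p))\<^sup>2) \<partial>lebesgue)"
    unfolding dirichlet_energy_eq[OF w D(1)] using D(2) by (intro nn_integral_mono) (auto simp: indicator_def)
  show cU: "continuous_on UNIV U" using has_derivative_continuous[OF d] by (simp add: continuous_on_eq_continuous_at)
  have "has_trace_at U D (x, 0) x" for x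
    by (rule continuous_has_trace) (use cU U0 in \<open>auto simp: continuous_on_eq_continuous_at\<close>)
  then show "substrate_condition h D U" unfolding substrate_condition_def by simp
qed

text \<open>The competitor is the optimal rectangle enlarged to width T L0 and height T^2 H0, with a
  half-strip displacement restricted to it. Restriction only lowers the energy, so the bound holds
  for every single \<open>V\<close>.\<close>

lemma F_ell_upper_bound:
  assumes V: "0 < V" and \<delta>: "0 < \<delta>"
  shows "F_ell V \<le> ennreal ((V powr (1/3))\<^sup>2 * (3 * H0 + \<delta>))"
proof -
  define T where "T = V powr (1/3)"
  have T: "0 < T" "T ^ 3 = V" using V by (simp_all add: T_def powr_realpow[symmetric] powr_powr)
  define l where "l = T * L0"
  define H where "H = T\<^sup>2 * H0"
  have lH: "0 < l" "0 < H" using T L0_pos by (simp_all add: l_def H_def)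
  have VlH: "H * l = V" using c0_L0(3) T by (simp add: l_def H_def power2_eq_square power3_eq_cube mult_ac)
  note rp = rect_profile_props[OF lH]
  let ?h = "rect_profile l H" and ?D = "film_domain (rect_profile l H)"
  obtain U dU where U: "displacement U dU" "(\<integral>\<^sup>+ p\<in>({0<..<l} \<times> {0<..}). ennreal ((norm (dU p))\<^sup>2) \<partial>lebesgue) \<le> ennreal ((l / L0)\<^sup>2 * (H0 + \<delta>))"
    using strip_displacement[OF lH(1) \<delta>] by blast
  have D: "open ?D" "?D \<subseteq> {0<..<l} \<times> {0<..}" using open_film_domain[OF rp(1)] rp(5) by auto
  note cd = classical_displacement[OF U(1) D]
  have de: "dirichlet_energy U ?D \<le> ennreal ((l / L0)\<^sup>2 * (H0 + \<delta>))" by (rule order_trans[OF cd(2) U(2)])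
  have "U \<in> H1 ?D"
    unfolding H1_def
  proof (intro CollectI conjI cd(1))
    show "U \<in> borel_measurable (lebesgue_on ?D)"
      using cd(4) by (intro measurable_restrict_space1 borel_measurable_lebesgueI borel_measurable_continuous_onI)
    show "dirichlet_energy U ?D < \<infinity>" using order_le_less_trans[OF de ennreal_less_top] by simp
    let ?K = "{0..l} \<times> {0..H}"
    have "integrable lebesgue (\<lambda>p. indicator ?K p *\<^sub>R (U p)\<^sup>2)"
      by (intro integrable_lebesgue_compact(1) continuous_intros cd(4) compact_Times) auto
    then have "(\<integral>\<^sup>+ p. ennreal (norm (indicator ?K p *\<^sub>R (U p)\<^sup>2)) \<partial>lebesgue) < \<infinity>"
      unfolding integrable_iff_bounded by blast
    moreover have "(\<integral>\<^sup>+ p\<in>?D. ennreal ((U p)\<^sup>2) \<partial>lebesgue) \<le> (\<integral>\<^sup>+ p. ennreal (norm (indicator ?K p *\<^sub>R (U p)\<^sup>2)) \<partial>lebesgue)"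
      unfolding rp(5) by (intro nn_integral_mono) (auto simp: indicator_def)
    ultimately show "(\<integral>\<^sup>+ p\<in>?D. ennreal ((U p)\<^sup>2) \<partial>lebesgue) < \<infinity>" by (rule order_le_less_trans[rotated])
  qed
  then have "(U, ?h) \<in> admissible V"
    unfolding admissible_def using rect_profile_BV[OF lH] rp cd(3) VlH by simp
  then have "F_ell V \<le> film_energy U ?h" unfolding F_ell_def by (intro INF_lower2) auto
  also have "\<dots> \<le> ennreal ((l / L0)\<^sup>2 * (H0 + \<delta>)) + ennreal (2 * H)"
    unfolding film_energy_def by (intro add_mono de rect_profile_variation lH)
  also have "\<dots> = ennreal ((l / L0)\<^sup>2 * (H0 + \<delta>) + 2 * H)" using lH L0_pos \<delta> by (intro ennreal_plus[symmetric]) auto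
  also have "(l / L0)\<^sup>2 * (H0 + \<delta>) + 2 * H = T\<^sup>2 * (3 * H0 + \<delta>)" using L0_pos by (simp add: l_def H_def algebra_simps)
  finally show ?thesis by (simp add: T_def)
qed

section \<open>The minimal value of the limit functional\<close>

lemma hausdorff_measure1_empty: "hausdorff_measure1 ({} :: 'a::metric_space set) = 0"
proof -
  have "(INF E \<in> {E::nat \<Rightarrow> 'a set. {} \<subseteq> (\<Union>i. E i) \<and> (\<forall>i. bounded (E i) \<and> diameter (E i) \<le> \<delta>)}. \<Sum>i. ennreal (diameter (E i))) = 0"
    if "0 < \<delta>" for \<delta> :: real
  proof -
    have "(INF E \<in> {E::nat \<Rightarrow> 'a set. {} \<subseteq> (\<Union>i. E i) \<and> (\<forall>i. bounded (E i) \<and> diameter (E i) \<le> \<delta>)}. \<Sum>i. ennreal (diameter (E i))) \<le> 0"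
      by (rule INF_lower2[of "\<lambda>_. {}"]) (use that in auto)
    then show ?thesis by simp
  qed
  then have "hausdorff_measure1 ({} :: 'a set) \<le> 0"
    unfolding hausdorff_measure1_def by (intro SUP_least) auto
  then show ?thesis by simp
qed

text \<open>At every point one of the one-sided limits does not exceed the value: the left limit 0
  up to the left side, the right limit 0 from the right side on, and the right limit
  \<open>H\<close> in between.\<close>

lemma cuts_rect_profile:
  assumes "0 < l" "0 < H"
  shows "cuts (rect_profile l H) = {}"
proof -
  have "lower_limit (rect_profile l H) x \<le> rect_profile l H x" for x
  proof -
    let ?h = "rect_profile l H"
    consider "x \<le> 0" | "l \<le> x" | "0 < x" "x < l" by linarith
    then show ?thesis
    proof cases
      case 1
      have "eventually (\<lambda>y. ?h y = 0) (at_left x)"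
        using 1 by (auto simp: eventually_at_left_field rect_profile_def intro!: exI[of _ "x - 1"])
      then have "(?h \<longlongrightarrow> 0) (at_left x)" by (rule tendsto_eventually)
      then have "Lim (at_left x) ?h = 0" by (intro tendsto_Lim) auto
      then show ?thesis using rect_profile_props(2)[OF assms, of x] by (simp add: lower_limit_def min_le_iff_disj)
    next
      case 2
      have "eventually (\<lambda>y. ?h y = 0) (at_right x)"
        using 2 by (auto simp: eventually_at_right_field rect_profile_def intro!: exI[of _ "x + 1"])
      then have "(?h \<longlongrightarrow> 0) (at_right x)" by (rule tendsto_eventually)
      then have "Lim (at_right x) ?h = 0" by (intro tendsto_Lim) auto
      then show ?thesis using rect_profile_props(2)[OF assms, of x] by (simp add: lower_limit_def min_le_iff_disj)
    next
      case 3
      have "eventually (\<lambda>y. ?h y = H) (at_right x)"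
        using 3 by (auto simp: eventually_at_right_field rect_profile_def intro!: exI[of _ l])
      then have "(?h \<longlongrightarrow> H) (at_right x)" by (rule tendsto_eventually)
      then have "Lim (at_right x) ?h = H" by (intro tendsto_Lim) auto
      then show ?thesis using 3 by (simp add: lower_limit_def min_le_iff_disj rect_profile_def)
    qed
  qed
  then show ?thesis by (auto simp: cuts_def not_le[symmetric])
qed

lemma G_rect_profile: "G (rect_profile L0 H0) \<le> ennreal (3 * H0)"
proof (rule ennreal_le_epsilon)
  fix \<delta> :: real assume \<delta>: "0 < \<delta>"
  note rp = rect_profile_props[OF L0_pos]
  let ?D = "strip_domain (rect_profile L0 H0)"
  obtain U dU where U: "displacement U dU" "(\<integral>\<^sup>+ p\<in>({0<..<L0} \<times> {0<..}). ennreal ((norm (dU p))\<^sup>2) \<partial>lebesgue) \<le> ennreal ((L0 / L0)\<^sup>2 * (H0 + \<delta>))"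
    using strip_displacement[OF L0_pos(1) \<delta>] by blast
  have D: "open ?D" "?D \<subseteq> {0<..<L0} \<times> {0<..}" using open_strip_domain[OF rp(1)] rp(6) by auto
  note cd = classical_displacement[OF U(1) D]
  have "(INF u \<in> {u. weakly_differentiable u ?D \<and> substrate_condition (rect_profile L0 H0) ?D u}. dirichlet_energy u ?D) \<le> ennreal (H0 + \<delta>)"
    by (rule INF_lower2[of U]) (use cd(1,3) order_trans[OF cd(2) U(2)] L0_pos in auto)
  then have "G (rect_profile L0 H0) \<le> ennreal (H0 + \<delta>) + ennreal (2 * H0) + 2 * 0"
    unfolding G_def cuts_rect_profile[OF L0_pos] hausdorff_measure1_empty
    by (intro add_mono rect_profile_variation L0_pos) auto
  also have "\<dots> = ennreal (3 * H0) + ennreal \<delta>"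
    using L0_pos \<delta> by (simp add: ennreal_plus[symmetric] del: ennreal_plus)
  finally show "G (rect_profile L0 H0) \<le> ennreal (3 * H0) + ennreal \<delta>" .
qed

text \<open>The asymptotic lower bound is applied to the constant sequence \<open>k\<close> with
  stretching factors \<open>Suc n\<close>. Since energy and variation do not depend on
  \<open>n\<close>, it becomes an exact inequality. The cut term is nonnegative and is
  dropped.\<close>

lemma G_lower_bound:
  assumes "k \<in> G_admissible"
  shows "ennreal (3 * H0) \<le> G k"
proof -
  have k: "lsc k" "\<And>x. 0 \<le> k x" "integrable lborel k" "(LINT x|lborel. k x) = 1" "pointwise_variation k < \<infinity>"
    using assms unfolding G_admissible_def by auto
  define B where "B = enn2real (pointwise_variation k)"
  have eB: "pointwise_variation k = ennreal B" using k(5) by (simp add: B_def)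
  obtain v where v: "variation_bound k v B" using variation_bound_exists[OF k(5)] unfolding B_def by blast
  have B0: "0 \<le> B" by (simp add: B_def)
  have "ennreal (3 * H0 - B) \<le> dirichlet_energy u (strip_domain k)"
    if u: "weakly_differentiable u (strip_domain k)" "substrate_condition k (strip_domain k) u" for u
  proof (cases "dirichlet_energy u (strip_domain k) < \<infinity>")
    case False then show ?thesis by (simp add: less_top[symmetric])
  next
    case True
    define e where "e = enn2real (dirichlet_energy u (strip_domain k))"
    have ee: "dirichlet_energy u (strip_domain k) = ennreal e" "0 \<le> e" using True by (simp_all add: e_def)
    have "3 * H0 \<le> e + B"
    proof (rule ccontr)
      assume lt: "\<not> 3 * H0 \<le> e + B"
      \<comment> \<open>The negated claim itself supplies the upper energy bound required by
        \<open>near_minimal_profiles\<close>. With half of the gap as margin the conclusion,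
        constant in \<open>n\<close>, is false.\<close>
      have "eventually (\<lambda>n. 3 * H0 - (3 * H0 - (e + B)) / 2 \<le> e + B) sequentially"
      proof (rule near_minimal_profiles(3)[where h = "\<lambda>_. k" and v = "\<lambda>_. v" and T = "\<lambda>n. real (Suc n)"])
        show "elastic_bound (real (Suc n)) k e" for n
          by (rule strip_elastic_bound[OF k(1) u]) (use ee in auto)
        show "filterlim (\<lambda>n. real (Suc n)) at_top sequentially"
          by (intro filterlim_compose[OF filterlim_real_sequentially] filterlim_Suc)
        show "0 < (3 * H0 - (e + B)) / 2" using lt by simp
      qed (use k v lt in auto)
      then show False using lt by (auto simp: eventually_sequentially field_simps)
    qed
    then show ?thesis unfolding ee by (intro ennreal_leI) simp
  qed
  then have "ennreal (3 * H0 - B) \<le> (INF u \<in> {u. weakly_differentiable u (strip_domain k) \<and> substrate_condition k (strip_domain k) u}.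
      dirichlet_energy u (strip_domain k))"
    by (intro INF_greatest) auto
  then have "ennreal (3 * H0 - B) + ennreal B \<le> G k"
    unfolding G_def eB by (intro add_increasing2 add_mono) auto
  \<comment> \<open>If \<open>B\<close> exceeds 3 \<open>H0\<close>, then \<open>ennreal\<close>
    sends the negative difference to 0 and the inequality persists.\<close>
  moreover have "ennreal (3 * H0) \<le> ennreal (3 * H0 - B) + ennreal B"
  proof -
    have "ennreal (3 * H0) \<le> ennreal (max 0 (3 * H0 - B) + B)" by (intro ennreal_leI) simp
    also have "\<dots> = ennreal (max 0 (3 * H0 - B)) + ennreal B" using B0 by (intro ennreal_plus) auto
    finally show ?thesis by (simp add: ennreal_max_0)
  qed
  ultimately show ?thesis by (rule order_trans[rotated])
qed

lemma G_minimizer_rect_profile: "G_minimizer (rect_profile L0 H0)"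
proof -
  note rp = rect_profile_props[OF L0_pos]
  have "pointwise_variation (rect_profile L0 H0) < \<infinity>"
    using order_le_less_trans[OF rect_profile_variation[OF L0_pos] ennreal_less_top] by simp
  then have "rect_profile L0 H0 \<in> G_admissible" unfolding G_admissible_def using rp c0_L0(3) by (simp add: mult.commute)
  then show ?thesis unfolding G_minimizer_def using order_trans[OF G_rect_profile G_lower_bound] by blast
qed

lemma rescaled_profile_props:
  assumes V: "0 < V" and h: "lsc h" "\<And>x. 0 \<le> h x" "integrable lborel h" "(LINT x|lborel. h x) = V" and v: "variation_bound h v B"
  defines "T \<equiv> V powr (1/3)"
  shows "lsc (rescaled_profile V h)" "0 \<le> rescaled_profile V h x" "integrable lborel (rescaled_profile V h)"
    "(LINT x|lborel. rescaled_profile V h x) = 1" "variation_bound (rescaled_profile V h) (\<lambda>x. v (T * x) / T\<^sup>2) (B / T\<^sup>2)"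
proof -
  have T: "0 < T" "T ^ 3 = V" using V by (simp_all add: T_def powr_realpow[symmetric] powr_powr)
  have eq: "rescaled_profile V h = (\<lambda>x. h (T * x) / T\<^sup>2)" using rescaled_profile_eq[OF V] by (auto simp: T_def)
  have "{x. c < h (T * x) / T\<^sup>2} = (\<lambda>x. T * x) -` {x. c * T\<^sup>2 < h x}" for c using T by (auto simp: field_simps)
  moreover have "open ((\<lambda>x. T * x) -` {x. c * T\<^sup>2 < h x})" for c
    using h(1) unfolding lsc_def by (intro open_vimage) (auto intro!: continuous_intros)
  ultimately have "open {x. c < h (T * x) / T\<^sup>2}" for c by metis
  then show "lsc (rescaled_profile V h)" by (simp add: lsc_def eq)
  show "0 \<le> rescaled_profile V h x" using h(2) by (simp add: eq)
  have "integrable lborel (\<lambda>x. h (0 + T * x))" using T by (intro lborel_integrable_real_affine h(3)) auto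
  then show "integrable lborel (rescaled_profile V h)" by (simp add: eq)
  have "V = T * (LINT x|lborel. h (T * x))" using lborel_integral_real_affine[of T h 0] T h(4) by simp
  then have "(LINT x|lborel. h (T * x)) = T\<^sup>2" using T by (auto simp: power2_eq_square power3_eq_cube)
  then show "(LINT x|lborel. rescaled_profile V h x) = 1" using T by (simp add: eq)
  have v': "\<And>x. 0 \<le> v x \<and> v x \<le> B" "\<And>x y. x \<le> y \<Longrightarrow> \<bar>h y - h x\<bar> \<le> v y - v x"
    using v unfolding variation_bound_def by auto
  show "variation_bound (rescaled_profile V h) (\<lambda>x. v (T * x) / T\<^sup>2) (B / T\<^sup>2)"
    unfolding variation_bound_def eq
  proof (intro conjI allI impI)
    show "0 \<le> v (T * x) / T\<^sup>2" "v (T * x) / T\<^sup>2 \<le> B / T\<^sup>2" for x using v'(1) T by (auto intro: divide_right_mono)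
    fix x y :: real assume "x \<le> y"
    then have "\<bar>h (T * y) - h (T * x)\<bar> / T\<^sup>2 \<le> (v (T * y) - v (T * x)) / T\<^sup>2" using T by (intro divide_right_mono v'(2)) auto
    then show "\<bar>h (T * y) / T\<^sup>2 - h (T * x) / T\<^sup>2\<bar> \<le> v (T * y) / T\<^sup>2 - v (T * x) / T\<^sup>2"
      unfolding diff_divide_distrib[symmetric] abs_divide by simp
  qed
qed

theorem theorem4p11:
  fixes V :: "nat \<Rightarrow> real"
    and u :: "nat \<Rightarrow> real \<times> real \<Rightarrow> real"
    and h :: "nat \<Rightarrow> real \<Rightarrow> real"
  assumes "\<And>n. V n > 0"
    and "filterlim V at_top sequentially"
    and "\<And>n. film_minimizer (V n) (u n) (h n)"
  shows "\<exists>(r :: nat \<Rightarrow> nat) (c :: nat \<Rightarrow> real) (h' :: real \<Rightarrow> real).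
           strict_mono r \<and>
           L1_convergent_to
             (\<lambda>n. translate (c n) (rescaled_profile (V (r n)) (h (r n)))) h' \<and>
           G_minimizer h' \<and>
           hausdorff_convergent_to
             (\<lambda>n. - film_domain (translate (c n) (rescaled_profile (V (r n)) (h (r n)))))
             (- film_domain h')"
proof -
  define T where "T n = V n powr (1/3)" for n
  have T0: "0 < T n" for n using assms(1)[of n] by (simp add: T_def)
  have adm: "(u n, h n) \<in> admissible (V n)" and en: "film_energy (u n) (h n) = F_ell (V n)" for n
    using assms(3)[of n] unfolding film_minimizer_def by auto
  have h: "lsc (h n)" "0 \<le> h n x" "integrable lborel (h n)" "(LINT x|lborel. h n x) = V n" for n x
    using adm[of n] unfolding admissible_def BV_def by auto
  have fin: "dirichlet_energy (u n) (film_domain (h n)) < \<infinity> \<and> pointwise_variation (h n) < \<infinity>" for n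
  proof -
    have "film_energy (u n) (h n) < \<infinity>" unfolding en
      using order_le_less_trans[OF F_ell_upper_bound[OF assms(1)[of n] zero_less_one] ennreal_less_top] by simp
    then show ?thesis unfolding film_energy_def by (simp add: less_top[symmetric])
  qed
  define e where "e n = enn2real (dirichlet_energy (u n) (film_domain (h n)))" for n
  define b where "b n = enn2real (pointwise_variation (h n))" for n
  have eb: "dirichlet_energy (u n) (film_domain (h n)) = ennreal (e n)" "pointwise_variation (h n) = ennreal (b n)" "0 \<le> e n" "0 \<le> b n" for n
    using fin[of n] by (simp_all add: e_def b_def)
  have "\<exists>v. variation_bound (h n) v (b n)" for n using variation_bound_exists[of "h n"] fin[of n] by (simp add: b_def)
  then obtain v where v: "\<And>n. variation_bound (h n) (v n) (b n)" by metis
  note rp = rescaled_profile_props[OF assms(1) h(1) h(2) h(3) h(4) v]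
  define k where "k n = rescaled_profile (V n) (h n)" for n
  define w where "w n x = v n (T n * x) / (T n)\<^sup>2" for n x
  have k: "lsc (k n)" "0 \<le> k n x" "integrable lborel (k n)" "(LINT x|lborel. k n x) = 1" "variation_bound (k n) (w n) (b n / (T n)\<^sup>2)" for n x
    unfolding k_def w_def[abs_def] T_def using rp by auto
  have EB: "elastic_bound (T n) (k n) (e n / (T n)\<^sup>2)" for n
    unfolding T_def k_def by (rule film_elastic_bound[OF adm assms(1)]) (use eb in auto)
  have T_lim: "filterlim T at_top sequentially"
    unfolding filterlim_at_top
  proof
    fix Z
    have "eventually (\<lambda>n. (max Z 1) ^ 3 \<le> V n) sequentially" using assms(2) by (simp add: filterlim_at_top)
    then show "eventually (\<lambda>n. Z \<le> T n) sequentially"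
    proof eventually_elim
      case (elim n)
      have "T n ^ 3 = V n" using assms(1)[of n] by (simp add: T_def powr_realpow[symmetric] powr_powr)
      with elim have "(max Z 1) ^ 3 \<le> T n ^ 3" by (simp only:)
      then have "max Z 1 \<le> T n" using T0[of n] power_mono_iff[of "max Z 1" "T n" 3] by auto
      then show ?case by simp
    qed
  qed
  \<comment> \<open>Division by T^2 brings the film energy to the scale of G, where the minimal
    value is 3 \<open>H0\<close>.\<close>
  have bound: "e n / (T n)\<^sup>2 + b n / (T n)\<^sup>2 \<le> 3 * H0 + \<delta>" if "0 < \<delta>" for n \<delta>
  proof -
    have "ennreal (e n + b n) = film_energy (u n) (h n)"
      unfolding film_energy_def eb(1,2) by (rule ennreal_plus[OF eb(3,4)])
    also have "\<dots> \<le> ennreal ((T n)\<^sup>2 * (3 * H0 + \<delta>))" unfolding en T_def by (rule F_ell_upper_bound[OF assms(1) that])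
    finally have le: "ennreal (e n + b n) \<le> ennreal ((T n)\<^sup>2 * (3 * H0 + \<delta>))" .
    have "0 \<le> (T n)\<^sup>2 * (3 * H0 + \<delta>)" using that L0_pos(2) by simp
    from le[unfolded ennreal_le_iff[OF this]] have "e n + b n \<le> (3 * H0 + \<delta>) * (T n)\<^sup>2" by (simp add: mult.commute)
    moreover have "0 < (T n)\<^sup>2" using T0[of n] by simp
    ultimately show ?thesis unfolding add_divide_distrib[symmetric] by (simp only: divide_le_eq if_True)
  qed
  note np = near_minimal_profiles[where h = k and v = w and T = T and E = "\<lambda>n. e n / (T n)\<^sup>2" and B = "\<lambda>n. b n / (T n)\<^sup>2",
      OF k(1-5) EB T0 T_lim always_eventually[OF allI[OF bound]]]
  obtain a where a: "(\<lambda>n. LINT x|lborel. \<bar>k n (x + a n) - H0 * indicator {0<..<L0} x\<bar>) \<longlonglongrightarrow> 0"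
    using np(1) by blast
  define f where "f n = translate (- a n) (k n)" for n
  have f_eq: "f n = (\<lambda>x. k n (x + a n))" for n by (auto simp: f_def translate_def)
  have fi: "integrable lborel (f n)" for n
    using lborel_integrable_real_affine[OF k(3)[of n], of 1 "a n"] by (simp add: f_eq add.commute)
  have f0: "0 \<le> f n x" for n x using k(2) by (simp add: f_eq)
  have fv: "variation_bound (f n) (\<lambda>x. w n (x + a n)) (b n / (T n)\<^sup>2)" for n
    using k(5)[of n] unfolding variation_bound_def f_eq by auto
  note rr = rect_profile_props[OF L0_pos]
  have L1: "(\<lambda>n. LINT x|lborel. \<bar>f n x - rect_profile L0 H0 x\<bar>) \<longlonglongrightarrow> 0" using a by (simp add: f_eq rect_profile_def)
  have "L1_convergent_to f (rect_profile L0 H0)"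
    unfolding L1_convergent_to_def
  proof (intro conjI allI fi rr(3))
    have "(\<integral>\<^sup>+ x. ennreal \<bar>f n x - rect_profile L0 H0 x\<bar> \<partial>lborel) = ennreal (LINT x|lborel. \<bar>f n x - rect_profile L0 H0 x\<bar>)" for n
      using fi rr(3) by (intro nn_integral_eq_integral) auto
    then show "(\<lambda>n. \<integral>\<^sup>+ x. ennreal \<bar>f n x - rect_profile L0 H0 x\<bar> \<partial>lborel) \<longlonglongrightarrow> 0"
      using tendsto_ennrealI[OF L1] by simp
  qed
  moreover have "hausdorff_convergent_to (\<lambda>n. - film_domain (f n)) (- film_domain (rect_profile L0 H0))"
    by (rule film_complements_converge[OF f0 fi fv np(2) L1 L0_pos])
  \<comment> \<open>The subsequence is the identity, since the whole translated sequence converges.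
    \<open>translate\<close> shifts to the right, whence the sign of \<open>a n\<close>.\<close>
  ultimately show ?thesis
    using G_minimizer_rect_profile
    by (intro exI[of _ id] exI[of _ "\<lambda>n. - a n"] exI[of _ "rect_profile L0 H0"]) (simp add: f_def[abs_def] k_def strict_mono_id)
qed

end
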